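(* Let $1/2<H<1$, let $k\ge1$ be a real number, and let $h:\mathbb{R}\to\mathbb{R}$ be continuous. Let $c\in\mathbb{R}$ and let $\sigma(\cdot)>0$ and $\mu(\cdot)$ be real functions on $\mathbb{R}$ such that: - $\sigma(\cdot)$ is $C^1$ and Lipschitz on $\mathbb{R}$ and bounded away from zero, and there is a constant $\eta$ with $\frac1H-1<\eta\le1$ such that for every $N_0>0$ there exists $M_{N_0}>0$ with $|\dot\sigma(x)-\dot\sigma(y)|\le M_{N_0}|x-y|^\eta$ for all $|x|,|y|\le N_0$; - $\mu(\cdot)$ is $C^1$, bounded and Lipschitz on $\mathbb{R}$. Let $X$ be the solution of $X(t)=c+\int_0^t\sigma(X(u))\,db_H(u)+\int_0^t\mu(X(u))\,du$, $t\ge0$, extended by $X(t)=c$ for $t<0$, and $X_\varepsilon=\varphi_\varepsilon*X$. Then, almost surely, $$\frac{1}{\mathbb{E}[|N|^k]}\int_0^1h(X_\varepsilon(u))\left|\frac{\varepsilon^{2-H}\ddot X_\varepsilon(u)}{\sigma_{2H}}\right|^k\,du\longrightarrow\int_0^1h(X(u))[\sigma(X(u))]^k\,du\quad\text{as }\varepsilon\to0.$$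
   Context: $\{b_H(t),t\in\mathbb{R}\}$ is a (continuous version of) fractional Brownian motion with parameter $H$: a centered Gaussian process with $\mathbb{E}[b_H(t)b_H(s)]=\frac12 v_{2H}^2[|t|^{2H}+|s|^{2H}-|t-s|^{2H}]$, $v_{2H}^2=[\Gamma(2H+1)\sin(\pi H)]^{-1}$. $N$ is a standard Gaussian variable. The integral with respect to $b_H$ is defined pathwise as the limit of Riemann sums; the equation has a unique solution, with almost surely $(H-\delta)$-Hölder continuous trajectories on compacts of $\mathbb{R}^+$ for every $\delta>0$. Kernel: $\varphi$ is a $C^2$ probability density with compact support included in $[-1,1]$, $\widehat\varphi(x)=\int e^{-ixy}\varphi(y)\,dy$, $\varphi_\varepsilon(\cdot)=\frac1\varepsilon\varphi(\frac{\cdot}{\varepsilon})$, and $\sigma_{2H}>0$ is given by $\sigma_{2H}^2=\frac{1}{2\pi}\int_{-\infty}^{\infty}|x|^{3-2H}|\widehat\varphi(-x)|^2\,dx$. *)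

theory Defs
  imports "HOL-Probability.Probability"
begin

section \<open>Fractional Brownian motion\<close>

text \<open>Point masses count as Gaussian: a linear combination of the values of a Gaussian process
  may be degenerate.\<close>

definition gaussian_rv :: "'a measure \<Rightarrow> ('a \<Rightarrow> real) \<Rightarrow> bool" where
  "gaussian_rv M Y \<longleftrightarrow> Y \<in> borel_measurable M \<and>
     (\<exists>m. (AE \<omega> in M. Y \<omega> = m) \<or> (\<exists>s>0. distributed M lborel Y (normal_density m s)))"

definition centered_gaussian_process :: "'a measure \<Rightarrow> (real \<Rightarrow> 'a \<Rightarrow> real) \<Rightarrow> bool" where
  "centered_gaussian_process M b \<longleftrightarrow>
     (\<forall>T a. finite T \<longrightarrow> gaussian_rv M (\<lambda>\<omega>. \<Sum>t\<in>T. a t * b t \<omega>)) \<and>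
     (\<forall>t. (\<integral>\<omega>. b t \<omega> \<partial>M) = 0)"

definition v2_sq :: "real \<Rightarrow> real" where
  "v2_sq H = inverse (Gamma (2 * H + 1) * sin (pi * H))"

definition fractional_brownian_motion :: "'a measure \<Rightarrow> real \<Rightarrow> (real \<Rightarrow> 'a \<Rightarrow> real) \<Rightarrow> bool" where
  "fractional_brownian_motion M H b \<longleftrightarrow>
     centered_gaussian_process M b \<and>
     (\<forall>s t. (\<integral>\<omega>. b t \<omega> * b s \<omega> \<partial>M) =
        1 / 2 * v2_sq H * (\<bar>t\<bar> powr (2 * H) + \<bar>s\<bar> powr (2 * H) - \<bar>t - s\<bar> powr (2 * H))) \<and>
     (AE \<omega> in M. continuous_on UNIV (\<lambda>t. b t \<omega>))"

section \<open>The pathwise stochastic differential equation\<close>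

text \<open>The Riemann-Stieltjes integral of \<open>f\<close> with respect to \<open>g\<close> over \<open>[l, r]\<close>: the limit of the
  Riemann sums with arbitrary tags as the mesh tends to zero. Since the radius \<open>d\<close> is constant,
  being fine for the balls of radius \<open>d\<close> is a condition on the mesh only (up to a factor 2).\<close>

definition has_rs_integral ::
  "(real \<Rightarrow> real) \<Rightarrow> (real \<Rightarrow> real) \<Rightarrow> real \<Rightarrow> real \<Rightarrow> real \<Rightarrow> bool" where
  "has_rs_integral f g l r I \<longleftrightarrow>
     (\<forall>e>0. \<exists>d>0. \<forall>p. p tagged_division_of {l..r} \<and> (\<lambda>x. ball x d) fine p \<longrightarrow>
        \<bar>(\<Sum>(x, K)\<in>p. f x * (g (Sup K) - g (Inf K))) - I\<bar> < e)"

text \<open>A trajectory \<open>x\<close> solving the equation driven by the trajectory \<open>g\<close>, extended by the initial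
  value \<open>c\<close> to negative times.\<close>

definition pathwise_solution ::
  "real \<Rightarrow> (real \<Rightarrow> real) \<Rightarrow> (real \<Rightarrow> real) \<Rightarrow> (real \<Rightarrow> real) \<Rightarrow> (real \<Rightarrow> real) \<Rightarrow> bool" where
  "pathwise_solution c \<sigma> \<mu> g x \<longleftrightarrow>
     (\<forall>t<0. x t = c) \<and>
     (\<forall>t\<ge>0. \<exists>I. has_rs_integral (\<lambda>u. \<sigma> (x u)) g 0 t I \<and>
        (\<lambda>u. \<mu> (x u)) integrable_on {0..t} \<and>
        x t = c + I + integral {0..t} (\<lambda>u. \<mu> (x u)))"

definition sde_solution ::
  "'a measure \<Rightarrow> real \<Rightarrow> (real \<Rightarrow> real) \<Rightarrow> (real \<Rightarrow> real) \<Rightarrow>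
   (real \<Rightarrow> 'a \<Rightarrow> real) \<Rightarrow> (real \<Rightarrow> 'a \<Rightarrow> real) \<Rightarrow> bool" where
  "sde_solution M c \<sigma> \<mu> b X \<longleftrightarrow>
     (\<forall>t. X t \<in> borel_measurable M) \<and>
     (AE \<omega> in M. pathwise_solution c \<sigma> \<mu> (\<lambda>t. b t \<omega>) (\<lambda>t. X t \<omega>))"

section \<open>Smoothing\<close>

definition C2_on_reals :: "(real \<Rightarrow> real) \<Rightarrow> bool" where
  "C2_on_reals f \<longleftrightarrow> f C1_differentiable_on UNIV \<and> deriv f C1_differentiable_on UNIV"

definition smoothing_kernel :: "(real \<Rightarrow> real) \<Rightarrow> bool" where
  "smoothing_kernel \<phi> \<longleftrightarrow>
     C2_on_reals \<phi> \<and> (\<forall>x. 0 \<le> \<phi> x) \<and> (\<integral>x. \<phi> x \<partial>lborel) = 1 \<and> (\<forall>x. 1 < \<bar>x\<bar> \<longrightarrow> \<phi> x = 0)"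

definition fourier :: "(real \<Rightarrow> real) \<Rightarrow> real \<Rightarrow> complex" where
  "fourier \<phi> x = (\<integral>y. exp (- (\<i> * complex_of_real (x * y))) * complex_of_real (\<phi> y) \<partial>lborel)"

definition sigma2 :: "(real \<Rightarrow> real) \<Rightarrow> real \<Rightarrow> real" where
  "sigma2 \<phi> H =
     sqrt (1 / (2 * pi) * (\<integral>x. \<bar>x\<bar> powr (3 - 2 * H) * (cmod (fourier \<phi> (- x)))\<^sup>2 \<partial>lborel))"

definition rescaled :: "(real \<Rightarrow> real) \<Rightarrow> real \<Rightarrow> real \<Rightarrow> real" where
  "rescaled \<phi> \<epsilon> x = 1 / \<epsilon> * \<phi> (x / \<epsilon>)"

definition convolve :: "(real \<Rightarrow> real) \<Rightarrow> (real \<Rightarrow> real) \<Rightarrow> real \<Rightarrow> real" where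
  "convolve f g u = (\<integral>v. f (u - v) * g v \<partial>lborel)"

definition smoothed :: "(real \<Rightarrow> real) \<Rightarrow> real \<Rightarrow> (real \<Rightarrow> real) \<Rightarrow> real \<Rightarrow> real" where
  "smoothed \<phi> \<epsilon> x = convolve (rescaled \<phi> \<epsilon>) x"

definition gaussian_abs_moment :: "real \<Rightarrow> real" where
  "gaussian_abs_moment k = (\<integral>x. \<bar>x\<bar> powr k \<partial>std_normal_distribution)"

end

theory Submission
  imports Defs
begin

text \<open>Since the driver has paths of Hoelder exponent above one half, hence zero quadratic variation,
  the Doss--Sussmann transform \<open>F (X t) = F c + b t - b 0 + \<integral> \<mu> (X) / \<sigma> (X)\<close>, \<open>F' = 1 / \<sigma>\<close>, follows
  directly from the existence of the Riemann--Stieltjes integrals. Hence \<open>X\<close> is Hoelder continuous and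
  its increments are \<open>\<sigma> (X)\<close> times those of \<open>b\<close> up to a negligible error, so the normalized second
  derivative of \<open>X\<close> may be replaced by \<open>\<sigma> (X)\<close> times that of \<open>b\<close>. The latter is a stationary Gaussian
  process of unit variance whose correlation decays like a power of \<open>\<epsilon>\<close>. Computing covariances of its
  cosines and of its hyperbolic cosine shows, along a polynomial grid of \<open>\<epsilon>\<close>, that its occupation
  measures converge to the standard Gaussian law with exponential moments bounded, which gives the
  limit for the absolute moments; Hoelder continuity of \<open>b\<close> fills the gaps of the grid.\<close>

section \<open>Riemann--Stieltjes sums\<close>

text \<open>The weight that finally multiplies the normalized second derivative is
  \<open>h (X u \<omega>) * \<sigma> (X u \<omega>) powr k\<close>, so it depends on the path, and
  the exceptional null set has to be fixed before the weight is known. Almost sure statements are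
  therefore made for the countable family of monomials \<open>u ^ j\<close> and frequencies
  \<open>pi * i / R\<close> only; Weierstrass approximation, once in time and once in space, does
  the rest along a single path. Two exponents compete. The second moments of the time averages are
  of order \<open>\<epsilon> powr (1 - H)\<close>, and the grid
  \<open>real (Suc n) powr (- (2 / (1 - H)))\<close> makes them summable. Between grid points only
  Hoelder continuity of exponent \<open>\<gamma> < H\<close> is available: it lets
  \<open>k\<close>-th powers grow like \<open>\<epsilon> powr (- (k * (H - \<gamma>)))\<close>,
  while passing to the neighbouring grid point gains
  \<open>\<epsilon> powr (\<gamma> * (1 - H) / 2)\<close>. Since \<open>\<gamma> > 1 / 2\<close>,
  the condition \<open>k * (H - \<gamma>) < (1 - H) / 4\<close> makes the gain win, and it can be
  met by taking \<open>\<gamma>\<close> close to \<open>H\<close>.\<close>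

inductive rs_sum :: "(real \<Rightarrow> real) \<Rightarrow> (real \<Rightarrow> real) \<Rightarrow> real \<Rightarrow> real \<Rightarrow> real \<Rightarrow> real \<Rightarrow> bool"
  for f g d a where
  rs_refl: "rs_sum f g d a a 0"
| rs_step: "\<lbrakk>rs_sum f g d a b S; b \<le> \<tau>; \<tau> \<le> c; b < c; c - b < d\<rbrakk>
    \<Longrightarrow> rs_sum f g d a c (S + f \<tau> * (g c - g b))"

lemma rs_sum_le: "rs_sum f g d a b S \<Longrightarrow> a \<le> b"
  by (induction rule: rs_sum.induct) auto

lemma rs_sum_mono: "rs_sum f g d a b S \<Longrightarrow> d \<le> d' \<Longrightarrow> rs_sum f g d' a b S"
  by (induction rule: rs_sum.induct) (auto intro: rs_sum.intros)

lemma rs_sum_append: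
  assumes "rs_sum f g d a b S" "rs_sum f g d b c T"
  shows "rs_sum f g d a c (S + T)"
  using assms(2,1)
proof (induction rule: rs_sum.induct)
  case (rs_step c' T' \<tau> c)
  then have "rs_sum f g d a c ((S + T') + f \<tau> * (g c - g c'))"
    by (intro rs_sum.rs_step) auto
  then show ?case by (simp add: add.assoc)
qed auto

lemma rs_sum_single:
  assumes "a \<le> \<tau>" "\<tau> \<le> b" "a < b" "b - a < d"
  shows "rs_sum f g d a b (f \<tau> * (g b - g a))"
  using rs_sum.rs_step[OF rs_sum.rs_refl assms] by simp

lemma rs_sum_sequence:
  assumes "\<And>i. i < n \<Longrightarrow> rs_sum f g d (s i) (s (Suc i)) (y i)"
  shows "rs_sum f g d (s 0) (s n) (\<Sum>i<n. y i)"
  using assms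
proof (induction n)
  case 0
  then show ?case by (simp add: rs_sum.rs_refl)
next
  case (Suc n)
  then show ?case by (auto intro: rs_sum_append)
qed

lemma rs_sum_exists:
  assumes "0 < d" "a \<le> b"
  shows "\<exists>S. rs_sum f g d a b S"
proof (cases "a = b")
  case True
  then show ?thesis by (auto intro: rs_sum.rs_refl)
next
  case False
  obtain n :: nat where n: "(b - a) / d < real n"
    using reals_Archimedean2 by blast
  have n0: "n > 0" using n assms False by (cases n) (auto simp: divide_less_0_iff)
  define s where "s i = a + real i * ((b - a) / n)" for i :: nat
  have "rs_sum f g d (s i) (s (Suc i)) (f (s i) * (g (s (Suc i)) - g (s i)))" for i
  proof (rule rs_sum_single)
    have *: "s (Suc i) - s i = (b - a) / n" by (simp add: s_def distrib_right add_divide_distrib)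
    show "s (Suc i) - s i < d" unfolding * using n n0 assms by (simp add: field_simps)
    have "(b - a) / n > 0" using n0 assms False by simp
    with * show "s i < s (Suc i)" by linarith
    then show "s i \<le> s (Suc i)" by simp
  qed simp
  then have "rs_sum f g d (s 0) (s n) (\<Sum>i<n. f (s i) * (g (s (Suc i)) - g (s i)))"
    by (rule rs_sum_sequence)
  then show ?thesis
    using n0 by (auto simp: s_def)
qed

text \<open>Bridge from the inductive partitions to the tagged divisions of
  \<open>has_rs_integral\<close>: a cell shorter than \<open>d\<close> lies in the ball of radius
  \<open>d\<close> about any tag inside it. The integral is always a hypothesis, so this one
  direction suffices.\<close>

lemma rs_sum_tagged_division:
  assumes "rs_sum f g d a b S" "0 < d"
  shows "\<exists>p. p tagged_division_of {a..b} \<and> (\<lambda>x. ball x d) fine p \<and>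
    (\<Sum>(x, K)\<in>p. f x * (g (Sup K) - g (Inf K))) = S"
  using assms
proof (induction rule: rs_sum.induct)
  case rs_refl
  have "{(a, {a})} tagged_division_of {a..a}"
    using tagged_division_of_self_real[of a a a] by simp
  then show ?case using rs_refl by (intro exI[of _ "{(a, {a})}"]) (auto simp: fine_def)
next
  case (rs_step b S \<tau> c)
  then obtain p where p: "p tagged_division_of {a..b}" "(\<lambda>x. ball x d) fine p"
      "(\<Sum>(x, K)\<in>p. f x * (g (Sup K) - g (Inf K))) = S" by auto
  have ab: "a \<le> b" using rs_step rs_sum_le by blast
  have q: "{(\<tau>, {b..c})} tagged_division_of {b..c}"
    using tagged_division_of_self_real[of \<tau> b c] rs_step by simp
  have "p \<union> {(\<tau>, {b..c})} tagged_division_of {a..b} \<union> {b..c}"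
    by (rule tagged_division_Un[OF p(1) q]) auto
  moreover have "{a..b} \<union> {b..c} = {a..c}" using ab rs_step by auto
  moreover have "(\<tau>, {b..c}) \<notin> p"
  proof
    assume "(\<tau>, {b..c}) \<in> p"
    then have "{b..c} \<subseteq> {a..b}" using tagged_division_ofD(3)[OF p(1)] by blast
    then show False using rs_step by auto
  qed
  moreover have "finite p" using p(1) by (rule tagged_division_of_finite)
  moreover have "(\<lambda>x. ball x d) fine (p \<union> {(\<tau>, {b..c})})"
    using p(2) rs_step by (auto simp: fine_def dist_real_def)
  moreover have "Sup {b..c} = c" "Inf {b..c} = b" using rs_step by auto
  ultimately show ?case using p(3)
    by (intro exI[of _ "p \<union> {(\<tau>, {b..c})}"]) (auto simp: add.commute)
qed

lemma has_rs_integral_rs_sum: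
  assumes "has_rs_integral f g l r I" "0 < e"
  shows "\<exists>d>0. \<forall>S. rs_sum f g d l r S \<longrightarrow> \<bar>S - I\<bar> < e"
proof -
  obtain d where d: "d > 0" "\<forall>p. p tagged_division_of {l..r} \<and> (\<lambda>x. ball x d) fine p \<longrightarrow>
        \<bar>(\<Sum>(x, K)\<in>p. f x * (g (Sup K) - g (Inf K))) - I\<bar> < e"
    using assms(1)[unfolded has_rs_integral_def, rule_format, OF assms(2)] by (elim exE conjE)
  have "\<bar>S - I\<bar> < e" if "rs_sum f g d l r S" for S
    using rs_sum_tagged_division[OF that d(1)] d(2) by auto
  then show ?thesis using d(1) by blast
qed

text \<open>A fine sum over \<open>[l, s]\<close> put in front of a sum over \<open>[s, r]\<close>
  is a fine sum over \<open>[l, r]\<close>, so subtraction leaves an approximation of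
  \<open>J - I\<close>. This gives additivity in the upper endpoint without assuming an integral
  over \<open>[s, r]\<close>.\<close>

lemma has_rs_integral_increment:
  assumes "has_rs_integral f g l s I" "has_rs_integral f g l r J" "l \<le> s" "s \<le> r" "0 < e"
  shows "\<exists>d>0. \<forall>S. rs_sum f g d s r S \<longrightarrow> \<bar>S - (J - I)\<bar> < e"
proof -
  obtain d1 where d1: "d1 > 0" "\<And>S. rs_sum f g d1 l s S \<Longrightarrow> \<bar>S - I\<bar> < e / 2"
    using has_rs_integral_rs_sum[OF assms(1), of "e / 2"] assms(5) by auto
  obtain d2 where d2: "d2 > 0" "\<And>S. rs_sum f g d2 l r S \<Longrightarrow> \<bar>S - J\<bar> < e / 2"
    using has_rs_integral_rs_sum[OF assms(2), of "e / 2"] assms(5) by auto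
  let ?d = "min d1 d2"
  obtain S1 where S1: "rs_sum f g ?d l s S1"
    using rs_sum_exists[of ?d l s f g] d1(1) d2(1) assms(3) by fastforce
  have "\<bar>S - (J - I)\<bar> < e" if "rs_sum f g ?d s r S" for S
  proof -
    have "\<bar>S1 - I\<bar> < e / 2" using S1 by (intro d1 rs_sum_mono[OF S1]) simp
    moreover have "\<bar>S1 + S - J\<bar> < e / 2"
      by (intro d2 rs_sum_mono[OF rs_sum_append[OF S1 that]]) simp
    ultimately show ?thesis by linarith
  qed
  then show ?thesis using d1 d2 by (intro exI[of _ ?d]) auto
qed

text \<open>The analogue of Henstock's lemma: replacing some of the cells by much finer partitions
  changes the Riemann sum by little, whatever the set of cells.\<close>

lemma has_rs_integral_Henstock:
  assumes int: "\<And>r. l \<le> r \<Longrightarrow> r \<le> t \<Longrightarrow> has_rs_integral f g l r (I r)"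
    and "l \<le> t" "0 < e"
  obtains d where "0 < d"
    and "\<And>n s \<tau>. \<lbrakk>l \<le> s 0; s n \<le> t;
      \<And>i. i < n \<Longrightarrow> s i < s (Suc i) \<and> s (Suc i) - s i < d \<and> s i \<le> \<tau> i \<and> \<tau> i \<le> s (Suc i)\<rbrakk> \<Longrightarrow>
      (\<Sum>i<n. \<bar>I (s (Suc i)) - I (s i) - f (\<tau> i) * (g (s (Suc i)) - g (s i))\<bar>) \<le> e"
proof -
  obtain d where d: "d > 0" "\<And>S. rs_sum f g d l t S \<Longrightarrow> \<bar>S - I t\<bar> < e / 6"
    using has_rs_integral_rs_sum[OF int[of t], of "e / 6"] assms(2,3) by auto
  have "(\<Sum>i<n. \<bar>I (s (Suc i)) - I (s i) - f (\<tau> i) * (g (s (Suc i)) - g (s i))\<bar>) \<le> e"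
    if s: "l \<le> s 0" "s n \<le> t"
      "\<And>i. i < n \<Longrightarrow> s i < s (Suc i) \<and> s (Suc i) - s i < d \<and> s i \<le> \<tau> i \<and> \<tau> i \<le> s (Suc i)"
    for n :: nat and s \<tau> :: "nat \<Rightarrow> real"
  proof -
    have mono: "s i \<le> s j" if "i \<le> j" "j \<le> n" for i j
      using that
    proof (induction j)
      case (Suc j)
      then show ?case using s(3)[of j] by (cases "i = Suc j") auto
    qed auto
    define E where "E i = I (s (Suc i)) - I (s i) - f (\<tau> i) * (g (s (Suc i)) - g (s i))" for i
    obtain P where P: "rs_sum f g d l (s 0) P" using rs_sum_exists d(1) s(1) by blast
    obtain Q where Q: "rs_sum f g d (s n) t Q" using rs_sum_exists d(1) s(2) by blast
    \<comment> \<open>Every cell gets a refined sum missing the increment of \<open>I\<close> by at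
      most \<open>e / 6 / Suc n\<close>, hence by at most \<open>e / 6\<close> over any set of
      cells. Taking \<open>min d d'\<close> as mesh keeps the refinement admissible for
      \<open>d\<close>.\<close>
    have "\<exists>y. rs_sum f g d (s i) (s (Suc i)) y \<and> \<bar>y - (I (s (Suc i)) - I (s i))\<bar> < e / 6 / Suc n"
      if i: "i < n" for i
    proof -
      have "l \<le> s i" "s i \<le> s (Suc i)" "s (Suc i) \<le> t"
        using s mono[of 0 i] mono[of i "Suc i"] mono[of "Suc i" n] i by auto
      then obtain d' where d': "d' > 0"
        "\<And>S. rs_sum f g d' (s i) (s (Suc i)) S \<Longrightarrow> \<bar>S - (I (s (Suc i)) - I (s i))\<bar> < e / 6 / Suc n"
        using has_rs_integral_increment[OF int[of "s i"] int[of "s (Suc i)"], of "e / 6 / Suc n"]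
          assms(3) by auto
      obtain S where "rs_sum f g (min d d') (s i) (s (Suc i)) S"
        using rs_sum_exists[of "min d d'" "s i" "s (Suc i)" f g] d(1) d'(1) \<open>s i \<le> s (Suc i)\<close> by fastforce
      then show ?thesis using d'(2) by (meson min.cobounded1 min.cobounded2 rs_sum_mono)
    qed
    then obtain y where y: "\<And>i. i < n \<Longrightarrow> rs_sum f g d (s i) (s (Suc i)) (y i)"
      "\<And>i. i < n \<Longrightarrow> \<bar>y i - (I (s (Suc i)) - I (s i))\<bar> < e / 6 / Suc n"
      by metis
    \<comment> \<open>Refining exactly the cells in \<open>A\<close> yields two admissible sums over
      all of \<open>[l, t]\<close>, each within \<open>e / 6\<close> of \<open>I t\<close>. Their
      difference involves the cells of \<open>A\<close> only; with the refinement error this gives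
      \<open>3 * (e / 6)\<close>.\<close>
    have part: "\<bar>\<Sum>i\<in>A. E i\<bar> \<le> e / 2" if A: "A \<subseteq> {..<n}" for A
    proof -
      define z where "z i = f (\<tau> i) * (g (s (Suc i)) - g (s i))" for i
      define w where "w i = (if i \<in> A then y i else z i)" for i
      have z: "rs_sum f g d (s i) (s (Suc i)) (z i)" if "i < n" for i
        unfolding z_def using s(3)[OF that] by (intro rs_sum_single) auto
      then have w: "rs_sum f g d (s i) (s (Suc i)) (w i)" if "i < n" for i
        using that y by (auto simp: w_def)
      have "\<bar>P + (\<Sum>i<n. z i) + Q - I t\<bar> < e / 6"
        using rs_sum_append[OF rs_sum_append[OF P rs_sum_sequence[of n f g d s z]] Q] z by (intro d(2)) auto
      moreover have "\<bar>P + (\<Sum>i<n. w i) + Q - I t\<bar> < e / 6"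
        using rs_sum_append[OF rs_sum_append[OF P rs_sum_sequence[of n f g d s w]] Q] w by (intro d(2)) auto
      moreover have "(\<Sum>i<n. w i) - (\<Sum>i<n. z i) = (\<Sum>i\<in>A. y i - z i)"
      proof -
        have "(\<Sum>i<n. w i) - (\<Sum>i<n. z i) = (\<Sum>i<n. if i \<in> A then y i - z i else 0)"
          by (subst sum_subtractf[symmetric], intro sum.cong) (auto simp: w_def)
        also have "\<dots> = (\<Sum>i\<in>{..<n} \<inter> A. y i - z i)" by (simp add: sum.inter_restrict)
        finally show ?thesis using A by (simp add: Int_absorb1)
      qed
      moreover have "(\<Sum>i\<in>A. E i) = (\<Sum>i\<in>A. y i - z i) - (\<Sum>i\<in>A. y i - (I (s (Suc i)) - I (s i)))"
        by (simp add: E_def z_def sum_subtractf[symmetric] algebra_simps)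
      moreover have "\<bar>\<Sum>i\<in>A. y i - (I (s (Suc i)) - I (s i))\<bar> \<le> e / 6"
      proof -
        have "\<bar>\<Sum>i\<in>A. y i - (I (s (Suc i)) - I (s i))\<bar> \<le> (\<Sum>i\<in>A. \<bar>y i - (I (s (Suc i)) - I (s i))\<bar>)"
          by simp
        also have "\<dots> \<le> (\<Sum>i<n. \<bar>y i - (I (s (Suc i)) - I (s i))\<bar>)"
          using A by (intro sum_mono2) auto
        also have "\<dots> \<le> (\<Sum>i<n. e / 6 / Suc n)"
          using y(2) by (intro sum_mono) (auto intro: less_imp_le)
        also have "\<dots> \<le> e / 6" using assms(3) by (simp add: field_simps)
        finally show ?thesis .
      qed
      ultimately show ?thesis by linarith
    qed
    \<comment> \<open>Freedom in \<open>A\<close> upgrades signed sums to absolute ones: the bound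
      is applied to the cells of nonnegative and of negative error separately.\<close>
    have "(\<Sum>i<n. \<bar>E i\<bar>) = (\<Sum>i\<in>{i. i < n \<and> E i \<ge> 0}. E i) - (\<Sum>i\<in>{i. i < n \<and> \<not> E i \<ge> 0}. E i)"
    proof -
      have "(\<Sum>i<n. \<bar>E i\<bar>) = (\<Sum>i<n. if E i \<ge> 0 then E i else - E i)"
        by (intro sum.cong) auto
      also have "\<dots> = (\<Sum>i\<in>{i. i < n \<and> E i \<ge> 0}. E i) + (\<Sum>i\<in>{i. i < n \<and> \<not> E i \<ge> 0}. - E i)"
        by (subst sum.If_cases) (auto simp: Int_def)
      finally show ?thesis by (simp add: sum_negf)
    qed
    also have "\<dots> \<le> e" using part[of "{i. i < n \<and> E i \<ge> 0}"] part[of "{i. i < n \<and> \<not> E i \<ge> 0}"]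
      by (auto simp: subset_eq)
    finally show ?thesis by (simp add: E_def)
  qed
  then show thesis using that d(1) by blast
qed

section \<open>The pathwise equation\<close>

lemma pathwise_solution_decomposition:
  assumes "pathwise_solution c \<sigma> \<mu> g x"
  obtains I where "\<And>t. 0 \<le> t \<Longrightarrow> has_rs_integral (\<lambda>u. \<sigma> (x u)) g 0 t (I t)"
    and "\<And>t. 0 \<le> t \<Longrightarrow> (\<lambda>u. \<mu> (x u)) integrable_on {0..t}"
    and "\<And>t. 0 \<le> t \<Longrightarrow> x t = c + I t + integral {0..t} (\<lambda>u. \<mu> (x u))"
    and "x 0 = c"
proof -
  have "\<forall>t\<ge>0. \<exists>I. has_rs_integral (\<lambda>u. \<sigma> (x u)) g 0 t I \<and>
        (\<lambda>u. \<mu> (x u)) integrable_on {0..t} \<and>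
        x t = c + I + integral {0..t} (\<lambda>u. \<mu> (x u))"
    using assms unfolding pathwise_solution_def by blast
  then obtain I where I: "\<forall>t\<ge>0. has_rs_integral (\<lambda>u. \<sigma> (x u)) g 0 t (I t) \<and>
        (\<lambda>u. \<mu> (x u)) integrable_on {0..t} \<and>
        x t = c + I t + integral {0..t} (\<lambda>u. \<mu> (x u))"
    by (auto simp: choice_iff')
  \<comment> \<open>On \<open>[0, 0]\<close> the empty sum is admissible for every mesh, which
    forces \<open>I 0 = 0\<close> and hence the initial value \<open>x 0 = c\<close>.\<close>
  have "\<bar>I 0\<bar> < e" if "e > 0" for e
  proof -
    from I have "has_rs_integral (\<lambda>u. \<sigma> (x u)) g 0 0 (I 0)" by simp
    from has_rs_integral_rs_sum[OF this that] obtain d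
      where "\<forall>S. rs_sum (\<lambda>u. \<sigma> (x u)) g d 0 0 S \<longrightarrow> \<bar>S - I 0\<bar> < e" by blast
    from this[rule_format, OF rs_sum.rs_refl] show ?thesis by simp
  qed
  then have "I 0 = 0" by (metis abs_of_nonneg abs_ge_zero less_irrefl zero_less_abs_iff)
  then have "x 0 = c" using I by auto
  with I show thesis by (intro that) auto
qed

lemma integral_increment:
  fixes f :: "real \<Rightarrow> real"
  assumes "f integrable_on {a..t}" "a \<le> s" "s \<le> r" "r \<le> t"
  shows "integral {a..r} f - integral {a..s} f = integral {s..r} f"
proof -
  have "f integrable_on {a..r}" using assms by (auto intro: integrable_on_subinterval)
  from Henstock_Kurzweil_Integration.integral_combine[OF assms(2,3) this] show ?thesis by simp
qed

lemma integral_increment_bound: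
  fixes f :: "real \<Rightarrow> real"
  assumes "f integrable_on {a..t}" "a \<le> s" "s \<le> r" "r \<le> t" "\<And>u. u \<in> {s..r} \<Longrightarrow> \<bar>f u\<bar> \<le> B" "0 \<le> B"
  shows "\<bar>integral {a..r} f - integral {a..s} f\<bar> \<le> B * (r - s)"
proof -
  have "f integrable_on {s..r}" using assms by (auto intro: integrable_on_subinterval)
  from has_integral_bound_real[OF assms(6) finite.emptyI integrable_integral[OF this]]
  show ?thesis using assms integral_increment[OF assms(1-4)] by simp
qed

text \<open>The Henstock estimate is applied to one short cell having the fixed point
  \<open>s\<close> as an endpoint and as its tag. The increment of the integral is then close to
  \<open>\<sigma> (x s)\<close> times that of \<open>g\<close>, with a frozen coefficient, so
  continuity of \<open>g\<close> suffices and nothing about \<open>x\<close> is presupposed.\<close>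

lemma pathwise_solution_continuous:
  assumes sol: "pathwise_solution c \<sigma> \<mu> g x"
    and cont: "continuous_on {0..T} g"
    and \<mu>: "\<And>y. \<bar>\<mu> y\<bar> \<le> B"
  shows "continuous_on {0..T} x"
  unfolding continuous_on_iff
proof (intro ballI allI impI)
  fix s e :: real assume s: "s \<in> {0..T}" and e: "e > 0"
  then have T: "0 \<le> T" by simp
  obtain I where I: "\<And>t. 0 \<le> t \<Longrightarrow> has_rs_integral (\<lambda>u. \<sigma> (x u)) g 0 t (I t)"
      "\<And>t. 0 \<le> t \<Longrightarrow> (\<lambda>u. \<mu> (x u)) integrable_on {0..t}"
      "\<And>t. 0 \<le> t \<Longrightarrow> x t = c + I t + integral {0..t} (\<lambda>u. \<mu> (x u))"
    by (rule pathwise_solution_decomposition[OF sol]) blast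
  have B: "0 \<le> B" using \<mu>[of 0] by linarith
  obtain d where d: "d > 0" "\<And>n s \<tau>. \<lbrakk>0 \<le> s 0; s n \<le> T;
      \<And>i. i < n \<Longrightarrow> s i < s (Suc i) \<and> s (Suc i) - s i < d \<and> s i \<le> \<tau> i \<and> \<tau> i \<le> s (Suc i)\<rbrakk> \<Longrightarrow>
      (\<Sum>i<n. \<bar>I (s (Suc i)) - I (s i) - \<sigma> (x (\<tau> i)) * (g (s (Suc i)) - g (s i))\<bar>) \<le> e / 4"
    by (rule has_rs_integral_Henstock[of 0 T "\<lambda>u. \<sigma> (x u)" g I "e / 4"]) (use I(1) T e in auto)
  have single: "\<bar>I r - I p - \<sigma> (x q) * (g r - g p)\<bar> \<le> e / 4"
    if "0 \<le> p" "p < r" "r \<le> T" "r - p < d" "p \<le> q" "q \<le> r" for p q r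
    using d(2)[of "\<lambda>i. if i = 0 then p else r" 1 "\<lambda>_. q"] that by simp
  have "0 < e / (4 * (\<bar>\<sigma> (x s)\<bar> + 1))" using e by (intro divide_pos_pos) auto
  then obtain d' where d': "d' > 0" "\<And>r. r \<in> {0..T} \<Longrightarrow> dist r s < d' \<Longrightarrow> dist (g r) (g s) < e / (4 * (\<bar>\<sigma> (x s)\<bar> + 1))"
    using cont[unfolded continuous_on_iff] s by metis
  define d'' where "d'' = min (min d d') (e / (4 * (B + 1)))"
  show "\<exists>d>0. \<forall>r\<in>{0..T}. dist r s < d \<longrightarrow> dist (x r) (x s) < e"
  proof (intro exI[of _ d''] conjI ballI impI)
    show "d'' > 0" using d(1) d'(1) e B by (simp add: d''_def)
    fix r assume r: "r \<in> {0..T}" "dist r s < d''"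
    define A where "A = integral {0..r} (\<lambda>u. \<mu> (x u)) - integral {0..s} (\<lambda>u. \<mu> (x u))"
    have "\<bar>I r - I s - \<sigma> (x s) * (g r - g s)\<bar> \<le> e / 4"
    proof (cases r s rule: linorder_cases)
      case less
      have "\<bar>I s - I r - \<sigma> (x s) * (g s - g r)\<bar> \<le> e / 4"
        using r s less by (intro single) (auto simp: d''_def dist_real_def)
      then show ?thesis by (simp add: algebra_simps abs_minus_commute)
    next
      case greater
      then show ?thesis using r s by (intro single) (auto simp: d''_def dist_real_def)
    qed (use e in simp)
    moreover have "\<bar>\<sigma> (x s) * (g r - g s)\<bar> \<le> e / 4"
    proof -
      have "\<bar>g r - g s\<bar> \<le> e / (4 * (\<bar>\<sigma> (x s)\<bar> + 1))"
        using d'(2)[of r] r by (auto simp: dist_real_def d''_def)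
      then have "\<bar>\<sigma> (x s) * (g r - g s)\<bar> \<le> \<bar>\<sigma> (x s)\<bar> * (e / (4 * (\<bar>\<sigma> (x s)\<bar> + 1)))"
        unfolding abs_mult by (rule mult_left_mono) simp
      also have "\<dots> \<le> e / 4"
        using e by (simp add: field_simps)
      finally show ?thesis .
    qed
    moreover have "\<bar>A\<bar> \<le> e / 4"
    proof -
      have "\<bar>A\<bar> \<le> B * \<bar>r - s\<bar>"
        using integral_increment_bound[OF I(2)[OF T], of s r B] B \<mu> r s
          integral_increment_bound[OF I(2)[OF T], of r s B]
        by (cases "s \<le> r") (auto simp: A_def abs_minus_commute)
      also have "\<dots> \<le> B * (e / (4 * (B + 1)))"
        using r B by (intro mult_left_mono) (auto simp: d''_def dist_real_def)
      also have "\<dots> \<le> e / 4" using e B by (simp add: field_simps)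
      finally show ?thesis .
    qed
    moreover have "x r - x s = I r - I s + A"
      using I(3)[of r] I(3)[of s] r s by (simp add: A_def)
    ultimately show "dist (x r) (x s) < e" using e unfolding dist_real_def by linarith
  qed
qed

section \<open>Quadratic errors and the chain rule without correction term\<close>

lemma reciprocal_antiderivative_expansion:
  fixes F \<sigma> :: "real \<Rightarrow> real"
  assumes F: "\<And>y. (F has_real_derivative 1 / \<sigma> y) (at y)"
    and m: "0 < m" "\<And>y. m \<le> \<sigma> y" and L: "L-lipschitz_on UNIV \<sigma>"
  shows "\<bar>F y - F x - (y - x) / \<sigma> x\<bar> \<le> L / m\<^sup>2 * (y - x)\<^sup>2"
proof -
  have L0: "0 \<le> L" using L by (rule lipschitz_on_nonneg)
  have pos: "\<sigma> z > 0" for z using m(1) m(2)[of z] by linarith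
  \<comment> \<open>With an intermediate point \<open>z\<close>, the error is
    \<open>\<bar>y - x\<bar>\<close> times the difference of \<open>1 / \<sigma>\<close> at
    \<open>z\<close> and \<open>x\<close>. Because \<open>\<sigma> \<ge> m\<close>, the function
    \<open>1 / \<sigma>\<close> is Lipschitz with constant \<open>L / m\<^sup>2\<close>.\<close>
  have main: "\<exists>z. \<bar>z - x\<bar> \<le> \<bar>y - x\<bar> \<and> F y - F x = (y - x) / \<sigma> z"
  proof (cases x y rule: linorder_cases)
    case less
    from MVT2[OF this F] obtain z where "x < z" "z < y" "F y - F x = (y - x) * (1 / \<sigma> z)" by blast
    then show ?thesis by (intro exI[of _ z]) auto
  next
    case greater
    from MVT2[OF this F] obtain z where "y < z" "z < x" "F x - F y = (x - y) * (1 / \<sigma> z)" by blast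
    then show ?thesis by (intro exI[of _ z]) (auto simp: field_simps diff_divide_distrib)
  qed (use pos in auto)
  then obtain z where z: "\<bar>z - x\<bar> \<le> \<bar>y - x\<bar>" "F y - F x = (y - x) / \<sigma> z" by blast
  have "\<bar>F y - F x - (y - x) / \<sigma> x\<bar> = \<bar>y - x\<bar> * \<bar>\<sigma> x - \<sigma> z\<bar> / (\<sigma> x * \<sigma> z)"
  proof -
    have "F y - F x - (y - x) / \<sigma> x = (y - x) * (\<sigma> x - \<sigma> z) / (\<sigma> x * \<sigma> z)"
      unfolding z(2) using pos[of x] pos[of z] by (simp add: field_simps)
    then show ?thesis using pos[of x] pos[of z] by (simp add: abs_mult)
  qed
  also have "\<dots> \<le> \<bar>y - x\<bar> * (L * \<bar>y - x\<bar>) / (m * m)"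
  proof (intro frac_le mult_left_mono mult_mono)
    have "\<bar>\<sigma> x - \<sigma> z\<bar> \<le> L * \<bar>x - z\<bar>"
      using lipschitz_onD[OF L, of x z] by (simp add: dist_real_def)
    also have "\<dots> \<le> L * \<bar>y - x\<bar>" using z(1) L0 by (intro mult_left_mono) auto
    finally show "\<bar>\<sigma> x - \<sigma> z\<bar> \<le> L * \<bar>y - x\<bar>" .
  qed (use m L0 pos in \<open>auto intro: less_imp_le\<close>)
  also have "\<dots> = L / m\<^sup>2 * (y - x)\<^sup>2" by (simp add: power2_eq_square flip: abs_mult)
  finally show ?thesis .
qed

text \<open>Each of the \<open>n\<close> squared increments is of order
  \<open>n powr (- 2 * \<gamma>)\<close>, so their sum is of order
  \<open>n powr (1 - 2 * \<gamma>)\<close>; this is where an exponent above one half enters.\<close>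

lemma holder_quadratic_variation:
  fixes g :: "real \<Rightarrow> real" and t :: real
  assumes holder: "\<And>s r. s \<in> {0..T} \<Longrightarrow> r \<in> {0..T} \<Longrightarrow> \<bar>g r - g s\<bar> \<le> K * \<bar>r - s\<bar> powr \<gamma>"
    and "1 / 2 < \<gamma>" "0 < t" "t \<le> T"
  shows "(\<lambda>n. \<Sum>i<n. (g (t * Suc i / n) - g (t * i / n))\<^sup>2) \<longlonglongrightarrow> 0"
proof -
  have "(\<lambda>n::nat. (K\<^sup>2 * t powr (2 * \<gamma>)) * real n powr (1 - 2 * \<gamma>)) \<longlonglongrightarrow> (K\<^sup>2 * t powr (2 * \<gamma>)) * 0"
    using assms(2) by (intro tendsto_mult tendsto_const tendsto_neg_powr filterlim_real_sequentially) auto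
  moreover have "\<forall>\<^sub>F n in sequentially. norm (\<Sum>i<n. (g (t * Suc i / n) - g (t * i / n))\<^sup>2)
      \<le> (K\<^sup>2 * t powr (2 * \<gamma>)) * real n powr (1 - 2 * \<gamma>)"
    using eventually_gt_at_top[of 0]
  proof eventually_elim
    case (elim n)
    have "(g (t * Suc i / n) - g (t * i / n))\<^sup>2 \<le> K\<^sup>2 * (t / n) powr (2 * \<gamma>)" if i: "i < n" for i
    proof -
      have "real i / n \<le> 1" "real (Suc i) / n \<le> 1"
        using i elim by (simp_all add: divide_le_eq)
      from this[THEN mult_left_mono, of t] have "t * real i / n \<le> t" "t * real (Suc i) / n \<le> t"
        using assms(3) by simp_all
      then have "t * real i / n \<in> {0..T}" "t * real (Suc i) / n \<in> {0..T}"
        using assms(3,4) by auto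
      from holder[OF this] have "\<bar>g (t * Suc i / n) - g (t * i / n)\<bar> \<le> K * \<bar>t * Suc i / n - t * i / n\<bar> powr \<gamma>" .
      also have "t * Suc i / n - t * i / n = t / n" by (simp only: of_nat_Suc distrib_left mult_1_right add_divide_distrib add_diff_cancel_right')
      also have "\<bar>t / n\<bar> = t / n" using assms(3) by simp
      finally have "\<bar>g (t * Suc i / n) - g (t * i / n)\<bar> \<le> K * (t / n) powr \<gamma>" .
      then have "\<bar>g (t * Suc i / n) - g (t * i / n)\<bar>\<^sup>2 \<le> (K * (t / n) powr \<gamma>)\<^sup>2"
        by (rule power_mono) (rule abs_ge_zero)
      also have "\<dots> = K\<^sup>2 * (t / n) powr (2 * \<gamma>)"
        unfolding power_mult_distrib by (simp only: power2_eq_square mult_2 powr_add)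
      finally show ?thesis unfolding power2_abs .
    qed
    then have "(\<Sum>i<n. (g (t * Suc i / n) - g (t * i / n))\<^sup>2) \<le> (\<Sum>i<n. K\<^sup>2 * (t / n) powr (2 * \<gamma>))"
      by (intro sum_mono) (simp only: lessThan_iff)
    also have "\<dots> = real n * (K\<^sup>2 * (t powr (2 * \<gamma>) / real n powr (2 * \<gamma>)))"
      using assms(3) by (simp add: powr_divide)
    also have "\<dots> = (K\<^sup>2 * t powr (2 * \<gamma>)) * (real n / real n powr (2 * \<gamma>))" by simp
    also have "real n / real n powr (2 * \<gamma>) = real n powr (1 - 2 * \<gamma>)"
      using elim by (simp add: powr_diff)
    finally have *: "(\<Sum>i<n. (g (t * Suc i / n) - g (t * i / n))\<^sup>2)
      \<le> (K\<^sup>2 * t powr (2 * \<gamma>)) * real n powr (1 - 2 * \<gamma>)" .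
    have "0 \<le> (\<Sum>i<n. (g (t * Suc i / n) - g (t * i / n))\<^sup>2)" by (intro sum_nonneg) (rule zero_le_power2)
    with * show ?case unfolding real_norm_def by (simp only: abs_of_nonneg)
  qed
  ultimately show ?thesis by (auto intro: Lim_null_comparison)
qed

text \<open>Serves to pass from the Henstock bound on a sum of absolute errors to the sum of their
  squares.\<close>

lemma sum_power2_le:
  fixes a :: "'a \<Rightarrow> real"
  assumes "finite A"
  shows "(\<Sum>i\<in>A. (a i)\<^sup>2) \<le> (\<Sum>i\<in>A. \<bar>a i\<bar>)\<^sup>2"
proof -
  have "(\<Sum>i\<in>A. (a i)\<^sup>2) = (\<Sum>i\<in>A. \<bar>a i\<bar> * \<bar>a i\<bar>)" by (simp add: power2_eq_square)
  also have "\<dots> \<le> (\<Sum>i\<in>A. \<bar>a i\<bar> * (\<Sum>j\<in>A. \<bar>a j\<bar>))"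
    using assms by (intro sum_mono mult_left_mono member_le_sum) auto
  finally show ?thesis by (simp add: power2_eq_square sum_distrib_right)
qed

text \<open>The Doss--Sussmann transform. The driver has zero quadratic variation, so the chain rule
  for an antiderivative \<open>F\<close> of \<open>1 / \<sigma>\<close> has no correction term and \<open>F \<circ> x\<close> differs from the driver
  by a Lipschitz function.\<close>

theorem pathwise_solution_Doss:
  fixes F \<sigma> \<mu> g x :: "real \<Rightarrow> real"
  assumes sol: "pathwise_solution c \<sigma> \<mu> g x"
    and holder: "\<And>s r. s \<in> {0..T} \<Longrightarrow> r \<in> {0..T} \<Longrightarrow> \<bar>g r - g s\<bar> \<le> K * \<bar>r - s\<bar> powr \<gamma>"
    and \<gamma>: "1 / 2 < \<gamma>"
    and cont: "continuous_on {0..T} g"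
    and \<mu>: "continuous_on UNIV \<mu>" "\<And>y. \<bar>\<mu> y\<bar> \<le> B"
    and m: "0 < m" "\<And>y. m \<le> \<sigma> y" and L: "L-lipschitz_on UNIV \<sigma>"
    and F: "\<And>y. (F has_real_derivative 1 / \<sigma> y) (at y)"
    and t: "0 \<le> t" "t \<le> T"
  shows "F (x t) = F c + (g t - g 0) + integral {0..t} (\<lambda>u. \<mu> (x u) / \<sigma> (x u))"
proof (cases "t = 0")
  case True
  have "x 0 = c" by (rule pathwise_solution_decomposition[OF sol])
  then show ?thesis using True by simp
next
  case False
  with t have t0: "0 < t" by simp
  obtain I where I: "\<And>t. 0 \<le> t \<Longrightarrow> has_rs_integral (\<lambda>u. \<sigma> (x u)) g 0 t (I t)"
      "\<And>t. 0 \<le> t \<Longrightarrow> (\<lambda>u. \<mu> (x u)) integrable_on {0..t}"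
      "\<And>t. 0 \<le> t \<Longrightarrow> x t = c + I t + integral {0..t} (\<lambda>u. \<mu> (x u))" "x 0 = c"
    by (rule pathwise_solution_decomposition[OF sol]) blast
  have pos: "\<sigma> z > 0" for z using m(1) m(2)[of z] by linarith
  have B: "0 \<le> B" using \<mu>(2)[of 0] by linarith
  have L0: "0 \<le> L" using L by (rule lipschitz_on_nonneg)
  have contx: "continuous_on {0..t} x"
    using pathwise_solution_continuous[OF sol cont \<mu>(2)] by (rule continuous_on_subset) (use t in auto)
  have \<sigma>_cont: "continuous_on UNIV \<sigma>" using L by (rule lipschitz_on_continuous_on)
  have contf: "continuous_on {0..t} (\<lambda>u. \<sigma> (x u))"
    by (rule continuous_on_compose2[OF \<sigma>_cont contx]) auto
  have contr: "continuous_on {0..t} (\<lambda>u. 1 / \<sigma> (x u))"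
    using pos by (intro continuous_intros contf) (auto simp: less_imp_neq[symmetric])
  have contq: "continuous_on {0..t} (\<lambda>u. \<mu> (x u) / \<sigma> (x u))"
    using pos by (intro continuous_intros contf continuous_on_compose2[OF \<mu>(1) contx]) (auto simp: less_imp_neq[symmetric])
  obtain Kf where Kf: "\<And>u. u \<in> {0..t} \<Longrightarrow> \<bar>\<sigma> (x u)\<bar> \<le> Kf"
  proof -
    have "bounded ((\<lambda>u. \<sigma> (x u)) ` {0..t})" using contf by (intro compact_imp_bounded compact_continuous_image) auto
    then obtain a where "\<forall>y\<in>(\<lambda>u. \<sigma> (x u)) ` {0..t}. norm y \<le> a" by (auto simp: bounded_iff)
    then show thesis by (intro that[of a]) auto
  qed
  define D where "D = F (x t) - F c - (g t - g 0) - integral {0..t} (\<lambda>u. \<mu> (x u) / \<sigma> (x u))"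
  \<comment> \<open>The defect \<open>D\<close> will be at most \<open>C * e\<close> for every
    \<open>e\<close> in (0, 1). The three parts of \<open>C\<close> stem from the quadratic
    remainders of \<open>F\<close>, from the Henstock errors divided by
    \<open>\<sigma> \<ge> m\<close>, and from freezing \<open>1 / \<sigma>\<close> in the
    drift.\<close>
  define C where "C = 3 * L / m\<^sup>2 * (1 + Kf\<^sup>2 + 1) + 1 / m + B * t"
  have bound: "\<bar>D\<bar> \<le> C * e" if e: "0 < e" "e < 1" for e
  proof -
    obtain d where d: "d > 0" "\<And>n s \<tau>. \<lbrakk>0 \<le> s 0; s n \<le> t;
        \<And>i. i < n \<Longrightarrow> s i < s (Suc i) \<and> s (Suc i) - s i < d \<and> s i \<le> \<tau> i \<and> \<tau> i \<le> s (Suc i)\<rbrakk> \<Longrightarrow>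
        (\<Sum>i<n. \<bar>I (s (Suc i)) - I (s i) - \<sigma> (x (\<tau> i)) * (g (s (Suc i)) - g (s i))\<bar>) \<le> e"
      by (rule has_rs_integral_Henstock[of 0 t "\<lambda>u. \<sigma> (x u)" g I e]) (use I(1) t e in auto)
    obtain d2 where d2: "d2 > 0" "\<And>u v. u \<in> {0..t} \<Longrightarrow> v \<in> {0..t} \<Longrightarrow> dist v u < d2 \<Longrightarrow>
        dist (1 / \<sigma> (x v)) (1 / \<sigma> (x u)) < e"
      using compact_uniformly_continuous[OF contr compact_Icc,
          unfolded uniformly_continuous_on_def, rule_format, OF e(1)] by blast
    have lim: "(\<lambda>n. a / real n) \<longlonglongrightarrow> 0" for a by (rule lim_const_over_n)
    have "\<forall>\<^sub>F n in sequentially. n > 0 \<and> t / n < d \<and> t / n < d2 \<and> B\<^sup>2 * t\<^sup>2 / n < e \<and>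
        (\<Sum>i<n. (g (t * Suc i / n) - g (t * i / n))\<^sup>2) < e"
      by (intro eventually_conj eventually_gt_at_top order_tendstoD(2)[OF lim]
          order_tendstoD(2)[OF holder_quadratic_variation[OF holder \<gamma> t0 t(2)]]) (use d d2 e in auto)
    \<comment> \<open>One uniform partition meets all demands: mesh below the Henstock gauge
      \<open>d\<close> and below the modulus \<open>d2\<close> of \<open>1 / \<sigma> (x u)\<close>,
      squared drift contributions below \<open>e\<close>, and squared increments of \<open>g\<close>
      below \<open>e\<close>.\<close>
    from eventually_happens'[OF sequentially_bot this]
    obtain n where n: "n > 0" "t / n < d" "t / n < d2" "B\<^sup>2 * t\<^sup>2 / n < e"
        "(\<Sum>i<n. (g (t * Suc i / n) - g (t * i / n))\<^sup>2) < e"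
      by (elim exE conjE)
    define s where "s i = t * real i / n" for i
    have s_step: "s (Suc i) - s i = t / n" for i using n(1) by (simp add: s_def field_simps)
    have tn: "0 < t / n" using t0 n(1) by simp
    have s_mono: "s i \<le> s j" if "i \<le> j" for i j
      using that t0 n(1) by (auto simp: s_def divide_right_mono)
    have s0: "s 0 = 0" and sn: "s n = t" using n(1) by (auto simp: s_def)
    have s_in: "0 \<le> s i" "i \<le> n \<Longrightarrow> s i \<le> t" for i
      using s_mono[of 0 i] s_mono[of i n] s0 sn by auto
    define E where "E i = I (s (Suc i)) - I (s i) - \<sigma> (x (s i)) * (g (s (Suc i)) - g (s i))" for i
    have sumE: "(\<Sum>i<n. \<bar>E i\<bar>) \<le> e"
      unfolding E_def
    proof (rule d(2))
      fix i
      show "s i < s (Suc i) \<and> s (Suc i) - s i < d \<and> s i \<le> s i \<and> s i \<le> s (Suc i)"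
        using s_step[of i] tn n(2) by auto
    qed (use s0 sn in auto)
    define \<Delta> where "\<Delta> i = x (s (Suc i)) - x (s i)" for i
    define G where "G i = g (s (Suc i)) - g (s i)" for i
    define A where "A i = integral {s i..s (Suc i)} (\<lambda>u. \<mu> (x u))" for i
    define Q where "Q i = integral {s i..s (Suc i)} (\<lambda>u. \<mu> (x u) / \<sigma> (x u))" for i
    have \<Delta>: "\<Delta> i = E i + \<sigma> (x (s i)) * G i + A i" if "i < n" for i
      using I(3)[of "s i"] I(3)[of "s (Suc i)"] s_in s_mono[of i "Suc i"] that
        integral_increment[OF I(2)[of t], of "s i" "s (Suc i)"] t0
      by (simp add: \<Delta>_def E_def G_def A_def)
    have int: "(\<lambda>u. \<mu> (x u)) integrable_on {s i..s (Suc i)}"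
        "(\<lambda>u. \<mu> (x u) / \<sigma> (x u)) integrable_on {s i..s (Suc i)}" if "i < n" for i
      using s_in(1)[of i] s_in(2)[of "Suc i"] that
      by (auto intro!: integrable_on_subinterval[OF I(2)[of t]] integrable_on_subinterval[OF integrable_continuous_real[OF contq]] simp: t)
    have A: "\<bar>A i\<bar> \<le> B * (t / n)" if "i < n" for i
      using has_integral_bound_real[OF B finite.emptyI integrable_integral[OF int(1)[OF that]]] \<mu>(2) s_step[of i] tn
      by (simp add: A_def)
    have AQ: "\<bar>A i / \<sigma> (x (s i)) - Q i\<bar> \<le> B * e * (t / n)" if i: "i < n" for i
    proof -
      have "((\<lambda>u. \<mu> (x u) / \<sigma> (x (s i)) - \<mu> (x u) / \<sigma> (x u)) has_integral (A i / \<sigma> (x (s i)) - Q i)) {s i..s (Suc i)}"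
        unfolding A_def Q_def using int[OF i]
        by (intro has_integral_diff has_integral_divide integrable_integral)
      moreover have "norm (\<mu> (x u) / \<sigma> (x (s i)) - \<mu> (x u) / \<sigma> (x u)) \<le> B * e" if u: "u \<in> {s i..s (Suc i)} - {}" for u
      proof -
        have "dist u (s i) < d2" using u s_step[of i] n(3) by (auto simp: dist_real_def)
        then have "\<bar>1 / \<sigma> (x u) - 1 / \<sigma> (x (s i))\<bar> < e"
          using d2(2)[of "s i" u] u s_in(1)[of i] s_in(2)[of i] s_in(2)[of "Suc i"] i by (auto simp: dist_real_def)
        then have "\<bar>\<mu> (x u)\<bar> * \<bar>1 / \<sigma> (x u) - 1 / \<sigma> (x (s i))\<bar> \<le> B * e"
          using \<mu>(2) B by (intro mult_mono) auto
        moreover have "\<mu> (x u) / \<sigma> (x (s i)) - \<mu> (x u) / \<sigma> (x u) = - (\<mu> (x u) * (1 / \<sigma> (x u) - 1 / \<sigma> (x (s i))))"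
          by (simp add: algebra_simps)
        ultimately show ?thesis by (simp add: abs_mult)
      qed
      ultimately have "norm (A i / \<sigma> (x (s i)) - Q i) \<le> B * e * Henstock_Kurzweil_Integration.content {s i..s (Suc i)}"
        using B e by (intro has_integral_bound_real[OF _ finite.emptyI]) auto
      then show ?thesis using s_step[of i] tn by simp
    qed
    \<comment> \<open>The quadratic variation of \<open>x\<close> is small because that of each of
      the three summands of \<open>\<Delta> i\<close> is. For the Henstock errors it is at most the
      square of their absolute sum, hence at most \<open>e\<^sup>2 \<le> e\<close>.\<close>
    have \<Delta>2: "(\<Sum>i<n. (\<Delta> i)\<^sup>2) \<le> 3 * (1 + Kf\<^sup>2 + 1) * e"
    proof -
      have "(\<Delta> i)\<^sup>2 \<le> 3 * ((E i)\<^sup>2 + Kf\<^sup>2 * (G i)\<^sup>2 + (B * (t / n))\<^sup>2)" if i: "i < n" for i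
      proof -
        have sq: "(a + b + c)\<^sup>2 \<le> 3 * (a\<^sup>2 + b\<^sup>2 + c\<^sup>2)" for a b c :: real
          using sum_squares_ge_zero[of "a - b" "b - c"] zero_le_power2[of "a - c"]
          by (simp add: power2_eq_square algebra_simps)
        have "(\<Delta> i)\<^sup>2 \<le> 3 * ((E i)\<^sup>2 + (\<sigma> (x (s i)) * G i)\<^sup>2 + (A i)\<^sup>2)"
          unfolding \<Delta>[OF i] by (rule sq)
        moreover have "(\<sigma> (x (s i)) * G i)\<^sup>2 \<le> Kf\<^sup>2 * (G i)\<^sup>2"
          unfolding power_mult_distrib
          using power_mono[OF Kf[of "s i"], of 2] s_in[of i] i by (intro mult_right_mono) auto
        moreover have "(A i)\<^sup>2 \<le> (B * (t / n))\<^sup>2" using power_mono[OF A[OF i], of 2] by simp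
        ultimately show ?thesis by (elim order_trans) (intro mult_left_mono add_mono; simp)
      qed
      then have "(\<Sum>i<n. (\<Delta> i)\<^sup>2) \<le> (\<Sum>i<n. 3 * ((E i)\<^sup>2 + Kf\<^sup>2 * (G i)\<^sup>2 + (B * (t / n))\<^sup>2))"
        by (intro sum_mono) auto
      also have "\<dots> = 3 * ((\<Sum>i<n. (E i)\<^sup>2) + Kf\<^sup>2 * (\<Sum>i<n. (G i)\<^sup>2) + n * (B * (t / n))\<^sup>2)"
        by (simp add: sum.distrib sum_distrib_left)
      also have "\<dots> \<le> 3 * (e + Kf\<^sup>2 * e + e)"
      proof -
        have g1: "(\<Sum>i<n. (E i)\<^sup>2) \<le> e"
        proof -
          have "(\<Sum>i<n. (E i)\<^sup>2) \<le> (\<Sum>i<n. \<bar>E i\<bar>)\<^sup>2" by (rule sum_power2_le) simp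
          also have "\<dots> \<le> e\<^sup>2" using sumE by (intro power_mono) (auto intro: sum_nonneg)
          also have "\<dots> \<le> e" using e by (simp add: power2_eq_square mult_le_one mult_left_le)
          finally show ?thesis .
        qed
        have g2: "Kf\<^sup>2 * (\<Sum>i<n. (G i)\<^sup>2) \<le> Kf\<^sup>2 * e"
          using n(5) by (intro mult_left_mono) (auto simp: G_def s_def)
        have g3: "n * (B * (t / n))\<^sup>2 \<le> e"
          using n(1,4) by (simp add: power2_eq_square field_simps)
        show ?thesis by (rule mult_left_mono[OF add_mono[OF add_mono[OF g1 g2] g3]]) simp
      qed
      finally show ?thesis by (simp add: algebra_simps)
    qed
    have tele: "D = (\<Sum>i<n. (F (x (s (Suc i))) - F (x (s i))) - G i - Q i)"
    proof -
      have "(\<Sum>i<n. F (x (s (Suc i))) - F (x (s i))) = F (x t) - F c"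
        using sum_lessThan_telescope[of "\<lambda>i. F (x (s i))" n] s0 sn I(4) by simp
      moreover have "(\<Sum>i<n. G i) = g t - g 0"
        using sum_lessThan_telescope[of "\<lambda>i. g (s i)" n] s0 sn by (simp add: G_def)
      moreover have "(\<Sum>i<n. Q i) = integral {0..t} (\<lambda>u. \<mu> (x u) / \<sigma> (x u))"
      proof -
        have "Q i = integral {0..s (Suc i)} (\<lambda>u. \<mu> (x u) / \<sigma> (x u)) - integral {0..s i} (\<lambda>u. \<mu> (x u) / \<sigma> (x u))"
          if "i < n" for i
          unfolding Q_def using s_in(1)[of i] s_in(2)[of "Suc i"] s_mono[of i "Suc i"] that
          by (intro integral_increment[symmetric, of _ _ t] integrable_continuous_real contq) auto
        then have "(\<Sum>i<n. Q i) = (\<Sum>i<n. integral {0..s (Suc i)} (\<lambda>u. \<mu> (x u) / \<sigma> (x u)) - integral {0..s i} (\<lambda>u. \<mu> (x u) / \<sigma> (x u)))"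
          by (intro sum.cong) auto
        also have "\<dots> = integral {0..t} (\<lambda>u. \<mu> (x u) / \<sigma> (x u))"
          by (subst sum_lessThan_telescope[of "\<lambda>i. integral {0..s i} (\<lambda>u. \<mu> (x u) / \<sigma> (x u))"]) (simp add: s0 sn)
        finally show ?thesis .
      qed
      ultimately show ?thesis by (simp add: D_def sum_subtractf)
    qed
    have cell: "\<bar>(F (x (s (Suc i))) - F (x (s i))) - G i - Q i\<bar> \<le>
        L / m\<^sup>2 * (\<Delta> i)\<^sup>2 + \<bar>E i\<bar> / m + B * e * (t / n)" if i: "i < n" for i
    proof -
      have "(F (x (s (Suc i))) - F (x (s i))) - G i - Q i =
          (F (x (s (Suc i))) - F (x (s i)) - \<Delta> i / \<sigma> (x (s i))) + E i / \<sigma> (x (s i)) + (A i / \<sigma> (x (s i)) - Q i)"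
        unfolding \<Delta>[OF i] using pos[of "x (s i)"] by (simp add: field_simps)
      moreover have "\<bar>F (x (s (Suc i))) - F (x (s i)) - \<Delta> i / \<sigma> (x (s i))\<bar> \<le> L / m\<^sup>2 * (\<Delta> i)\<^sup>2"
        unfolding \<Delta>_def by (rule reciprocal_antiderivative_expansion[OF F m L])
      moreover have "\<bar>E i / \<sigma> (x (s i))\<bar> \<le> \<bar>E i\<bar> / m"
        using pos[of "x (s i)"] m by (auto simp: abs_divide intro!: divide_left_mono mult_pos_pos)
      ultimately show ?thesis using AQ[OF i] by linarith
    qed
    have "\<bar>D\<bar> \<le> (\<Sum>i<n. \<bar>(F (x (s (Suc i))) - F (x (s i))) - G i - Q i\<bar>)"
      unfolding tele by (rule sum_abs)
    also have "\<dots> \<le> (\<Sum>i<n. L / m\<^sup>2 * (\<Delta> i)\<^sup>2 + \<bar>E i\<bar> / m + B * e * (t / n))"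
      by (intro sum_mono cell) auto
    also have "\<dots> = L / m\<^sup>2 * (\<Sum>i<n. (\<Delta> i)\<^sup>2) + (\<Sum>i<n. \<bar>E i\<bar>) / m + B * e * t"
      using n(1) by (simp add: sum.distrib sum_distrib_left sum_divide_distrib)
    also have "\<dots> \<le> L / m\<^sup>2 * (3 * (1 + Kf\<^sup>2 + 1) * e) + e / m + B * e * t"
      using \<Delta>2 sumE L0 m(1) B e by (intro add_mono mult_left_mono divide_right_mono) auto
    also have "\<dots> = C * e" using m(1) by (simp add: C_def field_simps)
    finally show ?thesis .
  qed
  have "D = 0"
  proof (rule ccontr)
    assume "D \<noteq> 0"
    define e where "e = min (1 / 2) (\<bar>D\<bar> / (2 * (\<bar>C\<bar> + 1)))"
    have "\<bar>D\<bar> \<le> C * e" using \<open>D \<noteq> 0\<close> by (intro bound) (auto simp: e_def)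
    also have "\<dots> \<le> (\<bar>C\<bar> + 1) * e" using \<open>D \<noteq> 0\<close> by (intro mult_right_mono) (auto simp: e_def)
    also have "\<dots> \<le> (\<bar>C\<bar> + 1) * (\<bar>D\<bar> / (2 * (\<bar>C\<bar> + 1)))" by (intro mult_left_mono) (auto simp: e_def)
    also have "\<dots> = \<bar>D\<bar> / 2" by (simp add: field_simps)
    finally show False using \<open>D \<noteq> 0\<close> by simp
  qed
  then show ?thesis by (simp add: D_def)
qed

text \<open>The Doss identity makes \<open>F (x t)\<close> as regular as the driver. On the compact
  range of \<open>x\<close> the inverse of \<open>F\<close> is Lipschitz, so \<open>x\<close>
  inherits the exponent \<open>\<gamma>\<close>; expanding \<open>F\<close> at \<open>x s\<close>
  then gives the increments. The error \<open>\<bar>r - s\<bar>\<close> comes from the drift, the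
  error with exponent \<open>2 * \<gamma>\<close> from the quadratic remainder.\<close>

lemma pathwise_solution_expansion:
  fixes \<sigma> \<mu> g x :: "real \<Rightarrow> real"
  assumes sol: "pathwise_solution c \<sigma> \<mu> g x"
    and holder: "\<And>s r. s \<in> {0..T} \<Longrightarrow> r \<in> {0..T} \<Longrightarrow> \<bar>g r - g s\<bar> \<le> K * \<bar>r - s\<bar> powr \<gamma>"
    and \<gamma>: "1 / 2 < \<gamma>" "\<gamma> \<le> 1" and K: "0 \<le> K" and T: "0 < T"
    and cont: "continuous_on {0..T} g"
    and \<mu>: "continuous_on UNIV \<mu>" "\<And>y. \<bar>\<mu> y\<bar> \<le> B"
    and m: "0 < m" "\<And>y. m \<le> \<sigma> y" and L: "L-lipschitz_on UNIV \<sigma>"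
  obtains C where "0 \<le> C"
    and "\<And>s r. s \<in> {0..T} \<Longrightarrow> r \<in> {0..T} \<Longrightarrow> \<bar>x r - x s\<bar> \<le> C * \<bar>r - s\<bar> powr \<gamma>"
    and "\<And>s r. s \<in> {0..T} \<Longrightarrow> r \<in> {0..T} \<Longrightarrow>
      \<bar>x r - x s - \<sigma> (x s) * (g r - g s)\<bar> \<le> C * (\<bar>r - s\<bar> + \<bar>r - s\<bar> powr (2 * \<gamma>))"
proof -
  have pos: "\<sigma> z > 0" for z using m(1) m(2)[of z] by linarith
  have B: "0 \<le> B" using \<mu>(2)[of 0] by linarith
  have L0: "0 \<le> L" using L by (rule lipschitz_on_nonneg)
  have \<sigma>_cont: "continuous_on UNIV \<sigma>" using L by (rule lipschitz_on_continuous_on)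
  have "isCont (\<lambda>y. 1 / \<sigma> y) y" for y
    using \<sigma>_cont pos[of y] by (intro continuous_intros) (auto simp: continuous_on_eq_continuous_at)
  then obtain F where "\<forall>y::real. -\<infinity> < ereal y \<longrightarrow> ereal y < \<infinity> \<longrightarrow> (F has_vector_derivative 1 / \<sigma> y) (at y)"
    using einterval_antiderivative[of "-\<infinity>" "\<infinity>" "\<lambda>y. 1 / \<sigma> y"] by auto
  then have F: "(F has_real_derivative 1 / \<sigma> y) (at y)" for y
    by (simp add: has_real_derivative_iff_has_vector_derivative)
  have contx: "continuous_on {0..T} x"
    using pathwise_solution_continuous[OF sol cont \<mu>(2)] .
  obtain R where R: "\<And>u. u \<in> {0..T} \<Longrightarrow> \<bar>x u\<bar> \<le> R"
  proof -
    have "bounded (x ` {0..T})" using contx by (intro compact_imp_bounded compact_continuous_image) auto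
    then obtain a where "\<forall>y\<in>x ` {0..T}. norm y \<le> a" by (auto simp: bounded_iff)
    then show thesis by (intro that[of a]) auto
  qed
  \<comment> \<open>A bound for \<open>\<sigma>\<close> on the range of \<open>x\<close>. Globally
    \<open>\<sigma>\<close> may be unbounded, but being Lipschitz it grows at most linearly.
    \<open>S\<close> is the Lipschitz constant of the inverse of \<open>F\<close> there.\<close>
  define S where "S = \<sigma> 0 + L * R"
  have S: "\<sigma> z \<le> S" if "\<bar>z\<bar> \<le> R" for z
  proof -
    have "\<bar>\<sigma> z - \<sigma> 0\<bar> \<le> L * \<bar>z\<bar>" using lipschitz_onD[OF L, of z 0] by (simp add: dist_real_def)
    also have "\<dots> \<le> L * R" using that L0 by (intro mult_left_mono)
    finally show ?thesis by (simp add: S_def)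
  qed
  have S0: "0 < S" using S[of "x 0"] R[of 0] T pos[of "x 0"] by auto
  have inv_le: "y - z \<le> S * (F y - F z)" if "\<bar>y\<bar> \<le> R" "\<bar>z\<bar> \<le> R" "z < y" for y z
  proof -
    from MVT2[OF that(3) F] obtain \<xi> where \<xi>: "z < \<xi>" "\<xi> < y" "F y - F z = (y - z) * (1 / \<sigma> \<xi>)" by blast
    have "\<sigma> \<xi> \<le> S" using \<xi> that by (intro S) auto
    then have "(y - z) * \<sigma> \<xi> \<le> (y - z) * S" using that by (intro mult_left_mono) auto
    then show ?thesis unfolding \<xi>(3) using pos[of \<xi>] by (simp add: field_simps)
  qed
  have SA: "S * w \<le> S * \<bar>w\<bar>" for w using S0 by (intro mult_left_mono) auto
  have inv: "\<bar>y - z\<bar> \<le> S * \<bar>F y - F z\<bar>" if "\<bar>y\<bar> \<le> R" "\<bar>z\<bar> \<le> R" for y z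
  proof (cases y z rule: linorder_cases)
    case less
    then show ?thesis using order_trans[OF inv_le[of z y] SA] that by (simp add: abs_minus_commute)
  next
    case greater
    then show ?thesis using order_trans[OF inv_le[of y z] SA] that by simp
  qed simp
  define J where "J t = integral {0..t} (\<lambda>u. \<mu> (x u) / \<sigma> (x u))" for t
  have contq: "continuous_on {0..T} (\<lambda>u. \<mu> (x u) / \<sigma> (x u))"
    using pos by (intro continuous_intros continuous_on_compose2[OF \<mu>(1) contx] continuous_on_compose2[OF \<sigma>_cont contx])
      (auto simp: less_imp_neq[symmetric])
  have q: "\<bar>\<mu> z / \<sigma> z\<bar> \<le> B / m" for z
    using \<mu>(2)[of z] m(1) m(2)[of z] pos[of z] B by (auto simp: abs_divide intro!: frac_le)
  have J: "\<bar>J r - J s\<bar> \<le> B / m * \<bar>r - s\<bar>" if "s \<in> {0..T}" "r \<in> {0..T}" for r s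
    using integral_increment_bound[OF integrable_continuous_real[OF contq], of s r "B / m"]
      integral_increment_bound[OF integrable_continuous_real[OF contq], of r s "B / m"] q B m(1) that
    by (cases "s \<le> r") (auto simp: J_def abs_minus_commute)
  have Y: "F (x r) - F (x s) = (g r - g s) + (J r - J s)" if "s \<in> {0..T}" "r \<in> {0..T}" for r s
    using pathwise_solution_Doss[OF sol holder \<gamma>(1) cont \<mu> m L F, of r]
      pathwise_solution_Doss[OF sol holder \<gamma>(1) cont \<mu> m L F, of s] that by (simp add: J_def)
  \<comment> \<open>The factor \<open>T powr (1 - \<gamma>)\<close> turns the Lipschitz bound for
    the drift into one of exponent \<open>\<gamma>\<close> on \<open>[0, T]\<close>.\<close>
  define C1 where "C1 = S * (K + B / m * T powr (1 - \<gamma>))"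
  have C1: "0 \<le> C1" using S0 K B m(1) by (simp add: C1_def)
  have x_holder: "\<bar>x r - x s\<bar> \<le> C1 * \<bar>r - s\<bar> powr \<gamma>" if sr: "s \<in> {0..T}" "r \<in> {0..T}" for r s
  proof (cases "r = s")
    case False
    have "\<bar>r - s\<bar> = \<bar>r - s\<bar> powr (1 - \<gamma>) * \<bar>r - s\<bar> powr \<gamma>"
      using False by (simp flip: powr_add)
    also have "\<dots> \<le> T powr (1 - \<gamma>) * \<bar>r - s\<bar> powr \<gamma>"
      using sr \<gamma> by (intro mult_right_mono powr_mono2) auto
    finally have rs: "\<bar>r - s\<bar> \<le> T powr (1 - \<gamma>) * \<bar>r - s\<bar> powr \<gamma>" .
    have "\<bar>x r - x s\<bar> \<le> S * \<bar>(g r - g s) + (J r - J s)\<bar>"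
      using inv[of "x r" "x s"] R sr Y[OF sr] by simp
    also have "\<dots> \<le> S * (K * \<bar>r - s\<bar> powr \<gamma> + B / m * (T powr (1 - \<gamma>) * \<bar>r - s\<bar> powr \<gamma>))"
    proof -
      have "B / m * \<bar>r - s\<bar> \<le> B / m * (T powr (1 - \<gamma>) * \<bar>r - s\<bar> powr \<gamma>)"
        using rs B m(1) by (intro mult_left_mono) auto
      then show ?thesis using holder[OF sr] J[OF sr] S0 by (intro mult_left_mono) linarith+
    qed
    also have "\<dots> = C1 * \<bar>r - s\<bar> powr \<gamma>" by (simp add: C1_def algebra_simps)
    finally show ?thesis .
  qed simp
  define C where "C = C1 + S * (B / m) + S * (L / m\<^sup>2) * C1\<^sup>2"
  have parts: "0 \<le> S * (B / m)" "0 \<le> S * (L / m\<^sup>2) * C1\<^sup>2" using S0 B L0 m(1) by auto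
  show thesis
  proof (rule that[of C])
    show "0 \<le> C" using C1 parts by (simp add: C_def)
    show "\<bar>x r - x s\<bar> \<le> C * \<bar>r - s\<bar> powr \<gamma>" if "s \<in> {0..T}" "r \<in> {0..T}" for r s
      using x_holder[OF that] mult_right_mono[of C1 C "\<bar>r - s\<bar> powr \<gamma>"] parts by (simp add: C_def)
    show "\<bar>x r - x s - \<sigma> (x s) * (g r - g s)\<bar> \<le> C * (\<bar>r - s\<bar> + \<bar>r - s\<bar> powr (2 * \<gamma>))"
      if sr: "s \<in> {0..T}" "r \<in> {0..T}" for r s
    proof -
      have \<sigma>s: "\<sigma> (x s) \<le> S" using S R sr by auto
      have "x r - x s - \<sigma> (x s) * (g r - g s) =
          \<sigma> (x s) * (J r - J s) - \<sigma> (x s) * (F (x r) - F (x s) - (x r - x s) / \<sigma> (x s))"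
        using pos[of "x s"] by (simp add: Y[OF sr] field_simps)
      moreover have "\<bar>\<sigma> (x s) * (J r - J s)\<bar> \<le> S * (B / m * \<bar>r - s\<bar>)"
        unfolding abs_mult using \<sigma>s pos[of "x s"] J[OF sr] by (intro mult_mono) auto
      moreover have "\<bar>\<sigma> (x s) * (F (x r) - F (x s) - (x r - x s) / \<sigma> (x s))\<bar> \<le> S * (L / m\<^sup>2 * (C1 * \<bar>r - s\<bar> powr \<gamma>)\<^sup>2)"
        unfolding abs_mult
      proof (intro mult_mono)
        have "\<bar>F (x r) - F (x s) - (x r - x s) / \<sigma> (x s)\<bar> \<le> L / m\<^sup>2 * (x r - x s)\<^sup>2"
          by (rule reciprocal_antiderivative_expansion[OF F m L])
        also have "\<dots> \<le> L / m\<^sup>2 * (C1 * \<bar>r - s\<bar> powr \<gamma>)\<^sup>2"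
          using power_mono[OF x_holder[OF sr], of 2] L0 by (intro mult_left_mono) auto
        finally show "\<bar>F (x r) - F (x s) - (x r - x s) / \<sigma> (x s)\<bar> \<le> L / m\<^sup>2 * (C1 * \<bar>r - s\<bar> powr \<gamma>)\<^sup>2" .
      qed (use \<sigma>s pos[of "x s"] S0 in auto)
      moreover have "(C1 * \<bar>r - s\<bar> powr \<gamma>)\<^sup>2 = C1\<^sup>2 * \<bar>r - s\<bar> powr (2 * \<gamma>)"
        unfolding power_mult_distrib by (simp only: power2_eq_square mult_2 powr_add)
      ultimately have "\<bar>x r - x s - \<sigma> (x s) * (g r - g s)\<bar> \<le>
          (S * (B / m)) * \<bar>r - s\<bar> + (S * (L / m\<^sup>2) * C1\<^sup>2) * \<bar>r - s\<bar> powr (2 * \<gamma>)"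
        by (simp add: mult.assoc)
      also have "\<dots> \<le> C * \<bar>r - s\<bar> + C * \<bar>r - s\<bar> powr (2 * \<gamma>)"
        using parts C1 by (intro add_mono mult_right_mono) (auto simp: C_def)
      finally show ?thesis by (simp add: distrib_left)
    qed
  qed
qed

section \<open>The spectral constant of fractional Brownian motion\<close>

lemma Gamma_reflection_real: "Gamma z * Gamma (1 - z) = pi / sin (pi * z)" for z :: real
proof -
  have "complex_of_real (Gamma z * Gamma (1 - z)) = Gamma (complex_of_real z) * Gamma (1 - complex_of_real z)"
    by (simp only: of_real_mult Gamma_complex_of_real[symmetric] of_real_diff of_real_1)
  also have "\<dots> = of_real pi / sin (of_real pi * complex_of_real z)"
    by (rule Gamma_reflection_complex)
  also have "\<dots> = complex_of_real (pi / sin (pi * z))"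
    by (simp only: of_real_divide sin_of_real[symmetric] of_real_mult)
  finally show ?thesis by (simp only: of_real_eq_iff)
qed

text \<open>Gamma integral rescaled by \<open>x\<close>. Read from right to left it writes the
  singular weight \<open>x powr (- (a + 1))\<close> as a mixture of exponentials, against which
  \<open>1 - cos x\<close> can be integrated explicitly.\<close>

lemma nn_integral_powr_times_exp:
  fixes a x :: real
  assumes "a > -1" "x > 0"
  shows "(\<integral>\<^sup>+t. ennreal (indicator {0..} t * (t powr a * exp (- (x * t)))) \<partial>lborel)
    = ennreal (Gamma (a + 1) * x powr (- (a + 1)))"
proof -
  have "ennreal (Gamma (a + 1)) = (\<integral>\<^sup>+t. ennreal (indicator {0..} t * t powr a / exp t) \<partial>lborel)"
    using Gamma_conv_nn_integral_real[of "a + 1"] assms(1) by simp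
  also have "\<dots> = \<bar>x\<bar> * (\<integral>\<^sup>+t. ennreal (indicator {0..} (0 + x * t) * (0 + x * t) powr a / exp (0 + x * t)) \<partial>lborel)"
    using assms(2) by (intro nn_integral_real_affine) auto
  also have "(\<integral>\<^sup>+t. ennreal (indicator {0..} (0 + x * t) * (0 + x * t) powr a / exp (0 + x * t)) \<partial>lborel)
      = (\<integral>\<^sup>+t. ennreal (x powr a) * ennreal (indicator {0..} t * (t powr a * exp (- (x * t)))) \<partial>lborel)"
    using assms(2)
    by (intro nn_integral_cong) (auto simp: indicator_def zero_le_mult_iff powr_mult exp_minus field_simps simp flip: ennreal_mult)
  also have "\<dots> = ennreal (x powr a) * (\<integral>\<^sup>+t. ennreal (indicator {0..} t * (t powr a * exp (- (x * t)))) \<partial>lborel)"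
    by (intro nn_integral_cmult) auto
  finally have eq: "ennreal (Gamma (a + 1)) = ennreal (x powr (a + 1)) *
      (\<integral>\<^sup>+t. ennreal (indicator {0..} t * (t powr a * exp (- (x * t)))) \<partial>lborel)" (is "_ = _ * ?I")
  proof -
    have "ennreal (x powr (a + 1)) = ennreal \<bar>x\<bar> * ennreal (x powr a)"
      using assms(2) by (simp add: powr_add mult.commute ennreal_mult')
    then show "ennreal (Gamma (a + 1)) = ennreal \<bar>x\<bar> * (ennreal (x powr a) * ?I) \<Longrightarrow> ?thesis"
      by (simp add: mult.assoc)
  qed
  have "ennreal (Gamma (a + 1) * x powr (- (a + 1))) = ennreal (x powr (- (a + 1))) * ennreal (Gamma (a + 1))"
    using assms by (simp add: mult.commute flip: ennreal_mult)
  also have "\<dots> = (ennreal (x powr (- (a + 1))) * ennreal (x powr (a + 1))) * ?I"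
    unfolding eq by (simp add: mult.assoc)
  also have "ennreal (x powr (- (a + 1))) * ennreal (x powr (a + 1)) = 1"
    using assms(2) by (simp flip: ennreal_mult powr_add)
  finally show ?thesis by simp
qed

lemma nn_integral_one_minus_cos_times_exp:
  fixes t :: real
  assumes t: "t > 0"
  shows "(\<integral>\<^sup>+x. ennreal (indicator {0..} x * ((1 - cos x) * exp (- (x * t)))) \<partial>lborel)
    = ennreal (1 / (t * (1 + t\<^sup>2)))"
proof -
  \<comment> \<open>An explicit antiderivative: the first term integrates the exponential, the
    second its product with the cosine. The value at 0 is
    \<open>-(1 / t - t / (1 + t\<^sup>2))\<close>.\<close>
  define F where "F x = - exp (- (x * t)) / t - exp (- (x * t)) * (sin x - t * cos x) / (1 + t\<^sup>2)" for x :: real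
  have t2: "1 + t\<^sup>2 > 0" by (simp add: add_pos_nonneg)
  have lim0: "((\<lambda>x. exp (- (x * t)) * (1 / t + (1 + t) / (1 + t\<^sup>2))) \<longlongrightarrow> 0 * (1 / t + (1 + t) / (1 + t\<^sup>2))) at_top"
  proof (intro tendsto_mult tendsto_const)
    have "filterlim (\<lambda>x. - (x * t)) at_bot at_top"
      using filterlim_tendsto_pos_mult_at_top[OF tendsto_const t filterlim_ident]
      by (simp add: filterlim_uminus_at_bot mult.commute)
    then show "((\<lambda>x. exp (- (x * t))) \<longlongrightarrow> 0) at_top" by (rule filterlim_compose[OF exp_at_bot])
  qed
  have "(F \<longlongrightarrow> 0) at_top"
  proof (rule Lim_null_comparison)
    show "\<forall>\<^sub>F x in at_top. norm (F x) \<le> exp (- (x * t)) * (1 / t + (1 + t) / (1 + t\<^sup>2))"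
    proof (rule always_eventually, rule allI)
      fix x
      have "\<bar>sin x - t * cos x\<bar> \<le> \<bar>sin x\<bar> + t * \<bar>cos x\<bar>" using abs_triangle_ineq4[of "sin x" "t * cos x"] t by (simp add: abs_mult)
      also have "\<dots> \<le> 1 + t * 1" using t by (intro add_mono mult_left_mono) auto
      finally have "\<bar>sin x - t * cos x\<bar> / (1 + t\<^sup>2) \<le> (1 + t) / (1 + t\<^sup>2)" using t2 by (intro divide_right_mono) auto
      then have "exp (- (x * t)) * (1 / t + \<bar>sin x - t * cos x\<bar> / (1 + t\<^sup>2)) \<le> exp (- (x * t)) * (1 / t + (1 + t) / (1 + t\<^sup>2))"
        by (intro mult_left_mono) auto
      moreover have "norm (F x) \<le> norm (- exp (- (x * t)) / t) + norm (exp (- (x * t)) * (sin x - t * cos x) / (1 + t\<^sup>2))"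
        unfolding F_def by (rule norm_triangle_ineq4)
      moreover have "norm (- exp (- (x * t)) / t) + norm (exp (- (x * t)) * (sin x - t * cos x) / (1 + t\<^sup>2))
          = exp (- (x * t)) * (1 / t + \<bar>sin x - t * cos x\<bar> / (1 + t\<^sup>2))"
        using t t2 by (simp add: abs_mult abs_divide distrib_left)
      ultimately show "norm (F x) \<le> exp (- (x * t)) * (1 / t + (1 + t) / (1 + t\<^sup>2))" by linarith
    qed
  qed (use lim0 in simp)
  moreover have "DERIV F x :> (1 - cos x) * exp (- (x * t))" for x
    unfolding F_def using t t2
    by (auto intro!: derivative_eq_intros simp: divide_simps power2_eq_square) (simp add: algebra_simps)
  ultimately have "(\<integral>\<^sup>+x. ennreal ((1 - cos x) * exp (- (x * t))) * indicator {0..} x \<partial>lborel) = 0 - F 0"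
    by (intro nn_integral_FTC_atLeast) auto
  moreover have "- F 0 = 1 / (t * (1 + t\<^sup>2))"
    using t t2 by (simp add: F_def field_simps power2_eq_square)
  moreover have "(\<integral>\<^sup>+x. ennreal ((1 - cos x) * exp (- (x * t))) * indicator {0..} x \<partial>lborel) =
      (\<integral>\<^sup>+x. ennreal (indicator {0..} x * ((1 - cos x) * exp (- (x * t)))) \<partial>lborel)"
    by (intro nn_integral_cong) (auto simp: indicator_def)
  ultimately show ?thesis by simp
qed

text \<open>Substituting \<open>w = t\<^sup>2 / (1 + t\<^sup>2)\<close> turns this integral into a Beta integral.\<close>

lemma nn_integral_powr_over_one_plus_square:
  fixes a :: real
  assumes a: "0 < a" "a < 2"
  shows "(\<integral>\<^sup>+t. ennreal (indicator {0<..} t * (t powr (a - 1) / (1 + t\<^sup>2))) \<partial>lborel)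
    = ennreal (pi / (2 * sin (pi * a / 2)))"
proof -
  define g :: "real \<Rightarrow> real" where "g t = t\<^sup>2 / (1 + t\<^sup>2)" for t
  define g' :: "real \<Rightarrow> real" where "g' t = 2 * t / (1 + t\<^sup>2)\<^sup>2" for t
  define f :: "real \<Rightarrow> real" where "f w = w powr (a / 2 - 1) * (1 - w) powr (1 - a / 2 - 1)" for w
  have p: "1 + t\<^sup>2 > 0" for t :: real by (simp add: add_pos_nonneg)
  have g_def': "g t = 1 - 1 / (1 + t\<^sup>2)" for t using p[of t] by (simp add: g_def field_simps)
  have der: "(g has_field_derivative g' t) (at t within {0<..})" for t
    unfolding g_def g'_def using p[of t]
    by (auto intro!: derivative_eq_intros simp: field_simps power2_eq_square)
  have inj: "inj_on g {0<..}"
  proof (rule inj_onI)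
    fix s t :: real assume "s \<in> {0<..}" "t \<in> {0<..}" "g s = g t"
    then have "s\<^sup>2 = t\<^sup>2" "0 < s" "0 < t" using p[of s] p[of t] by (auto simp: g_def' field_simps)
    then show "s = t" by (simp add: power2_eq_iff)
  qed
  have img: "g ` {0<..} = {0<..<1}"
  proof (intro equalityI subsetI)
    fix w :: real assume w: "w \<in> {0<..<1}"
    then have "g (sqrt (w / (1 - w))) = w" by (simp add: g_def field_simps)
    moreover have "sqrt (w / (1 - w)) \<in> {0<..}" using w by simp
    ultimately show "w \<in> g ` {0<..}" by (metis imageI)
  qed (use p in \<open>auto simp: g_def field_simps\<close>)
  have f_int: "(f has_integral Beta (a / 2) (1 - a / 2)) {0<..<1}"
    unfolding f_def using has_integral_Beta_real[of "a / 2" "1 - a / 2"] a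
    by (simp add: has_integral_Icc_iff_Ioo)
  then have "f absolutely_integrable_on g ` {0<..} \<and> integral (g ` {0<..}) f = Beta (a / 2) (1 - a / 2)"
    unfolding img by (auto intro!: nonnegative_absolutely_integrable_1 simp: f_def integral_unique has_integral_integrable)
  then have int: "(\<lambda>t. \<bar>g' t\<bar> * f (g t)) absolutely_integrable_on {0<..}"
      "integral {0<..} (\<lambda>t. \<bar>g' t\<bar> * f (g t)) = Beta (a / 2) (1 - a / 2)"
    using has_absolute_integral_change_of_variables_1'[OF _ der inj, of f] by auto
  have eq: "\<bar>g' t\<bar> * f (g t) = 2 * (t powr (a - 1) / (1 + t\<^sup>2))" if t: "t \<in> {0<..}" for t
  proof -
    have ea: "g t powr (a / 2 - 1) = t powr (a - 2) / (1 + t\<^sup>2) powr (a / 2 - 1)"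
    proof -
      have "t\<^sup>2 powr (a / 2 - 1) = t powr (a - 2)"
        using t by (simp add: powr_powr algebra_simps flip: powr_numeral)
      then show ?thesis using t p[of t] by (simp add: g_def powr_divide)
    qed
    have eb: "(1 - g t) powr (1 - a / 2 - 1) = (1 + t\<^sup>2) powr (a / 2)"
      using p[of t] by (simp add: g_def' powr_divide powr_minus field_simps)
    have e1: "(1 + t\<^sup>2) powr (a / 2) / (1 + t\<^sup>2) powr (a / 2 - 1) = 1 + t\<^sup>2"
      using p[of t] by (simp flip: powr_diff)
    have e2: "t * t powr (a - 2) = t powr (a - 1)"
      using t powr_mult_base[of t "a - 2"] by simp
    have "\<bar>g' t\<bar> * f (g t) = 2 * (t * t powr (a - 2)) *
        ((1 + t\<^sup>2) powr (a / 2) / (1 + t\<^sup>2) powr (a / 2 - 1)) / (1 + t\<^sup>2)\<^sup>2"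
      unfolding f_def ea eb using t by (simp add: g'_def mult_ac)
    also have "\<dots> = 2 * t powr (a - 1) * (1 + t\<^sup>2) / (1 + t\<^sup>2)\<^sup>2"
      unfolding e1 e2 ..
    also have "\<dots> = 2 * (t powr (a - 1) / (1 + t\<^sup>2))" using p[of t] by (simp add: power2_eq_square)
    finally show ?thesis .
  qed
  have "((\<lambda>t. \<bar>g' t\<bar> * f (g t)) has_integral Beta (a / 2) (1 - a / 2)) {0<..}"
    using int by (metis integrable_integral set_lebesgue_integral_eq_integral(1))
  then have "((\<lambda>t. 2 * (t powr (a - 1) / (1 + t\<^sup>2))) has_integral Beta (a / 2) (1 - a / 2)) {0<..}"
    by (rule has_integral_eq[rotated]) (use eq in auto)
  then have "((\<lambda>t. (1 / 2) * (2 * (t powr (a - 1) / (1 + t\<^sup>2)))) has_integral (1 / 2) * Beta (a / 2) (1 - a / 2)) {0<..}"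
    by (rule has_integral_mult_right)
  then have hi: "((\<lambda>t. t powr (a - 1) / (1 + t\<^sup>2)) has_integral Beta (a / 2) (1 - a / 2) / 2) {0<..}" by simp
  have "(\<integral>\<^sup>+t. ennreal (indicator {0<..} t * (t powr (a - 1) / (1 + t\<^sup>2))) \<partial>lborel) = ennreal (Beta (a / 2) (1 - a / 2) / 2)"
    by (rule nn_integral_has_integral_lebesgue[OF _ hi]) (use p in \<open>auto simp: less_imp_le\<close>)
  also have "Beta (a / 2) (1 - a / 2) / 2 = pi / (2 * sin (pi * a / 2))"
    using Gamma_reflection_real[of "a / 2"] by (simp add: Beta_def)
  finally show ?thesis .
qed

text \<open>Multiplying by \<open>Gamma (a + 1)\<close> replaces the weight by its exponential
  mixture. Tonelli's theorem then swaps the integrals: the inner one is the rational function of the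
  previous computation, the outer one is a Beta integral. Nonnegative integrals make the exchange
  free of integrability conditions.\<close>

lemma nn_integral_one_minus_cos_half_line:
  fixes a :: real
  assumes a: "0 < a" "a < 2"
  shows "(\<integral>\<^sup>+x. ennreal (indicator {0<..} x * ((1 - cos x) * x powr (- (a + 1)))) \<partial>lborel)
    = ennreal (pi / (2 * Gamma (a + 1) * sin (pi * a / 2)))"
proof -
  let ?I = "\<integral>\<^sup>+x. ennreal (indicator {0<..} x * ((1 - cos x) * x powr (- (a + 1)))) \<partial>lborel"
  have G: "Gamma (a + 1) > 0" using a by (intro Gamma_real_pos) auto
  have "ennreal (Gamma (a + 1)) * ?I = (\<integral>\<^sup>+x. ennreal (Gamma (a + 1)) * ennreal (indicator {0<..} x * ((1 - cos x) * x powr (- (a + 1)))) \<partial>lborel)"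
    by (intro nn_integral_cmult[symmetric]) auto
  also have "\<dots> = (\<integral>\<^sup>+x. (\<integral>\<^sup>+t. ennreal (indicator {0<..} x * (1 - cos x) * (indicator {0..} t * (t powr a * exp (- (x * t))))) \<partial>lborel) \<partial>lborel)"
  proof (intro nn_integral_cong)
    fix x :: real
    show "ennreal (Gamma (a + 1)) * ennreal (indicator {0<..} x * ((1 - cos x) * x powr (- (a + 1))))
      = (\<integral>\<^sup>+t. ennreal (indicator {0<..} x * (1 - cos x) * (indicator {0..} t * (t powr a * exp (- (x * t))))) \<partial>lborel)"
    proof (cases "x > 0")
      case True
      have "(\<integral>\<^sup>+t. ennreal (indicator {0<..} x * (1 - cos x) * (indicator {0..} t * (t powr a * exp (- (x * t))))) \<partial>lborel)
        = (\<integral>\<^sup>+t. ennreal (1 - cos x) * ennreal (indicator {0..} t * (t powr a * exp (- (x * t)))) \<partial>lborel)"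
        using True by (intro nn_integral_cong) (simp flip: ennreal_mult)
      also have "\<dots> = ennreal (1 - cos x) * ennreal (Gamma (a + 1) * x powr (- (a + 1)))"
        using nn_integral_powr_times_exp[of a x] a True by (subst nn_integral_cmult) auto
      finally show ?thesis using True G by (simp add: mult_ac flip: ennreal_mult)
    qed simp
  qed
  also have "\<dots> = (\<integral>\<^sup>+t. (\<integral>\<^sup>+x. ennreal (indicator {0<..} x * (1 - cos x) * (indicator {0..} t * (t powr a * exp (- (x * t))))) \<partial>lborel) \<partial>lborel)"
    by (rule lborel_pair.Fubini') measurable
  also have "\<dots> = (\<integral>\<^sup>+t. ennreal (indicator {0<..} t * (t powr (a - 1) / (1 + t\<^sup>2))) \<partial>lborel)"
  proof (intro nn_integral_cong)
    fix t :: real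
    show "(\<integral>\<^sup>+x. ennreal (indicator {0<..} x * (1 - cos x) * (indicator {0..} t * (t powr a * exp (- (x * t))))) \<partial>lborel)
      = ennreal (indicator {0<..} t * (t powr (a - 1) / (1 + t\<^sup>2)))"
    proof (cases "t > 0")
      case True
      have "(\<integral>\<^sup>+x. ennreal (indicator {0<..} x * (1 - cos x) * (indicator {0..} t * (t powr a * exp (- (x * t))))) \<partial>lborel)
        = (\<integral>\<^sup>+x. ennreal (t powr a) * ennreal (indicator {0..} x * ((1 - cos x) * exp (- (x * t)))) \<partial>lborel)"
        using True by (intro nn_integral_cong) (auto simp: indicator_def mult_ac not_less simp flip: ennreal_mult)
      also have "\<dots> = ennreal (t powr a) * ennreal (1 / (t * (1 + t\<^sup>2)))"
        using nn_integral_one_minus_cos_times_exp[OF True] by (subst nn_integral_cmult) auto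
      also have "\<dots> = ennreal (t powr (a - 1) / (1 + t\<^sup>2))"
        using True by (simp add: powr_diff add_pos_nonneg less_imp_le flip: ennreal_mult)
      finally show ?thesis using True by simp
    next
      case False
      then show ?thesis using a by (cases "t = 0") auto
    qed
  qed
  also have "\<dots> = ennreal (pi / (2 * sin (pi * a / 2)))"
    by (rule nn_integral_powr_over_one_plus_square[OF a])
  finally have eq: "ennreal (Gamma (a + 1)) * ?I = ennreal (pi / (2 * sin (pi * a / 2)))" .
  have "?I = (ennreal (1 / Gamma (a + 1)) * ennreal (Gamma (a + 1))) * ?I"
    using G by (simp flip: ennreal_mult)
  also have "\<dots> = ennreal (1 / Gamma (a + 1)) * ennreal (pi / (2 * sin (pi * a / 2)))"
    unfolding mult.assoc eq ..
  also have "\<dots> = ennreal (pi / (2 * Gamma (a + 1) * sin (pi * a / 2)))"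
    using G sin_gt_zero[of "pi * a / 2"] a by (simp add: field_simps flip: ennreal_mult)
  finally show ?thesis .
qed

lemma v2_sq_pos:
  assumes "0 < H" "H < 1"
  shows "0 < v2_sq H"
proof -
  have "sin (pi * H) > 0" using assms by (intro sin_gt_zero) auto
  moreover have "Gamma (2 * H + 1) > 0" using assms by (intro Gamma_real_pos) auto
  ultimately show ?thesis by (simp add: v2_sq_def)
qed

text \<open>Evenness doubles the half-line value for \<open>a = 2 * H\<close>, and scaling by
  \<open>y\<close> produces \<open>\<bar>y\<bar> powr (2 * H)\<close>. The doubled constant is
  \<open>pi\<close> over \<open>Gamma (2 * H + 1) * sin (pi * H)\<close>, that is,
  \<open>pi * v2_sq H\<close>.\<close>

lemma nn_integral_one_minus_cos:
  fixes H y :: real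
  assumes H: "0 < H" "H < 1"
  shows "(\<integral>\<^sup>+x. ennreal ((1 - cos (x * y)) * \<bar>x\<bar> powr (- (2 * H + 1))) \<partial>lborel)
    = ennreal (pi * v2_sq H * \<bar>y\<bar> powr (2 * H))"
proof (cases "y = 0")
  case False
  define k where "k x = (1 - cos x) * \<bar>x\<bar> powr (- (2 * H + 1))" for x :: real
  have k0: "k x \<ge> 0" for x by (simp add: k_def)
  have [measurable]: "k \<in> borel_measurable borel" unfolding k_def by measurable
  define c where "c = pi / (2 * Gamma (2 * H + 1) * sin (pi * H))"
  have half: "(\<integral>\<^sup>+x. ennreal (indicator {0<..} x * k x) \<partial>lborel) = ennreal c"
  proof -
    have "(\<integral>\<^sup>+x. ennreal (indicator {0<..} x * k x) \<partial>lborel) =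
        (\<integral>\<^sup>+x. ennreal (indicator {0<..} x * ((1 - cos x) * x powr (- (2 * H + 1)))) \<partial>lborel)"
      by (intro nn_integral_cong) (auto simp: k_def indicator_def)
    then show ?thesis using nn_integral_one_minus_cos_half_line[of "2 * H"] H by (simp add: c_def)
  qed
  have refl: "(\<integral>\<^sup>+x. ennreal (indicator {..<0} x * k x) \<partial>lborel) = ennreal c"
  proof -
    have "(\<integral>\<^sup>+x. ennreal (indicator {..<0} x * k x) \<partial>lborel) =
        ennreal \<bar>- 1\<bar> * (\<integral>\<^sup>+x. ennreal (indicator {..<0} (0 + (- 1) * x) * k (0 + (- 1) * x)) \<partial>lborel)"
      by (rule nn_integral_real_affine) auto
    also have "\<dots> = (\<integral>\<^sup>+x. ennreal (indicator {0<..} x * k x) \<partial>lborel)"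
      by (simp, intro nn_integral_cong) (auto simp: k_def indicator_def)
    finally show ?thesis using half by simp
  qed
  have c_eq: "c = pi * v2_sq H / 2" by (simp add: c_def v2_sq_def inverse_eq_divide)
  have c0: "c \<ge> 0" unfolding c_eq using v2_sq_pos[OF H] by (simp add: less_imp_le)
  have "(\<integral>\<^sup>+x. ennreal (k x) \<partial>lborel) =
      (\<integral>\<^sup>+x. ennreal (indicator {0<..} x * k x) + ennreal (indicator {..<0} x * k x) \<partial>lborel)"
  proof (intro nn_integral_cong)
    fix x :: real
    show "ennreal (k x) = ennreal (indicator {0<..} x * k x) + ennreal (indicator {..<0} x * k x)"
      by (cases x "0 :: real" rule: linorder_cases) (auto simp: k_def)
  qed
  also have "\<dots> = ennreal c + ennreal c" by (subst nn_integral_add) (auto simp: half refl)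
  also have "\<dots> = ennreal (2 * c)" using c0 by (simp flip: ennreal_plus)
  also have "2 * c = pi * v2_sq H" by (simp add: c_eq)
  finally have full: "(\<integral>\<^sup>+x. ennreal (k x) \<partial>lborel) = ennreal (pi * v2_sq H)" .
  have "(\<integral>\<^sup>+x. ennreal ((1 - cos (x * y)) * \<bar>x\<bar> powr (- (2 * H + 1))) \<partial>lborel)
      = (\<integral>\<^sup>+x. ennreal (\<bar>y\<bar> powr (2 * H + 1)) * ennreal (k (0 + y * x)) \<partial>lborel)"
  proof (intro nn_integral_cong)
    fix x :: real
    have "\<bar>y\<bar> powr (2 * H + 1) * k (0 + y * x) =
        (1 - cos (x * y)) * \<bar>x\<bar> powr (- (2 * H + 1)) * (\<bar>y\<bar> powr (2 * H + 1) * \<bar>y\<bar> powr (- (2 * H + 1)))"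
      unfolding k_def by (simp add: abs_mult powr_mult mult_ac)
    also have "\<bar>y\<bar> powr (2 * H + 1) * \<bar>y\<bar> powr (- (2 * H + 1)) = 1"
      unfolding powr_add[symmetric] using False by simp
    finally show "ennreal ((1 - cos (x * y)) * \<bar>x\<bar> powr (- (2 * H + 1))) =
        ennreal (\<bar>y\<bar> powr (2 * H + 1)) * ennreal (k (0 + y * x))"
      using k0 by (simp flip: ennreal_mult)
  qed
  also have "\<dots> = ennreal (\<bar>y\<bar> powr (2 * H)) * (ennreal \<bar>y\<bar> * (\<integral>\<^sup>+x. ennreal (k (0 + y * x)) \<partial>lborel))"
  proof -
    have "ennreal (\<bar>y\<bar> powr (2 * H + 1)) = ennreal (\<bar>y\<bar> powr (2 * H)) * ennreal \<bar>y\<bar>"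
      using False by (simp add: powr_add flip: ennreal_mult)
    then show ?thesis by (subst nn_integral_cmult) (auto simp: mult.assoc)
  qed
  also have "ennreal \<bar>y\<bar> * (\<integral>\<^sup>+x. ennreal (k (0 + y * x)) \<partial>lborel) = (\<integral>\<^sup>+x. ennreal (k x) \<partial>lborel)"
    using False by (intro nn_integral_real_affine[symmetric]) auto
  also have "ennreal (\<bar>y\<bar> powr (2 * H)) * \<dots> = ennreal (pi * v2_sq H * \<bar>y\<bar> powr (2 * H))"
    unfolding full using v2_sq_pos[OF H] by (simp add: mult_ac flip: ennreal_mult)
  finally show ?thesis .
qed simp

lemma
  fixes H y :: real
  assumes H: "0 < H" "H < 1"
  shows integrable_one_minus_cos: "integrable lborel (\<lambda>x. (1 - cos (x * y)) * \<bar>x\<bar> powr (- (2 * H + 1)))"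
    and integral_one_minus_cos:
      "(\<integral>x. (1 - cos (x * y)) * \<bar>x\<bar> powr (- (2 * H + 1)) \<partial>lborel) = pi * v2_sq H * \<bar>y\<bar> powr (2 * H)"
proof -
  have "integrable lborel (\<lambda>x. (1 - cos (x * y)) * \<bar>x\<bar> powr (- (2 * H + 1))) \<and>
      (\<integral>x. (1 - cos (x * y)) * \<bar>x\<bar> powr (- (2 * H + 1)) \<partial>lborel) = pi * v2_sq H * \<bar>y\<bar> powr (2 * H)"
    using nn_integral_one_minus_cos[OF H, of y] v2_sq_pos[OF H]
    by (subst nn_integral_eq_integrable[symmetric]) auto
  then show "integrable lborel (\<lambda>x. (1 - cos (x * y)) * \<bar>x\<bar> powr (- (2 * H + 1)))"
    "(\<integral>x. (1 - cos (x * y)) * \<bar>x\<bar> powr (- (2 * H + 1)) \<partial>lborel) = pi * v2_sq H * \<bar>y\<bar> powr (2 * H)"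
    by auto
qed

text \<open>Links the Lebesgue integrals of the definitions with the gauge integrals over intervals
  in which the calculus is carried out.\<close>

lemma lborel_integral_supported:
  fixes f :: "real \<Rightarrow> real"
  assumes "continuous_on {a..b} f" "\<And>x. x \<notin> {a..b} \<Longrightarrow> f x = 0"
  shows "integrable lborel f" "(\<integral>x. f x \<partial>lborel) = integral {a..b} f"
proof -
  have f: "f = (\<lambda>x. indicator {a..b} x *\<^sub>R f x)" using assms(2) by (auto simp: indicator_def fun_eq_iff)
  have "set_integrable lborel {a..b} f"
    using assms(1) by (rule borel_integrable_atLeastAtMost')
  from this set_borel_integral_eq_integral(2)[OF this]
  show "integrable lborel f" "(\<integral>x. f x \<partial>lborel) = integral {a..b} f"
    unfolding set_integrable_def set_lebesgue_integral_def f[symmetric] by auto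
qed

lemma continuous_on_integral_param:
  fixes f :: "real \<Rightarrow> real \<Rightarrow> real"
  assumes "continuous_on UNIV (\<lambda>(x, t). f x t)"
  shows "continuous_on S (\<lambda>x. integral {a..b} (f x))"
proof -
  have "continuous_on UNIV (\<lambda>x. integral (cbox a b) (f x))"
    by (rule integral_continuous_on_param) (rule continuous_on_subset[OF assms], simp)
  then show ?thesis by (auto intro: continuous_on_subset)
qed

text \<open>The constant \<open>v2_sq H\<close> is exactly the one for which \<open>\<bar>y\<bar> powr (2 * H)\<close> is a mixture of the
  functions \<open>1 - cos (x * y)\<close> with weight \<open>\<bar>x\<bar> powr (- (2 * H + 1))\<close>.\<close>

lemma double_integral_powr_eq_Fourier:
  fixes \<psi> :: "real \<Rightarrow> real" and H :: real
  assumes H: "0 < H" "H < 1"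
    and cont: "continuous_on UNIV \<psi>" and supp: "\<And>x. x \<notin> {-1..1} \<Longrightarrow> \<psi> x = 0"
    and mean: "integral {-1..1} \<psi> = 0"
  defines "A \<equiv> \<lambda>x. integral {-1..1} (\<lambda>p. \<psi> p * cos (x * p))"
    and "B \<equiv> \<lambda>x. integral {-1..1} (\<lambda>p. \<psi> p * sin (x * p))"
  shows "integrable lborel (\<lambda>x. \<bar>x\<bar> powr (- (2 * H + 1)) * ((A x)\<^sup>2 + (B x)\<^sup>2))"
    and "pi * v2_sq H * integral {-1..1} (\<lambda>p. integral {-1..1} (\<lambda>q. \<psi> p * \<psi> q * \<bar>p - q\<bar> powr (2 * H)))
      = - (\<integral>x. \<bar>x\<bar> powr (- (2 * H + 1)) * ((A x)\<^sup>2 + (B x)\<^sup>2) \<partial>lborel)"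
proof -
  note [continuous_intros] = continuous_on_compose2[OF cont]
  have [measurable]: "\<psi> \<in> borel_measurable borel" using cont by (rule borel_measurable_continuous_onI)
  define w where "w x = \<bar>x\<bar> powr (- (2 * H + 1))" for x :: real
  have [measurable]: "w \<in> borel_measurable borel" unfolding w_def by measurable
  have w0: "w x \<ge> 0" for x by (simp add: w_def)
  \<comment> \<open>Integrated first over the frequency \<open>x\<close>, \<open>W\<close> gives the
    power \<open>\<bar>p - q\<bar> powr (2 * H)\<close>. Integrated first over the pair, the
    constant 1 drops out because \<psi> has mean zero, and the addition formula for the cosine
    leaves \<open>-(A\<^sup>2 + B\<^sup>2)\<close>.\<close>
  define W :: "(real \<times> real) \<times> real \<Rightarrow> real"
    where "W = (\<lambda>(z, x). \<psi> (fst z) * \<psi> (snd z) * ((1 - cos (x * (fst z - snd z))) * w x))"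
  define c where "c = pi * v2_sq H"
  have c0: "c > 0" using v2_sq_pos[OF H] by (simp add: c_def)
  have int_x: "integrable lborel (\<lambda>x. (1 - cos (x * y)) * w x)"
      "(\<integral>x. (1 - cos (x * y)) * w x \<partial>lborel) = c * \<bar>y\<bar> powr (2 * H)" for y
    using integrable_one_minus_cos[OF H] integral_one_minus_cos[OF H] by (simp_all add: w_def c_def)
  have W_x: "integrable lborel (\<lambda>x. W (z, x))"
      "(\<integral>x. W (z, x) \<partial>lborel) = c * (\<psi> (fst z) * \<psi> (snd z) * \<bar>fst z - snd z\<bar> powr (2 * H))"
      "(\<integral>x. norm (W (z, x)) \<partial>lborel) = c * \<bar>\<psi> (fst z) * \<psi> (snd z) * \<bar>fst z - snd z\<bar> powr (2 * H)\<bar>" for z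
  proof -
    show "integrable lborel (\<lambda>x. W (z, x))" unfolding W_def by (simp add: int_x)
    show "(\<integral>x. W (z, x) \<partial>lborel) = c * (\<psi> (fst z) * \<psi> (snd z) * \<bar>fst z - snd z\<bar> powr (2 * H))"
      unfolding W_def by (simp add: int_x)
    have "(\<lambda>x. norm (W (z, x))) = (\<lambda>x. \<bar>\<psi> (fst z) * \<psi> (snd z)\<bar> * ((1 - cos (x * (fst z - snd z))) * w x))"
      using w0 by (auto simp: W_def abs_mult fun_eq_iff)
    then show "(\<integral>x. norm (W (z, x)) \<partial>lborel) = c * \<bar>\<psi> (fst z) * \<psi> (snd z) * \<bar>fst z - snd z\<bar> powr (2 * H)\<bar>"
      by (simp add: int_x abs_mult)
  qed
  define f where "f z = \<psi> (fst z) * \<psi> (snd z) * \<bar>fst z - snd z\<bar> powr (2 * H)" for z :: "real \<times> real"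
  have f_cont: "continuous_on S f" for S
    unfolding f_def using H by (intro continuous_intros continuous_on_powr') auto
  have box: "cbox (-1, -1) (1, 1) = {-1..1 :: real} \<times> {-1..1 :: real}" by (simp add: cbox_Pair_eq)
  have int2: "integrable lborel g" if g: "continuous_on UNIV g" "\<And>z. fst z \<notin> {-1..1} \<Longrightarrow> g z = 0" "\<And>z. snd z \<notin> {-1..1} \<Longrightarrow> g z = 0"
    for g :: "real \<times> real \<Rightarrow> real"
  proof -
    have "integrable lborel (\<lambda>z. indicator (cbox (-1, -1) (1, 1)) z *\<^sub>R g z)"
      by (intro borel_integrable_compact compact_cbox continuous_on_subset[OF g(1)]) simp
    moreover have "(\<lambda>z. indicator (cbox (-1, -1) (1, 1)) z *\<^sub>R g z) = g"
    proof
      fix z :: "real \<times> real"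
      show "indicator (cbox (-1, -1) (1, 1)) z *\<^sub>R g z = g z"
        unfolding box using g(2,3)[of z] by (cases z) (auto simp: indicator_def)
    qed
    ultimately show ?thesis by simp
  qed
  have f_int: "integrable lborel f"
    by (rule int2[OF f_cont]) (auto simp: f_def supp)
  have "W \<in> borel_measurable (borel \<Otimes>\<^sub>M borel)"
    unfolding W_def case_prod_beta' borel_prod[symmetric] by measurable
  then have W_meas: "W \<in> borel_measurable (lborel \<Otimes>\<^sub>M lborel)" by simp
  \<comment> \<open>The frequency integral of \<open>\<bar>W\<bar>\<close> is a multiple of the
    absolute value of the continuous, compactly supported \<open>f\<close>, because
    \<open>1 - cos\<close> and the weight are nonnegative. This justifies Fubini.\<close>
  have W_int: "integrable (lborel \<Otimes>\<^sub>M lborel) W"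
  proof (rule lborel_pair.Fubini_integrable[OF W_meas])
    show "integrable lborel (\<lambda>z. \<integral>x. norm (W (z, x)) \<partial>lborel)"
      unfolding W_x f_def[symmetric] using f_int by simp
    show "AE z in lborel. integrable lborel (\<lambda>x. W (z, x))" using W_x(1) by simp
  qed
  have iter: "(\<integral>z. g z \<partial>lborel) = (\<integral>p. \<integral>q. g (p, q) \<partial>lborel \<partial>lborel)" if "integrable lborel g"
    for g :: "real \<times> real \<Rightarrow> real"
    using lborel_pair.integral_fst'[of g] that by (simp add: lborel_prod)
  have W_z: "(\<integral>z. W (z, x) \<partial>lborel) = - (w x * ((A x)\<^sup>2 + (B x)\<^sup>2))" for x
  proof -
    define g where "g z = \<psi> (fst z) * \<psi> (snd z) * (1 - cos (x * (fst z - snd z)))" for z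
    have g_int: "integrable lborel g"
      by (rule int2) (auto simp: g_def supp intro!: continuous_intros)
    have s: "integrable lborel (\<lambda>p. \<psi> p * cos (x * p))" "(\<integral>p. \<psi> p * cos (x * p) \<partial>lborel) = A x"
        "integrable lborel (\<lambda>p. \<psi> p * sin (x * p))" "(\<integral>p. \<psi> p * sin (x * p) \<partial>lborel) = B x"
        "integrable lborel \<psi>" "(\<integral>p. \<psi> p \<partial>lborel) = 0"
    proof -
      have c: "continuous_on {-1..1} (\<lambda>p. \<psi> p * cos (x * p))" "continuous_on {-1..1} (\<lambda>p. \<psi> p * sin (x * p))"
        by (intro continuous_intros; simp)+
      have c': "continuous_on {-1..1} \<psi>" by (rule continuous_on_subset[OF cont]) simp
      show "integrable lborel (\<lambda>p. \<psi> p * cos (x * p))" "(\<integral>p. \<psi> p * cos (x * p) \<partial>lborel) = A x"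
        using lborel_integral_supported[OF c(1)] supp by (auto simp: A_def)
      show "integrable lborel (\<lambda>p. \<psi> p * sin (x * p))" "(\<integral>p. \<psi> p * sin (x * p) \<partial>lborel) = B x"
        using lborel_integral_supported[OF c(2)] supp by (auto simp: B_def)
      show "integrable lborel \<psi>" "(\<integral>p. \<psi> p \<partial>lborel) = 0"
        using lborel_integral_supported[OF c'] supp mean by auto
    qed
    have inner: "(\<integral>q. g (p, q) \<partial>lborel) = - (\<psi> p * cos (x * p) * A x + \<psi> p * sin (x * p) * B x)" for p
    proof -
      have "(\<lambda>q. g (p, q)) = (\<lambda>q. \<psi> p * \<psi> q - ((\<psi> p * cos (x * p)) * (\<psi> q * cos (x * q)) + (\<psi> p * sin (x * p)) * (\<psi> q * sin (x * q))))"
        by (auto simp: fun_eq_iff g_def right_diff_distrib cos_diff algebra_simps)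
      then show ?thesis using s by simp
    qed
    have eqg: "(\<integral>z. g z \<partial>lborel) = - ((A x)\<^sup>2 + (B x)\<^sup>2)"
      unfolding iter[OF g_int] inner using s by (simp add: power2_eq_square)
    have "(\<integral>z. W (z, x) \<partial>lborel) = (\<integral>z. w x * g z \<partial>lborel)"
      by (intro Bochner_Integration.integral_cong) (auto simp: W_def g_def)
    also have "\<dots> = w x * (\<integral>z. g z \<partial>lborel)" using g_int by simp
    finally show ?thesis unfolding eqg by (simp only: mult_minus_right)
  qed
  have "integrable lborel (\<lambda>x. \<integral>z. W (z, x) \<partial>lborel)"
    using lborel_pair.integrable_snd[of "\<lambda>z x. W (z, x)"] W_int by simp
  then have "integrable lborel (\<lambda>x. - (w x * ((A x)\<^sup>2 + (B x)\<^sup>2)))" unfolding W_z .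
  then show "integrable lborel (\<lambda>x. \<bar>x\<bar> powr (- (2 * H + 1)) * ((A x)\<^sup>2 + (B x)\<^sup>2))"
    by (drule_tac Bochner_Integration.integrable_minus) (simp add: w_def)
  have "(\<integral>x. \<integral>z. W (z, x) \<partial>lborel \<partial>lborel) = (\<integral>z. \<integral>x. W (z, x) \<partial>lborel \<partial>lborel)"
    using lborel_pair.Fubini_integral[of "\<lambda>z x. W (z, x)"] W_int by simp
  then have eq: "- (\<integral>x. w x * ((A x)\<^sup>2 + (B x)\<^sup>2) \<partial>lborel) = c * (\<integral>z. f z \<partial>lborel)"
    unfolding W_z W_x f_def[symmetric] by simp
  have inner: "(\<integral>q. f (p, q) \<partial>lborel) = integral {-1..1} (\<lambda>q. \<psi> p * \<psi> q * \<bar>p - q\<bar> powr (2 * H))" for p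
  proof -
    have "continuous_on {-1..1} (\<lambda>q. f (p, q))"
      by (rule continuous_on_compose2[OF f_cont[of UNIV]]) (auto intro!: continuous_intros)
    from lborel_integral_supported(2)[OF this] show ?thesis using supp by (auto simp: f_def)
  qed
  have "(\<integral>p. \<integral>q. f (p, q) \<partial>lborel \<partial>lborel) = integral {-1..1} (\<lambda>p. integral {-1..1} (\<lambda>q. \<psi> p * \<psi> q * \<bar>p - q\<bar> powr (2 * H)))"
    unfolding inner
  proof (rule lborel_integral_supported(2))
    show "continuous_on {-1..1} (\<lambda>p. integral {-1..1} (\<lambda>q. \<psi> p * \<psi> q * \<bar>p - q\<bar> powr (2 * H)))"
      using f_cont[of UNIV] by (intro continuous_on_integral_param) (simp add: f_def split_beta)
  qed (auto simp: supp)
  then show "pi * v2_sq H * integral {-1..1} (\<lambda>p. integral {-1..1} (\<lambda>q. \<psi> p * \<psi> q * \<bar>p - q\<bar> powr (2 * H)))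
      = - (\<integral>x. \<bar>x\<bar> powr (- (2 * H + 1)) * ((A x)\<^sup>2 + (B x)\<^sup>2) \<partial>lborel)"
    using eq iter[OF f_int] by (simp add: w_def c_def)
qed

section \<open>The smoothing kernel\<close>

text \<open>The support condition speaks of \<open>\<bar>x\<bar> > 1\<close> only; continuity
  extends it to the endpoints, which makes the boundary terms of integrations by parts
  disappear.\<close>

lemma vanishes_at_boundary:
  fixes f :: "real \<Rightarrow> real"
  assumes "continuous_on UNIV f" "\<And>x. 1 < \<bar>x\<bar> \<Longrightarrow> f x = 0" "1 \<le> \<bar>x\<bar>"
  shows "f x = 0"
proof -
  have "(\<lambda>n. x * (1 + 1 / real (Suc n))) \<longlonglongrightarrow> x * (1 + 0)"
    by (intro tendsto_intros LIMSEQ_Suc[OF lim_const_over_n])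
  then have "(\<lambda>n. f (x * (1 + 1 / real (Suc n)))) \<longlonglongrightarrow> f x"
    using assms(1) by (intro isCont_tendsto_compose[of x f]) (auto simp: continuous_on_eq_continuous_at)
  moreover have "f (x * (1 + 1 / real (Suc n))) = 0" for n
  proof (rule assms(2))
    have "1 * 1 < \<bar>x\<bar> * (1 + 1 / real (Suc n))" using assms(3) by (intro mult_le_less_imp_less) auto
    then show "1 < \<bar>x * (1 + 1 / real (Suc n))\<bar>" by (simp add: abs_mult)
  qed
  ultimately show ?thesis by (simp add: LIMSEQ_const_iff)
qed

text \<open>Outside \<open>[-1, 1]\<close> the function is locally constant; the endpoints follow
  from continuity of the derivative.\<close>

lemma deriv_vanishes_outside:
  fixes f :: "real \<Rightarrow> real"
  assumes der: "\<And>x. (f has_real_derivative f' x) (at x)" and cont: "continuous_on UNIV f'"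
    and f0: "\<And>x. 1 < \<bar>x\<bar> \<Longrightarrow> f x = 0" and x: "1 \<le> \<bar>x\<bar>"
  shows "f' x = 0"
proof (rule vanishes_at_boundary[OF cont _ x])
  fix y :: real assume y: "1 < \<bar>y\<bar>"
  show "f' y = 0"
  proof (rule DERIV_local_const[OF der])
    show "0 < \<bar>y\<bar> - 1" using y by simp
    show "\<forall>z. \<bar>y - z\<bar> < \<bar>y\<bar> - 1 \<longrightarrow> f y = f z" using f0 y by (auto simp: f0)
  qed
qed

lemma C1_differentiable_on_UNIV_deriv:
  fixes f :: "real \<Rightarrow> real"
  assumes "f C1_differentiable_on UNIV"
  shows "(f has_real_derivative deriv f x) (at x)" "continuous_on UNIV (deriv f)"
proof -
  obtain D where D: "\<And>x. (f has_vector_derivative D x) (at x)" "continuous_on UNIV D"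
    using assms unfolding C1_differentiable_on_def by auto
  then have d: "(f has_real_derivative D x) (at x)" for x
    by (simp add: has_real_derivative_iff_has_vector_derivative)
  then have "deriv f = D" by (auto intro!: DERIV_imp_deriv)
  with d D(2) show "(f has_real_derivative deriv f x) (at x)" "continuous_on UNIV (deriv f)" by auto
qed

lemma smoothing_kernelD:
  assumes "smoothing_kernel \<phi>"
  shows "(\<phi> has_real_derivative deriv \<phi> x) (at x)"
    and "(deriv \<phi> has_real_derivative deriv (deriv \<phi>) x) (at x)"
    and "continuous_on UNIV \<phi>" "continuous_on UNIV (deriv \<phi>)" "continuous_on UNIV (deriv (deriv \<phi>))"
    and "1 \<le> \<bar>x\<bar> \<Longrightarrow> \<phi> x = 0" "1 \<le> \<bar>x\<bar> \<Longrightarrow> deriv \<phi> x = 0" "1 \<le> \<bar>x\<bar> \<Longrightarrow> deriv (deriv \<phi>) x = 0"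
    and "0 \<le> \<phi> x" "integral {-1..1} \<phi> = 1"
proof -
  have C: "\<phi> C1_differentiable_on UNIV" "deriv \<phi> C1_differentiable_on UNIV"
    and z: "\<And>x. 1 < \<bar>x\<bar> \<Longrightarrow> \<phi> x = 0" and I: "(\<integral>x. \<phi> x \<partial>lborel) = 1"
    using assms by (auto simp: smoothing_kernel_def C2_on_reals_def)
  note d1 = C1_differentiable_on_UNIV_deriv[OF C(1)] and d2 = C1_differentiable_on_UNIV_deriv[OF C(2)]
  show "(\<phi> has_real_derivative deriv \<phi> x) (at x)" "continuous_on UNIV (deriv \<phi>)" by fact+
  show "(deriv \<phi> has_real_derivative deriv (deriv \<phi>) x) (at x)" "continuous_on UNIV (deriv (deriv \<phi>))" by fact+
  show cont: "continuous_on UNIV \<phi>" using d1(1) by (intro continuous_at_imp_continuous_on ballI DERIV_isCont)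
  have z1: "deriv \<phi> x = 0" if "1 \<le> \<bar>x\<bar>" for x by (rule deriv_vanishes_outside[OF d1 z that])
  then show "1 \<le> \<bar>x\<bar> \<Longrightarrow> deriv \<phi> x = 0" .
  show "1 \<le> \<bar>x\<bar> \<Longrightarrow> deriv (deriv \<phi>) x = 0"
    by (rule deriv_vanishes_outside[OF d2]) (auto intro: z1)
  show "1 \<le> \<bar>x\<bar> \<Longrightarrow> \<phi> x = 0" by (rule vanishes_at_boundary[OF cont z])
  show "0 \<le> \<phi> x" using assms by (simp add: smoothing_kernel_def)
  show "integral {-1..1} \<phi> = 1"
  proof -
    have "\<phi> x = 0" if "x \<notin> {-1..1}" for x using that by (intro z) auto
    from lborel_integral_supported(2)[OF continuous_on_subset[OF cont subset_UNIV] this] I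
    show ?thesis by simp
  qed
qed

text \<open>Integration by parts with vanishing boundary terms. The second derivative of the kernel
  thus annihilates constants and linear functions, which later produces the decay of correlations,
  and its Fourier transform is that of \<phi> times \<open>- x\<^sup>2\<close>.\<close>

lemma
  assumes \<phi>: "smoothing_kernel \<phi>"
  shows integral_deriv2_kernel: "integral {-1..1} (deriv (deriv \<phi>)) = 0"
    and integral_deriv2_kernel_times_id: "integral {-1..1} (\<lambda>v. deriv (deriv \<phi>) v * v) = 0"
    and integral_deriv2_kernel_cos: "integral {-1..1} (\<lambda>v. deriv (deriv \<phi>) v * cos (x * v)) = - x\<^sup>2 * integral {-1..1} (\<lambda>v. \<phi> v * cos (x * v))"
    and integral_deriv2_kernel_sin: "integral {-1..1} (\<lambda>v. deriv (deriv \<phi>) v * sin (x * v)) = - x\<^sup>2 * integral {-1..1} (\<lambda>v. \<phi> v * sin (x * v))"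
proof -
  note k = smoothing_kernelD[OF \<phi>]
  have FTC: "(f' has_integral 0) {-1..1}"
    if "\<And>v. (f has_real_derivative f' v) (at v)" "f 1 = 0" "f (-1) = 0" for f f' :: "real \<Rightarrow> real"
    using fundamental_theorem_of_calculus[of "-1" 1 f f'] that
    by (auto simp: has_real_derivative_iff_has_vector_derivative[symmetric] intro: DERIV_subset)
  show "integral {-1..1} (deriv (deriv \<phi>)) = 0"
    by (rule integral_unique, rule FTC[OF k(2)]) (auto intro: k)
  have der: "((\<lambda>v. deriv \<phi> v * v - \<phi> v) has_real_derivative deriv (deriv \<phi>) v * v) (at v)" for v
    by (auto intro!: derivative_eq_intros k)
  show "integral {-1..1} (\<lambda>v. deriv (deriv \<phi>) v * v) = 0"
    by (rule integral_unique, rule FTC[OF der]) (auto simp: k)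
  note [continuous_intros] = continuous_on_compose2[OF k(3)]
  have int: "(\<lambda>v. \<phi> v * cos (x * v)) integrable_on {-1..1}" "(\<lambda>v. \<phi> v * sin (x * v)) integrable_on {-1..1}"
    by (intro integrable_continuous_real continuous_intros; simp)+
  have "((\<lambda>v. deriv \<phi> v * cos (x * v) + x * \<phi> v * sin (x * v)) has_real_derivative
      deriv (deriv \<phi>) v * cos (x * v) + x\<^sup>2 * (\<phi> v * cos (x * v))) (at v)" for v
    by (auto intro!: derivative_eq_intros k simp: power2_eq_square algebra_simps)
  then have "((\<lambda>v. deriv (deriv \<phi>) v * cos (x * v) + x\<^sup>2 * (\<phi> v * cos (x * v))) has_integral 0) {-1..1}"
    by (rule FTC) (auto simp: k)
  from has_integral_diff[OF this has_integral_mult_right[OF integrable_integral[OF int(1)], of "x\<^sup>2"]]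
  show "integral {-1..1} (\<lambda>v. deriv (deriv \<phi>) v * cos (x * v)) = - x\<^sup>2 * integral {-1..1} (\<lambda>v. \<phi> v * cos (x * v))"
    by (simp add: integral_unique)
  have "((\<lambda>v. deriv \<phi> v * sin (x * v) - x * \<phi> v * cos (x * v)) has_real_derivative
      deriv (deriv \<phi>) v * sin (x * v) + x\<^sup>2 * (\<phi> v * sin (x * v))) (at v)" for v
    by (auto intro!: derivative_eq_intros k simp: power2_eq_square algebra_simps)
  then have "((\<lambda>v. deriv (deriv \<phi>) v * sin (x * v) + x\<^sup>2 * (\<phi> v * sin (x * v))) has_integral 0) {-1..1}"
    by (rule FTC) (auto simp: k)
  from has_integral_diff[OF this has_integral_mult_right[OF integrable_integral[OF int(2)], of "x\<^sup>2"]]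
  show "integral {-1..1} (\<lambda>v. deriv (deriv \<phi>) v * sin (x * v)) = - x\<^sup>2 * integral {-1..1} (\<lambda>v. \<phi> v * sin (x * v))"
    by (simp add: integral_unique)
qed

lemma cmod_fourier_kernel:
  assumes \<phi>: "smoothing_kernel \<phi>"
  shows "(cmod (fourier \<phi> (- x)))\<^sup>2 =
    (integral {-1..1} (\<lambda>v. \<phi> v * cos (x * v)))\<^sup>2 + (integral {-1..1} (\<lambda>v. \<phi> v * sin (x * v)))\<^sup>2"
proof -
  note k = smoothing_kernelD[OF \<phi>]
  note [continuous_intros] = continuous_on_compose2[OF k(3)]
  have s: "integrable lborel (\<lambda>v. \<phi> v * cos (x * v))" "(\<integral>v. \<phi> v * cos (x * v) \<partial>lborel) = integral {-1..1} (\<lambda>v. \<phi> v * cos (x * v))"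
    "integrable lborel (\<lambda>v. \<phi> v * sin (x * v))" "(\<integral>v. \<phi> v * sin (x * v) \<partial>lborel) = integral {-1..1} (\<lambda>v. \<phi> v * sin (x * v))"
  proof -
    have c: "continuous_on {-1..1} (\<lambda>v. \<phi> v * cos (x * v))" "continuous_on {-1..1} (\<lambda>v. \<phi> v * sin (x * v))"
      by (intro continuous_intros; simp)+
    have supp: "\<phi> x = 0" if "x \<notin> {-1..1}" for x using that by (intro k(6)) auto
    show "integrable lborel (\<lambda>v. \<phi> v * cos (x * v))" "(\<integral>v. \<phi> v * cos (x * v) \<partial>lborel) = integral {-1..1} (\<lambda>v. \<phi> v * cos (x * v))"
      using lborel_integral_supported[OF c(1)] supp by auto
    show "integrable lborel (\<lambda>v. \<phi> v * sin (x * v))" "(\<integral>v. \<phi> v * sin (x * v) \<partial>lborel) = integral {-1..1} (\<lambda>v. \<phi> v * sin (x * v))"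
      using lborel_integral_supported[OF c(2)] supp by auto
  qed
  have "fourier \<phi> (- x) = (\<integral>v. complex_of_real (\<phi> v * cos (x * v)) + \<i> * complex_of_real (\<phi> v * sin (x * v)) \<partial>lborel)"
    unfolding fourier_def
  proof (rule Bochner_Integration.integral_cong[OF refl])
    fix v
    have "exp (- (\<i> * complex_of_real (- x * v))) = cis (x * v)" by (simp add: cis_conv_exp)
    then show "exp (- (\<i> * complex_of_real (- x * v))) * complex_of_real (\<phi> v) =
        complex_of_real (\<phi> v * cos (x * v)) + \<i> * complex_of_real (\<phi> v * sin (x * v))"
      by (simp add: complex_eq_iff)
  qed
  also have "\<dots> = complex_of_real (integral {-1..1} (\<lambda>v. \<phi> v * cos (x * v))) + \<i> * complex_of_real (integral {-1..1} (\<lambda>v. \<phi> v * sin (x * v)))"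
    using s by (subst Bochner_Integration.integral_add) (simp_all del: of_real_mult)
  finally show ?thesis by (simp add: cmod_power2)
qed

text \<open>For a kernel \<psi> of mean zero this is, up to the factor
  \<open>\<epsilon> powr (2 * H)\<close>, the covariance of two averages of the fractional Brownian
  motion at scale \<epsilon> whose centres are \<open>s * \<epsilon>\<close> apart. The terms of the
  covariance function that depend on one time only do not survive.\<close>

definition kernel_cov :: "real \<Rightarrow> (real \<Rightarrow> real) \<Rightarrow> real \<Rightarrow> real" where
  "kernel_cov H \<psi> s = - (v2_sq H / 2) *
     integral {-1..1} (\<lambda>p. integral {-1..1} (\<lambda>q. \<psi> p * \<psi> q * \<bar>s - (p - q)\<bar> powr (2 * H)))"

text \<open>Two derivatives multiply the squared Fourier transform by \<open>x ^ 4\<close>, turning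
  the weight \<open>\<bar>x\<bar> powr (- (2 * H + 1))\<close> into
  \<open>\<bar>x\<bar> powr (3 - 2 * H)\<close>. The spectral constant of the theorem is therefore
  the variance of the smoothed second derivative before scaling.\<close>

lemma
  assumes \<phi>: "smoothing_kernel \<phi>" and H: "0 < H" "H < 1"
  shows sigma2_pos: "0 < sigma2 \<phi> H"
    and sigma2_eq_kernel_cov: "(sigma2 \<phi> H)\<^sup>2 = kernel_cov H (deriv (deriv \<phi>)) 0"
proof -
  note k = smoothing_kernelD[OF \<phi>]
  note [continuous_intros] = continuous_on_compose2[OF k(3)]
  define a where "a x = integral {-1..1} (\<lambda>v. \<phi> v * cos (x * v))" for x
  define b where "b x = integral {-1..1} (\<lambda>v. \<phi> v * sin (x * v))" for x
  define S where "S x = \<bar>x\<bar> powr (3 - 2 * H) * (cmod (fourier \<phi> (- x)))\<^sup>2" for x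
  have S: "S x = \<bar>x\<bar> powr (3 - 2 * H) * ((a x)\<^sup>2 + (b x)\<^sup>2)" for x
    by (simp add: S_def a_def b_def cmod_fourier_kernel[OF \<phi>])
  have S': "\<bar>x\<bar> powr (- (2 * H + 1)) * ((integral {-1..1} (\<lambda>p. deriv (deriv \<phi>) p * cos (x * p)))\<^sup>2
      + (integral {-1..1} (\<lambda>p. deriv (deriv \<phi>) p * sin (x * p)))\<^sup>2) = S x" for x
  proof (cases "x = 0")
    case False
    have "\<bar>x\<bar> powr (- (2 * H + 1)) * x ^ 4 = \<bar>x\<bar> powr (3 - 2 * H)"
    proof -
      have "x ^ 4 = \<bar>x\<bar> ^ 4" by simp
      also have "\<dots> = \<bar>x\<bar> powr 4" using False by (subst powr_numeral) auto
      finally have "\<bar>x\<bar> powr (- (2 * H + 1)) * x ^ 4 = \<bar>x\<bar> powr (- (2 * H + 1) + 4)"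
        by (simp only: powr_add)
      then show ?thesis by (simp add: algebra_simps)
    qed
    moreover have "(x\<^sup>2)\<^sup>2 = x ^ 4" by simp
    ultimately show ?thesis
      unfolding S integral_deriv2_kernel_cos[OF \<phi>] integral_deriv2_kernel_sin[OF \<phi>] a_def[symmetric] b_def[symmetric]
      by (simp add: power_mult_distrib flip: distrib_left)
  qed (simp add: S)
  have int: "integrable lborel S"
    and eq: "pi * v2_sq H * integral {-1..1} (\<lambda>p. integral {-1..1} (\<lambda>q. deriv (deriv \<phi>) p * deriv (deriv \<phi>) q * \<bar>p - q\<bar> powr (2 * H)))
      = - (\<integral>x. S x \<partial>lborel)"
  proof -
    have supp: "deriv (deriv \<phi>) x = 0" if "x \<notin> {-1..1}" for x using that by (intro k(8)) auto
    note * = double_integral_powr_eq_Fourier[OF H k(5) supp integral_deriv2_kernel[OF \<phi>]]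
    show "integrable lborel S" using *(1) unfolding S' by simp
    show "pi * v2_sq H * integral {-1..1} (\<lambda>p. integral {-1..1} (\<lambda>q. deriv (deriv \<phi>) p * deriv (deriv \<phi>) q * \<bar>p - q\<bar> powr (2 * H)))
      = - (\<integral>x. S x \<partial>lborel)" using *(2) unfolding S' by simp
  qed
  have S0: "S x \<ge> 0" for x by (simp add: S)
  have "(\<integral>x. S x \<partial>lborel) > 0"
  proof -
    \<comment> \<open>Positivity from one band of frequencies: for
      \<open>1/2 \<le> x \<le> 1\<close> and \<open>\<bar>v\<bar> \<le> 1\<close> the angle
      \<open>x * v\<close> stays below \<open>pi / 3\<close>, so the cosine transform of \<phi> is
      at least 1/2 and its square at least 1/4.\<close>
    define e where "e = (1 / 2) powr (3 - 2 * H) / 4"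
    have low: "e * indicator {1/2..1} x \<le> S x" for x :: real
    proof (cases "x \<in> {1/2..1}")
      case True
      have "integral {-1..1} (\<lambda>v. \<phi> v * (1 / 2)) \<le> a x"
        unfolding a_def
      proof (rule integral_le)
        show "(\<lambda>v. \<phi> v * (1 / 2)) integrable_on {-1..1}" "(\<lambda>v. \<phi> v * cos (x * v)) integrable_on {-1..1}"
          by (intro integrable_continuous_real continuous_intros; simp)+
        fix v :: real assume v: "v \<in> {-1..1}"
        have "\<bar>x * v\<bar> \<le> 1 * 1" unfolding abs_mult using True v by (intro mult_mono) auto
        then have "\<bar>x * v\<bar> \<le> pi / 3" using pi_gt3 by linarith
        then have "cos (pi / 3) \<le> cos \<bar>x * v\<bar>" by (intro cos_monotone_0_pi_le) auto
        then have "1 / 2 \<le> cos (x * v)" by (simp add: cos_60)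
        then show "\<phi> v * (1 / 2) \<le> \<phi> v * cos (x * v)" using k(9) by (intro mult_left_mono) auto
      qed
      then have "1 / 2 \<le> a x" using k(10) by simp
      then have "(1 / 2)\<^sup>2 \<le> (a x)\<^sup>2" by (intro power_mono) auto
      moreover have "(a x)\<^sup>2 \<le> (a x)\<^sup>2 + (b x)\<^sup>2" by simp
      moreover have "(1 / 2 :: real)\<^sup>2 = 1 / 4" by (simp add: power_divide)
      ultimately have "1 / 4 \<le> (a x)\<^sup>2 + (b x)\<^sup>2" by linarith
      moreover have "(1 / 2) powr (3 - 2 * H) \<le> \<bar>x\<bar> powr (3 - 2 * H)"
        using True H by (intro powr_mono2) auto
      ultimately have "(1 / 2) powr (3 - 2 * H) * (1 / 4) \<le> S x" unfolding S by (intro mult_mono) auto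
      then show ?thesis using True by (simp add: e_def)
    qed (simp add: S0)
    have "(\<integral>x. e * indicator {1/2..1::real} x \<partial>lborel) \<le> (\<integral>x. S x \<partial>lborel)"
    proof (intro integral_mono int low integrable_mult_right integrable_real_indicator)
      have "emeasure lborel {1/2..1::real} = ennreal (1 - 1/2)" by (rule emeasure_lborel_Icc) simp
      then show "emeasure lborel {1/2..1::real} < \<infinity>" by (simp only: infinity_ennreal_def ennreal_less_top)
    qed simp
    moreover have "0 < (\<integral>x. e * indicator {1/2..1::real} x \<partial>lborel)" by (simp add: e_def)
    ultimately show ?thesis by linarith
  qed
  then show "0 < sigma2 \<phi> H" unfolding sigma2_def S_def[symmetric] by simp
  have "(sigma2 \<phi> H)\<^sup>2 = 1 / (2 * pi) * (\<integral>x. S x \<partial>lborel)"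
    unfolding sigma2_def S_def[symmetric] using \<open>(\<integral>x. S x \<partial>lborel) > 0\<close> by simp
  also have "\<dots> = - (1 / (2 * pi)) * (pi * v2_sq H * integral {-1..1} (\<lambda>p. integral {-1..1} (\<lambda>q. deriv (deriv \<phi>) p * deriv (deriv \<phi>) q * \<bar>p - q\<bar> powr (2 * H))))"
    unfolding eq by simp
  also have "\<dots> = kernel_cov H (deriv (deriv \<phi>)) 0"
    by (simp add: kernel_cov_def abs_minus_commute)
  finally show "(sigma2 \<phi> H)\<^sup>2 = kernel_cov H (deriv (deriv \<phi>)) 0" .
qed

section \<open>Decay of the covariance at large lags\<close>

lemma powr_second_order_pos:
  fixes a y q :: real
  assumes "1 < a" "a < 2" "2 \<le> y" "\<bar>q\<bar> \<le> 1"
  shows "\<bar>(y + q) powr a - y powr a - a * y powr (a - 1) * q\<bar> \<le> a * (a - 1) * (y - 1) powr (a - 2)"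
proof -
  define K where "K = (a - 1) * (y - 1) powr (a - 2)"
  \<comment> \<open>The mean value inequality is used twice, here for the derivative and below for
    the function. Since \<open>a < 2\<close>, the second derivative is largest at the left end
    \<open>y - 1\<close>.\<close>
  have first: "\<bar>(y + z) powr (a - 1) - y powr (a - 1)\<bar> \<le> K" if z: "z \<in> {-1..1}" for z
  proof -
    have "norm ((y + z) powr (a - 1) - (y + 0) powr (a - 1)) \<le> K * norm (z - 0)"
    proof (rule field_differentiable_bound[of "{-1..1}" _ "\<lambda>w. (a - 1) * (y + w) powr (a - 2)"])
      fix w :: real assume w: "w \<in> {-1..1}"
      show "((\<lambda>w. (y + w) powr (a - 1)) has_field_derivative (a - 1) * (y + w) powr (a - 2)) (at w within {-1..1})"
        using w assms by (auto intro!: derivative_eq_intros simp: algebra_simps)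
      have "(y + w) powr (a - 2) \<le> (y - 1) powr (a - 2)" using w assms by (intro powr_mono2') auto
      then show "norm ((a - 1) * (y + w) powr (a - 2)) \<le> K"
        using assms by (simp add: K_def abs_mult mult_left_mono)
    qed (use z in auto)
    also have "\<dots> \<le> K * 1" using z assms by (intro mult_left_mono) (auto simp: K_def)
    finally show ?thesis by simp
  qed
  have "norm (((y + q) powr a - a * y powr (a - 1) * q) - ((y + 0) powr a - a * y powr (a - 1) * 0)) \<le> (a * K) * norm (q - 0)"
  proof (rule field_differentiable_bound[of "{-1..1}" _ "\<lambda>w. a * ((y + w) powr (a - 1) - y powr (a - 1))"])
    fix w :: real assume w: "w \<in> {-1..1}"
    show "((\<lambda>w. (y + w) powr a - a * y powr (a - 1) * w) has_field_derivative a * ((y + w) powr (a - 1) - y powr (a - 1))) (at w within {-1..1})"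
      using w assms by (auto intro!: derivative_eq_intros simp: algebra_simps)
    show "norm (a * ((y + w) powr (a - 1) - y powr (a - 1))) \<le> a * K"
      using first[OF w] assms by (simp add: abs_mult)
  qed (use assms in auto)
  also have "\<dots> \<le> a * K * 1" using assms by (intro mult_left_mono) (auto simp: K_def)
  finally show ?thesis by (simp add: K_def algebra_simps)
qed

text \<open>Reflection reduces negative \<open>y\<close> to the positive case. The slope
  \<open>d\<close> is left unspecified because it will be integrated against a kernel with vanishing
  first moment.\<close>

lemma abs_powr_second_order:
  fixes a y :: real
  assumes "1 < a" "a < 2" "2 \<le> \<bar>y\<bar>"
  obtains d where "\<And>q. \<bar>q\<bar> \<le> 1 \<Longrightarrow> \<bar>\<bar>y + q\<bar> powr a - \<bar>y\<bar> powr a - d * q\<bar> \<le> a * (a - 1) * (\<bar>y\<bar> - 1) powr (a - 2)"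
proof (cases "y > 0")
  case True
  show thesis
  proof (rule that[of "a * y powr (a - 1)"])
    fix q :: real assume q: "\<bar>q\<bar> \<le> 1"
    then have "\<bar>y + q\<bar> = y + q" using True assms by auto
    then show "\<bar>\<bar>y + q\<bar> powr a - \<bar>y\<bar> powr a - a * y powr (a - 1) * q\<bar> \<le> a * (a - 1) * (\<bar>y\<bar> - 1) powr (a - 2)"
      using powr_second_order_pos[of a y q] True assms q by simp
  qed
next
  case False
  show thesis
  proof (rule that[of "- (a * (- y) powr (a - 1))"])
    fix q :: real assume q: "\<bar>q\<bar> \<le> 1"
    then have "\<bar>y + q\<bar> = - y + - q" using False assms by auto
    then show "\<bar>\<bar>y + q\<bar> powr a - \<bar>y\<bar> powr a - - (a * (- y) powr (a - 1)) * q\<bar> \<le> a * (a - 1) * (\<bar>y\<bar> - 1) powr (a - 2)"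
      using powr_second_order_pos[of a "- y" "- q"] False assms q by simp
  qed
qed

text \<open>For fixed \<open>p\<close> the integral over \<open>q\<close> removes the constant and
  linear parts of the power at \<open>s - p\<close>, because the second derivative of \<phi> has
  vanishing moments of order 0 and 1. Only a second-order remainder of size
  \<open>\<bar>s\<bar> powr (2 * H - 2)\<close> is left, and the integral over \<open>p\<close> is
  estimated trivially.\<close>

lemma kernel_cov_decay:
  assumes \<phi>: "smoothing_kernel \<phi>" and H: "1 / 2 < H" "H < 1"
  obtains C where "0 \<le> C"
    "\<And>s. 4 \<le> \<bar>s\<bar> \<Longrightarrow> \<bar>kernel_cov H (deriv (deriv \<phi>)) s\<bar> \<le> C * \<bar>s\<bar> powr (2 * H - 2)"
proof -
  define \<psi> where "\<psi> = deriv (deriv \<phi>)"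
  have cont: "continuous_on UNIV \<psi>" unfolding \<psi>_def by (rule smoothing_kernelD[OF \<phi>])
  note [continuous_intros] = continuous_on_compose2[OF cont]
  obtain M where M: "\<And>q. q \<in> {-1..1} \<Longrightarrow> \<bar>\<psi> q\<bar> \<le> M"
  proof -
    have "bounded (\<psi> ` {-1..1})"
      using continuous_on_subset[OF cont] by (intro compact_imp_bounded compact_continuous_image) auto
    then obtain a where "\<forall>y\<in>\<psi> ` {-1..1}. norm y \<le> a" by (auto simp: bounded_iff)
    then show thesis by (intro that[of a]) auto
  qed
  have M0: "0 \<le> M" using M[of 0] by auto
  have \<psi>_int: "(\<psi> has_integral 0) {-1..1}" "((\<lambda>q. \<psi> q * q) has_integral 0) {-1..1}"
  proof -
    have "\<psi> integrable_on {-1..1}" "(\<lambda>q. \<psi> q * q) integrable_on {-1..1}"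
      by (intro integrable_continuous_real continuous_on_subset[OF cont] continuous_intros; simp)+
    then show "(\<psi> has_integral 0) {-1..1}" "((\<lambda>q. \<psi> q * q) has_integral 0) {-1..1}"
      using integral_deriv2_kernel[OF \<phi>] integral_deriv2_kernel_times_id[OF \<phi>]
      by (metis \<psi>_def integrable_integral)+
  qed
  define a where "a = 2 * H"
  have a: "1 < a" "a < 2" using H by (auto simp: a_def)
  define K where "K s = a * (a - 1) * (\<bar>s\<bar> / 2) powr (a - 2)" for s
  have cont2: "continuous_on UNIV (\<lambda>(p, q). \<psi> p * \<psi> q * \<bar>s - (p - q)\<bar> powr a)" for s
    unfolding split_beta using a by (intro continuous_intros continuous_on_powr') auto
  have inner: "\<bar>integral {-1..1} (\<lambda>q. \<psi> p * \<psi> q * \<bar>s - (p - q)\<bar> powr a)\<bar> \<le> M * (M * K s) * 2"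
    if s: "4 \<le> \<bar>s\<bar>" and p: "p \<in> {-1..1}" for s p
  proof -
    define y where "y = s - p"
    \<comment> \<open>The threshold 4 enters here: \<open>\<bar>s\<bar> - 2\<close> is at least
      \<open>\<bar>s\<bar> / 2\<close> exactly when \<open>\<bar>s\<bar> \<ge> 4\<close>.\<close>
    have y: "2 \<le> \<bar>y\<bar>" "\<bar>s\<bar> / 2 \<le> \<bar>y\<bar> - 1" using s p unfolding y_def by (auto simp: abs_if split: if_splits)
    obtain d where d: "\<And>q. \<bar>q\<bar> \<le> 1 \<Longrightarrow> \<bar>\<bar>y + q\<bar> powr a - \<bar>y\<bar> powr a - d * q\<bar> \<le> a * (a - 1) * (\<bar>y\<bar> - 1) powr (a - 2)"
      using abs_powr_second_order[OF a y(1)] by blast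
    have K: "a * (a - 1) * (\<bar>y\<bar> - 1) powr (a - 2) \<le> K s"
      unfolding K_def using y s a by (intro mult_left_mono powr_mono2') auto
    have "(\<lambda>q. \<psi> p * \<psi> q * \<bar>y + q\<bar> powr a) integrable_on {-1..1}"
      using a by (intro integrable_continuous_real continuous_intros continuous_on_powr') auto
    note I = integrable_integral[OF this]
    have "((\<lambda>q. \<psi> p * \<psi> q * \<bar>y + q\<bar> powr a - (\<psi> p * \<bar>y\<bar> powr a) * \<psi> q - (\<psi> p * d) * (\<psi> q * q)) has_integral
        (integral {-1..1} (\<lambda>q. \<psi> p * \<psi> q * \<bar>y + q\<bar> powr a) - (\<psi> p * \<bar>y\<bar> powr a) * 0 - (\<psi> p * d) * 0)) {-1..1}"
      by (intro has_integral_diff has_integral_mult_right I \<psi>_int)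
    then have hi: "((\<lambda>q. \<psi> p * (\<psi> q * (\<bar>y + q\<bar> powr a - \<bar>y\<bar> powr a - d * q))) has_integral
        integral {-1..1} (\<lambda>q. \<psi> p * \<psi> q * \<bar>y + q\<bar> powr a)) {-1..1}"
      by (simp add: algebra_simps)
    have "norm (integral {-1..1} (\<lambda>q. \<psi> p * \<psi> q * \<bar>y + q\<bar> powr a)) \<le> M * (M * K s) * Henstock_Kurzweil_Integration.content {-1..1::real}"
    proof (rule has_integral_bound_real[OF _ finite.emptyI hi])
      show "0 \<le> M * (M * K s)" using M0 a by (simp add: K_def)
      fix q :: real assume q: "q \<in> {-1..1} - {}"
      have "\<bar>q\<bar> \<le> 1" using q by auto
      then have "\<bar>\<bar>y + q\<bar> powr a - \<bar>y\<bar> powr a - d * q\<bar> \<le> K s" using d K by (blast intro: order_trans)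
      then show "norm (\<psi> p * (\<psi> q * (\<bar>y + q\<bar> powr a - \<bar>y\<bar> powr a - d * q))) \<le> M * (M * K s)"
        unfolding real_norm_def abs_mult using M[OF p] M[of q] q M0 by (intro mult_mono) auto
    qed
    then show ?thesis by (simp add: y_def algebra_simps)
  qed
  define C where "C = v2_sq H / 2 * (M * (M * (a * (a - 1) * (1 / 2) powr (a - 2))) * 2 * 2)"
  have v: "0 < v2_sq H" using H by (intro v2_sq_pos) auto
  show thesis
  proof (rule that[of C])
    show "0 \<le> C" using v M0 a by (simp add: C_def)
    fix s :: real assume s: "4 \<le> \<bar>s\<bar>"
    have "continuous_on {-1..1} (\<lambda>p. integral {-1..1} (\<lambda>q. \<psi> p * \<psi> q * \<bar>s - (p - q)\<bar> powr a))"
      by (rule continuous_on_integral_param[OF cont2])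
    then have "norm (integral {-1..1} (\<lambda>p. integral {-1..1} (\<lambda>q. \<psi> p * \<psi> q * \<bar>s - (p - q)\<bar> powr a)))
        \<le> M * (M * K s) * 2 * Henstock_Kurzweil_Integration.content {-1..1::real}"
      using inner[OF s] M0 a
      by (intro has_integral_bound_real[OF _ finite.emptyI integrable_integral[OF integrable_continuous_real]]) (auto simp: K_def)
    then have "\<bar>integral {-1..1} (\<lambda>p. integral {-1..1} (\<lambda>q. \<psi> p * \<psi> q * \<bar>s - (p - q)\<bar> powr a))\<bar> \<le> M * (M * K s) * 2 * 2"
      by simp
    then have "v2_sq H / 2 * \<bar>integral {-1..1} (\<lambda>p. integral {-1..1} (\<lambda>q. \<psi> p * \<psi> q * \<bar>s - (p - q)\<bar> powr a))\<bar> \<le> v2_sq H / 2 * (M * (M * K s) * 2 * 2)"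
      using v by (intro mult_left_mono) auto
    moreover have "\<bar>kernel_cov H \<psi> s\<bar> = v2_sq H / 2 * \<bar>integral {-1..1} (\<lambda>p. integral {-1..1} (\<lambda>q. \<psi> p * \<psi> q * \<bar>s - (p - q)\<bar> powr a))\<bar>"
      using v by (simp add: kernel_cov_def a_def abs_mult)
    moreover have "K s = a * (a - 1) * (1 / 2) powr (a - 2) * \<bar>s\<bar> powr (2 * H - 2)"
    proof -
      have "(\<bar>s\<bar> / 2) powr (a - 2) = (1 / 2 * \<bar>s\<bar>) powr (a - 2)" by simp
      also have "\<dots> = (1 / 2) powr (a - 2) * \<bar>s\<bar> powr (a - 2)" by (rule powr_mult)
      finally show ?thesis by (simp add: K_def a_def)
    qed
    ultimately show "\<bar>kernel_cov H (deriv (deriv \<phi>)) s\<bar> \<le> C * \<bar>s\<bar> powr (2 * H - 2)"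
      by (simp add: C_def \<psi>_def mult_ac)
  qed
qed

section \<open>Gaussian laws\<close>

text \<open>The law is that of \<open>s\<close> times a standard normal variable, rather than one
  given by a density. Thus \<open>s = 0\<close> is the point mass at 0, and the class is closed
  under limits even when the variance degenerates.\<close>

definition gaussian_with_std :: "'a measure \<Rightarrow> ('a \<Rightarrow> real) \<Rightarrow> real \<Rightarrow> bool" where
  "gaussian_with_std M Y s \<longleftrightarrow> Y \<in> borel_measurable M \<and>
     distr M borel Y = distr std_normal_distribution borel ((*) s)"

abbreviation "std_normal \<equiv> std_normal_distribution"

lemma prob_space_std_normal: "prob_space std_normal"
  using prob_space_normal_density[of 1 0] by simp

context prob_space
begin

lemma gaussian_with_std_measurable: "gaussian_with_std M Y s \<Longrightarrow> Y \<in> borel_measurable M"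
  by (simp add: gaussian_with_std_def)

lemma gaussian_with_std_integral:
  fixes f :: "real \<Rightarrow> 'b::{banach, second_countable_topology}"
  assumes "gaussian_with_std M Y s" and [measurable]: "f \<in> borel_measurable borel"
  shows "(\<integral>\<omega>. f (Y \<omega>) \<partial>M) = (\<integral>x. f (s * x) \<partial>std_normal)"
    and "integrable M (\<lambda>\<omega>. f (Y \<omega>)) \<longleftrightarrow> integrable std_normal (\<lambda>x. f (s * x))"
proof -
  have [measurable]: "Y \<in> borel_measurable M" and eq: "distr M borel Y = distr std_normal borel ((*) s)"
    using assms(1) by (auto simp: gaussian_with_std_def)
  have "(\<integral>\<omega>. f (Y \<omega>) \<partial>M) = (\<integral>y. f y \<partial>distr M borel Y)" by (subst integral_distr) auto
  also have "\<dots> = (\<integral>x. f (s * x) \<partial>std_normal)" unfolding eq by (subst integral_distr) auto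
  finally show "(\<integral>\<omega>. f (Y \<omega>) \<partial>M) = (\<integral>x. f (s * x) \<partial>std_normal)" .
  have "integrable M (\<lambda>\<omega>. f (Y \<omega>)) \<longleftrightarrow> integrable (distr M borel Y) f" by (subst integrable_distr_eq) auto
  also have "\<dots> \<longleftrightarrow> integrable std_normal (\<lambda>x. f (s * x))" unfolding eq by (subst integrable_distr_eq) auto
  finally show "integrable M (\<lambda>\<omega>. f (Y \<omega>)) \<longleftrightarrow> integrable std_normal (\<lambda>x. f (s * x))" .
qed

text \<open>Mean zero places a point mass at 0, so the degenerate case of \<open>gaussian_rv\<close>
  becomes \<open>s = 0\<close>.\<close>

lemma gaussian_rv_imp_gaussian_with_std:
  assumes Y: "gaussian_rv M Y" and mean: "(\<integral>\<omega>. Y \<omega> \<partial>M) = 0"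
  shows "\<exists>s\<ge>0. gaussian_with_std M Y s"
proof -
  interpret N: prob_space std_normal by (rule prob_space_std_normal)
  have [measurable]: "Y \<in> borel_measurable M" using Y by (simp add: gaussian_rv_def)
  consider (point) m where "AE \<omega> in M. Y \<omega> = m"
    | (normal) m s where "s > 0" "distributed M lborel Y (normal_density m s)"
    using Y unfolding gaussian_rv_def by blast
  then show ?thesis
  proof cases
    case point
    have "(\<integral>\<omega>. Y \<omega> \<partial>M) = (\<integral>\<omega>. m \<partial>M)" using point by (intro integral_cong_AE) auto
    then have "m = 0" using mean by (simp add: prob_space)
    have "distr M borel Y = distr M borel (\<lambda>_. 0)"
      using point \<open>m = 0\<close> by (intro distr_cong_AE) auto
    also have "\<dots> = distr std_normal borel ((*) 0)"
    proof -
      have "((*) (0 :: real)) = (\<lambda>_. 0)" by auto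
      then show ?thesis by (simp add: distr_const N.distr_const)
    qed
    finally show ?thesis by (intro exI[of _ 0]) (simp add: gaussian_with_std_def)
  next
    case normal
    have "m = 0" using normal_distributed_expectation[OF normal] mean by simp
    have "distributed std_normal lborel (\<lambda>x. x) (normal_density 0 1)"
      by (simp add: distributed_def distr_id2)
    from N.normal_density_affine[OF this, of s 0] normal(1)
    have "distr std_normal lborel ((*) s) = density lborel (normal_density 0 s)"
      by (simp add: distributed_def)
    moreover have "distr M lborel Y = density lborel (normal_density 0 s)"
      using normal \<open>m = 0\<close> by (simp add: distributed_def)
    moreover have "distr M lborel Y = distr M borel Y" "distr std_normal lborel ((*) s) = distr std_normal borel ((*) s)"
      by (auto intro!: distr_cong)
    ultimately show ?thesis using normal(1) by (intro exI[of _ s]) (simp add: gaussian_with_std_def)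
  qed
qed

lemma gaussian_with_std_char:
  assumes "gaussian_with_std M Y s"
  shows "(\<integral>\<omega>. iexp (t * Y \<omega>) \<partial>M) = complex_of_real (exp (- ((t * s)\<^sup>2) / 2))"
proof -
  have "(\<integral>\<omega>. iexp (t * Y \<omega>) \<partial>M) = (\<integral>x. iexp ((t * s) * x) \<partial>std_normal)"
    using gaussian_with_std_integral(1)[OF assms, of "\<lambda>y. iexp (t * y)"] by (simp add: mult.assoc)
  also have "\<dots> = char std_normal (t * s)" by (simp add: char_def)
  finally show ?thesis by (simp add: char_std_normal_distribution)
qed

lemma gaussian_with_stdI_char:
  assumes [measurable]: "Y \<in> borel_measurable M"
    and char: "\<And>t. (\<integral>\<omega>. iexp (t * Y \<omega>) \<partial>M) = complex_of_real (exp (- ((t * s)\<^sup>2) / 2))"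
  shows "gaussian_with_std M Y s"
proof -
  interpret N: prob_space std_normal by (rule prob_space_std_normal)
  have "distr M borel Y = distr std_normal borel ((*) s)"
  proof (rule Levy_uniqueness)
    show "real_distribution (distr M borel Y)"
      by (auto simp: real_distribution_def real_distribution_axioms_def intro!: prob_space_distr)
    show "real_distribution (distr std_normal borel ((*) s))"
      by (auto simp: real_distribution_def real_distribution_axioms_def intro!: N.prob_space_distr)
    show "char (distr M borel Y) = char (distr std_normal borel ((*) s))"
    proof
      fix t
      have "char (distr M borel Y) t = (\<integral>\<omega>. iexp (t * Y \<omega>) \<partial>M)"
        unfolding char_def by (subst integral_distr) auto
      also have "\<dots> = char std_normal (t * s)" unfolding char by (simp add: char_std_normal_distribution)
      also have "\<dots> = (\<integral>x. iexp (t * (s * x)) \<partial>std_normal)" by (simp add: char_def mult.assoc)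
      also have "\<dots> = char (distr std_normal borel ((*) s)) t"
        unfolding char_def by (subst integral_distr) auto
      finally show "char (distr M borel Y) t = char (distr std_normal borel ((*) s)) t" .
    qed
  qed
  then show ?thesis by (simp add: gaussian_with_std_def)
qed

text \<open>Characteristic functions converge by dominated convergence on one side and by the
  explicit formula on the other; Levy's uniqueness theorem identifies the law of the limit.\<close>

lemma gaussian_with_std_limit:
  assumes gauss: "\<And>n. gaussian_with_std M (Y n) (s n)"
    and lim: "\<And>\<omega>. \<omega> \<in> space M \<Longrightarrow> (\<lambda>n. Y n \<omega>) \<longlonglongrightarrow> Z \<omega>" and s: "s \<longlonglongrightarrow> r"
  shows "gaussian_with_std M Z r"
proof (rule gaussian_with_stdI_char)
  have [measurable]: "Y n \<in> borel_measurable M" for n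
    using gauss by (rule gaussian_with_std_measurable)
  show [measurable]: "Z \<in> borel_measurable M"
    using lim by (rule borel_measurable_LIMSEQ_real) measurable
  fix t
  have "(\<lambda>n. \<integral>\<omega>. iexp (t * Y n \<omega>) \<partial>M) \<longlonglongrightarrow> (\<integral>\<omega>. iexp (t * Z \<omega>) \<partial>M)"
    by (rule integral_dominated_convergence[where w = "\<lambda>_. 1"])
       (auto intro!: AE_I2 tendsto_intros lim)
  moreover have "(\<lambda>n. \<integral>\<omega>. iexp (t * Y n \<omega>) \<partial>M) \<longlonglongrightarrow> complex_of_real (exp (- ((t * r)\<^sup>2) / 2))"
    unfolding gaussian_with_std_char[OF gauss] by (auto intro!: tendsto_intros s)
  ultimately show "(\<integral>\<omega>. iexp (t * Z \<omega>) \<partial>M) = complex_of_real (exp (- ((t * r)\<^sup>2) / 2))"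
    by (rule LIMSEQ_unique)
qed

lemma gaussian_with_std_second_moment:
  assumes "gaussian_with_std M Y s"
  shows "integrable M (\<lambda>\<omega>. (Y \<omega>)\<^sup>2)" "(\<integral>\<omega>. (Y \<omega>)\<^sup>2 \<partial>M) = s\<^sup>2"
proof -
  note m = std_normal_distribution_even_moments[of 1, simplified]
  show "integrable M (\<lambda>\<omega>. (Y \<omega>)\<^sup>2)" "(\<integral>\<omega>. (Y \<omega>)\<^sup>2 \<partial>M) = s\<^sup>2"
    using gaussian_with_std_integral[OF assms, of "\<lambda>y. y\<^sup>2"] m by (simp_all add: power_mult_distrib)
qed

lemma gaussian_with_std_even_moment:
  assumes "gaussian_with_std M Y s"
  shows "integrable M (\<lambda>\<omega>. (Y \<omega>) ^ (2 * n))"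
    "(\<integral>\<omega>. (Y \<omega>) ^ (2 * n) \<partial>M) = s ^ (2 * n) * (fact (2 * n) / (2 ^ n * fact n))"
  using gaussian_with_std_integral[OF assms, of "\<lambda>y. y ^ (2 * n)"] std_normal_distribution_even_moments[of n]
  by (simp_all add: power_mult_distrib)

end

lemma std_normal_cos:
  "integrable std_normal (\<lambda>x. cos (t * (s * x)))"
  "(\<integral>x. cos (t * (s * x)) \<partial>std_normal) = exp (- (t\<^sup>2) * s\<^sup>2 / 2)"
proof -
  interpret N: prob_space std_normal by (rule prob_space_std_normal)
  show "integrable std_normal (\<lambda>x. cos (t * (s * x)))"
    by (rule N.integrable_const_bound[of _ 1]) auto
  have i: "integrable std_normal (\<lambda>x. iexp ((t * s) * x))" by (rule N.integrable_iexp) auto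
  have "complex_of_real (exp (- ((t * s)\<^sup>2) / 2)) = (\<integral>x. iexp ((t * s) * x) \<partial>std_normal)"
    using fun_cong[OF char_std_normal_distribution, of "t * s", symmetric] by (simp only: char_def)
  then have "exp (- ((t * s)\<^sup>2) / 2) = Re (\<integral>x. iexp ((t * s) * x) \<partial>std_normal)"
    by (metis Re_complex_of_real)
  also have "\<dots> = (\<integral>x. Re (iexp ((t * s) * x)) \<partial>std_normal)" by (rule integral_Re[OF i, symmetric])
  also have "\<dots> = (\<integral>x. cos (t * (s * x)) \<partial>std_normal)"
    by (intro Bochner_Integration.integral_cong HOL.refl) (simp add: Re_exp mult.assoc)
  finally show "(\<integral>x. cos (t * (s * x)) \<partial>std_normal) = exp (- (t\<^sup>2) * s\<^sup>2 / 2)"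
    by (simp add: power_mult_distrib)
qed

lemma std_normal_exp:
  "integrable std_normal (\<lambda>x. exp (s * x))"
  "(\<integral>x. exp (s * x) \<partial>std_normal) = exp (s\<^sup>2 / 2)"
proof -
  have eq: "std_normal_density x * exp (s * x) = exp (s\<^sup>2 / 2) * normal_density s 1 x" for x
    unfolding normal_density_def by (simp add: power2_eq_square field_simps flip: exp_add)
  have "integrable lborel (\<lambda>x. exp (s\<^sup>2 / 2) * normal_density s 1 x)" by simp
  then show "integrable std_normal (\<lambda>x. exp (s * x))"
    by (subst integrable_density) (auto simp: eq)
  show "(\<integral>x. exp (s * x) \<partial>std_normal) = exp (s\<^sup>2 / 2)"
    by (subst integral_density) (auto simp: eq)
qed

lemma std_normal_cosh:
  "integrable std_normal (\<lambda>x. cosh (s * x))"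
  "(\<integral>x. cosh (s * x) \<partial>std_normal) = exp (s\<^sup>2 / 2)"
  using std_normal_exp[of s] std_normal_exp[of "- s"] by (simp_all add: cosh_def)

section \<open>Riemann sums\<close>

text \<open>Stated through the oscillation at the scale of the mesh, so that it can be applied
  uniformly in a parameter for double sums.\<close>

lemma riemann_sum_error:
  fixes f :: "real \<Rightarrow> real" and n :: nat
  assumes cont: "continuous_on {a..b} f" and ab: "a \<le> b" and n: "0 < n"
    and osc: "\<And>x y. x \<in> {a..b} \<Longrightarrow> y \<in> {a..b} \<Longrightarrow> \<bar>x - y\<bar> \<le> (b - a) / n \<Longrightarrow> \<bar>f x - f y\<bar> \<le> e"
  shows "\<bar>(b - a) / n * (\<Sum>i<n. f (a + (b - a) / n * i)) - integral {a..b} f\<bar> \<le> e * (b - a)"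
proof -
  define h where "h = (b - a) / n"
  define x where "x i = a + h * real i" for i :: nat
  have h: "0 \<le> h" using ab by (simp add: h_def)
  have xn: "x n = b" and x0: "x 0 = a" using n by (auto simp: x_def h_def)
  have step: "x (Suc i) = x i + h" for i by (simp add: x_def algebra_simps)
  have mono: "x i \<le> x j" if "i \<le> j" for i j using that h by (simp add: x_def mult_left_mono)
  have x_in: "x i \<in> {a..b}" if "i \<le> n" for i using mono[of 0 i] mono[of i n] that x0 xn by auto
  have int: "f integrable_on {a..b}" using cont by (rule integrable_continuous_real)
  have "integral {a..b} f = (\<Sum>i<n. integral {a..x (Suc i)} f - integral {a..x i} f)"
    by (subst sum_lessThan_telescope[of "\<lambda>i. integral {a..x i} f"]) (simp add: x0 xn)
  also have "\<dots> = (\<Sum>i<n. integral {x i..x (Suc i)} f)"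
  proof (intro sum.cong HOL.refl)
    fix i assume "i \<in> {..<n}"
    then have i: "i \<le> n" "Suc i \<le> n" by auto
    show "integral {a..x (Suc i)} f - integral {a..x i} f = integral {x i..x (Suc i)} f"
      using x_in[OF i(1)] x_in[OF i(2)] mono[of i "Suc i"] by (intro integral_increment[OF int]) auto
  qed
  finally have split: "integral {a..b} f = (\<Sum>i<n. integral {x i..x (Suc i)} f)" .
  have e0: "0 \<le> e" using osc[of a a] ab by simp
  have cell: "\<bar>h * f (x i) - integral {x i..x (Suc i)} f\<bar> \<le> e * h" if i: "i < n" for i
  proof -
    have sub: "{x i..x (Suc i)} \<subseteq> {a..b}" using x_in[of i] x_in[of "Suc i"] i by auto
    have "f integrable_on {x i..x (Suc i)}" using int sub by (rule integrable_on_subinterval)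
    moreover have "((\<lambda>_. f (x i)) has_integral f (x i) * h) {x i..x (Suc i)}"
      using has_integral_const_real[of "f (x i)" "x i" "x (Suc i)"] h by (simp add: step mult.commute)
    ultimately have "((\<lambda>t. f (x i) - f t) has_integral f (x i) * h - integral {x i..x (Suc i)} f) {x i..x (Suc i)}"
      by (intro has_integral_diff integrable_integral)
    then have "norm (f (x i) * h - integral {x i..x (Suc i)} f) \<le> e * Henstock_Kurzweil_Integration.content {x i..x (Suc i)}"
    proof (rule has_integral_bound_real[OF e0 finite.emptyI])
      fix t assume t: "t \<in> {x i..x (Suc i)} - {}"
      then show "norm (f (x i) - f t) \<le> e"
        using sub x_in[of i] i h step[of i] unfolding real_norm_def by (intro osc) (auto simp: h_def[symmetric])
    qed
    then show ?thesis using h by (simp add: step mult.commute)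
  qed
  have "\<bar>h * (\<Sum>i<n. f (x i)) - integral {a..b} f\<bar> = \<bar>\<Sum>i<n. h * f (x i) - integral {x i..x (Suc i)} f\<bar>"
    unfolding split by (simp add: sum_distrib_left sum_subtractf)
  also have "\<dots> \<le> (\<Sum>i<n. \<bar>h * f (x i) - integral {x i..x (Suc i)} f\<bar>)" by (rule sum_abs)
  also have "\<dots> \<le> (\<Sum>i<n. e * h)" by (intro sum_mono cell) simp
  also have "\<dots> = e * (b - a)" using n by (simp add: h_def)
  finally show ?thesis by (simp add: h_def x_def)
qed

lemma riemann_sum_tendsto:
  fixes f :: "real \<Rightarrow> real"
  assumes cont: "continuous_on {a..b} f" and ab: "a \<le> b"
  shows "(\<lambda>n. (b - a) / real n * (\<Sum>i<n. f (a + (b - a) / real n * real i))) \<longlonglongrightarrow> integral {a..b} f"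
proof (rule LIMSEQ_I)
  fix r :: real assume r: "0 < r"
  define e where "e = r / (2 * (b - a + 1))"
  have e: "0 < e" using r ab by (simp add: e_def)
  obtain d where d: "d > 0" "\<And>u v. u \<in> {a..b} \<Longrightarrow> v \<in> {a..b} \<Longrightarrow> dist v u < d \<Longrightarrow> dist (f v) (f u) < e"
    using compact_uniformly_continuous[OF cont compact_Icc,
        unfolded uniformly_continuous_on_def, rule_format, OF e] by blast
  have "\<forall>\<^sub>F n in sequentially. 0 < n \<and> (b - a) / real n < d"
    by (intro eventually_conj eventually_gt_at_top order_tendstoD(2)[OF lim_const_over_n] d(1))
  then obtain N where N: "\<And>n. n \<ge> N \<Longrightarrow> 0 < n \<and> (b - a) / real n < d"
    by (auto simp: eventually_sequentially)
  show "\<exists>no. \<forall>n\<ge>no. norm ((b - a) / real n * (\<Sum>i<n. f (a + (b - a) / real n * real i)) - integral {a..b} f) < r"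
  proof (intro exI[of _ N] allI impI)
    fix n assume "N \<le> n"
    note n = N[OF this]
    have "\<bar>(b - a) / real n * (\<Sum>i<n. f (a + (b - a) / real n * real i)) - integral {a..b} f\<bar> \<le> e * (b - a)"
    proof (rule riemann_sum_error[OF cont ab])
      fix x y assume "x \<in> {a..b}" "y \<in> {a..b}" "\<bar>x - y\<bar> \<le> (b - a) / real n"
      then show "\<bar>f x - f y\<bar> \<le> e" using d(2)[of y x] n by (auto simp: dist_real_def)
    qed (use n in auto)
    also have "\<dots> < r"
    proof -
      have "e * (b - a) \<le> e * (b - a + 1)" using e by (intro mult_left_mono) auto
      also have "\<dots> = r / 2" using ab by (simp add: e_def field_simps)
      finally show ?thesis using r by simp
    qed
    finally show "norm ((b - a) / real n * (\<Sum>i<n. f (a + (b - a) / real n * real i)) - integral {a..b} f) < r" by simp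
  qed
qed

text \<open>Uniform continuity on the square makes the error \<open>E n\<close> of the inner sums
  small uniformly in the outer variable; what remains is a Riemann sum of the continuous inner
  integral. The sum has the shape of the variance of a Riemann sum of a Gaussian path.\<close>

lemma double_riemann_sum_tendsto:
  fixes G :: "real \<Rightarrow> real \<Rightarrow> real"
  assumes cont: "continuous_on UNIV (\<lambda>(p, q). G p q)" and ab: "a \<le> b"
  shows "(\<lambda>n. ((b - a) / real n)\<^sup>2 * (\<Sum>i<n. \<Sum>j<n. G (a + (b - a) / real n * real i) (a + (b - a) / real n * real j)))
    \<longlonglongrightarrow> integral {a..b} (\<lambda>p. integral {a..b} (G p))"
proof -
  define x where "x n i = a + (b - a) / real n * real i" for n i :: nat
  define E where "E n = (b - a) / real n * (\<Sum>i<n. (b - a) / real n * (\<Sum>j<n. G (x n i) (x n j)) - integral {a..b} (G (x n i)))" for n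
  have cont_G: "continuous_on {a..b} (G p)" for p
    by (rule continuous_on_compose2[OF cont, of _ "\<lambda>q. (p, q)", simplified]) (auto intro!: continuous_intros)
  have "E \<longlonglongrightarrow> 0"
  proof (rule LIMSEQ_I)
    fix r :: real assume r: "0 < r"
    define e where "e = r / (2 * ((b - a) * (b - a) + 1))"
    have den: "(b - a) * (b - a) + 1 > 0" by (simp add: add_nonneg_pos)
    have e: "0 < e" using r den by (simp add: e_def)
    have uc: "uniformly_continuous_on ({a..b} \<times> {a..b}) (\<lambda>(p, q). G p q)"
      by (intro compact_uniformly_continuous continuous_on_subset[OF cont] compact_Times compact_Icc) auto
    obtain d where d: "d > 0" "\<And>u v. u \<in> {a..b} \<times> {a..b} \<Longrightarrow> v \<in> {a..b} \<times> {a..b} \<Longrightarrow> dist v u < d \<Longrightarrow>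
        dist ((\<lambda>(p, q). G p q) v) ((\<lambda>(p, q). G p q) u) < e"
      using uc[unfolded uniformly_continuous_on_def, rule_format, OF e] by blast
    have "\<forall>\<^sub>F n in sequentially. 0 < n \<and> (b - a) / real n < d"
      by (intro eventually_conj eventually_gt_at_top order_tendstoD(2)[OF lim_const_over_n] d(1))
    then obtain N where N: "\<And>n. n \<ge> N \<Longrightarrow> 0 < n \<and> (b - a) / real n < d"
      by (auto simp: eventually_sequentially)
    show "\<exists>no. \<forall>n\<ge>no. norm (E n - 0) < r"
    proof (intro exI[of _ N] allI impI)
      fix n assume "N \<le> n"
      note n = N[OF this]
      have x_in: "x n i \<in> {a..b}" if "i < n" for i
      proof -
        have "real i / real n \<le> 1" using that by simp
        then have "(b - a) * (real i / real n) \<le> (b - a) * 1" using ab by (intro mult_left_mono) auto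
        then show ?thesis using ab by (simp add: x_def)
      qed
      have inner: "\<bar>(b - a) / real n * (\<Sum>j<n. G (x n i) (x n j)) - integral {a..b} (G (x n i))\<bar> \<le> e * (b - a)" if "i < n" for i
        unfolding x_def[of n "_::nat"]
      proof (rule riemann_sum_error[OF cont_G ab])
        fix y z assume yz: "y \<in> {a..b}" "z \<in> {a..b}" "\<bar>y - z\<bar> \<le> (b - a) / real n"
        have "dist (x n i, y) (x n i, z) < d" using yz n by (simp add: dist_Pair_Pair dist_real_def)
        then show "\<bar>G (a + (b - a) / real n * real i) y - G (a + (b - a) / real n * real i) z\<bar> \<le> e"
          using d(2)[of "(x n i, z)" "(x n i, y)"] yz x_in[OF that] by (simp add: dist_real_def x_def)
      qed (use n in auto)
      have "\<bar>E n\<bar> \<le> (b - a) / real n * (\<Sum>i<n. \<bar>(b - a) / real n * (\<Sum>j<n. G (x n i) (x n j)) - integral {a..b} (G (x n i))\<bar>)"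
      proof -
        have h0: "0 \<le> (b - a) / real n" using ab by simp
        show ?thesis unfolding E_def abs_mult abs_of_nonneg[OF h0] by (intro mult_left_mono sum_abs h0)
      qed
      also have "\<dots> \<le> (b - a) / real n * (\<Sum>i<n. e * (b - a))"
        using ab inner by (intro mult_left_mono sum_mono) auto
      also have "\<dots> = e * ((b - a) * (b - a))" using n by simp
      also have "\<dots> \<le> e * ((b - a) * (b - a) + 1)" using e by (intro mult_left_mono) auto
      also have "\<dots> = r / 2" using den by (simp add: e_def field_simps)
      finally show "norm (E n - 0) < r" using r by simp
    qed
  qed
  moreover have "(\<lambda>n. (b - a) / real n * (\<Sum>i<n. integral {a..b} (G (x n i)))) \<longlonglongrightarrow> integral {a..b} (\<lambda>p. integral {a..b} (G p))"
    unfolding x_def by (rule riemann_sum_tendsto[OF continuous_on_integral_param[OF cont] ab])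
  ultimately have "(\<lambda>n. E n + (b - a) / real n * (\<Sum>i<n. integral {a..b} (G (x n i)))) \<longlonglongrightarrow> 0 + integral {a..b} (\<lambda>p. integral {a..b} (G p))"
    by (rule tendsto_add)
  moreover have "E n + (b - a) / real n * (\<Sum>i<n. integral {a..b} (G (x n i))) =
      ((b - a) / real n)\<^sup>2 * (\<Sum>i<n. \<Sum>j<n. G (x n i) (x n j))" for n
  proof -
    have "E n = (b - a) / real n * ((b - a) / real n * (\<Sum>i<n. \<Sum>j<n. G (x n i) (x n j)) - (\<Sum>i<n. integral {a..b} (G (x n i))))"
      unfolding E_def sum_subtractf by (simp only: sum_distrib_left[symmetric])
    then show ?thesis by (simp only: power2_eq_square right_diff_distrib diff_add_cancel mult.assoc)
  qed
  ultimately show ?thesis by (simp add: x_def)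
qed

section \<open>Fractional Brownian motion with continuous paths\<close>

definition fbm_cov :: "real \<Rightarrow> real \<Rightarrow> real \<Rightarrow> real" where
  "fbm_cov H s t = 1 / 2 * v2_sq H * (\<bar>s\<bar> powr (2 * H) + \<bar>t\<bar> powr (2 * H) - \<bar>s - t\<bar> powr (2 * H))"

text \<open>Every path is continuous, not just almost every one, so time integrals are limits of
  Riemann sums at each point of the space. A general fractional Brownian motion is brought into this
  form by a change on a null set.\<close>

locale continuous_fbm = prob_space M for M :: "'a measure" +
  fixes H :: real and b :: "real \<Rightarrow> 'a \<Rightarrow> real"
  assumes H: "1 / 2 < H" "H < 1"
    and paths: "\<And>\<omega>. continuous_on UNIV (\<lambda>t. b t \<omega>)"
    and gauss: "\<And>T a. finite T \<Longrightarrow> gaussian_with_std M (\<lambda>\<omega>. \<Sum>t\<in>T. a t * b t \<omega>)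
      (sqrt (\<Sum>s\<in>T. \<Sum>t\<in>T. a s * a t * fbm_cov H s t))"
begin

text \<open>The times \<open>\<tau> i\<close> may coincide, as they do for overlapping windows;
  coefficients belonging to one time are merged before the locale assumption is applied.\<close>

lemma gauss_family:
  assumes I: "finite I"
  shows "gaussian_with_std M (\<lambda>\<omega>. \<Sum>i\<in>I. c i * b (\<tau> i) \<omega>)
      (sqrt (\<Sum>i\<in>I. \<Sum>j\<in>I. c i * c j * fbm_cov H (\<tau> i) (\<tau> j)))"
proof -
  define a where "a s = (\<Sum>i\<in>{i \<in> I. \<tau> i = s}. c i)" for s
  have gather: "(\<Sum>s\<in>\<tau> ` I. a s * f s) = (\<Sum>i\<in>I. c i * f (\<tau> i))" for f
  proof -
    have "(\<Sum>s\<in>\<tau> ` I. a s * f s) = (\<Sum>s\<in>\<tau> ` I. \<Sum>i\<in>{i \<in> I. \<tau> i = s}. c i * f (\<tau> i))"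
      by (intro sum.cong HOL.refl) (simp add: a_def sum_distrib_right)
    also have "\<dots> = (\<Sum>i\<in>I. c i * f (\<tau> i))" by (rule sum.image_gen[OF I, symmetric])
    finally show ?thesis .
  qed
  have "(\<Sum>s\<in>\<tau> ` I. \<Sum>t\<in>\<tau> ` I. a s * a t * fbm_cov H s t) =
      (\<Sum>s\<in>\<tau> ` I. a s * (\<Sum>t\<in>\<tau> ` I. a t * fbm_cov H s t))"
    by (simp add: sum_distrib_left mult.assoc)
  also have "\<dots> = (\<Sum>i\<in>I. c i * (\<Sum>j\<in>I. c j * fbm_cov H (\<tau> i) (\<tau> j)))" by (simp only: gather)
  also have "\<dots> = (\<Sum>i\<in>I. \<Sum>j\<in>I. c i * c j * fbm_cov H (\<tau> i) (\<tau> j))"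
    by (simp add: sum_distrib_left mult.assoc)
  finally show ?thesis using gauss[of "\<tau> ` I" a] I by (simp add: gather)
qed

lemma measurable_b [measurable]: "b t \<in> borel_measurable M"
  using gaussian_with_std_measurable[OF gauss_family[of "{()}" "\<lambda>_. 1" "\<lambda>_. t"]] by simp

lemma fbm_cov_continuous: "continuous_on UNIV (\<lambda>(s, t). fbm_cov H s t)"
  unfolding fbm_cov_def split_beta using H by (intro continuous_intros continuous_on_powr') auto

text \<open>Riemann sums of a path are linear combinations of its values, and Gaussian laws are closed
  under pointwise limits.\<close>

lemma gauss_integral_pair:
  fixes \<alpha> \<beta> u u' \<epsilon> :: real
  assumes w: "continuous_on UNIV w"
  defines "G \<equiv> \<lambda>p q. w p * w q * (\<alpha>\<^sup>2 * fbm_cov H (u - \<epsilon> * p) (u - \<epsilon> * q)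
      + \<alpha> * \<beta> * fbm_cov H (u - \<epsilon> * p) (u' - \<epsilon> * q) + \<beta> * \<alpha> * fbm_cov H (u' - \<epsilon> * p) (u - \<epsilon> * q)
      + \<beta>\<^sup>2 * fbm_cov H (u' - \<epsilon> * p) (u' - \<epsilon> * q))"
  shows "gaussian_with_std M
    (\<lambda>\<omega>. integral {-1..1} (\<lambda>v. w v * (\<alpha> * b (u - \<epsilon> * v) \<omega> + \<beta> * b (u' - \<epsilon> * v) \<omega>)))
    (sqrt (integral {-1..1} (\<lambda>p. integral {-1..1} (G p))))"
proof (rule gaussian_with_std_limit)
  note [continuous_intros] = continuous_on_compose2[OF w] continuous_on_compose2[OF paths]
  define x :: "nat \<Rightarrow> nat \<Rightarrow> real" where "x n i = -1 + (1 - -1) / real n * real i" for n i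
  define h where "h n = (1 - -1) / real n" for n
  \<comment> \<open>The Boolean in the index selects the centre \<open>u\<close> or
    \<open>u'\<close>, so that a Riemann sum for the pair is a single linear combination of values
    of the process.\<close>
  define c where "c n = (\<lambda>(i, k). h n * w (x n i) * (if k then \<alpha> else \<beta>))" for n
  define \<tau> where "\<tau> n = (\<lambda>(i, k). (if k then u else u') - \<epsilon> * x n i)" for n
  define V where "V n = (h n)\<^sup>2 * (\<Sum>i<n. \<Sum>j<n. G (x n i) (x n j))" for n
  have sumI: "(\<Sum>(i, k)\<in>{..<n} \<times> (UNIV :: bool set). f i k) = (\<Sum>i<n. f i True + f i False)" for n :: nat and f :: "nat \<Rightarrow> bool \<Rightarrow> real"
    by (subst sum.cartesian_product[symmetric]) (simp add: UNIV_bool add.commute)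
  show "gaussian_with_std M (\<lambda>\<omega>. h n * (\<Sum>i<n. w (x n i) * (\<alpha> * b (u - \<epsilon> * x n i) \<omega> + \<beta> * b (u' - \<epsilon> * x n i) \<omega>))) (sqrt (V n))" for n
  proof -
    have "(\<Sum>i\<in>{..<n} \<times> UNIV. c n i * b (\<tau> n i) \<omega>) =
        h n * (\<Sum>i<n. w (x n i) * (\<alpha> * b (u - \<epsilon> * x n i) \<omega> + \<beta> * b (u' - \<epsilon> * x n i) \<omega>))" for \<omega>
    proof -
      have "(\<Sum>i\<in>{..<n} \<times> UNIV. c n i * b (\<tau> n i) \<omega>) = (\<Sum>(i, k)\<in>{..<n} \<times> UNIV. c n (i, k) * b (\<tau> n (i, k)) \<omega>)"
        by (simp add: split_beta)
      also have "\<dots> = (\<Sum>i<n. c n (i, True) * b (\<tau> n (i, True)) \<omega> + c n (i, False) * b (\<tau> n (i, False)) \<omega>)"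
        by (rule sumI)
      finally show ?thesis by (simp add: c_def \<tau>_def sum_distrib_left algebra_simps)
    qed
    moreover have "(\<Sum>i\<in>{..<n} \<times> UNIV. \<Sum>j\<in>{..<n} \<times> UNIV. c n i * c n j * fbm_cov H (\<tau> n i) (\<tau> n j)) = V n"
    proof -
      define C where "C i k j l = c n (i, k) * c n (j, l) * fbm_cov H (\<tau> n (i, k)) (\<tau> n (j, l))" for i k j l
      have "(\<Sum>i\<in>{..<n} \<times> UNIV. \<Sum>j\<in>{..<n} \<times> UNIV. c n i * c n j * fbm_cov H (\<tau> n i) (\<tau> n j)) =
          (\<Sum>(i, k)\<in>{..<n} \<times> UNIV. \<Sum>(j, l)\<in>{..<n} \<times> UNIV. C i k j l)"
        by (simp add: split_beta C_def)
      also have "\<dots> = (\<Sum>i<n. \<Sum>j<n. C i True j True + C i True j False + C i False j True + C i False j False)"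
        unfolding sumI by (simp add: sum.distrib)
      also have "\<dots> = (\<Sum>i<n. \<Sum>j<n. (h n)\<^sup>2 * G (x n i) (x n j))"
        by (intro sum.cong HOL.refl) (simp add: C_def c_def \<tau>_def G_def power2_eq_square algebra_simps)
      finally show ?thesis by (simp add: V_def sum_distrib_left)
    qed
    ultimately show ?thesis
      using gauss_family[of "{..<n} \<times> (UNIV :: bool set)" "c n" "\<tau> n"] by simp
  qed
  show "(\<lambda>n. h n * (\<Sum>i<n. w (x n i) * (\<alpha> * b (u - \<epsilon> * x n i) \<omega> + \<beta> * b (u' - \<epsilon> * x n i) \<omega>))) \<longlonglongrightarrow>
      integral {-1..1} (\<lambda>v. w v * (\<alpha> * b (u - \<epsilon> * v) \<omega> + \<beta> * b (u' - \<epsilon> * v) \<omega>))" for \<omega>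
    unfolding h_def x_def by (rule riemann_sum_tendsto) (auto intro!: continuous_intros)
  have "V \<longlonglongrightarrow> integral {-1..1} (\<lambda>p. integral {-1..1} (G p))"
    unfolding V_def h_def x_def
  proof (rule double_riemann_sum_tendsto)
    note [continuous_intros] = continuous_on_compose2[OF fbm_cov_continuous, where f = "\<lambda>x. (f x, g x)" for f g, simplified]
    show "continuous_on UNIV (\<lambda>(p, q). G p q)"
      unfolding G_def split_beta by (intro continuous_intros) auto
  qed simp
  then show "(\<lambda>n. sqrt (V n)) \<longlonglongrightarrow> sqrt (integral {-1..1} (\<lambda>p. integral {-1..1} (G p)))"
    by (rule tendsto_real_sqrt)
qed

end

text \<open>Exchanging \<open>p\<close> and \<open>q\<close> reverses the sign of the lag.\<close>

lemma kernel_cov_minus: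
  assumes \<psi>: "continuous_on UNIV \<psi>" and H: "0 < H"
  shows "kernel_cov H \<psi> (- s) = kernel_cov H \<psi> s"
proof -
  note [continuous_intros] = continuous_on_compose2[OF \<psi>]
  have "continuous_on (cbox (-1, -1) (1, 1)) (\<lambda>(p, q). \<psi> p * \<psi> q * \<bar>- s - (p - q)\<bar> powr (2 * H))"
    unfolding split_beta using H by (intro continuous_intros continuous_on_powr') auto
  from integral_swap_continuous[OF this]
  have "integral {-1..1} (\<lambda>p. integral {-1..1} (\<lambda>q. \<psi> p * \<psi> q * \<bar>- s - (p - q)\<bar> powr (2 * H))) =
      integral {-1..1} (\<lambda>q. integral {-1..1} (\<lambda>p. \<psi> p * \<psi> q * \<bar>- s - (p - q)\<bar> powr (2 * H)))" by simp
  also have "\<dots> = integral {-1..1} (\<lambda>q. integral {-1..1} (\<lambda>p. \<psi> q * \<psi> p * \<bar>s - (q - p)\<bar> powr (2 * H)))"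
  proof -
    have "\<bar>- s - (p - q)\<bar> = \<bar>s - (q - p)\<bar>" for p q by linarith
    then show ?thesis by (simp add: mult.commute)
  qed
  finally show ?thesis by (simp add: kernel_cov_def)
qed

text \<open>The terms of the covariance depending on one time only vanish against the mean-zero
  kernel in the other variable. The increment term is homogeneous of degree \<open>2 * H\<close> and
  depends on \<open>u - u'\<close> alone: this is self-similarity together with stationarity of the
  increments.\<close>

lemma integral_kernel_fbm_cov:
  assumes \<psi>: "continuous_on UNIV \<psi>" and mean: "integral {-1..1} \<psi> = 0" and H: "0 < H" and \<epsilon>: "0 < \<epsilon>"
  shows "integral {-1..1} (\<lambda>p. integral {-1..1} (\<lambda>q. \<psi> p * \<psi> q * fbm_cov H (u - \<epsilon> * p) (u' - \<epsilon> * q)))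
    = \<epsilon> powr (2 * H) * kernel_cov H \<psi> ((u - u') / \<epsilon>)"
proof -
  note [continuous_intros] = continuous_on_compose2[OF \<psi>]
  define v where "v = 1 / 2 * v2_sq H"
  define s where "s = (u - u') / \<epsilon>"
  have s: "\<bar>u - \<epsilon> * p - (u' - \<epsilon> * q)\<bar> powr (2 * H) = \<epsilon> powr (2 * H) * \<bar>s - (p - q)\<bar> powr (2 * H)" for p q
  proof -
    have "u - \<epsilon> * p - (u' - \<epsilon> * q) = \<epsilon> * (s - (p - q))" using \<epsilon> by (simp add: s_def field_simps)
    then show ?thesis using \<epsilon> by (simp add: abs_mult powr_mult)
  qed
  have mean': "(\<psi> has_integral 0) {-1..1}"
    using mean integrable_continuous_real[OF continuous_on_subset[OF \<psi>, of "{-1..1}"]] by (metis integrable_integral top_greatest)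
  define g where "g y q = \<psi> q * \<bar>y - \<epsilon> * q\<bar> powr (2 * H)" for y q
  define k where "k p q = \<psi> p * \<psi> q * \<bar>s - (p - q)\<bar> powr (2 * H)" for p q
  have k_cont: "continuous_on UNIV (\<lambda>(p, q). k p q)"
    unfolding k_def split_beta using H by (intro continuous_intros continuous_on_powr') auto
  have k_q: "(k p has_integral integral {-1..1} (k p)) {-1..1}" for p
    unfolding k_def using H by (intro integrable_integral integrable_continuous_real continuous_intros continuous_on_powr') auto
  have k_p: "((\<lambda>p. integral {-1..1} (k p)) has_integral integral {-1..1} (\<lambda>p. integral {-1..1} (k p))) {-1..1}"
    by (intro integrable_integral integrable_continuous_real continuous_on_integral_param[OF k_cont])
  have g_q: "(g y has_integral integral {-1..1} (g y)) {-1..1}" for y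
    unfolding g_def using H by (intro integrable_integral integrable_continuous_real continuous_intros continuous_on_powr') auto
  have inner: "integral {-1..1} (\<lambda>q. \<psi> p * \<psi> q * fbm_cov H (u - \<epsilon> * p) (u' - \<epsilon> * q)) =
      (v * integral {-1..1} (g u')) * \<psi> p - v * \<epsilon> powr (2 * H) * integral {-1..1} (k p)" for p
  proof -
    have "((\<lambda>q. v * \<psi> p * \<bar>u - \<epsilon> * p\<bar> powr (2 * H) * \<psi> q + v * \<psi> p * g u' q - v * \<epsilon> powr (2 * H) * k p q) has_integral
        (v * \<psi> p * \<bar>u - \<epsilon> * p\<bar> powr (2 * H) * 0 + v * \<psi> p * integral {-1..1} (g u') - v * \<epsilon> powr (2 * H) * integral {-1..1} (k p))) {-1..1}"
      by (intro has_integral_diff has_integral_add has_integral_mult_right mean' g_q k_q)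
    moreover have "(\<lambda>q. v * \<psi> p * \<bar>u - \<epsilon> * p\<bar> powr (2 * H) * \<psi> q + v * \<psi> p * g u' q - v * \<epsilon> powr (2 * H) * k p q) =
        (\<lambda>q. \<psi> p * \<psi> q * fbm_cov H (u - \<epsilon> * p) (u' - \<epsilon> * q))"
      unfolding fbm_cov_def s v_def[symmetric] by (auto simp: g_def k_def algebra_simps)
    ultimately show ?thesis by (simp add: integral_unique algebra_simps)
  qed
  have "((\<lambda>p. (v * integral {-1..1} (g u')) * \<psi> p - v * \<epsilon> powr (2 * H) * integral {-1..1} (k p)) has_integral
      ((v * integral {-1..1} (g u')) * 0 - v * \<epsilon> powr (2 * H) * integral {-1..1} (\<lambda>p. integral {-1..1} (k p)))) {-1..1}"
    by (intro has_integral_diff has_integral_mult_right mean' k_p)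
  then show ?thesis unfolding inner
    by (simp add: integral_unique kernel_cov_def k_def[symmetric] v_def s_def[symmetric])
qed

section \<open>The smoothed process\<close>

lemma double_integral_add:
  fixes f g :: "real \<Rightarrow> real \<Rightarrow> real"
  assumes f: "continuous_on UNIV (\<lambda>(p, q). f p q)" and g: "continuous_on UNIV (\<lambda>(p, q). g p q)"
  shows "integral {a..b} (\<lambda>p. integral {a..b} (\<lambda>q. f p q + g p q)) =
    integral {a..b} (\<lambda>p. integral {a..b} (f p)) + integral {a..b} (\<lambda>p. integral {a..b} (g p))"
proof -
  have sec: "continuous_on {a..b} (h p)" if "continuous_on UNIV (\<lambda>(p, q). h p q)" for h :: "real \<Rightarrow> real \<Rightarrow> real" and p
    by (rule continuous_on_compose2[OF that, of _ "\<lambda>q. (p, q)", simplified]) (auto intro!: continuous_intros)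
  have "integral {a..b} (\<lambda>q. f p q + g p q) = integral {a..b} (f p) + integral {a..b} (g p)" for p
    by (rule Henstock_Kurzweil_Integration.integral_add) (auto intro!: integrable_continuous_real sec f g)
  then show ?thesis
    by (simp add: Henstock_Kurzweil_Integration.integral_add integrable_continuous_real
        continuous_on_integral_param[OF f] continuous_on_integral_param[OF g])
qed

lemma abs_exp_minus_one_le: "\<bar>exp x - 1\<bar> \<le> \<bar>x\<bar> * exp \<bar>x\<bar>" for x :: real
proof (cases "x \<ge> 0")
  case True
  have "1 - x \<le> exp (- x)" using exp_ge_add_one_self[of "- x"] by simp
  then have "exp x * (1 - x) \<le> exp x * exp (- x)" by (rule mult_left_mono) simp
  also have "exp x * exp (- x) = 1" by (simp flip: exp_add)
  finally show ?thesis using True by (simp add: algebra_simps)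
next
  case False
  have "1 - exp x \<le> - x" using exp_ge_add_one_self[of x] by linarith
  also have "\<dots> \<le> - x * exp (- x)" using False mult_left_mono[of 1 "exp (- x)" "- x"] by simp
  finally show ?thesis using False by simp
qed

locale smoothed_fbm = continuous_fbm M H b for M :: "'a measure" and H b +
  fixes \<phi> :: "real \<Rightarrow> real"
  assumes \<phi>: "smoothing_kernel \<phi>"
begin

abbreviation "\<psi> \<equiv> deriv (deriv \<phi>)"

lemmas \<psi>_cont = smoothing_kernelD(5)[OF \<phi>]

definition \<rho> :: "real \<Rightarrow> real" where "\<rho> s = kernel_cov H \<psi> s / (sigma2 \<phi> H)\<^sup>2"

text \<open>The second derivative of the smoothed driver times
  \<open>\<epsilon> powr (2 - H)\<close>, divided by the spectral constant; two powers of \<epsilon>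
  already cancel against those from differentiating the kernel.\<close>

definition \<zeta> :: "real \<Rightarrow> real \<Rightarrow> 'a \<Rightarrow> real" where
  "\<zeta> \<epsilon> u \<omega> = \<epsilon> powr (- H) / sigma2 \<phi> H * integral {-1..1} (\<lambda>v. \<psi> v * b (u - \<epsilon> * v) \<omega>)"

lemma sigma2_pos': "0 < sigma2 \<phi> H" and sigma2_eq': "(sigma2 \<phi> H)\<^sup>2 = kernel_cov H \<psi> 0"
  using sigma2_pos[OF \<phi>] sigma2_eq_kernel_cov[OF \<phi>] H by auto

text \<open>Knowing the law of every linear combination of two values is all that the covariance
  computations below ask for; no joint density appears.\<close>

lemma \<zeta>_pair:
  assumes \<epsilon>: "0 < \<epsilon>"
  shows "gaussian_with_std M (\<lambda>\<omega>. \<alpha> * \<zeta> \<epsilon> u \<omega> + \<beta> * \<zeta> \<epsilon> u' \<omega>)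
    (sqrt (\<alpha>\<^sup>2 + \<beta>\<^sup>2 + 2 * \<alpha> * \<beta> * \<rho> ((u - u') / \<epsilon>)))"
proof -
  define c where "c = \<epsilon> powr (- H) / sigma2 \<phi> H"
  define K where "K = kernel_cov H \<psi>"
  define R where "R u u' p q = \<psi> p * \<psi> q * fbm_cov H (u - \<epsilon> * p) (u' - \<epsilon> * q)" for u u' p q
  note [continuous_intros] = continuous_on_compose2[OF \<psi>_cont] continuous_on_compose2[OF paths]
    continuous_on_compose2[OF fbm_cov_continuous, where f = "\<lambda>x. (f x, g x)" for f g, simplified]
  have R_cont: "continuous_on UNIV (\<lambda>(p, q). d * R u u' p q)" for d u u'
    unfolding R_def split_beta by (intro continuous_intros) auto
  have R: "integral {-1..1} (\<lambda>p. integral {-1..1} (R u u' p)) = \<epsilon> powr (2 * H) * K ((u - u') / \<epsilon>)" for u u'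
    using integral_kernel_fbm_cov[OF \<psi>_cont integral_deriv2_kernel[OF \<phi>] _ \<epsilon>, of H u u'] H
    unfolding R_def[abs_def] K_def by simp
  have "integral {-1..1} (\<lambda>p. integral {-1..1} (\<lambda>q. \<psi> p * \<psi> q * ((\<alpha> * c)\<^sup>2 * fbm_cov H (u - \<epsilon> * p) (u - \<epsilon> * q)
      + \<alpha> * c * (\<beta> * c) * fbm_cov H (u - \<epsilon> * p) (u' - \<epsilon> * q) + \<beta> * c * (\<alpha> * c) * fbm_cov H (u' - \<epsilon> * p) (u - \<epsilon> * q)
      + (\<beta> * c)\<^sup>2 * fbm_cov H (u' - \<epsilon> * p) (u' - \<epsilon> * q)))) =
    integral {-1..1} (\<lambda>p. integral {-1..1} (\<lambda>q. ((\<alpha> * c)\<^sup>2 * R u u p q + (\<alpha> * c * (\<beta> * c)) * R u u' p q)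
      + ((\<alpha> * c * (\<beta> * c)) * R u' u p q + (\<beta> * c)\<^sup>2 * R u' u' p q)))"
    by (simp add: R_def algebra_simps)
  also have "\<dots> = (\<alpha> * c)\<^sup>2 * (\<epsilon> powr (2 * H) * K 0) + (\<alpha> * c * (\<beta> * c)) * (\<epsilon> powr (2 * H) * K ((u - u') / \<epsilon>))
      + ((\<alpha> * c * (\<beta> * c)) * (\<epsilon> powr (2 * H) * K ((u' - u) / \<epsilon>)) + (\<beta> * c)\<^sup>2 * (\<epsilon> powr (2 * H) * K 0))"
  proof -
    have cont2: "continuous_on UNIV (\<lambda>(p, q). d * R u u' p q + d' * R w w' p q)" for d d' u u' w w'
      using continuous_on_add[OF R_cont[of d u u'] R_cont[of d' w w']] by (simp add: split_beta)
    show ?thesis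
      by (simp add: double_integral_add[OF cont2 cont2] double_integral_add[OF R_cont R_cont] R)
  qed
  also have "K ((u' - u) / \<epsilon>) = K ((u - u') / \<epsilon>)"
    using kernel_cov_minus[OF \<psi>_cont, of H "(u - u') / \<epsilon>"] H by (simp add: K_def minus_divide_left)
  also have "(\<alpha> * c)\<^sup>2 * (\<epsilon> powr (2 * H) * K 0) + (\<alpha> * c * (\<beta> * c)) * (\<epsilon> powr (2 * H) * K ((u - u') / \<epsilon>))
      + ((\<alpha> * c * (\<beta> * c)) * (\<epsilon> powr (2 * H) * K ((u - u') / \<epsilon>)) + (\<beta> * c)\<^sup>2 * (\<epsilon> powr (2 * H) * K 0))
      = (c\<^sup>2 * \<epsilon> powr (2 * H)) * (\<alpha>\<^sup>2 * K 0 + \<beta>\<^sup>2 * K 0 + 2 * \<alpha> * \<beta> * K ((u - u') / \<epsilon>))"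
    by (simp add: power2_eq_square algebra_simps)
  also have "c\<^sup>2 * \<epsilon> powr (2 * H) = 1 / (sigma2 \<phi> H)\<^sup>2"
  proof -
    have "(\<epsilon> powr (- H))\<^sup>2 * \<epsilon> powr (2 * H) = 1"
      unfolding power2_eq_square powr_add[symmetric] using \<epsilon> by simp
    then show ?thesis by (simp add: c_def power_divide)
  qed
  also have "1 / (sigma2 \<phi> H)\<^sup>2 * (\<alpha>\<^sup>2 * K 0 + \<beta>\<^sup>2 * K 0 + 2 * \<alpha> * \<beta> * K ((u - u') / \<epsilon>))
      = \<alpha>\<^sup>2 + \<beta>\<^sup>2 + 2 * \<alpha> * \<beta> * \<rho> ((u - u') / \<epsilon>)"
    using sigma2_pos' by (simp add: K_def \<rho>_def field_simps flip: sigma2_eq')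
  finally have var: "integral {-1..1} (\<lambda>p. integral {-1..1} (\<lambda>q. \<psi> p * \<psi> q * ((\<alpha> * c)\<^sup>2 * fbm_cov H (u - \<epsilon> * p) (u - \<epsilon> * q)
      + \<alpha> * c * (\<beta> * c) * fbm_cov H (u - \<epsilon> * p) (u' - \<epsilon> * q) + \<beta> * c * (\<alpha> * c) * fbm_cov H (u' - \<epsilon> * p) (u - \<epsilon> * q)
      + (\<beta> * c)\<^sup>2 * fbm_cov H (u' - \<epsilon> * p) (u' - \<epsilon> * q))))
    = \<alpha>\<^sup>2 + \<beta>\<^sup>2 + 2 * \<alpha> * \<beta> * \<rho> ((u - u') / \<epsilon>)" .
  have "integral {-1..1} (\<lambda>v. \<psi> v * (\<alpha> * c * b (u - \<epsilon> * v) \<omega> + \<beta> * c * b (u' - \<epsilon> * v) \<omega>))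
      = \<alpha> * \<zeta> \<epsilon> u \<omega> + \<beta> * \<zeta> \<epsilon> u' \<omega>" for \<omega>
  proof -
    have int: "(\<lambda>v. \<psi> v * b (y - \<epsilon> * v) \<omega>) integrable_on {-1..1}" for y
      by (intro integrable_continuous_real continuous_intros) auto
    have "((\<lambda>v. (\<alpha> * c) * (\<psi> v * b (u - \<epsilon> * v) \<omega>) + (\<beta> * c) * (\<psi> v * b (u' - \<epsilon> * v) \<omega>)) has_integral
        ((\<alpha> * c) * integral {-1..1} (\<lambda>v. \<psi> v * b (u - \<epsilon> * v) \<omega>) + (\<beta> * c) * integral {-1..1} (\<lambda>v. \<psi> v * b (u' - \<epsilon> * v) \<omega>))) {-1..1}"
      by (intro has_integral_add has_integral_mult_right integrable_integral int)
    then show ?thesis by (simp add: integral_unique \<zeta>_def c_def algebra_simps)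
  qed
  then show ?thesis
    using gauss_integral_pair[OF \<psi>_cont, of "\<alpha> * c" u \<epsilon> "\<beta> * c" u'] unfolding var by simp
qed

lemma \<zeta>_single: "0 < \<epsilon> \<Longrightarrow> gaussian_with_std M (\<zeta> \<epsilon> u) 1"
  using \<zeta>_pair[of \<epsilon> 1 u 0 u] by simp

lemma measurable_\<zeta> [measurable]: "0 < \<epsilon> \<Longrightarrow> \<zeta> \<epsilon> u \<in> borel_measurable M"
  by (rule gaussian_with_std_measurable[OF \<zeta>_single])

text \<open>Second moments of sum and difference add up to 4 by the parallelogram law. They are
  known only as squares of \<open>sqrt\<close> of expressions whose sign is still open, hence as
  \<open>\<bar>2 + 2 * \<rho> s\<bar>\<close> and \<open>\<bar>2 - 2 * \<rho> s\<bar>\<close>; these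
  add up to 4 only if \<open>\<bar>\<rho> s\<bar> \<le> 1\<close>.\<close>

lemma \<rho>_le_1: "\<bar>\<rho> s\<bar> \<le> 1"
proof -
  note p = gaussian_with_std_second_moment[OF \<zeta>_pair[of 1 1 s 1 0]]
  note m = gaussian_with_std_second_moment[OF \<zeta>_pair[of 1 1 s "-1" 0]]
  note u = gaussian_with_std_second_moment[OF \<zeta>_single[of 1 s]]
  note u' = gaussian_with_std_second_moment[OF \<zeta>_single[of 1 0]]
  have "(\<integral>\<omega>. (1 * \<zeta> 1 s \<omega> + 1 * \<zeta> 1 0 \<omega>)\<^sup>2 \<partial>M) + (\<integral>\<omega>. (1 * \<zeta> 1 s \<omega> + -1 * \<zeta> 1 0 \<omega>)\<^sup>2 \<partial>M)
      = (\<integral>\<omega>. (1 * \<zeta> 1 s \<omega> + 1 * \<zeta> 1 0 \<omega>)\<^sup>2 + (1 * \<zeta> 1 s \<omega> + -1 * \<zeta> 1 0 \<omega>)\<^sup>2 \<partial>M)"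
    using p(1) m(1) by (intro Bochner_Integration.integral_add[symmetric]) auto
  also have "\<dots> = (\<integral>\<omega>. 2 * (\<zeta> 1 s \<omega>)\<^sup>2 + 2 * (\<zeta> 1 0 \<omega>)\<^sup>2 \<partial>M)"
    by (intro Bochner_Integration.integral_cong HOL.refl) (simp add: power2_eq_square algebra_simps)
  also have "\<dots> = 4" using u u' by simp
  finally have "(sqrt (2 + 2 * \<rho> s))\<^sup>2 + (sqrt (2 - 2 * \<rho> s))\<^sup>2 = 4"
    using p(2) m(2) by simp
  then have "\<bar>2 + 2 * \<rho> s\<bar> + \<bar>2 - 2 * \<rho> s\<bar> = 4" by (simp only: real_sqrt_power[symmetric] real_sqrt_abs)
  then show ?thesis by linarith
qed

lemma \<rho>_decay:
  obtains A where "0 < A" "\<And>s. s \<noteq> 0 \<Longrightarrow> \<bar>\<rho> s\<bar> \<le> A * \<bar>s\<bar> powr (2 * H - 2)"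
proof -
  obtain C where C: "0 \<le> C" "\<And>s. 4 \<le> \<bar>s\<bar> \<Longrightarrow> \<bar>kernel_cov H \<psi> s\<bar> \<le> C * \<bar>s\<bar> powr (2 * H - 2)"
    using kernel_cov_decay[OF \<phi> H] by blast
  define A where "A = C / (sigma2 \<phi> H)\<^sup>2 + 4"
  have s2: "0 < (sigma2 \<phi> H)\<^sup>2" using sigma2_pos' by simp
  show thesis
  proof (rule that[of A])
    show "0 < A" using C(1) s2 by (simp add: A_def add_nonneg_pos)
    fix s :: real assume s: "s \<noteq> 0"
    show "\<bar>\<rho> s\<bar> \<le> A * \<bar>s\<bar> powr (2 * H - 2)"
    proof (cases "4 \<le> \<bar>s\<bar>")
      case True
      have "\<bar>\<rho> s\<bar> = \<bar>kernel_cov H \<psi> s\<bar> / (sigma2 \<phi> H)\<^sup>2" by (simp add: \<rho>_def)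
      also have "\<dots> \<le> C * \<bar>s\<bar> powr (2 * H - 2) / (sigma2 \<phi> H)\<^sup>2"
        using C(2)[OF True] s2 by (intro divide_right_mono) auto
      also have "\<dots> \<le> A * \<bar>s\<bar> powr (2 * H - 2)" by (simp add: A_def distrib_right)
      finally show ?thesis .
    next
      case False
      \<comment> \<open>For lags below 4 the trivial bound 1 on the correlation suffices: since
        \<open>2 * H - 2 \<ge> -1\<close>, the power of the lag is at least 1/4. Hence the summand 4
        in \<open>A\<close>.\<close>
      have "1 / 4 = inverse ((4 :: real) powr 1)" by (subst powr_one) auto
      also have "\<dots> = 4 powr (- 1)" by (rule powr_minus[symmetric])
      also have "\<dots> \<le> 4 powr (2 * H - 2)" using H by (intro powr_mono) auto
      also have "\<dots> \<le> \<bar>s\<bar> powr (2 * H - 2)" using s False H by (intro powr_mono2') auto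
      finally have "1 \<le> 4 * \<bar>s\<bar> powr (2 * H - 2)" by simp
      also have "\<dots> \<le> A * \<bar>s\<bar> powr (2 * H - 2)" using C(1) s2 by (intro mult_right_mono) (auto simp: A_def)
      finally show ?thesis using \<rho>_le_1[of s] by linarith
    qed
  qed
qed

end

section \<open>Time averages of functions of the smoothed process along a grid of scales\<close>

lemma card_close_indices:
  assumes "0 \<le> r"
  shows "real (card {j. j < n \<and> \<bar>real i - real j\<bar> \<le> r}) \<le> 2 * r + 1"
proof -
  define K where "K = nat \<lfloor>r\<rfloor>"
  have "{j. j < n \<and> \<bar>real i - real j\<bar> \<le> r} \<subseteq> {i - K..i + K}"
  proof
    fix j assume "j \<in> {j. j < n \<and> \<bar>real i - real j\<bar> \<le> r}"
    then have j: "\<bar>real i - real j\<bar> \<le> r" by simp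
    have "i - j \<le> K" "j - i \<le> K"
      unfolding K_def using j by (auto intro!: le_nat_floor simp: of_nat_diff_real)
    then show "j \<in> {i - K..i + K}" by auto
  qed
  then have "card {j. j < n \<and> \<bar>real i - real j\<bar> \<le> r} \<le> card {i - K..i + K}" by (intro card_mono) auto
  also have "\<dots> \<le> 2 * K + 1" by auto
  finally have "real (card {j. j < n \<and> \<bar>real i - real j\<bar> \<le> r}) \<le> real (2 * K + 1)" by (rule of_nat_mono)
  also have "\<dots> \<le> 2 * r + 1" using assms of_nat_floor[of r] by (simp add: K_def)
  finally show ?thesis .
qed

text \<open>Both \<open>cos (t * x)\<close> and \<open>cosh x\<close> satisfy d'Alembert's equation, which reduces covariances of
  functions of a Gaussian pair to one-dimensional integrals.\<close>

locale dalembert =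
  fixes f :: "real \<Rightarrow> real" and \<kappa> :: real
  assumes f_cont: "continuous_on UNIV f"
    and f_mult: "\<And>x y. f x * f y = (f (x + y) + f (x - y)) / 2"
    and f_int: "\<And>s. integrable std_normal (\<lambda>x. f (s * x))"
    and f_mean: "\<And>s. (\<integral>x. f (s * x) \<partial>std_normal) = exp (\<kappa> * s\<^sup>2 / 2)"
begin

lemma measurable_f [measurable]: "f \<in> borel_measurable borel"
  using f_cont by (rule borel_measurable_continuous_onI)

end

text \<open>The parameter \<kappa> is the constant in \<open>f'' = \<kappa> * f\<close>, negative
  for cosines and positive for the hyperbolic cosine. The cosines will identify the limiting law;
  the hyperbolic cosine will control the tails.\<close>

lemma dalembert_cos: "dalembert (\<lambda>x. cos (t * x)) (- (t\<^sup>2))"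
proof
  show "continuous_on UNIV (\<lambda>x. cos (t * x))" by (intro continuous_intros)
  show "cos (t * x) * cos (t * y) = (cos (t * (x + y)) + cos (t * (x - y))) / 2" for x y
    by (simp add: cos_times_cos distrib_left right_diff_distrib)
qed (use std_normal_cos[of t] in auto)

lemma dalembert_cosh: "dalembert (cosh :: real \<Rightarrow> real) 1"
proof
  show "continuous_on UNIV (cosh :: real \<Rightarrow> real)" by (intro continuous_intros)
  show "cosh x * cosh y = (cosh (x + y) + cosh (x - y)) / 2" for x y :: real
    by (simp add: cosh_add cosh_diff)
qed (use std_normal_cosh in auto)

locale smoothed_fbm_dalembert = smoothed_fbm M H b \<phi> + dalembert f \<kappa>
  for M :: "'a measure" and H b \<phi> f \<kappa>
begin

definition m :: real where "m = exp (\<kappa> / 2)"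

lemma f_\<zeta>_pair:
  assumes "0 < \<epsilon>"
  shows "integrable M (\<lambda>\<omega>. f (\<alpha> * \<zeta> \<epsilon> u \<omega> + \<beta> * \<zeta> \<epsilon> u' \<omega>))"
    and "0 \<le> \<alpha>\<^sup>2 + \<beta>\<^sup>2 + 2 * \<alpha> * \<beta> * \<rho> ((u - u') / \<epsilon>) \<Longrightarrow>
      (\<integral>\<omega>. f (\<alpha> * \<zeta> \<epsilon> u \<omega> + \<beta> * \<zeta> \<epsilon> u' \<omega>) \<partial>M) = exp (\<kappa> * (\<alpha>\<^sup>2 + \<beta>\<^sup>2 + 2 * \<alpha> * \<beta> * \<rho> ((u - u') / \<epsilon>)) / 2)"
  using gaussian_with_std_integral[OF \<zeta>_pair[OF assms, of \<alpha> u \<beta> u'] measurable_f] f_int f_mean by auto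

lemma f_\<zeta>_single:
  assumes "0 < \<epsilon>"
  shows "integrable M (\<lambda>\<omega>. f (\<zeta> \<epsilon> u \<omega>))" "(\<integral>\<omega>. f (\<zeta> \<epsilon> u \<omega>) \<partial>M) = m"
  using f_\<zeta>_pair[OF assms, where \<alpha> = 1 and \<beta> = 0 and u = u and u' = u] by (simp_all add: m_def)

text \<open>By the product formula the covariance involves only the sum and the difference of the
  two values and equals \<open>exp \<kappa> * (cosh (\<kappa> * r) - 1)\<close>, with
  \<open>r\<close> their correlation. A bound linear in \<open>\<bar>r\<bar>\<close> is
  kept.\<close>

lemma f_\<zeta>_cov:
  assumes \<epsilon>: "0 < \<epsilon>"
  shows "integrable M (\<lambda>\<omega>. (f (\<zeta> \<epsilon> u \<omega>) - m) * (f (\<zeta> \<epsilon> u' \<omega>) - m))"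
    and "\<bar>\<integral>\<omega>. (f (\<zeta> \<epsilon> u \<omega>) - m) * (f (\<zeta> \<epsilon> u' \<omega>) - m) \<partial>M\<bar> \<le> \<bar>\<kappa>\<bar> * exp (2 * \<bar>\<kappa>\<bar>) * \<bar>\<rho> ((u - u') / \<epsilon>)\<bar>"
proof -
  define r where "r = \<rho> ((u - u') / \<epsilon>)"
  have r: "\<bar>r\<bar> \<le> 1" by (simp add: r_def \<rho>_le_1)
  note p = f_\<zeta>_pair[OF \<epsilon>, where \<alpha> = 1 and \<beta> = 1 and u = u and u' = u', simplified, folded r_def]
  note n = f_\<zeta>_pair[OF \<epsilon>, where \<alpha> = 1 and \<beta> = "-1" and u = u and u' = u', simplified, folded r_def]
  note s = f_\<zeta>_single[OF \<epsilon>]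
  have eq: "(f (\<zeta> \<epsilon> u \<omega>) - m) * (f (\<zeta> \<epsilon> u' \<omega>) - m) =
      ((f (\<zeta> \<epsilon> u \<omega> + \<zeta> \<epsilon> u' \<omega>) + f (\<zeta> \<epsilon> u \<omega> - \<zeta> \<epsilon> u' \<omega>)) / 2 - m * f (\<zeta> \<epsilon> u \<omega>)) - (m * f (\<zeta> \<epsilon> u' \<omega>) - m * m)" for \<omega>
    unfolding f_mult[symmetric] by (simp add: algebra_simps)
  show "integrable M (\<lambda>\<omega>. (f (\<zeta> \<epsilon> u \<omega>) - m) * (f (\<zeta> \<epsilon> u' \<omega>) - m))"
    unfolding eq using p(1) n(1) s(1) by simp
  have mm: "m * m = exp \<kappa>" by (simp add: m_def flip: exp_add)
  have "(\<integral>\<omega>. (f (\<zeta> \<epsilon> u \<omega>) - m) * (f (\<zeta> \<epsilon> u' \<omega>) - m) \<partial>M) =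
      ((exp (\<kappa> * (2 + 2 * r) / 2) + exp (\<kappa> * (2 - 2 * r) / 2)) / 2 - m * m) - (m * m - m * m)"
    unfolding eq using p n s r by (simp add: prob_space)
  also have "\<dots> = exp \<kappa> / 2 * ((exp (\<kappa> * r) - 1) + (exp (- (\<kappa> * r)) - 1))"
  proof -
    have "\<kappa> * (2 + 2 * r) / 2 = \<kappa> + \<kappa> * r" "\<kappa> * (2 - 2 * r) / 2 = \<kappa> + - (\<kappa> * r)"
      by (simp_all add: field_simps)
    then show ?thesis unfolding mm by (simp only: exp_add) (simp add: algebra_simps)
  qed
  finally have I: "(\<integral>\<omega>. (f (\<zeta> \<epsilon> u \<omega>) - m) * (f (\<zeta> \<epsilon> u' \<omega>) - m) \<partial>M) =
      exp \<kappa> / 2 * ((exp (\<kappa> * r) - 1) + (exp (- (\<kappa> * r)) - 1))" .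
  have "\<bar>\<kappa> * r\<bar> \<le> \<bar>\<kappa>\<bar>" using r mult_left_mono[of "\<bar>r\<bar>" 1 "\<bar>\<kappa>\<bar>"] by (simp add: abs_mult)
  then have "\<bar>\<kappa> * r\<bar> * exp \<bar>\<kappa> * r\<bar> \<le> \<bar>\<kappa> * r\<bar> * exp \<bar>\<kappa>\<bar>" by (intro mult_left_mono) auto
  then have "\<bar>(exp (\<kappa> * r) - 1) + (exp (- (\<kappa> * r)) - 1)\<bar> \<le> 2 * (\<bar>\<kappa> * r\<bar> * exp \<bar>\<kappa>\<bar>)"
    using abs_exp_minus_one_le[of "\<kappa> * r"] abs_exp_minus_one_le[of "- (\<kappa> * r)"]
      abs_triangle_ineq[of "exp (\<kappa> * r) - 1" "exp (- (\<kappa> * r)) - 1"] by simp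
  then have "exp \<kappa> / 2 * \<bar>(exp (\<kappa> * r) - 1) + (exp (- (\<kappa> * r)) - 1)\<bar> \<le> exp \<bar>\<kappa>\<bar> / 2 * (2 * (\<bar>\<kappa> * r\<bar> * exp \<bar>\<kappa>\<bar>))"
    by (intro mult_mono) auto
  also have "\<dots> = \<bar>\<kappa>\<bar> * exp (2 * \<bar>\<kappa>\<bar>) * \<bar>r\<bar>"
  proof -
    have "exp (2 * \<bar>\<kappa>\<bar>) = exp \<bar>\<kappa>\<bar> * exp \<bar>\<kappa>\<bar>" by (simp only: mult_2 exp_add)
    then show ?thesis unfolding abs_mult by simp
  qed
  finally show "\<bar>\<integral>\<omega>. (f (\<zeta> \<epsilon> u \<omega>) - m) * (f (\<zeta> \<epsilon> u' \<omega>) - m) \<partial>M\<bar> \<le> \<bar>\<kappa>\<bar> * exp (2 * \<bar>\<kappa>\<bar>) * \<bar>\<rho> ((u - u') / \<epsilon>)\<bar>"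
    unfolding I by (simp add: abs_mult r_def)
qed

lemma \<zeta>_continuous: "continuous_on UNIV (\<lambda>u. \<zeta> \<epsilon> u \<omega>)"
proof -
  have "continuous_on UNIV (\<lambda>(u, v). \<psi> v * b (u - \<epsilon> * v) \<omega>)"
    unfolding split_beta
    by (intro continuous_intros continuous_on_compose2[OF \<psi>_cont] continuous_on_compose2[OF paths]) auto
  from continuous_on_integral_param[OF this] show ?thesis
    unfolding \<zeta>_def by (intro continuous_intros)
qed

text \<open>Pairs of points at distance at most \<open>sqrt \<epsilon>\<close> are few, and the others are weakly correlated.\<close>

lemma integral_f_\<zeta>_L2_bound:
  obtains C where "0 \<le> C" "\<And>\<epsilon> j. 0 < \<epsilon> \<Longrightarrow> \<epsilon> \<le> 1 \<Longrightarrow>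
    (\<integral>\<^sup>+\<omega>. ennreal ((integral {0..1} (\<lambda>u. u ^ j * (f (\<zeta> \<epsilon> u \<omega>) - m)))\<^sup>2) \<partial>M) \<le> ennreal (C * \<epsilon> powr (1 - H))"
proof -
  obtain A where A: "0 < A" "\<And>s. s \<noteq> 0 \<Longrightarrow> \<bar>\<rho> s\<bar> \<le> A * \<bar>s\<bar> powr (2 * H - 2)" by (rule \<rho>_decay) blast
  define C0 where "C0 = \<bar>\<kappa>\<bar> * exp (2 * \<bar>\<kappa>\<bar>)"
  have C0: "0 \<le> C0" by (simp add: C0_def)
  show thesis
  proof (rule that[of "C0 * (3 + A)"])
    show "0 \<le> C0 * (3 + A)" using C0 A by simp
    fix \<epsilon> :: real and j :: nat assume \<epsilon>: "0 < \<epsilon>" "\<epsilon> \<le> 1"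
    define g where "g u \<omega> = f (\<zeta> \<epsilon> u \<omega>) - m" for u \<omega>
    have [measurable]: "g u \<in> borel_measurable M" for u using \<epsilon> unfolding g_def by measurable
    \<comment> \<open>The bound is proved for Riemann sums, whose second moments are finite double
      sums of covariances.\<close>
    define R where "R n \<omega> = 1 / real n * (\<Sum>i<n. (real i / n) ^ j * g (real i / n) \<omega>)" for n \<omega>
    have [measurable]: "R n \<in> borel_measurable M" for n unfolding R_def by measurable
    have lim: "(\<lambda>n. R n \<omega>) \<longlonglongrightarrow> integral {0..1} (\<lambda>u. u ^ j * g u \<omega>)" for \<omega>
    proof -
      have "continuous_on {0..1} (\<lambda>u. u ^ j * g u \<omega>)" unfolding g_def
        by (intro continuous_intros continuous_on_compose2[OF f_cont] continuous_on_subset[OF \<zeta>_continuous]) auto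
      from riemann_sum_tendsto[OF this] show ?thesis by (simp add: R_def)
    qed
    have D: "sqrt \<epsilon> \<le> \<epsilon> powr (1 - H)"
    proof -
      have "sqrt \<epsilon> = \<epsilon> powr (1 / 2)" using \<epsilon> by (simp add: powr_half_sqrt)
      also have "\<dots> \<le> \<epsilon> powr (1 - H)" using \<epsilon> H by (intro powr_mono') auto
      finally show ?thesis .
    qed
    have pair: "\<bar>\<rho> ((real i / n - real k / n) / \<epsilon>)\<bar> \<le> A * \<epsilon> powr (1 - H) + (if \<bar>real i - real k\<bar> \<le> n * sqrt \<epsilon> then 1 else 0)"
      if n: "0 < n" for i k n :: nat
    proof (cases "\<bar>real i - real k\<bar> \<le> n * sqrt \<epsilon>")
      case True
      then show ?thesis using \<rho>_le_1[of "(real i / n - real k / n) / \<epsilon>"] A by (simp add: add_nonneg_pos add_increasing)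
    next
      \<comment> \<open>Points farther apart than \<open>sqrt \<epsilon>\<close> have scaled lag
        above \<open>\<epsilon> powr (- (1 / 2))\<close>, and the decay \<open>2 * H - 2\<close>
        turns this into \<open>\<epsilon> powr (1 - H)\<close>.\<close>
      case False
      define s where "s = (real i / n - real k / n) / \<epsilon>"
      have "sqrt \<epsilon> < \<bar>real i - real k\<bar> / n" using False n by (simp add: field_simps)
      also have "\<dots> = \<epsilon> * \<bar>s\<bar>" using \<epsilon> by (simp add: s_def abs_mult diff_divide_distrib[symmetric])
      finally have "sqrt \<epsilon> < \<epsilon> * \<bar>s\<bar>" .
      then have "sqrt \<epsilon> / \<epsilon> < \<bar>s\<bar>" using \<epsilon> by (simp add: field_simps)
      moreover have "sqrt \<epsilon> / \<epsilon> = \<epsilon> powr (- (1 / 2))"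
      proof -
        have "sqrt \<epsilon> / \<epsilon> = \<epsilon> powr (1 / 2) / \<epsilon> powr 1" using \<epsilon> by (simp add: powr_half_sqrt)
        also have "\<dots> = \<epsilon> powr (1 / 2 - 1)" by (rule powr_diff[symmetric])
        finally show ?thesis by simp
      qed
      ultimately have s: "\<epsilon> powr (- (1 / 2)) < \<bar>s\<bar>" by simp
      have "0 < \<epsilon> powr (- (1 / 2))" using \<epsilon> by simp
      then have "s \<noteq> 0" using s by auto
      then have "\<bar>\<rho> s\<bar> \<le> A * \<bar>s\<bar> powr (2 * H - 2)" by (rule A(2))
      also have "\<dots> \<le> A * (\<epsilon> powr (- (1 / 2))) powr (2 * H - 2)"
        using s H A \<epsilon> by (intro mult_left_mono powr_mono2') auto
      also have "(\<epsilon> powr (- (1 / 2))) powr (2 * H - 2) = \<epsilon> powr (1 - H)" by (simp add: powr_powr algebra_simps)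
      finally show ?thesis using False by (simp add: s_def)
    qed
    have R_bound: "(\<integral>\<^sup>+\<omega>. ennreal ((R n \<omega>)\<^sup>2) \<partial>M) \<le> ennreal (C0 * (3 + A) * \<epsilon> powr (1 - H))"
      if n: "0 < n" "1 / real n \<le> sqrt \<epsilon>" for n
    proof -
      have sq: "(R n \<omega>)\<^sup>2 = 1 / (real n)\<^sup>2 * (\<Sum>i<n. \<Sum>k<n. ((real i / n) ^ j * (real k / n) ^ j) * (g (real i / n) \<omega> * g (real k / n) \<omega>))" for \<omega>
        unfolding R_def power2_eq_square
        by (simp add: sum_product mult_ac)
      have int: "integrable M (\<lambda>\<omega>. g (real i / n) \<omega> * g (real k / n) \<omega>)" for i k
        unfolding g_def using f_\<zeta>_cov(1)[OF \<epsilon>(1)] by simp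
      have cov: "\<bar>\<integral>\<omega>. g (real i / n) \<omega> * g (real k / n) \<omega> \<partial>M\<bar> \<le> C0 * (A * \<epsilon> powr (1 - H) + (if \<bar>real i - real k\<bar> \<le> n * sqrt \<epsilon> then 1 else 0))" for i k
        using f_\<zeta>_cov(2)[OF \<epsilon>(1), of "real i / n" "real k / n"] mult_left_mono[OF pair[OF n(1), of i k] C0]
        unfolding g_def C0_def by linarith
      have intR: "integrable M (\<lambda>\<omega>. (R n \<omega>)\<^sup>2)" unfolding sq using int by simp
      have "(\<integral>\<omega>. (R n \<omega>)\<^sup>2 \<partial>M) = 1 / (real n)\<^sup>2 * (\<Sum>i<n. \<Sum>k<n. ((real i / n) ^ j * (real k / n) ^ j) * (\<integral>\<omega>. g (real i / n) \<omega> * g (real k / n) \<omega> \<partial>M))"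
        unfolding sq using int by (simp add: Bochner_Integration.integral_sum)
      also have "\<dots> \<le> 1 / (real n)\<^sup>2 * (\<Sum>i<n. \<Sum>k<n. C0 * (A * \<epsilon> powr (1 - H) + (if \<bar>real i - real k\<bar> \<le> n * sqrt \<epsilon> then 1 else 0)))"
      proof (intro mult_left_mono sum_mono)
        fix i k assume ik: "i \<in> {..<n}" "k \<in> {..<n}"
        define W where "W = (real i / n) ^ j * (real k / n) ^ j"
        have W: "0 \<le> W" "W \<le> 1" using ik by (auto simp: W_def intro!: mult_le_one power_le_one)
        have "W * (\<integral>\<omega>. g (real i / n) \<omega> * g (real k / n) \<omega> \<partial>M) \<le> W * \<bar>\<integral>\<omega>. g (real i / n) \<omega> * g (real k / n) \<omega> \<partial>M\<bar>"
          using W by (intro mult_left_mono) auto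
        also have "\<dots> \<le> 1 * \<bar>\<integral>\<omega>. g (real i / n) \<omega> * g (real k / n) \<omega> \<partial>M\<bar>" using W by (intro mult_right_mono) auto
        finally show "(real i / n) ^ j * (real k / n) ^ j * (\<integral>\<omega>. g (real i / n) \<omega> * g (real k / n) \<omega> \<partial>M)
            \<le> C0 * (A * \<epsilon> powr (1 - H) + (if \<bar>real i - real k\<bar> \<le> n * sqrt \<epsilon> then 1 else 0))"
          using cov[of i k] by (simp only: W_def[symmetric] mult_1_left)
      qed simp
      also have "\<dots> \<le> 1 / (real n)\<^sup>2 * (\<Sum>i<n. C0 * (n * (A * \<epsilon> powr (1 - H)) + (2 * (n * sqrt \<epsilon>) + 1)))"
      proof (intro mult_left_mono sum_mono)
        fix i
        have "(\<Sum>k<n. if \<bar>real i - real k\<bar> \<le> n * sqrt \<epsilon> then 1 else 0 :: real) = real (card {k. k < n \<and> \<bar>real i - real k\<bar> \<le> n * sqrt \<epsilon>})"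
          by (subst sum.inter_filter[symmetric]) auto
        also have "\<dots> \<le> 2 * (n * sqrt \<epsilon>) + 1" using \<epsilon> by (intro card_close_indices) auto
        finally show "(\<Sum>k<n. C0 * (A * \<epsilon> powr (1 - H) + (if \<bar>real i - real k\<bar> \<le> n * sqrt \<epsilon> then 1 else 0)))
            \<le> C0 * (n * (A * \<epsilon> powr (1 - H)) + (2 * (n * sqrt \<epsilon>) + 1))"
          unfolding sum_distrib_left[symmetric] sum.distrib using C0 by (intro mult_left_mono) auto
      qed simp
      also have "\<dots> = C0 * (A * \<epsilon> powr (1 - H) + (2 * sqrt \<epsilon> + 1 / n))"
        using n by (simp add: power2_eq_square field_simps)
      \<comment> \<open>Near pairs contribute \<open>2 * sqrt \<epsilon> + 1 / n\<close>, which is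
        at most \<open>3 * sqrt \<epsilon>\<close> for such \<open>n\<close>; and
        \<open>sqrt \<epsilon> \<le> \<epsilon> powr (1 - H)\<close> because
        \<open>H > 1 / 2\<close>.\<close>
      also have "\<dots> \<le> C0 * (A * \<epsilon> powr (1 - H) + 3 * \<epsilon> powr (1 - H))"
        using n(2) D C0 by (intro mult_left_mono) auto
      finally have "(\<integral>\<omega>. (R n \<omega>)\<^sup>2 \<partial>M) \<le> C0 * (3 + A) * \<epsilon> powr (1 - H)" by (simp add: algebra_simps)
      then show ?thesis using intR by (subst nn_integral_eq_integral) (auto intro!: ennreal_leI)
    qed
    have "(\<integral>\<^sup>+\<omega>. ennreal ((integral {0..1} (\<lambda>u. u ^ j * g u \<omega>))\<^sup>2) \<partial>M) = (\<integral>\<^sup>+\<omega>. liminf (\<lambda>n. ennreal ((R n \<omega>)\<^sup>2)) \<partial>M)"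
    proof (intro nn_integral_cong)
      fix \<omega>
      have "(\<lambda>n. ennreal ((R n \<omega>)\<^sup>2)) \<longlonglongrightarrow> ennreal ((integral {0..1} (\<lambda>u. u ^ j * g u \<omega>))\<^sup>2)"
        by (intro tendsto_ennrealI tendsto_power lim)
      then show "ennreal ((integral {0..1} (\<lambda>u. u ^ j * g u \<omega>))\<^sup>2) = liminf (\<lambda>n. ennreal ((R n \<omega>)\<^sup>2))"
        by (intro lim_imp_Liminf[symmetric]) auto
    qed
    \<comment> \<open>Fatou's lemma carries the bound over from the Riemann sums to the time
      integral, so joint measurability in time and chance never comes up.\<close>
    also have "\<dots> \<le> liminf (\<lambda>n. \<integral>\<^sup>+\<omega>. ennreal ((R n \<omega>)\<^sup>2) \<partial>M)"
      by (rule nn_integral_liminf) measurable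
    also have "\<dots> \<le> liminf (\<lambda>n::nat. ennreal (C0 * (3 + A) * \<epsilon> powr (1 - H)))"
    proof (rule Liminf_mono)
      have "\<forall>\<^sub>F n in sequentially. 0 < n \<and> 1 / real n < sqrt \<epsilon>"
        by (intro eventually_conj eventually_gt_at_top order_tendstoD(2)[OF lim_const_over_n]) (use \<epsilon> in auto)
      then show "\<forall>\<^sub>F n in sequentially. (\<integral>\<^sup>+\<omega>. ennreal ((R n \<omega>)\<^sup>2) \<partial>M) \<le> ennreal (C0 * (3 + A) * \<epsilon> powr (1 - H))"
        by eventually_elim (intro R_bound, auto)
    qed
    also have "\<dots> = ennreal (C0 * (3 + A) * \<epsilon> powr (1 - H))" by (intro Liminf_const) auto
    finally show "(\<integral>\<^sup>+\<omega>. ennreal ((integral {0..1} (\<lambda>u. u ^ j * (f (\<zeta> \<epsilon> u \<omega>) - m)))\<^sup>2) \<partial>M) \<le> ennreal (C0 * (3 + A) * \<epsilon> powr (1 - H))"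
      by (simp only: g_def)
  qed
qed

end

text \<open>The exponent is such that \<open>grid H n powr (1 - H)\<close> is
  \<open>real (Suc n) powr (- 2)\<close>, a summable sequence. As the grid is polynomial, ratios of
  consecutive points still tend to 1.\<close>

definition grid :: "real \<Rightarrow> nat \<Rightarrow> real" where
  "grid H n = real (Suc n) powr (- (2 / (1 - H)))"

lemma grid_pos: "0 < grid H n"
  by (simp add: grid_def)

lemma grid_le_1: "H < 1 \<Longrightarrow> grid H n \<le> 1"
  using powr_mono[of "- (2 / (1 - H))" 0 "real (Suc n)"] by (simp add: grid_def)

lemma grid_powr:
  assumes "H < 1"
  shows "grid H n powr (1 - H) = real (Suc n) powr (- 2)"
proof -
  have "1 - H \<noteq> 0" using assms by simp
  then have "- (2 / (1 - H)) * (1 - H) = - 2"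
    by (simp only: mult_minus_left times_divide_eq_left nonzero_mult_div_cancel_right not_False_eq_True)
  then show ?thesis by (simp only: grid_def powr_powr)
qed

context smoothed_fbm_dalembert
begin

lemma measurable_integral_f_\<zeta>:
  assumes \<epsilon>: "0 < \<epsilon>"
  shows "(\<lambda>\<omega>. integral {0..1} (\<lambda>u. u ^ j * (f (\<zeta> \<epsilon> u \<omega>) - m))) \<in> borel_measurable M"
proof (rule borel_measurable_LIMSEQ_real)
  define R where "R n \<omega> = 1 / real n * (\<Sum>i<n. (real i / n) ^ j * (f (\<zeta> \<epsilon> (real i / n) \<omega>) - m))" for n \<omega>
  show "R n \<in> borel_measurable M" for n using \<epsilon> unfolding R_def by measurable
  show "(\<lambda>n. R n \<omega>) \<longlonglongrightarrow> integral {0..1} (\<lambda>u. u ^ j * (f (\<zeta> \<epsilon> u \<omega>) - m))" for \<omega>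
  proof -
    have "continuous_on {0..1} (\<lambda>u. u ^ j * (f (\<zeta> \<epsilon> u \<omega>) - m))"
      by (intro continuous_intros continuous_on_compose2[OF f_cont] continuous_on_subset[OF \<zeta>_continuous]) auto
    from riemann_sum_tendsto[OF this] show ?thesis by (simp add: R_def)
  qed
qed

text \<open>The second moments are summable along the grid, so the series of squares has finite
  expectation and converges almost surely; its terms tend to 0. Countably many powers
  \<open>u ^ j\<close> share one exceptional set.\<close>

lemma AE_integral_f_\<zeta>_tendsto:
  "AE \<omega> in M. \<forall>j. (\<lambda>n. integral {0..1} (\<lambda>u. u ^ j * (f (\<zeta> (grid H n) u \<omega>) - m))) \<longlonglongrightarrow> 0"
  unfolding AE_all_countable
proof
  fix j :: nat
  define I where "I n \<omega> = integral {0..1} (\<lambda>u. u ^ j * (f (\<zeta> (grid H n) u \<omega>) - m))" for n \<omega>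
  have [measurable]: "I n \<in> borel_measurable M" for n
    unfolding I_def by (rule measurable_integral_f_\<zeta>[OF grid_pos])
  obtain C where C: "0 \<le> C" "\<And>\<epsilon> j. 0 < \<epsilon> \<Longrightarrow> \<epsilon> \<le> 1 \<Longrightarrow>
    (\<integral>\<^sup>+\<omega>. ennreal ((integral {0..1} (\<lambda>u. u ^ j * (f (\<zeta> \<epsilon> u \<omega>) - m)))\<^sup>2) \<partial>M) \<le> ennreal (C * \<epsilon> powr (1 - H))"
    using integral_f_\<zeta>_L2_bound by blast
  have bound: "(\<integral>\<^sup>+\<omega>. ennreal ((I n \<omega>)\<^sup>2) \<partial>M) \<le> ennreal (C * real (Suc n) powr (- 2))" for n
    using C(2)[OF grid_pos grid_le_1, of H n j] C(2)[OF grid_pos grid_le_1, of H j n] H by (simp add: I_def grid_powr)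
  have summ: "summable (\<lambda>n. C * real (Suc n) powr (- 2))"
  proof -
    have "summable (\<lambda>n. real n powr (- 2))" by (subst summable_real_powr_iff) simp
    then show ?thesis by (subst (asm) summable_Suc_iff[symmetric]) (rule summable_mult)
  qed
  have "(\<integral>\<^sup>+\<omega>. (\<Sum>n. ennreal ((I n \<omega>)\<^sup>2)) \<partial>M) = (\<Sum>n. \<integral>\<^sup>+\<omega>. ennreal ((I n \<omega>)\<^sup>2) \<partial>M)"
    by (intro nn_integral_suminf) measurable
  also have "\<dots> \<le> (\<Sum>n. ennreal (C * real (Suc n) powr (- 2)))"
    by (intro suminf_le bound) auto
  also have "\<dots> = ennreal (\<Sum>n. C * real (Suc n) powr (- 2))"
    using C(1) by (intro suminf_ennreal2 summ) auto
  also have "\<dots> < \<infinity>" by simp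
  finally have "(\<integral>\<^sup>+\<omega>. (\<Sum>n. ennreal ((I n \<omega>)\<^sup>2)) \<partial>M) \<noteq> \<infinity>" by simp
  then have "AE \<omega> in M. (\<Sum>n. ennreal ((I n \<omega>)\<^sup>2)) \<noteq> \<infinity>"
    by (intro nn_integral_PInf_AE) measurable
  then show "AE \<omega> in M. (\<lambda>n. integral {0..1} (\<lambda>u. u ^ j * (f (\<zeta> (grid H n) u \<omega>) - m))) \<longlonglongrightarrow> 0"
  proof eventually_elim
    case (elim \<omega>)
    then have "summable (\<lambda>n. (I n \<omega>)\<^sup>2)" by (intro summable_suminf_not_top) auto
    then have "(\<lambda>n. (I n \<omega>)\<^sup>2) \<longlonglongrightarrow> 0" by (rule summable_LIMSEQ_zero)
    then have "(\<lambda>n. sqrt ((I n \<omega>)\<^sup>2)) \<longlonglongrightarrow> sqrt 0" by (rule tendsto_real_sqrt)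
    then have "(\<lambda>n. \<bar>I n \<omega>\<bar>) \<longlonglongrightarrow> 0" by simp
    then show ?case unfolding I_def by (rule tendsto_rabs_zero_cancel)
  qed
qed

end

context smoothed_fbm
begin

lemma \<zeta>_continuous': "continuous_on UNIV (\<lambda>u. \<zeta> \<epsilon> u \<omega>)"
proof -
  interpret dalembert "cosh :: real \<Rightarrow> real" 1 by (rule dalembert_cosh)
  interpret smoothed_fbm_dalembert M H b \<phi> "cosh :: real \<Rightarrow> real" 1 ..
  show ?thesis by (rule \<zeta>_continuous)
qed

lemma AE_cos_\<zeta>_tendsto:
  "AE \<omega> in M. \<forall>j. (\<lambda>n. integral {0..1} (\<lambda>u. u ^ j * (cos (t * \<zeta> (grid H n) u \<omega>) - exp (- (t\<^sup>2) / 2)))) \<longlonglongrightarrow> 0"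
proof -
  interpret dalembert "\<lambda>x. cos (t * x)" "- (t\<^sup>2)" by (rule dalembert_cos)
  interpret smoothed_fbm_dalembert M H b \<phi> "\<lambda>x. cos (t * x)" "- (t\<^sup>2)" ..
  show ?thesis using AE_integral_f_\<zeta>_tendsto unfolding m_def .
qed

text \<open>For the weight \<open>u ^ 0\<close> the averages converge to the Gaussian mean of
  \<open>cosh\<close>, hence are bounded. This replaces any tightness or uniform integrability
  argument.\<close>

lemma AE_cosh_\<zeta>_bounded:
  "AE \<omega> in M. \<exists>K. \<forall>n. integral {0..1} (\<lambda>u. cosh (\<zeta> (grid H n) u \<omega>)) \<le> K"
proof -
  interpret dalembert "cosh :: real \<Rightarrow> real" 1 by (rule dalembert_cosh)
  interpret smoothed_fbm_dalembert M H b \<phi> "cosh :: real \<Rightarrow> real" 1 ..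
  show ?thesis using AE_integral_f_\<zeta>_tendsto
  proof eventually_elim
    case (elim \<omega>)
    have int: "(\<lambda>u. cosh (\<zeta> (grid H n) u \<omega>)) integrable_on {0..1}" for n
      by (intro integrable_continuous_real continuous_intros continuous_on_subset[OF \<zeta>_continuous']) auto
    have eq: "integral {0..1} (\<lambda>u. u ^ 0 * (cosh (\<zeta> (grid H n) u \<omega>) - m)) = integral {0..1} (\<lambda>u. cosh (\<zeta> (grid H n) u \<omega>)) - m" for n
      using Henstock_Kurzweil_Integration.integral_diff[OF int[of n] integrable_const_ivl[of m 0 1]] by simp
    from elim have "(\<lambda>n. integral {0..1} (\<lambda>u. cosh (\<zeta> (grid H n) u \<omega>)) - m) \<longlonglongrightarrow> 0"
      unfolding eq[symmetric] by blast
    then have "Bseq (\<lambda>n. integral {0..1} (\<lambda>u. cosh (\<zeta> (grid H n) u \<omega>)) - m)"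
      by (intro convergent_imp_Bseq convergentI)
    then obtain K where "\<And>n. norm (integral {0..1} (\<lambda>u. cosh (\<zeta> (grid H n) u \<omega>)) - m) \<le> K"
      unfolding Bseq_def by blast
    then have "integral {0..1} (\<lambda>u. cosh (\<zeta> (grid H n) u \<omega>)) \<le> K + m" for n
      by (metis abs_le_D1 diff_le_eq real_norm_def)
    then show ?case by blast
  qed
qed

end

section \<open>Hoelder continuity of the paths\<close>

lemma dyadic_scale_exists:
  fixes d :: real
  assumes "0 < d" "d \<le> 1"
  obtains n where "(1 / 2) ^ Suc n < d" "d \<le> (1 / 2) ^ n"
proof -
  define P where "P n \<longleftrightarrow> (1 / 2 :: real) ^ Suc n < d" for n
  obtain n0 where "(1 / 2 :: real) ^ n0 < d" using real_arch_pow_inv[of d "1 / 2"] assms by auto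
  moreover have "(1 / 2 :: real) ^ Suc n0 \<le> (1 / 2) ^ n0" by simp
  ultimately have "P n0" unfolding P_def by linarith
  define n where "n = (LEAST n. P n)"
  have n: "P n" unfolding n_def using \<open>P n0\<close> by (rule LeastI)
  have "d \<le> (1 / 2) ^ n"
  proof (cases n)
    case 0
    then show ?thesis using assms by simp
  next
    case (Suc k)
    then have "\<not> P k" unfolding n_def by (intro not_less_Least) auto
    then show ?thesis by (simp add: P_def Suc)
  qed
  with n show thesis by (intro that) (auto simp: P_def)
qed

text \<open>Chaining along dyadic approximations from below. Two points at distance of order
  \<open>(1 / 2) ^ n\<close> have equal or adjacent approximations of level \<open>n\<close>, and
  passing from there to the points themselves costs a geometric series on each side.\<close>

lemma holder_from_dyadic:
  fixes f :: "real \<Rightarrow> real"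
  assumes cont: "continuous_on {0..1} f" and \<gamma>: "0 < \<gamma>" and K: "0 \<le> K"
    and dyadic: "\<And>n j. j < 2 ^ n \<Longrightarrow> \<bar>f (real (Suc j) / 2 ^ n) - f (real j / 2 ^ n)\<bar> \<le> K * (2 powr (- \<gamma>)) ^ n"
  obtains C where "0 \<le> C" "\<And>s t. s \<in> {0..1} \<Longrightarrow> t \<in> {0..1} \<Longrightarrow> \<bar>f t - f s\<bar> \<le> C * \<bar>t - s\<bar> powr \<gamma>"
proof -
  define q :: real where "q = 2 powr (- \<gamma>)"
  have q: "0 < q" "q < 1" using \<gamma> by (auto simp: q_def powr_less_one)
  define c where "c = 1 / (1 - q)"
  have c: "0 < c" using q by (simp add: c_def)
  define k where "k x n = nat \<lfloor>2 ^ n * x\<rfloor>" for x :: real and n :: nat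
  define X where "X x n = real (k x n) / 2 ^ n" for x n
  have k: "real (k x n) \<le> 2 ^ n * x" "2 ^ n * x < real (k x n) + 1" if "0 \<le> x" for x n
    unfolding k_def using that by (auto simp: of_nat_floor)
  have X_in: "X x n \<in> {0..1}" "\<bar>X x n - x\<bar> \<le> (1 / 2) ^ n" if x: "x \<in> {0..1}" for x n
  proof -
    have "X x n \<le> x" using k(1)[of x n] x by (simp add: X_def field_simps)
    moreover have "x < X x n + (1 / 2) ^ n" using k(2)[of x n] x by (simp add: X_def field_simps power_one_over)
    moreover have "0 \<le> X x n" by (simp add: X_def)
    ultimately show "X x n \<in> {0..1}" "\<bar>X x n - x\<bar> \<le> (1 / 2) ^ n" using x by auto
  qed
  have step: "\<bar>f (X x (Suc n)) - f (X x n)\<bar> \<le> K * q ^ n" if x: "x \<in> {0..1}" for x n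
  proof -
    have x0: "0 \<le> x" using x by simp
    \<comment> \<open>The integer part of a doubled number is twice the integer part, or one more;
      so consecutive approximations agree or are neighbours on the finer level.\<close>
    have "real (2 * k x n) < real (k x (Suc n) + 1)" "real (k x (Suc n)) < real (2 * k x n + 2)"
      using k[OF x0, of n] k[OF x0, of "Suc n"] by auto
    then have "k x (Suc n) = 2 * k x n \<or> k x (Suc n) = Suc (2 * k x n)" unfolding of_nat_less_iff by arith
    then show ?thesis
    proof
      assume "k x (Suc n) = 2 * k x n"
      then have "X x (Suc n) = X x n" by (simp add: X_def)
      then show ?thesis using K q by simp
    next
      assume e: "k x (Suc n) = Suc (2 * k x n)"
      have "2 ^ Suc n * x \<le> 2 ^ Suc n * 1" using x by (intro mult_left_mono) auto
      then have "real (k x (Suc n)) \<le> 2 ^ Suc n * 1" using k(1)[OF x0, of "Suc n"] by (rule order_trans[rotated])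
      then have "k x (Suc n) \<le> 2 ^ Suc n" by (metis mult.right_neutral of_nat_le_iff of_nat_numeral of_nat_power)
      then have "2 * k x n < 2 ^ Suc n" using e by simp
      from dyadic[OF this] have "\<bar>f (X x (Suc n)) - f (X x n)\<bar> \<le> K * q ^ Suc n"
        by (simp add: X_def e q_def)
      also have "\<dots> \<le> K * q ^ n" using K q by (intro mult_left_mono) (auto simp: mult_left_le_one_le)
      finally show ?thesis .
    qed
  qed
  have chain: "\<bar>f (X x (n + i)) - f (X x n)\<bar> \<le> K * q ^ n * c" if x: "x \<in> {0..1}" for x n i
  proof -
    have "\<bar>f (X x (n + i)) - f (X x n)\<bar> \<le> (\<Sum>j<i. K * q ^ (n + j))"
    proof (induction i)
      case (Suc i)
      have "\<bar>f (X x (n + Suc i)) - f (X x n)\<bar> \<le> \<bar>f (X x (Suc (n + i))) - f (X x (n + i))\<bar> + \<bar>f (X x (n + i)) - f (X x n)\<bar>"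
        by simp
      then show ?case using Suc step[OF x, of "n + i"] by simp
    qed simp
    also have "\<dots> = K * q ^ n * (\<Sum>j<i. q ^ j)" by (simp add: power_add sum_distrib_left mult.assoc)
    also have "\<dots> \<le> K * q ^ n * c"
    proof (intro mult_left_mono)
      have "(\<Sum>j<i. q ^ j) = (1 - q ^ i) / (1 - q)" using q by (subst sum_gp_strict) auto
      also have "\<dots> \<le> c" unfolding c_def using q by (intro divide_right_mono) auto
      finally show "(\<Sum>j<i. q ^ j) \<le> c" .
    qed (use K q in auto)
    finally show ?thesis .
  qed
  have approx: "\<bar>f x - f (X x n)\<bar> \<le> K * q ^ n * c" if x: "x \<in> {0..1}" for x n
  proof -
    have "(\<lambda>i. (1 / 2 :: real) ^ (n + i)) \<longlonglongrightarrow> 0"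
      using LIMSEQ_ignore_initial_segment[OF LIMSEQ_realpow_zero[of "1 / 2 :: real"], of n] by (simp add: add.commute)
    then have "(\<lambda>i. X x (n + i) - x) \<longlonglongrightarrow> 0"
      by (rule Lim_null_comparison[rotated]) (use X_in(2)[OF x] in auto)
    then have "(\<lambda>i. X x (n + i)) \<longlonglongrightarrow> x" by (simp add: LIM_zero_iff)
    then have "(\<lambda>i. f (X x (n + i))) \<longlonglongrightarrow> f x"
      by (rule continuous_on_tendsto_compose[OF cont]) (use x X_in(1)[OF x] in auto)
    then have "(\<lambda>i. \<bar>f (X x (n + i)) - f (X x n)\<bar>) \<longlonglongrightarrow> \<bar>f x - f (X x n)\<bar>" by (intro tendsto_intros)
    then show ?thesis by (rule LIMSEQ_le_const2) (use chain[OF x] in auto)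
  qed
  \<comment> \<open>Two geometric tails and one step between neighbours give
    \<open>2 * c + 1\<close>; the factor \<open>2 powr \<gamma>\<close> comes from comparing
    \<open>(1 / 2) ^ n\<close> with the actual distance.\<close>
  define C where "C = K * (2 * c + 1) * 2 powr \<gamma>"
  have C: "0 \<le> C" using K c by (simp add: C_def)
  have main: "\<bar>f t - f s\<bar> \<le> C * \<bar>t - s\<bar> powr \<gamma>" if st: "s \<in> {0..1}" "t \<in> {0..1}" "s < t" for s t
  proof -
    obtain n where n: "(1 / 2) ^ Suc n < t - s" "t - s \<le> (1 / 2) ^ n"
      using dyadic_scale_exists[of "t - s"] st by auto
    have st0: "0 \<le> s" "0 \<le> t" using st by auto
    have "\<bar>f (X t n) - f (X s n)\<bar> \<le> K * q ^ n"
    proof -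
      have "2 ^ n * (t - s) \<le> 2 ^ n * (1 / 2) ^ n" using n(2) by (intro mult_left_mono) auto
      also have "\<dots> = 1" by (simp flip: power_mult_distrib)
      finally have "2 ^ n * t \<le> 2 ^ n * s + 1" by (simp add: algebra_simps)
      then have "real (k t n) < real (k s n + 2)" using k(1)[OF st0(2), of n] k(2)[OF st0(1), of n] by simp
      moreover have "2 ^ n * s < 2 ^ n * t" using st by simp
      then have "real (k s n) < real (k t n + 1)" using k(2)[OF st0(2), of n] k(1)[OF st0(1), of n]
        unfolding of_nat_add of_nat_1 by linarith
      ultimately have "k t n = k s n \<or> k t n = Suc (k s n)" unfolding of_nat_less_iff by arith
      then show ?thesis
      proof
        assume "k t n = k s n"
        then show ?thesis using K q by (simp add: X_def)
      next
        assume e: "k t n = Suc (k s n)"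
        have "2 ^ n * t \<le> 2 ^ n * 1" using st by (intro mult_left_mono) auto
        then have "real (k t n) \<le> 2 ^ n * 1" using k(1)[OF st0(2), of n] by (rule order_trans[rotated])
        then have "k t n \<le> 2 ^ n" by (metis mult.right_neutral of_nat_le_iff of_nat_numeral of_nat_power)
        then have "k s n < 2 ^ n" using e by simp
        from dyadic[OF this] show ?thesis by (simp add: X_def e q_def)
      qed
    qed
    then have "\<bar>f t - f s\<bar> \<le> K * (2 * c + 1) * q ^ n"
      using approx[OF st(1), of n] approx[OF st(2), of n] by (simp add: algebra_simps)
    also have "q ^ n = ((1 / 2) ^ n) powr \<gamma>"
    proof -
      have "q ^ n = 2 powr (- \<gamma> * real n)" by (simp add: q_def powr_powr flip: powr_realpow)
      also have "\<dots> = (2 powr (- real n)) powr \<gamma>" by (simp add: powr_powr mult.commute)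
      also have "2 powr (- real n) = (1 / 2 :: real) ^ n" by (simp add: powr_minus powr_realpow power_one_over inverse_eq_divide)
      finally show ?thesis .
    qed
    also have "\<dots> \<le> (2 * (t - s)) powr \<gamma>" using n(1) \<gamma> by (intro powr_mono2) auto
    also have "(2 * (t - s)) powr \<gamma> = 2 powr \<gamma> * \<bar>t - s\<bar> powr \<gamma>" unfolding powr_mult using st by simp
    finally show ?thesis using K c by (simp add: C_def mult_left_mono mult.assoc)
  qed
  show thesis
  proof (rule that[OF C])
    fix s t :: real assume "s \<in> {0..1}" "t \<in> {0..1}"
    then show "\<bar>f t - f s\<bar> \<le> C * \<bar>t - s\<bar> powr \<gamma>"
      using main[of s t] main[of t s] by (cases s t rule: linorder_cases) (auto simp: abs_minus_commute)
  qed
qed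

context continuous_fbm
begin

lemma gauss_increment: "gaussian_with_std M (\<lambda>\<omega>. b t \<omega> - b s \<omega>) (sqrt (v2_sq H) * \<bar>t - s\<bar> powr H)"
proof -
  have "gaussian_with_std M (\<lambda>\<omega>. \<Sum>i\<in>(UNIV :: bool set). (if i then 1 else -1) * b (if i then t else s) \<omega>)
      (sqrt (\<Sum>i\<in>(UNIV :: bool set). \<Sum>j\<in>(UNIV :: bool set). (if i then 1 else -1) * (if j then 1 else -1)
        * fbm_cov H (if i then t else s) (if j then t else s)))"
    by (rule gauss_family) simp
  moreover have "(\<Sum>i\<in>(UNIV :: bool set). \<Sum>j\<in>(UNIV :: bool set). (if i then 1 else -1) * (if j then 1 else -1)
        * fbm_cov H (if i then t else s) (if j then t else s)) = v2_sq H * (\<bar>t - s\<bar> powr H)\<^sup>2"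
  proof -
    have "(\<bar>t - s\<bar> powr H)\<^sup>2 = \<bar>t - s\<bar> powr (2 * H)" by (simp only: power2_eq_square mult_2 powr_add)
    then show ?thesis by (simp add: UNIV_bool fbm_cov_def abs_minus_commute algebra_simps)
  qed
  ultimately show ?thesis by (simp add: UNIV_bool real_sqrt_mult)
qed

text \<open>Kolmogorov's criterion: summing high moments of all dyadic increments bounds them
  simultaneously.\<close>

lemma AE_holder:
  assumes \<gamma>: "0 < \<gamma>" "\<gamma> < H"
  shows "AE \<omega> in M. \<exists>K\<ge>0. \<forall>s\<in>{-1..2}. \<forall>t\<in>{-1..2}. \<bar>b t \<omega> - b s \<omega>\<bar> \<le> K * \<bar>t - s\<bar> powr \<gamma>"
proof -
  \<comment> \<open>Dyadic points of \<open>[0, 1]\<close> transported to \<open>[-1, 2]\<close>,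
    which contains every window around a time in \<open>[0, 1]\<close> of radius at most 1.\<close>
  define x where "x n j = -1 + 3 * (real j / 2 ^ n)" for n j :: nat
  define q :: real where "q = 2 powr (- \<gamma>)"
  have q: "0 < q" by (simp add: q_def)
  \<comment> \<open>The moment order: a scaled increment has moment of order
    \<open>2 powr (- 2 * p * n * (H - \<gamma>))\<close>, and there are \<open>2 ^ n\<close> of
    them. The requirement \<open>2 * p * (H - \<gamma>) > 1\<close> makes the ratio \<open>r\<close>
    smaller than 1.\<close>
  obtain p :: nat where p: "1 / (2 * (H - \<gamma>)) < real p" using reals_Archimedean2 by blast
  have p1: "1 < 2 * real p * (H - \<gamma>)" using p \<gamma> by (simp add: field_simps)
  define D where "D n j \<omega> = ((b (x n (Suc j)) \<omega> - b (x n j) \<omega>) / q ^ n) ^ (2 * p)" for n j \<omega>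
  have D0: "0 \<le> D n j \<omega>" for n j \<omega> by (simp add: D_def power_mult)
  define S where "S n \<omega> = (\<Sum>j<2 ^ n. D n j \<omega>)" for n \<omega>
  have [measurable]: "S n \<in> borel_measurable M" for n unfolding S_def D_def by measurable
  define c where "c = (sqrt (v2_sq H) * 3 powr H) ^ (2 * p) * (fact (2 * p) / (2 ^ p * fact p))"
  have c0: "0 \<le> c" by (simp add: c_def power_mult)
  define r :: real where "r = 2 powr (1 - 2 * real p * (H - \<gamma>))"
  have r: "0 < r" "r < 1" using p1 by (auto simp: r_def powr_less_one)
  have ED: "integrable M (D n j)" "(\<integral>\<omega>. D n j \<omega> \<partial>M) = c * (r / 2) ^ n" for n j
  proof -
    have xx: "\<bar>x n (Suc j) - x n j\<bar> = 3 / 2 ^ n" by (simp add: x_def field_simps)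
    note G = gaussian_with_std_even_moment[OF gauss_increment[of "x n (Suc j)" "x n j"], of p, unfolded xx]
    have D_eq: "D n j = (\<lambda>\<omega>. (b (x n (Suc j)) \<omega> - b (x n j) \<omega>) ^ (2 * p) / (q ^ n) ^ (2 * p))"
      by (simp add: D_def power_divide fun_eq_iff)
    show "integrable M (D n j)" unfolding D_eq using G(1) by simp
    have "(\<integral>\<omega>. D n j \<omega> \<partial>M) = (sqrt (v2_sq H) * (3 / 2 ^ n) powr H) ^ (2 * p) * (fact (2 * p) / (2 ^ p * fact p)) / (q ^ n) ^ (2 * p)"
      unfolding D_eq using G(2) by simp
    also have "\<dots> = c * (((1 / 2 ^ n) powr H) ^ (2 * p) / (q ^ n) ^ (2 * p))"
    proof -
      have "(3 / 2 ^ n) powr H = 3 powr H * (1 / 2 ^ n) powr H" using powr_mult[of 3 "1 / 2 ^ n" H] by simp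
      then show ?thesis by (simp add: c_def power_mult_distrib)
    qed
    also have "((1 / 2 ^ n) powr H) ^ (2 * p) / (q ^ n) ^ (2 * p) = (r / 2) ^ n"
    proof -
      have "((1 / 2 ^ n :: real) powr H) = 2 powr (- H * real n)"
      proof -
        have "(1 / 2 ^ n :: real) = 2 powr (- real n)" by (simp add: powr_minus powr_realpow inverse_eq_divide)
        then show ?thesis by (simp add: powr_powr mult.commute)
      qed
      then have "((1 / 2 ^ n :: real) powr H) ^ (2 * p) = 2 powr (- H * real n * real (2 * p))"
        by (simp add: powr_powr flip: powr_realpow)
      moreover have "(q ^ n) ^ (2 * p) = 2 powr (- \<gamma> * real n * real (2 * p))"
        unfolding q_def by (simp add: powr_powr flip: powr_realpow)
      moreover have "(r / 2) ^ n = 2 powr ((- 2 * real p * (H - \<gamma>)) * real n)"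
      proof -
        have "r = 2 powr (1 + - 2 * real p * (H - \<gamma>))" by (simp add: r_def)
        also have "\<dots> = 2 powr 1 * 2 powr (- 2 * real p * (H - \<gamma>))" by (rule powr_add)
        finally have "r / 2 = 2 powr (- 2 * real p * (H - \<gamma>))" by simp
        then show ?thesis by (simp add: powr_powr flip: powr_realpow)
      qed
      ultimately show ?thesis by (simp flip: powr_diff) (simp add: algebra_simps)
    qed
    finally show "(\<integral>\<omega>. D n j \<omega> \<partial>M) = c * (r / 2) ^ n" .
  qed
  have ES: "(\<integral>\<^sup>+\<omega>. ennreal (S n \<omega>) \<partial>M) = ennreal (c * r ^ n)" for n
  proof -
    have "(\<integral>\<omega>. S n \<omega> \<partial>M) = 2 ^ n * (c * (r / 2) ^ n)" unfolding S_def using ED by (simp add: Bochner_Integration.integral_sum)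
    also have "\<dots> = c * r ^ n" by (simp add: power_divide)
    finally have "(\<integral>\<omega>. S n \<omega> \<partial>M) = c * r ^ n" .
    moreover have "integrable M (S n)" unfolding S_def using ED by simp
    moreover have "0 \<le> S n \<omega>" for \<omega> unfolding S_def using D0 by (intro sum_nonneg) auto
    ultimately show ?thesis by (subst nn_integral_eq_integral) auto
  qed
  have "(\<integral>\<^sup>+\<omega>. (\<Sum>n. ennreal (S n \<omega>)) \<partial>M) = (\<Sum>n. \<integral>\<^sup>+\<omega>. ennreal (S n \<omega>) \<partial>M)"
    by (intro nn_integral_suminf) measurable
  also have "\<dots> = (\<Sum>n. ennreal (c * r ^ n))" by (simp only: ES)
  also have "\<dots> = ennreal (\<Sum>n. c * r ^ n)"
    using c0 r by (intro suminf_ennreal2 summable_mult summable_geometric) auto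
  also have "\<dots> < \<infinity>" by simp
  finally have "(\<integral>\<^sup>+\<omega>. (\<Sum>n. ennreal (S n \<omega>)) \<partial>M) \<noteq> \<infinity>" by simp
  then have "AE \<omega> in M. (\<Sum>n. ennreal (S n \<omega>)) \<noteq> \<infinity>"
    by (intro nn_integral_PInf_AE) measurable
  then show ?thesis
  proof eventually_elim
    case (elim \<omega>)
    have S0: "0 \<le> S n \<omega>" for n unfolding S_def using D0 by (intro sum_nonneg) auto
    have "summable (\<lambda>n. S n \<omega>)" using elim S0 by (intro summable_suminf_not_top) auto
    then have "Bseq (\<lambda>n. S n \<omega>)" by (intro convergent_imp_Bseq summable_LIMSEQ_zero[THEN convergentI])
    then obtain K where K: "0 < K" "\<And>n. norm (S n \<omega>) \<le> K" unfolding Bseq_def by blast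
    define f where "f s = b (-1 + 3 * s) \<omega>" for s
    have dyadic: "\<bar>f (real (Suc j) / 2 ^ n) - f (real j / 2 ^ n)\<bar> \<le> (1 + K) * (2 powr (- \<gamma>)) ^ n" if "j < 2 ^ n" for n j
    proof -
      define y where "y = \<bar>f (real (Suc j) / 2 ^ n) - f (real j / 2 ^ n)\<bar> / q ^ n"
      have y0: "0 \<le> y" using q by (simp add: y_def)
      have pp: "0 < p" using p1 by (cases p) auto
      have "y ^ (2 * p) = D n j \<omega>" by (simp add: D_def y_def f_def x_def power_divide power_even_abs)
      also have "\<dots> \<le> S n \<omega>" unfolding S_def using that D0 by (intro member_le_sum) auto
      also have "\<dots> \<le> K" using K(2)[of n] by simp
      finally have yK: "y ^ (2 * p) \<le> K" .
      \<comment> \<open>Avoids extracting a root of order \<open>2 * p\<close>: a value above 1 is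
        at most its own power, hence at most \<open>K\<close>.\<close>
      have "y \<le> 1 + K"
      proof (cases "y \<le> 1")
        case False
        then have "y ^ 1 \<le> y ^ (2 * p)" using pp by (intro power_increasing) auto
        then show ?thesis using yK by simp
      qed (use K in simp)
      then have "\<bar>f (real (Suc j) / 2 ^ n) - f (real j / 2 ^ n)\<bar> \<le> (1 + K) * q ^ n"
        using q by (simp add: y_def field_simps)
      then show ?thesis by (simp only: q_def)
    qed
    have cont: "continuous_on {0..1} f" unfolding f_def
      by (rule continuous_on_compose2[OF paths]) (auto intro!: continuous_intros)
    have K1: "0 \<le> 1 + K" using K by simp
    obtain C where C: "0 \<le> C" "\<And>s t. s \<in> {0..1} \<Longrightarrow> t \<in> {0..1} \<Longrightarrow> \<bar>f t - f s\<bar> \<le> C * \<bar>t - s\<bar> powr \<gamma>"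
      using holder_from_dyadic[OF cont \<gamma>(1) K1 dyadic] by blast
    show ?case
    proof (intro exI[of _ "C * (1 / 3) powr \<gamma>"] conjI ballI)
      show "0 \<le> C * (1 / 3) powr \<gamma>" using C by simp
      fix s t :: real assume "s \<in> {-1..2}" "t \<in> {-1..2}"
      then have "\<bar>f ((t + 1) / 3) - f ((s + 1) / 3)\<bar> \<le> C * \<bar>(t + 1) / 3 - (s + 1) / 3\<bar> powr \<gamma>" by (intro C) auto
      moreover have "(t + 1) / 3 - (s + 1) / 3 = 1 / 3 * (t - s)" by (simp add: diff_divide_distrib[symmetric])
      moreover have "f ((y + 1) / 3) = b y \<omega>" for y
      proof -
        have "-1 + 3 * ((y + 1) / 3) = y" by (simp add: add_divide_distrib)
        then show ?thesis by (simp only: f_def)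
      qed
      moreover have "\<bar>1 / 3 * (t - s)\<bar> powr \<gamma> = (1 / 3) powr \<gamma> * \<bar>t - s\<bar> powr \<gamma>"
        unfolding abs_mult by (subst powr_mult) auto
      ultimately show "\<bar>b t \<omega> - b s \<omega>\<bar> \<le> C * (1 / 3) powr \<gamma> * \<bar>t - s\<bar> powr \<gamma>"
        by (simp only: mult.assoc)
    qed
  qed
qed

end

section \<open>Convergence of occupation measures\<close>

text \<open>The hyperbolic cosine is the growth scale because its time averages are known to be
  bounded. One term of the exponential series dominates the power after rounding the exponent
  up.\<close>

lemma abs_powr_le_cosh:
  assumes "0 \<le> a"
  obtains C where "0 < C" "\<And>x::real. \<bar>x\<bar> powr a \<le> C * cosh x"
proof -
  obtain N :: nat where N: "a \<le> real N" using real_arch_simple by blast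
  have "\<bar>x\<bar> powr a \<le> (1 + 2 * fact N) * cosh x" for x :: real
  proof (cases "\<bar>x\<bar> \<le> 1")
    case True
    then have "\<bar>x\<bar> powr a \<le> 1 powr a" using assms by (intro powr_mono2) auto
    also have "\<dots> \<le> (1 + 2 * fact N) * 1" by simp
    also have "\<dots> \<le> (1 + 2 * fact N) * cosh x" using cosh_real_ge_1[of x] by (intro mult_left_mono) auto
    finally show ?thesis .
  next
    case False
    then have "\<bar>x\<bar> powr a \<le> \<bar>x\<bar> powr real N" using N by (intro powr_mono) auto
    also have "\<dots> = \<bar>x\<bar> ^ N" using False by (simp add: powr_realpow)
    also have "\<bar>x\<bar> ^ N \<le> fact N * exp \<bar>x\<bar>"
    proof -
      have "(\<Sum>n\<in>{N}. \<bar>x\<bar> ^ n /\<^sub>R fact n) \<le> (\<Sum>n. \<bar>x\<bar> ^ n /\<^sub>R fact n)"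
        by (intro sum_le_suminf summable_exp_generic) auto
      then show ?thesis by (simp add: exp_def field_simps)
    qed
    also have "exp \<bar>x\<bar> \<le> 2 * cosh x" by (cases "x \<ge> 0") (auto simp: cosh_def)
    finally have "\<bar>x\<bar> powr a \<le> 2 * fact N * cosh x" by simp
    also have "\<dots> \<le> (1 + 2 * fact N) * cosh x" using cosh_real_ge_1[of x] by (intro mult_right_mono) auto
    finally show ?thesis .
  qed
  then show thesis by (rule that[rotated]) (simp add: add_pos_nonneg)
qed

lemma integrable_abs_powr_std_normal:
  assumes "0 \<le> k"
  shows "integrable std_normal (\<lambda>x. \<bar>x\<bar> powr k)"
proof -
  obtain C where C: "0 < C" "\<And>x::real. \<bar>x\<bar> powr k \<le> C * cosh x" using abs_powr_le_cosh[OF assms] by blast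
  show ?thesis
  proof (rule Bochner_Integration.integrable_bound)
    show "integrable std_normal (\<lambda>x. C * cosh x)" using std_normal_cosh(1)[of 1] by simp
  qed (use C in auto)
qed

lemma gaussian_abs_moment_pos:
  assumes "0 \<le> k"
  shows "0 < gaussian_abs_moment k"
proof -
  have "gaussian_abs_moment k \<noteq> 0"
  proof
    assume "gaussian_abs_moment k = 0"
    then have "AE x in std_normal. \<bar>x\<bar> powr k = 0"
      unfolding gaussian_abs_moment_def using integrable_abs_powr_std_normal[OF assms]
      by (subst (asm) integral_nonneg_eq_0_iff_AE) auto
    then have "AE x in lborel. std_normal_density x > 0 \<longrightarrow> \<bar>x\<bar> powr k = 0"
      by (subst (asm) AE_density) auto
    then have "AE x in lborel. (x::real) = 0" by eventually_elim (simp add: normal_density_pos)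
    moreover have "AE x in lborel. (x::real) \<noteq> 0" by (rule AE_lborel_singleton)
    ultimately have "AE x in (lborel :: real measure). False" by eventually_elim simp
    then show False by (simp add: eventually_False ae_filter_eq_bot_iff)
  qed
  moreover have "0 \<le> gaussian_abs_moment k" unfolding gaussian_abs_moment_def by (intro Bochner_Integration.integral_nonneg) auto
  ultimately show ?thesis by simp
qed

text \<open>What is known along the grid for one fixed outcome; everything here is deterministic.
  Frequencies are restricted to \<open>pi * i / R\<close>: they form a countable set, yet for each
  \<open>R\<close> they generate all even continuous functions of period
  \<open>2 * R\<close>.\<close>

locale occupation =
  fixes Z :: "nat \<Rightarrow> real \<Rightarrow> real" and K :: real
  assumes Z_cont: "\<And>n. continuous_on {0..1} (Z n)"
    and Z_cos: "\<And>i R j. 0 < R \<Longrightarrow>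
      (\<lambda>n. integral {0..1} (\<lambda>u. u ^ j * (cos (pi * real i / real R * Z n u) - exp (- ((pi * real i / real R)\<^sup>2) / 2)))) \<longlonglongrightarrow> 0"
    and Z_cosh: "\<And>n. integral {0..1} (\<lambda>u. cosh (Z n u)) \<le> K"
begin

abbreviation E :: "(real \<Rightarrow> real) \<Rightarrow> real" where "E f \<equiv> \<integral>x. f x \<partial>std_normal"

text \<open>Arbitrary continuous weights are built in because the weight of interest is a function
  of the solution itself. Boundedness guarantees a finite Gaussian mean.\<close>

definition good :: "(real \<Rightarrow> real) \<Rightarrow> bool" where
  "good f \<longleftrightarrow> continuous_on UNIV f \<and> (\<exists>B. \<forall>x. \<bar>f x\<bar> \<le> B) \<and>
    (\<forall>w. continuous_on {0..1} w \<longrightarrow> (\<lambda>n. integral {0..1} (\<lambda>u. w u * (f (Z n u) - E f))) \<longlonglongrightarrow> 0)"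

lemma good_integrable: "good f \<Longrightarrow> integrable std_normal f"
proof -
  assume f: "good f"
  interpret N: prob_space std_normal by (rule prob_space_std_normal)
  have "f \<in> borel_measurable borel" using f unfolding good_def by (intro borel_measurable_continuous_onI) auto
  moreover obtain B where "\<And>x. \<bar>f x\<bar> \<le> B" using f unfolding good_def by blast
  ultimately show ?thesis by (intro N.integrable_const_bound[of _ B]) auto
qed

lemma cont_compose_Z:
  fixes f w :: "real \<Rightarrow> real"
  assumes "continuous_on UNIV f" "continuous_on {0..1} w"
  shows "continuous_on {0..1} (\<lambda>u. w u * (f (Z n u) - c))"
  by (intro continuous_intros assms(2) continuous_on_compose2[OF assms(1)] Z_cont) auto

lemma integral_unit_interval_abs_le:
  fixes f g :: "real \<Rightarrow> real"
  assumes "continuous_on {0..1} f" "continuous_on {0..1} g" "\<And>u. u \<in> {0..1} \<Longrightarrow> \<bar>f u\<bar> \<le> g u"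
  shows "\<bar>integral {0..1} f\<bar> \<le> integral {0..1} g"
  using integral_norm_bound_integral[of f "{0..1}" g] assms by (auto intro: integrable_continuous_real)

text \<open>The locale provides monomial weights, hence polynomial ones. Weierstrass approximation
  in time reaches every continuous weight, since the centred cosine is bounded by 2.\<close>

lemma good_cos:
  assumes R: "0 < R"
  shows "good (\<lambda>x. cos (pi * real i / real R * x))"
  unfolding good_def
proof (intro conjI allI impI)
  define t where "t = pi * real i / real R"
  define g where "g n u = cos (t * Z n u) - exp (- (t\<^sup>2) / 2)" for n u
  have Et: "E (\<lambda>x. cos (t * x)) = exp (- (t\<^sup>2) / 2)" using std_normal_cos(2)[of t 1] by simp
  have g_cont: "continuous_on {0..1} (\<lambda>u. w u * g n u)" if "continuous_on {0..1} w" for w n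
    unfolding g_def by (intro continuous_intros that Z_cont)
  have g_bound: "\<bar>g n u\<bar> \<le> 2" for n u
  proof -
    have "\<bar>cos (t * Z n u)\<bar> \<le> 1" "exp (- (t\<^sup>2) / 2) \<le> 1" "0 < exp (- (t\<^sup>2) / 2)" by auto
    then show ?thesis unfolding g_def by linarith
  qed
  fix w :: "real \<Rightarrow> real" assume w: "continuous_on {0..1} w"
  show "(\<lambda>n. integral {0..1} (\<lambda>u. w u * (cos (pi * real i / real R * Z n u) - E (\<lambda>x. cos (pi * real i / real R * x))))) \<longlonglongrightarrow> 0"
    unfolding t_def[symmetric] Et g_def[symmetric]
  proof (rule LIMSEQ_I)
    fix e :: real assume e: "0 < e"
    obtain p where p: "real_polynomial_function p" "\<And>u. u \<in> {0..1} \<Longrightarrow> \<bar>w u - p u\<bar> < e / 4"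
      using Stone_Weierstrass_real_polynomial_function[OF compact_Icc w, of "e / 4"] e by auto
    obtain a N where aN: "p = (\<lambda>u. \<Sum>j\<le>N. a j * u ^ j)" using p(1) real_polynomial_function_iff_sum by blast
    have p_cont: "continuous_on {0..1} p" unfolding aN by (intro continuous_intros)
    have mono_int: "(\<lambda>u. u ^ j * g n u) integrable_on {0..1}" for j n
      by (intro integrable_continuous_real g_cont continuous_intros)
    have "integral {0..1} (\<lambda>u. p u * g n u) = (\<Sum>j\<le>N. a j * integral {0..1} (\<lambda>u. u ^ j * g n u))" for n
    proof -
      have "((\<lambda>u. \<Sum>j\<le>N. a j * (u ^ j * g n u)) has_integral (\<Sum>j\<le>N. a j * integral {0..1} (\<lambda>u. u ^ j * g n u))) {0..1}"
        by (intro has_integral_sum has_integral_mult_right integrable_integral mono_int) auto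
      then show ?thesis by (simp add: aN sum_distrib_right mult.assoc integral_unique)
    qed
    moreover have "(\<lambda>n. \<Sum>j\<le>N. a j * integral {0..1} (\<lambda>u. u ^ j * g n u)) \<longlonglongrightarrow> (\<Sum>j\<le>N. a j * 0)"
      unfolding g_def t_def by (intro tendsto_sum tendsto_mult tendsto_const Z_cos R)
    ultimately have "(\<lambda>n. integral {0..1} (\<lambda>u. p u * g n u)) \<longlonglongrightarrow> 0" by simp
    from LIMSEQ_D[OF this, of "e / 2"] e obtain n0 where n0: "\<And>n. n \<ge> n0 \<Longrightarrow> \<bar>integral {0..1} (\<lambda>u. p u * g n u)\<bar> < e / 2" by auto
    show "\<exists>no. \<forall>n\<ge>no. norm (integral {0..1} (\<lambda>u. w u * g n u) - 0) < e"
    proof (intro exI[of _ n0] allI impI)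
      fix n assume n: "n0 \<le> n"
      have "integral {0..1} (\<lambda>u. w u * g n u) - integral {0..1} (\<lambda>u. p u * g n u) = integral {0..1} (\<lambda>u. (w u - p u) * g n u)"
        using Henstock_Kurzweil_Integration.integral_diff[OF integrable_continuous_real[OF g_cont[OF w]] integrable_continuous_real[OF g_cont[OF p_cont]]]
        by (simp add: left_diff_distrib)
      moreover have "\<bar>integral {0..1} (\<lambda>u. (w u - p u) * g n u)\<bar> \<le> integral {0..1} (\<lambda>u::real. e / 4 * 2)"
      proof (rule integral_unit_interval_abs_le)
        show "continuous_on {0..1} (\<lambda>u. (w u - p u) * g n u)" by (intro g_cont continuous_intros w p_cont)
        fix u :: real assume "u \<in> {0..1}"
        then show "\<bar>(w u - p u) * g n u\<bar> \<le> e / 4 * 2"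
          unfolding abs_mult using p(2)[of u] g_bound[of n u] e by (intro mult_mono) auto
      qed (intro continuous_intros)
      ultimately show "norm (integral {0..1} (\<lambda>u. w u * g n u) - 0) < e" using n0[OF n] by simp
    qed
  qed
qed (use R in \<open>auto intro!: continuous_intros exI[of _ 1]\<close>)

lemma good_lincomb:
  assumes f: "good f" and g: "good g"
  shows "good (\<lambda>x. a * f x + c * g x)"
  unfolding good_def
proof (intro conjI allI impI)
  show "continuous_on UNIV (\<lambda>x. a * f x + c * g x)" using f g unfolding good_def by (intro continuous_intros) auto
  obtain B B' where "\<And>x. \<bar>f x\<bar> \<le> B" "\<And>x. \<bar>g x\<bar> \<le> B'" using f g unfolding good_def by blast
  then have "\<bar>a * f x + c * g x\<bar> \<le> \<bar>a\<bar> * B + \<bar>c\<bar> * B'" for x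
    by (intro order_trans[OF abs_triangle_ineq] add_mono) (simp_all add: abs_mult mult_left_mono)
  then show "\<exists>B. \<forall>x. \<bar>a * f x + c * g x\<bar> \<le> B" by blast
  fix w :: "real \<Rightarrow> real" assume w: "continuous_on {0..1} w"
  have E: "E (\<lambda>x. a * f x + c * g x) = a * E f + c * E g" using good_integrable[OF f] good_integrable[OF g] by simp
  have "integral {0..1} (\<lambda>u. w u * (a * f (Z n u) + c * g (Z n u) - (a * E f + c * E g))) =
      a * integral {0..1} (\<lambda>u. w u * (f (Z n u) - E f)) + c * integral {0..1} (\<lambda>u. w u * (g (Z n u) - E g))" for n
  proof -
    have "((\<lambda>u. a * (w u * (f (Z n u) - E f)) + c * (w u * (g (Z n u) - E g))) has_integral
        (a * integral {0..1} (\<lambda>u. w u * (f (Z n u) - E f)) + c * integral {0..1} (\<lambda>u. w u * (g (Z n u) - E g)))) {0..1}"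
      using f g unfolding good_def
      by (intro has_integral_add has_integral_mult_right integrable_integral integrable_continuous_real cont_compose_Z w) auto
    moreover have "(\<lambda>u. a * (w u * (f (Z n u) - E f)) + c * (w u * (g (Z n u) - E g))) =
        (\<lambda>u. w u * (a * f (Z n u) + c * g (Z n u) - (a * E f + c * E g)))"
      by (simp add: fun_eq_iff algebra_simps)
    ultimately show ?thesis by (simp add: integral_unique)
  qed
  moreover have "(\<lambda>n. a * integral {0..1} (\<lambda>u. w u * (f (Z n u) - E f)) + c * integral {0..1} (\<lambda>u. w u * (g (Z n u) - E g))) \<longlonglongrightarrow> a * 0 + c * 0"
    using f g w unfolding good_def by (intro tendsto_intros) auto
  ultimately show "(\<lambda>n. integral {0..1} (\<lambda>u. w u * (a * f (Z n u) + c * g (Z n u) - E (\<lambda>x. a * f x + c * g x)))) \<longlonglongrightarrow> 0"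
    unfolding E by simp
qed

text \<open>Carrying the extra factor of frequency \<open>i\<close> makes the induction on the power
  close: one more cosine splits into the frequencies \<open>i + 1\<close> and \<open>i - 1\<close>.
  For \<open>i = 0\<close> the latter is replaced by 1, by evenness.\<close>

lemma good_cos_power_times_cos:
  assumes R: "0 < R"
  shows "good (\<lambda>x. cos (pi / real R * x) ^ l * cos (real i * (pi / real R * x)))"
proof (induction l arbitrary: i)
  case 0
  then show ?case using good_cos[OF R, of i] by (simp add: mult_ac)
next
  case (Suc l)
  have "cos y ^ Suc l * cos (real i * y) = 1 / 2 * (cos y ^ l * cos (real (Suc i) * y)) + 1 / 2 * (cos y ^ l * cos (real (if i = 0 then 1 else i - 1) * y))" for y :: real
  proof -
    have "cos y * cos (real i * y) = (cos (real i * y + y) + cos (real i * y - y)) / 2"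
      by (simp add: cos_add cos_diff)
    moreover have "real i * y + y = real (Suc i) * y" by (simp add: algebra_simps)
    moreover have "cos (real i * y - y) = cos (real (if i = 0 then 1 else i - 1) * y)"
      by (cases i) (auto simp: algebra_simps)
    ultimately have "cos y * cos (real i * y) = (cos (real (Suc i) * y) + cos (real (if i = 0 then 1 else i - 1) * y)) / 2" by simp
    then have "cos y ^ l * (cos y * cos (real i * y)) = cos y ^ l * ((cos (real (Suc i) * y) + cos (real (if i = 0 then 1 else i - 1) * y)) / 2)" by simp
    then show ?thesis by (simp only: power_Suc2 mult.assoc) (simp add: field_simps)
  qed
  then show ?case using good_lincomb[OF Suc[of "Suc i"] Suc[of "if i = 0 then 1 else i - 1"], of "1 / 2" "1 / 2"] by (simp only:)
qed

lemma good_polynomial_cos: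
  assumes R: "0 < R"
  shows "good (\<lambda>x. \<Sum>l\<le>N. a l * cos (pi / real R * x) ^ l)"
proof (induction N)
  case 0
  show ?case using good_lincomb[OF good_cos_power_times_cos[OF R, of 0 0] good_cos_power_times_cos[OF R, of 0 0], of "a 0" 0] by simp
next
  case (Suc N)
  show ?case using good_lincomb[OF Suc good_cos_power_times_cos[OF R, of "Suc N" 0], of 1 "a (Suc N)"] by simp
qed

text \<open>Approximation up to \<open>e * cosh\<close> suffices even for unbounded
  \<open>f\<close>: time averages of \<open>cosh\<close> are at most \<open>K\<close> and its
  Gaussian mean is \<open>exp (1 / 2)\<close>, so the error is at most \<open>e\<close> times a
  constant on both sides. This determines \<open>D\<close>.\<close>

lemma approximation_limit:
  fixes f w :: "real \<Rightarrow> real"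
  assumes f: "continuous_on UNIV f" "integrable std_normal f" and w: "continuous_on {0..1} w"
    and G: "\<And>e. 0 < e \<Longrightarrow> \<exists>g. good g \<and> (\<forall>x. \<bar>f x - g x\<bar> \<le> e * cosh x)"
  shows "(\<lambda>n. integral {0..1} (\<lambda>u. w u * (f (Z n u) - E f))) \<longlonglongrightarrow> 0"
proof (rule LIMSEQ_I)
  fix r :: real assume r: "0 < r"
  have "bounded (w ` {0..1})" using w by (intro compact_imp_bounded compact_continuous_image) auto
  then obtain W' where "\<forall>y\<in>w ` {0..1}. norm y \<le> W'" by (auto simp: bounded_iff)
  then have W': "\<And>u. u \<in> {0..1} \<Longrightarrow> \<bar>w u\<bar> \<le> W'" by auto
  define W where "W = \<bar>W'\<bar> + 1"
  have W: "0 < W" "\<And>u. u \<in> {0..1} \<Longrightarrow> \<bar>w u\<bar> \<le> W" using W' by (auto simp: W_def intro: order_trans[OF W'])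
  define D where "D = \<bar>K\<bar> + exp (1 / 2)"
  have D: "0 < D" by (simp add: D_def add_nonneg_pos)
  define e where "e = r / (2 * (W * D))"
  have e: "0 < e" using r W D by (simp add: e_def)
  obtain g where g: "good g" "\<And>x. \<bar>f x - g x\<bar> \<le> e * cosh x" using G[OF e] by blast
  have "(\<lambda>n. integral {0..1} (\<lambda>u. w u * (g (Z n u) - E g))) \<longlonglongrightarrow> 0" using g(1) w unfolding good_def by blast
  from LIMSEQ_D[OF this, of "r / 2"] r obtain n0 where n0: "\<And>n. n \<ge> n0 \<Longrightarrow> \<bar>integral {0..1} (\<lambda>u. w u * (g (Z n u) - E g))\<bar> < r / 2" by auto
  have gc: "continuous_on UNIV g" using g(1) by (simp add: good_def)
  have "\<bar>E f - E g\<bar> = \<bar>E (\<lambda>x. f x - g x)\<bar>" using f(2) good_integrable[OF g(1)] by simp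
  also have "\<dots> \<le> E (\<lambda>x. \<bar>f x - g x\<bar>)" by (rule integral_abs_bound)
  also have "\<dots> \<le> E (\<lambda>x. e * cosh x)"
    using f(2) good_integrable[OF g(1)] std_normal_cosh(1)[of 1] g(2) by (intro integral_mono) auto
  also have "\<dots> = e * exp (1 / 2)" using std_normal_cosh[of 1] by simp
  finally have EE: "\<bar>E f - E g\<bar> \<le> e * exp (1 / 2)" .
  show "\<exists>no. \<forall>n\<ge>no. norm (integral {0..1} (\<lambda>u. w u * (f (Z n u) - E f)) - 0) < r"
  proof (intro exI[of _ n0] allI impI)
    fix n assume n: "n0 \<le> n"
    have "integral {0..1} (\<lambda>u. w u * (f (Z n u) - E f)) - integral {0..1} (\<lambda>u. w u * (g (Z n u) - E g))
        = integral {0..1} (\<lambda>u. w u * (f (Z n u) - E f) - w u * (g (Z n u) - E g))"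
      by (intro Henstock_Kurzweil_Integration.integral_diff[symmetric] integrable_continuous_real cont_compose_Z f(1) gc w)
    moreover have "\<bar>integral {0..1} (\<lambda>u. w u * (f (Z n u) - E f) - w u * (g (Z n u) - E g))\<bar> \<le> integral {0..1} (\<lambda>u. (W * e) * cosh (Z n u) + W * (e * exp (1 / 2)))"
    proof (rule integral_unit_interval_abs_le)
      show "continuous_on {0..1} (\<lambda>u. w u * (f (Z n u) - E f) - w u * (g (Z n u) - E g))"
        by (intro continuous_on_diff cont_compose_Z f(1) gc w)
      show "continuous_on {0..1} (\<lambda>u. W * e * cosh (Z n u) + W * (e * exp (1 / 2)))"
        by (intro continuous_intros Z_cont)
      fix u :: real assume u: "u \<in> {0..1}"
      have "w u * (f (Z n u) - E f) - w u * (g (Z n u) - E g) = w u * ((f (Z n u) - g (Z n u)) - (E f - E g))"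
        by (simp add: algebra_simps)
      then have "\<bar>w u * (f (Z n u) - E f) - w u * (g (Z n u) - E g)\<bar> = \<bar>w u\<bar> * \<bar>(f (Z n u) - g (Z n u)) - (E f - E g)\<bar>"
        by (simp add: abs_mult)
      also have "\<dots> \<le> W * (e * cosh (Z n u) + e * exp (1 / 2))"
        using W(2)[OF u] W(1) abs_triangle_ineq4[of "f (Z n u) - g (Z n u)" "E f - E g"] g(2)[of "Z n u"] EE by (intro mult_mono) auto
      finally show "\<bar>w u * (f (Z n u) - E f) - w u * (g (Z n u) - E g)\<bar> \<le> W * e * cosh (Z n u) + W * (e * exp (1 / 2))"
        by (simp add: algebra_simps)
    qed
    moreover have "integral {0..1} (\<lambda>u. (W * e) * cosh (Z n u) + W * (e * exp (1 / 2))) \<le> r / 2"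
    proof -
      have ci: "(\<lambda>u. cosh (Z n u)) integrable_on {0..1}" by (intro integrable_continuous_real continuous_intros Z_cont)
      have cc: "((\<lambda>u. W * (e * exp (1 / 2))) has_integral W * (e * exp (1 / 2))) {0..1::real}"
        using has_integral_const_real[of "W * (e * exp (1 / 2))" 0 1] by simp
      have "((\<lambda>u. (W * e) * cosh (Z n u) + W * (e * exp (1 / 2))) has_integral
          ((W * e) * integral {0..1} (\<lambda>u. cosh (Z n u)) + W * (e * exp (1 / 2)))) {0..1}"
        by (rule has_integral_add[OF has_integral_mult_right[OF integrable_integral[OF ci]] cc])
      then have "integral {0..1} (\<lambda>u. (W * e) * cosh (Z n u) + W * (e * exp (1 / 2))) = (W * e) * integral {0..1} (\<lambda>u. cosh (Z n u)) + W * (e * exp (1 / 2))"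
        by (rule integral_unique)
      also have "\<dots> \<le> (W * e) * \<bar>K\<bar> + W * (e * exp (1 / 2))" using Z_cosh[of n] W e by (intro add_mono mult_left_mono) auto
      also have "\<dots> = W * D * e" by (simp add: D_def algebra_simps)
      also have "\<dots> = r / 2" using W D by (simp add: e_def)
      finally show ?thesis .
    qed
    ultimately show "norm (integral {0..1} (\<lambda>u. w u * (f (Z n u) - E f)) - 0) < r" using n0[OF n] by simp
  qed
qed

text \<open>On \<open>[-R, R]\<close> the function \<open>\<bar>x\<bar> powr k\<close> agrees with a continuous function of \<open>cos (pi * x / R)\<close>,
  which is uniformly close to a polynomial in that cosine.\<close>

theorem abs_powr_limit:
  assumes k: "1 \<le> k" and w: "continuous_on {0..1} w"
  shows "(\<lambda>n. integral {0..1} (\<lambda>u. w u * \<bar>Z n u\<bar> powr k)) \<longlonglongrightarrow> gaussian_abs_moment k * integral {0..1} w"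
proof -
  have kc: "continuous_on UNIV (\<lambda>x::real. \<bar>x\<bar> powr k)" using k by (intro continuous_on_powr' continuous_intros) auto
  have "(\<lambda>n. integral {0..1} (\<lambda>u. w u * (\<bar>Z n u\<bar> powr k - E (\<lambda>x. \<bar>x\<bar> powr k)))) \<longlonglongrightarrow> 0"
  proof (rule approximation_limit[OF kc _ w])
    show "integrable std_normal (\<lambda>x. \<bar>x\<bar> powr k)" using k by (intro integrable_abs_powr_std_normal) auto
    fix e :: real assume e: "0 < e"
    obtain C where C: "0 < C" "\<And>x::real. \<bar>x\<bar> powr (k + 1) \<le> C * cosh x" using abs_powr_le_cosh[of "k + 1"] k by auto
    \<comment> \<open>Outside \<open>[-R, R]\<close> the power is at most
      \<open>\<bar>x\<bar> powr (k + 1) / R\<close>, hence at most \<open>C / R * cosh x\<close>;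
      this choice of \<open>R\<close> brings \<open>C / R\<close> below
      \<open>e / 2\<close>.\<close>
    obtain R :: nat where R: "2 * C / e + 1 < real R" using reals_Archimedean2 by blast
    have R0: "0 < real R" using R C e by (smt (verit) divide_pos_pos)
    \<comment> \<open>Since \<open>arccos\<close> inverts the cosine on \<open>[0, pi]\<close>,
      \<open>q (cos (pi * x / R))\<close> equals \<open>\<bar>x\<bar> powr k\<close> for
      \<open>\<bar>x\<bar> \<le> R\<close>. Elsewhere it is the periodic extension, with values
      between 0 and \<open>R powr k\<close>.\<close>
    define q where "q y = \<bar>real R / pi * arccos y\<bar> powr k" for y
    have "continuous_on {-1..1} q" unfolding q_def
      using k by (intro continuous_on_powr' continuous_intros continuous_on_arccos') auto
    then obtain p where p: "real_polynomial_function p" "\<And>y. y \<in> {-1..1} \<Longrightarrow> \<bar>q y - p y\<bar> < e / 2"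
      using Stone_Weierstrass_real_polynomial_function[OF compact_Icc, of "-1" 1 q "e / 2"] e by auto
    obtain a N where aN: "p = (\<lambda>u. \<Sum>j\<le>N. a j * u ^ j)" using p(1) real_polynomial_function_iff_sum by blast
    have "\<bar>\<bar>x\<bar> powr k - p (cos (pi / real R * x))\<bar> \<le> e * cosh x" for x
    proof -
      define y where "y = pi / real R * x"
      have c1: "1 \<le> cosh x" by (rule cosh_real_ge_1)
      have py: "\<bar>q (cos y) - p (cos y)\<bar> \<le> e / 2" using p(2)[of "cos y"] by (auto intro: less_imp_le)
      have "\<bar>\<bar>x\<bar> powr k - q (cos y)\<bar> \<le> e / 2 * cosh x"
      proof (cases "\<bar>x\<bar> \<le> real R")
        case True
        have "\<bar>y\<bar> = pi * (\<bar>x\<bar> / real R)" using R0 by (simp add: y_def abs_mult)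
        also have "\<dots> \<le> pi * 1" using True R0 by (intro mult_left_mono) auto
        finally have "arccos (cos y) = \<bar>y\<bar>" using arccos_cos[of "\<bar>y\<bar>"] by simp
        then have "q (cos y) = \<bar>x\<bar> powr k" using R0 by (simp add: q_def y_def abs_mult)
        then show ?thesis using e c1 by simp
      next
        case False
        have "0 \<le> arccos (cos y)" "arccos (cos y) \<le> pi" by (auto intro: arccos_lbound arccos_ubound)
        then have "\<bar>real R / pi * arccos (cos y)\<bar> \<le> real R / pi * pi" using R0 by (simp only: abs_mult) (intro mult_mono, auto)
        then have "q (cos y) \<le> real R powr k" unfolding q_def using k by (intro powr_mono2) auto
        also have "\<dots> \<le> \<bar>x\<bar> powr k" using False k by (intro powr_mono2) auto
        finally have "\<bar>\<bar>x\<bar> powr k - q (cos y)\<bar> \<le> \<bar>x\<bar> powr k" by (simp add: q_def)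
        also have "\<dots> \<le> C / real R * cosh x"
        proof -
          have "real R * \<bar>x\<bar> powr k \<le> \<bar>x\<bar> * \<bar>x\<bar> powr k" using False by (intro mult_right_mono) auto
          also have "\<dots> = \<bar>x\<bar> powr (k + 1)" using False R0 by (subst powr_mult_base) (auto simp: add.commute)
          also have "\<dots> \<le> C * cosh x" by (rule C(2))
          finally show ?thesis using R0 by (simp add: field_simps)
        qed
        also have "\<dots> \<le> e / 2 * cosh x"
        proof (rule mult_right_mono)
          have "2 * C / e < real R" using R by simp
          then show "C / real R \<le> e / 2" using e R0 by (simp add: field_simps)
        qed (use c1 in simp)
        finally show ?thesis .
      qed
      moreover have "e / 2 * 1 \<le> e / 2 * cosh x" using e c1 by (intro mult_left_mono) auto
      moreover have "\<bar>\<bar>x\<bar> powr k - p (cos y)\<bar> \<le> \<bar>\<bar>x\<bar> powr k - q (cos y)\<bar> + \<bar>q (cos y) - p (cos y)\<bar>"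
        using abs_triangle_ineq[of "\<bar>x\<bar> powr k - q (cos y)" "q (cos y) - p (cos y)"] by simp
      ultimately have "\<bar>\<bar>x\<bar> powr k - p (cos y)\<bar> \<le> e / 2 * cosh x + e / 2 * cosh x" using py by simp
      then show ?thesis unfolding y_def by simp
    qed
    moreover have "good (\<lambda>x. p (cos (pi / real R * x)))" unfolding aN using R0 by (intro good_polynomial_cos) auto
    ultimately show "\<exists>g. good g \<and> (\<forall>x. \<bar>\<bar>x\<bar> powr k - g x\<bar> \<le> e * cosh x)" by blast
  qed
  then have "(\<lambda>n. integral {0..1} (\<lambda>u. w u * (\<bar>Z n u\<bar> powr k - gaussian_abs_moment k)) + gaussian_abs_moment k * integral {0..1} w)
      \<longlonglongrightarrow> 0 + gaussian_abs_moment k * integral {0..1} w"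
    unfolding gaussian_abs_moment_def by (intro tendsto_add tendsto_const)
  moreover have "integral {0..1} (\<lambda>u. w u * (\<bar>Z n u\<bar> powr k - gaussian_abs_moment k)) + gaussian_abs_moment k * integral {0..1} w =
      integral {0..1} (\<lambda>u. w u * \<bar>Z n u\<bar> powr k)" for n
  proof -
    have "((\<lambda>u. w u * (\<bar>Z n u\<bar> powr k - gaussian_abs_moment k) + gaussian_abs_moment k * w u) has_integral
        (integral {0..1} (\<lambda>u. w u * (\<bar>Z n u\<bar> powr k - gaussian_abs_moment k)) + gaussian_abs_moment k * integral {0..1} w)) {0..1}"
      by (intro has_integral_add has_integral_mult_right integrable_integral integrable_continuous_real cont_compose_Z[OF kc w] w)
    then show ?thesis by (simp add: algebra_simps integral_unique)
  qed
  ultimately show ?thesis by simp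
qed

end

section \<open>Derivatives of the smoothed solution\<close>

text \<open>Convolution at scale \<epsilon> after the substitution that fixes the domain to
  \<open>[-1, 1]\<close>, as a gauge integral. It serves both for \<phi> and for its second
  derivative.\<close>

definition kernel_average :: "(real \<Rightarrow> real) \<Rightarrow> (real \<Rightarrow> real) \<Rightarrow> real \<Rightarrow> real \<Rightarrow> real" where
  "kernel_average \<theta> x \<epsilon> u = integral {-1..1} (\<lambda>v. \<theta> v * x (u - \<epsilon> * v))"

lemma kernel_average_eq_convolution:
  fixes \<theta> x :: "real \<Rightarrow> real"
  assumes \<theta>: "continuous_on UNIV \<theta>" "\<And>v. 1 \<le> \<bar>v\<bar> \<Longrightarrow> \<theta> v = 0" and x: "continuous_on UNIV x" and \<epsilon>: "0 < \<epsilon>"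
  shows "(\<integral>v. \<theta> ((u - v) / \<epsilon>) * x v \<partial>lborel) = \<epsilon> * kernel_average \<theta> x \<epsilon> u"
proof -
  have "(\<integral>v. \<theta> ((u - v) / \<epsilon>) * x v \<partial>lborel) = \<bar>- \<epsilon>\<bar> *\<^sub>R (\<integral>w. \<theta> ((u - (u + (- \<epsilon>) * w)) / \<epsilon>) * x (u + (- \<epsilon>) * w) \<partial>lborel)"
    using \<epsilon> by (intro lborel_integral_real_affine) auto
  also have "\<dots> = \<epsilon> * (\<integral>w. \<theta> w * x (u - \<epsilon> * w) \<partial>lborel)" using \<epsilon> by simp
  also have "(\<integral>w. \<theta> w * x (u - \<epsilon> * w) \<partial>lborel) = kernel_average \<theta> x \<epsilon> u"
    unfolding kernel_average_def
  proof (rule lborel_integral_supported(2))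
    show "continuous_on {-1..1} (\<lambda>w. \<theta> w * x (u - \<epsilon> * w))"
      by (intro continuous_intros continuous_on_compose2[OF \<theta>(1)] continuous_on_compose2[OF x]) auto
    fix w :: real assume "w \<notin> {-1..1}"
    then have "1 \<le> \<bar>w\<bar>" by auto
    then show "\<theta> w * x (u - \<epsilon> * w) = 0" using \<theta>(2) by simp
  qed
  finally show ?thesis .
qed

text \<open>The derivative has to fall on the kernel, as \<open>x\<close> is merely continuous. For
  \<open>u\<close> within distance 1 of \<open>u\<^sub>0\<close> the integrand is supported in the
  fixed interval \<open>[-L, L]\<close>, so differentiation under the integral applies.\<close>

lemma DERIV_convolution:
  fixes \<theta> \<theta>' x :: "real \<Rightarrow> real"
  assumes der: "\<And>v. (\<theta> has_real_derivative \<theta>' v) (at v)" and cont: "continuous_on UNIV \<theta>'"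
    and supp: "\<And>v. 1 \<le> \<bar>v\<bar> \<Longrightarrow> \<theta> v = 0" "\<And>v. 1 \<le> \<bar>v\<bar> \<Longrightarrow> \<theta>' v = 0"
    and x: "continuous_on UNIV x" and \<epsilon>: "0 < \<epsilon>"
  shows "((\<lambda>u. \<integral>v. \<theta> ((u - v) / \<epsilon>) * x v \<partial>lborel) has_real_derivative
    (\<integral>v. \<theta>' ((u\<^sub>0 - v) / \<epsilon>) * x v \<partial>lborel) / \<epsilon>) (at u\<^sub>0)"
proof -
  have \<theta>_cont: "continuous_on UNIV \<theta>" using der by (intro continuous_at_imp_continuous_on ballI DERIV_isCont)
  note [continuous_intros] = continuous_on_compose2[OF \<theta>_cont] continuous_on_compose2[OF cont] continuous_on_compose2[OF x]
  define L where "L = \<bar>u\<^sub>0\<bar> + 1 + \<epsilon>"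
  have conv: "(\<integral>v. \<tau> ((u - v) / \<epsilon>) * x v \<partial>lborel) = integral (cbox (- L) L) (\<lambda>v. \<tau> ((u - v) / \<epsilon>) * x v)"
    if \<tau>: "continuous_on UNIV \<tau>" "\<And>v. 1 \<le> \<bar>v\<bar> \<Longrightarrow> \<tau> v = 0" and u: "u \<in> ball u\<^sub>0 1" for \<tau> u
    unfolding box_real
  proof (rule lborel_integral_supported(2))
    show "continuous_on {- L..L} (\<lambda>v. \<tau> ((u - v) / \<epsilon>) * x v)"
      using \<epsilon> by (intro continuous_intros continuous_on_compose2[OF \<tau>(1)]) auto
    fix v assume "v \<notin> {- L..L}"
    then have "\<epsilon> \<le> \<bar>u - v\<bar>" using u by (auto simp: L_def dist_real_def)
    then have "1 \<le> \<bar>(u - v) / \<epsilon>\<bar>" using \<epsilon> by simp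
    then show "\<tau> ((u - v) / \<epsilon>) * x v = 0" using \<tau>(2) by simp
  qed
  have "((\<lambda>u. integral (cbox (- L) L) (\<lambda>v. \<theta> ((u - v) / \<epsilon>) * x v)) has_field_derivative
      integral (cbox (- L) L) (\<lambda>v. \<theta>' ((u\<^sub>0 - v) / \<epsilon>) / \<epsilon> * x v)) (at u\<^sub>0 within ball u\<^sub>0 1)"
  proof (rule leibniz_rule_field_derivative)
    fix u v
    show "((\<lambda>u. \<theta> ((u - v) / \<epsilon>) * x v) has_field_derivative \<theta>' ((u - v) / \<epsilon>) / \<epsilon> * x v) (at u within ball u\<^sub>0 1)"
    proof -
      have "((\<lambda>u. (u - v) / \<epsilon>) has_real_derivative 1 / \<epsilon>) (at u within ball u\<^sub>0 1)"
        using \<epsilon> by (auto intro!: derivative_eq_intros)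
      from DERIV_cmult_right[OF DERIV_chain2[OF der this], of "x v"] show ?thesis by simp
    qed
  next
    show "(\<lambda>v. \<theta> ((u - v) / \<epsilon>) * x v) integrable_on cbox (- L) L" for u
      using \<epsilon> by (intro integrable_continuous continuous_intros) auto
    show "continuous_on (ball u\<^sub>0 1 \<times> cbox (- L) L) (\<lambda>(u, v). \<theta>' ((u - v) / \<epsilon>) / \<epsilon> * x v)"
      unfolding split_beta using \<epsilon> by (intro continuous_intros) auto
  qed auto
  then have "((\<lambda>u. integral (cbox (- L) L) (\<lambda>v. \<theta> ((u - v) / \<epsilon>) * x v)) has_field_derivative
      (\<integral>v. \<theta>' ((u\<^sub>0 - v) / \<epsilon>) * x v \<partial>lborel) / \<epsilon>) (at u\<^sub>0)"
  proof -
    have "(\<lambda>v. \<theta>' ((u\<^sub>0 - v) / \<epsilon>) / \<epsilon> * x v) = (\<lambda>v. \<theta>' ((u\<^sub>0 - v) / \<epsilon>) * x v / \<epsilon>)" by auto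
    moreover have "at u\<^sub>0 within ball u\<^sub>0 1 = at u\<^sub>0" by (rule at_within_open) auto
    moreover have "u\<^sub>0 \<in> ball u\<^sub>0 1" by simp
    ultimately show "((\<lambda>u. integral (cbox (- L) L) (\<lambda>v. \<theta> ((u - v) / \<epsilon>) * x v)) has_field_derivative
      integral (cbox (- L) L) (\<lambda>v. \<theta>' ((u\<^sub>0 - v) / \<epsilon>) / \<epsilon> * x v)) (at u\<^sub>0 within ball u\<^sub>0 1) \<Longrightarrow> ?thesis"
      using conv[OF cont supp(2), of u\<^sub>0] by (simp only: Henstock_Kurzweil_Integration.integral_divide)
  qed
  then show ?thesis
    by (rule has_field_derivative_transform_within_open[where S = "ball u\<^sub>0 1"])
       (use conv[OF \<theta>_cont supp(1)] in auto)
qed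

text \<open>Count of the powers of \<epsilon>: one inverse power from the normalization of the
  kernel, one from each derivative, and one power regained by the substitution.\<close>

lemma
  assumes \<phi>: "smoothing_kernel \<phi>" and x: "continuous_on UNIV x" and \<epsilon>: "0 < \<epsilon>"
  shows smoothed_eq_kernel_average: "smoothed \<phi> \<epsilon> x u = kernel_average \<phi> x \<epsilon> u"
    and smoothed_second_deriv: "(deriv ^^ 2) (smoothed \<phi> \<epsilon> x) u = kernel_average (deriv (deriv \<phi>)) x \<epsilon> u / \<epsilon>\<^sup>2"
proof -
  note k = smoothing_kernelD[OF \<phi>]
  define J where "J \<theta> u = (\<integral>v. \<theta> ((u - v) / \<epsilon>) * x v \<partial>lborel)" for \<theta> u
  have sm: "smoothed \<phi> \<epsilon> x = (\<lambda>u. J \<phi> u / \<epsilon>)"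
  proof
    fix u
    have "smoothed \<phi> \<epsilon> x u = (\<integral>v. (1 / \<epsilon>) * (\<phi> ((u - v) / \<epsilon>) * x v) \<partial>lborel)"
      by (simp add: smoothed_def convolve_def rescaled_def mult.assoc)
    also have "\<dots> = J \<phi> u / \<epsilon>" unfolding J_def by (subst integral_mult_right_zero) simp
    finally show "smoothed \<phi> \<epsilon> x u = J \<phi> u / \<epsilon>" .
  qed
  show "smoothed \<phi> \<epsilon> x u = kernel_average \<phi> x \<epsilon> u"
    using kernel_average_eq_convolution[OF k(3,6) x \<epsilon>, of u] \<epsilon> by (simp add: sm J_def)
  have d1: "(J \<phi> has_real_derivative J (deriv \<phi>) u / \<epsilon>) (at u)" for u
    unfolding J_def by (rule DERIV_convolution[OF k(1,4,6,7) x \<epsilon>])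
  have d2: "(J (deriv \<phi>) has_real_derivative J (deriv (deriv \<phi>)) u / \<epsilon>) (at u)" for u
    unfolding J_def by (rule DERIV_convolution[OF k(2,5,7,8) x \<epsilon>])
  have "deriv (smoothed \<phi> \<epsilon> x) = (\<lambda>u. J (deriv \<phi>) u / \<epsilon> / \<epsilon>)"
    unfolding sm by (intro ext DERIV_imp_deriv DERIV_cdivide d1)
  then have "deriv (deriv (smoothed \<phi> \<epsilon> x)) u = deriv (\<lambda>u. J (deriv \<phi>) u / \<epsilon> / \<epsilon>) u"
    by (simp only:)
  also have "\<dots> = J (deriv (deriv \<phi>)) u / \<epsilon> / \<epsilon> / \<epsilon>"
    by (intro DERIV_imp_deriv DERIV_cdivide d2)
  finally have "deriv (deriv (smoothed \<phi> \<epsilon> x)) u = J (deriv (deriv \<phi>)) u / \<epsilon> / \<epsilon> / \<epsilon>" .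
  moreover have "J (deriv (deriv \<phi>)) u = \<epsilon> * kernel_average (deriv (deriv \<phi>)) x \<epsilon> u"
    unfolding J_def by (rule kernel_average_eq_convolution[OF k(5,8) x \<epsilon>])
  ultimately show "(deriv ^^ 2) (smoothed \<phi> \<epsilon> x) u = kernel_average (deriv (deriv \<phi>)) x \<epsilon> u / \<epsilon>\<^sup>2"
    using \<epsilon> by (simp add: numeral_2_eq_2 power2_eq_square[unfolded numeral_2_eq_2])
qed

lemma kernel_average_abs_le:
  fixes \<theta> F :: "real \<Rightarrow> real"
  assumes \<theta>: "continuous_on UNIV \<theta>" "\<And>v. v \<in> {-1..1} \<Longrightarrow> \<bar>\<theta> v\<bar> \<le> B"
    and F: "continuous_on UNIV F" "\<And>v. v \<in> {-1..1} \<Longrightarrow> \<bar>F v\<bar> \<le> c"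
  shows "\<bar>integral {-1..1} (\<lambda>v. \<theta> v * F v)\<bar> \<le> 2 * B * c"
proof -
  have "norm (integral {-1..1} (\<lambda>v. \<theta> v * F v)) \<le> B * c * Henstock_Kurzweil_Integration.content {-1..1 :: real}"
  proof (rule has_integral_bound_real[OF _ finite.emptyI integrable_integral[OF integrable_continuous_real]])
    have "0 \<le> B" "0 \<le> c" using \<theta>(2)[of 0] F(2)[of 0] by auto
    then show "0 \<le> B * c" by simp
    show "continuous_on {-1..1} (\<lambda>v. \<theta> v * F v)"
      by (intro continuous_on_mult continuous_on_subset[OF \<theta>(1)] continuous_on_subset[OF F(1)]) auto
    show "norm (\<theta> v * F v) \<le> B * c" if "v \<in> {-1..1} - {}" for v
      unfolding real_norm_def abs_mult using \<theta>(2)[of v] F(2)[of v] that \<open>0 \<le> B\<close> by (intro mult_mono) auto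
  qed
  then show ?thesis by (simp add: algebra_simps)
qed

text \<open>A kernel of mean zero only sees increments.\<close>

lemma kernel_average_increment:
  fixes \<theta> x :: "real \<Rightarrow> real"
  assumes \<theta>: "continuous_on UNIV \<theta>" "integral {-1..1} \<theta> = 0" and x: "continuous_on UNIV x"
  shows "kernel_average \<theta> x \<epsilon> u = integral {-1..1} (\<lambda>v. \<theta> v * (x (u - \<epsilon> * v) - a))"
proof -
  have i1: "(\<lambda>v. \<theta> v * x (u - \<epsilon> * v)) integrable_on {-1..1}"
    by (intro integrable_continuous_real continuous_intros continuous_on_compose2[OF \<theta>(1)] continuous_on_compose2[OF x]) auto
  have "\<theta> integrable_on {-1..1}" by (intro integrable_continuous_real continuous_on_subset[OF \<theta>(1)]) simp
  then have "(\<theta> has_integral 0) {-1..1}" using \<theta>(2) by (metis integrable_integral)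
  from has_integral_diff[OF integrable_integral[OF i1] has_integral_mult_left[OF this, of a]]
  have "((\<lambda>v. \<theta> v * (x (u - \<epsilon> * v) - a)) has_integral kernel_average \<theta> x \<epsilon> u) {-1..1}"
    by (simp add: kernel_average_def right_diff_distrib)
  then show ?thesis by (simp add: integral_unique)
qed

lemma kernel_average_continuous:
  fixes \<theta> x :: "real \<Rightarrow> real"
  assumes "continuous_on UNIV \<theta>" "continuous_on UNIV x"
  shows "continuous_on S (kernel_average \<theta> x \<epsilon>)"
proof -
  have "continuous_on UNIV (\<lambda>(u, v). \<theta> v * x (u - \<epsilon> * v))"
    unfolding split_beta
    by (intro continuous_intros continuous_on_compose2[OF assms(1)] continuous_on_compose2[OF assms(2)]) auto
  from continuous_on_integral_param[OF this] show ?thesis unfolding kernel_average_def[abs_def] .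
qed

lemma powr_diff_le:
  fixes a b Q k :: real
  assumes "0 \<le> a" "0 \<le> b" "a \<le> Q" "b \<le> Q" "1 \<le> k"
  shows "\<bar>a powr k - b powr k\<bar> \<le> k * Q powr (k - 1) * \<bar>a - b\<bar>"
proof -
  have main: "y powr k - x powr k \<le> k * Q powr (k - 1) * (y - x)" if xy: "0 \<le> x" "x < y" "y \<le> Q" for x y
  proof -
    \<comment> \<open>The mean value theorem asks for differentiability in the open interval only,
      which admits the endpoint 0.\<close>
    have cont: "continuous_on {x..y} (\<lambda>z. z powr k)"
      using assms xy by (intro continuous_on_powr' continuous_intros) auto
    have diff: "(\<lambda>z. z powr k) differentiable (at z)" if "x < z" for z
      using that xy by (auto simp: real_differentiable_def intro!: exI derivative_eq_intros)
    obtain l z where z: "x < z" "z < y" "((\<lambda>z. z powr k) has_real_derivative l) (at z)" "y powr k - x powr k = (y - x) * l"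
      using MVT[OF xy(2) cont diff] by blast
    have "((\<lambda>z. z powr k) has_real_derivative k * z powr (k - 1)) (at z)"
      using z xy by (auto intro!: derivative_eq_intros)
    with z(3) have "l = k * z powr (k - 1)" by (rule DERIV_unique)
    moreover have "z powr (k - 1) \<le> Q powr (k - 1)" using z xy assms by (intro powr_mono2) auto
    ultimately have "l \<le> k * Q powr (k - 1)" using assms by simp
    then have "(y - x) * l \<le> (y - x) * (k * Q powr (k - 1))" using xy by (intro mult_left_mono) auto
    then show ?thesis unfolding z(4) by (simp add: mult.commute)
  qed
  have mono: "x powr k \<le> y powr k" if "0 \<le> x" "x < y" for x y
    using that assms by (intro powr_mono2) auto
  show ?thesis
    using main[of a b] main[of b a] mono[of a b] mono[of b a] assms
    by (cases a b rule: linorder_cases) auto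
qed

section \<open>Interpolation between grid points\<close>

lemma filterlim_inverse_powr_at_top:
  fixes c :: real
  assumes "0 < c"
  shows "filterlim (\<lambda>\<epsilon>::real. \<epsilon> powr (- c)) at_top (at_right 0)"
proof -
  have "filterlim (\<lambda>\<epsilon>::real. inverse \<epsilon> powr c) at_top (at_right 0)"
    by (rule filterlim_compose[OF real_powr_at_top[OF assms] filterlim_inverse_at_top_right])
  then show ?thesis
    by (rule filterlim_mono_eventually[OF _ order_refl order_refl])
       (auto simp: eventually_at_right_less powr_minus inverse_powr eventually_at_filter)
qed

lemma tendsto_powr_at_right_0:
  fixes c :: real
  assumes "0 < c"
  shows "((\<lambda>\<epsilon>::real. \<epsilon> powr c) \<longlongrightarrow> 0) (at_right 0)"
  using tendsto_inverse_0_at_top[OF filterlim_inverse_powr_at_top[OF assms]]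
  by (simp add: powr_minus)

text \<open>Inverts the grid: the integer part of \<open>\<epsilon> powr (- ((1 - H) / 2))\<close>
  is the base of the grid point, and 1 is subtracted because the base of \<open>grid H n\<close> is
  \<open>Suc n\<close>. Rounding down selects a grid point not below \<epsilon>.\<close>

definition grid_index :: "real \<Rightarrow> real \<Rightarrow> nat" where
  "grid_index H \<epsilon> = nat \<lfloor>\<epsilon> powr (- ((1 - H) / 2))\<rfloor> - 1"

lemma grid_index_at_top:
  assumes "H < 1"
  shows "filterlim (grid_index H) sequentially (at_right 0)"
proof -
  have "filterlim (\<lambda>\<epsilon>. nat \<lfloor>\<epsilon> powr (- ((1 - H) / 2))\<rfloor>) sequentially (at_right 0)"
    using assms by (intro filterlim_compose[OF filterlim_nat_sequentially]
      filterlim_compose[OF filterlim_floor_sequentially] filterlim_inverse_powr_at_top) auto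
  then show ?thesis unfolding grid_index_def
    using filterlim_compose[OF filterlim_minus_const_nat_at_top] by blast
qed

text \<open>The ratio of consecutive grid points is close enough to one for the Hoelder continuity of the
  paths to control the smoothed process between them.\<close>

lemma grid_ratio:
  fixes H \<epsilon> :: real
  assumes H: "1 / 2 < H" "H < 1" and \<epsilon>: "0 < \<epsilon>" "\<epsilon> \<le> 1"
  defines "e \<equiv> grid H (grid_index H \<epsilon>)" and "\<alpha> \<equiv> 2 / (1 - H)"
  shows "\<epsilon> \<le> e" "e \<le> (1 + 1 / real (Suc (grid_index H \<epsilon>))) powr \<alpha> * \<epsilon>" "e \<le> 2 powr \<alpha> * \<epsilon>"
    and "e - \<epsilon> \<le> \<alpha> * 2 powr \<alpha> * \<epsilon> powr (1 + 1 / \<alpha>)"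
proof -
  define y where "y = \<epsilon> powr (- (1 / \<alpha>))"
  have \<alpha>: "4 < \<alpha>" using H by (simp add: \<alpha>_def field_simps)
  have inv: "(1 - H) / 2 = 1 / \<alpha>" by (simp add: \<alpha>_def)
  have "\<epsilon> powr 0 \<le> \<epsilon> powr (- (1 / \<alpha>))" using \<epsilon> \<alpha> by (intro powr_mono') auto
  then have y1: "1 \<le> y" using \<epsilon> by (simp add: y_def)
  define N where "N = nat \<lfloor>y\<rfloor>"
  have N1: "1 \<le> N" using y1 by (simp add: N_def le_nat_floor)
  have gi: "Suc (grid_index H \<epsilon>) = N" using N1 by (simp add: grid_index_def inv N_def y_def)
  have e: "e = real N powr (- \<alpha>)" using gi by (simp add: e_def grid_def \<alpha>_def del: of_nat_Suc)
  have Ny: "real N \<le> y" "y < real N + 1" using y1 by (auto simp: N_def of_nat_floor)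
  have y\<epsilon>: "y powr (- \<alpha>) = \<epsilon>" using \<alpha> \<epsilon> by (simp add: y_def powr_powr)
  have N0: "0 < real N" using N1 by simp
  show le: "\<epsilon> \<le> e"
  proof -
    have "y powr (- \<alpha>) \<le> real N powr (- \<alpha>)" using Ny(1) N0 \<alpha> by (intro powr_mono2') auto
    then show ?thesis by (simp add: e y\<epsilon>)
  qed
  have lt: "(real N + 1) powr (- \<alpha>) \<le> \<epsilon>"
  proof -
    have "(real N + 1) powr (- \<alpha>) \<le> y powr (- \<alpha>)" using Ny(2) y1 \<alpha> by (intro powr_mono2') auto
    then show ?thesis by (simp add: y\<epsilon>)
  qed
  have e_eq: "e = (1 + 1 / real N) powr \<alpha> * (real N + 1) powr (- \<alpha>)"
  proof -
    have "(1 + 1 / real N) = (real N + 1) / real N" using N0 by (simp add: field_simps)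
    then have "(1 + 1 / real N) powr \<alpha> = (real N + 1) powr \<alpha> / real N powr \<alpha>" by (simp add: powr_divide)
    moreover have "(real N + 1) powr \<alpha> * (real N + 1) powr (- \<alpha>) = 1" by (simp flip: powr_add)
    ultimately show ?thesis by (simp add: e powr_minus divide_inverse)
  qed
  have up: "e \<le> (1 + 1 / real N) powr \<alpha> * \<epsilon>"
    unfolding e_eq using lt by (intro mult_left_mono) auto
  then show "e \<le> (1 + 1 / real (Suc (grid_index H \<epsilon>))) powr \<alpha> * \<epsilon>" unfolding gi .
  have "(1 + 1 / real N) powr \<alpha> \<le> 2 powr \<alpha>" using N1 \<alpha> by (intro powr_mono2) (auto simp: field_simps)
  then have "(1 + 1 / real N) powr \<alpha> * \<epsilon> \<le> 2 powr \<alpha> * \<epsilon>" using \<epsilon> by (intro mult_right_mono) auto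
  with up show e2: "e \<le> 2 powr \<alpha> * \<epsilon>" by simp
  \<comment> \<open>The Lipschitz bound for the power \<alpha> on \<open>[0, 1]\<close> gives a
    relative gap of at most \<open>\<alpha> / (N + 1)\<close>, and \<open>N + 1\<close> exceeds
    \<open>y = \<epsilon> powr (- (1 / \<alpha>))\<close>.\<close>
  have "e - \<epsilon> \<le> e * (\<alpha> / (real N + 1))"
  proof -
    have "(real N + 1) powr (- \<alpha>) = e * (real N / (real N + 1)) powr \<alpha>"
      using N0 by (simp add: e powr_divide powr_minus field_simps)
    moreover have "1 + \<alpha> * (- 1 / (real N + 1)) \<le> (real N / (real N + 1)) powr \<alpha>"
    proof -
      have "\<bar>1 powr \<alpha> - (real N / (real N + 1)) powr \<alpha>\<bar> \<le> \<alpha> * 1 powr (\<alpha> - 1) * \<bar>1 - real N / (real N + 1)\<bar>"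
        using N0 \<alpha> by (intro powr_diff_le) auto
      moreover have "1 - real N / (real N + 1) = 1 / (real N + 1)" using N0 by (simp add: field_simps)
      ultimately show ?thesis using N0 by simp
    qed
    moreover have "0 < e" using N0 by (simp add: e)
    ultimately have "e * (1 + \<alpha> * (- 1 / (real N + 1))) \<le> (real N + 1) powr (- \<alpha>)" by simp
    then show ?thesis using lt by (simp add: algebra_simps)
  qed
  also have "\<dots> \<le> (2 powr \<alpha> * \<epsilon>) * (\<alpha> / y)"
    using e2 Ny(2) y1 \<alpha> \<epsilon> by (intro mult_mono divide_left_mono) auto
  also have "\<dots> = \<alpha> * 2 powr \<alpha> * (\<epsilon> / y)" by simp
  also have "\<epsilon> / y = \<epsilon> powr (1 + 1 / \<alpha>)"
    using \<epsilon> by (simp add: y_def powr_add powr_minus divide_inverse)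
  finally show "e - \<epsilon> \<le> \<alpha> * 2 powr \<alpha> * \<epsilon> powr (1 + 1 / \<alpha>)" .
qed

text \<open>Mean zero reduces the average to increments over a distance at most \<epsilon>. For two
  scales the integrands are compared at the same \<open>v\<close>, where the arguments differ by
  \<open>(e - \<epsilon>) * v\<close>.\<close>

lemma kernel_average_holder:
  fixes \<psi> g :: "real \<Rightarrow> real"
  assumes \<psi>: "continuous_on UNIV \<psi>" "integral {-1..1} \<psi> = 0" "\<And>v. v \<in> {-1..1} \<Longrightarrow> \<bar>\<psi> v\<bar> \<le> B"
    and g: "continuous_on UNIV g"
    and holder: "\<And>s t. s \<in> {-1..2} \<Longrightarrow> t \<in> {-1..2} \<Longrightarrow> \<bar>g t - g s\<bar> \<le> K * \<bar>t - s\<bar> powr \<gamma>"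
    and K: "0 \<le> K" and \<gamma>: "0 < \<gamma>" and u: "u \<in> {0..1}" and \<epsilon>: "0 < \<epsilon>" "\<epsilon> \<le> 1"
  shows "\<bar>kernel_average \<psi> g \<epsilon> u\<bar> \<le> 2 * B * (K * \<epsilon> powr \<gamma>)"
    and "\<epsilon> \<le> e \<Longrightarrow> e \<le> 1 \<Longrightarrow> \<bar>kernel_average \<psi> g \<epsilon> u - kernel_average \<psi> g e u\<bar> \<le> 2 * B * (K * (e - \<epsilon>) powr \<gamma>)"
proof -
  note [continuous_intros] = continuous_on_compose2[OF \<psi>(1)] continuous_on_compose2[OF g]
  have in_range: "u - r * v \<in> {-1..2}" if "0 < r" "r \<le> 1" "v \<in> {-1..1}" for r v
  proof -
    have "\<bar>r * v\<bar> \<le> 1 * 1" unfolding abs_mult using that by (intro mult_mono) auto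
    then show ?thesis using u by auto
  qed
  have scale: "K * \<bar>r * v\<bar> powr \<gamma> \<le> K * r powr \<gamma>" if "0 \<le> r" "v \<in> {-1..1}" for r v
  proof -
    have "\<bar>r * v\<bar> \<le> r * 1" unfolding abs_mult using that by (intro mult_mono) auto
    then show ?thesis using K \<gamma> by (intro mult_left_mono powr_mono2) auto
  qed
  show "\<bar>kernel_average \<psi> g \<epsilon> u\<bar> \<le> 2 * B * (K * \<epsilon> powr \<gamma>)"
    unfolding kernel_average_increment[OF \<psi>(1,2) g, of \<epsilon> u "g u"]
  proof (rule kernel_average_abs_le[OF \<psi>(1,3)])
    fix v :: real assume v: "v \<in> {-1..1}"
    have "\<bar>g (u - \<epsilon> * v) - g u\<bar> \<le> K * \<bar>\<epsilon> * v\<bar> powr \<gamma>"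
      using holder[OF _ in_range[OF \<epsilon> v], of u] u by simp
    also have "\<dots> \<le> K * \<epsilon> powr \<gamma>" using v \<epsilon> by (intro scale) auto
    finally show "\<bar>g (u - \<epsilon> * v) - g u\<bar> \<le> K * \<epsilon> powr \<gamma>" .
  qed (auto intro!: continuous_intros)
  assume e: "\<epsilon> \<le> e" "e \<le> 1"
  have int: "(\<lambda>v. \<psi> v * g (u - r * v)) integrable_on {-1..1}" for r
    by (intro integrable_continuous_real continuous_intros) auto
  have "kernel_average \<psi> g \<epsilon> u - kernel_average \<psi> g e u = integral {-1..1} (\<lambda>v. \<psi> v * (g (u - \<epsilon> * v) - g (u - e * v)))"
    unfolding kernel_average_def
    by (subst Henstock_Kurzweil_Integration.integral_diff[symmetric, OF int int]) (simp add: right_diff_distrib)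
  also have "\<bar>\<dots>\<bar> \<le> 2 * B * (K * (e - \<epsilon>) powr \<gamma>)"
  proof (rule kernel_average_abs_le[OF \<psi>(1,3)])
    fix v :: real assume v: "v \<in> {-1..1}"
    have "\<bar>g (u - \<epsilon> * v) - g (u - e * v)\<bar> \<le> K * \<bar>(u - \<epsilon> * v) - (u - e * v)\<bar> powr \<gamma>"
      using v \<epsilon> e by (intro holder in_range) auto
    also have "(u - \<epsilon> * v) - (u - e * v) = (e - \<epsilon>) * v" by (simp add: algebra_simps)
    also have "K * \<bar>(e - \<epsilon>) * v\<bar> powr \<gamma> \<le> K * (e - \<epsilon>) powr \<gamma>" using v e by (intro scale) auto
    finally show "\<bar>g (u - \<epsilon> * v) - g (u - e * v)\<bar> \<le> K * (e - \<epsilon>) powr \<gamma>" .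
  qed (auto intro!: continuous_intros)
  finally show "\<bar>kernel_average \<psi> g \<epsilon> u - kernel_average \<psi> g e u\<bar> \<le> 2 * B * (K * (e - \<epsilon>) powr \<gamma>)" .
qed

text \<open>Each scale \<epsilon> is compared with the grid point just above it. Path regularity
  controls the difference of the averages, the changed normalization contributes a power of
  \<open>e \<epsilon> / \<epsilon>\<close>, and this ratio tends to 1.\<close>

lemma limit_from_grid:
  fixes \<psi> g w :: "real \<Rightarrow> real"
  assumes \<psi>: "continuous_on UNIV \<psi>" "integral {-1..1} \<psi> = 0" "\<And>v. v \<in> {-1..1} \<Longrightarrow> \<bar>\<psi> v\<bar> \<le> B"
    and g: "continuous_on UNIV g"
    and holder: "\<And>s t. s \<in> {-1..2} \<Longrightarrow> t \<in> {-1..2} \<Longrightarrow> \<bar>g t - g s\<bar> \<le> K * \<bar>t - s\<bar> powr \<gamma>"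
    and K: "0 \<le> K" and H: "1 / 2 < H" "H < 1" and \<gamma>: "1 / 2 < \<gamma>" "\<gamma> < H" and k: "1 \<le> k"
    and \<gamma>H: "k * (H - \<gamma>) < (1 - H) / 4" and s: "0 < s" and w: "continuous_on {0..1} w"
  defines "Y \<equiv> \<lambda>\<epsilon> u. \<epsilon> powr (- H) / s * kernel_average \<psi> g \<epsilon> u"
  assumes lim: "(\<lambda>n. integral {0..1} (\<lambda>u. w u * \<bar>Y (grid H n) u\<bar> powr k)) \<longlonglongrightarrow> m"
  shows "((\<lambda>\<epsilon>. integral {0..1} (\<lambda>u. w u * \<bar>Y \<epsilon> u\<bar> powr k)) \<longlongrightarrow> m) (at_right 0)"
proof -
  define \<alpha> where "\<alpha> = 2 / (1 - H)"
  have \<alpha>: "4 < \<alpha>" using H by (simp add: \<alpha>_def field_simps)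
  have B: "0 \<le> B" using \<psi>(3)[of 0] by auto
  define e where "e \<epsilon> = grid H (grid_index H \<epsilon>)" for \<epsilon>
  have e_pos: "0 < e \<epsilon>" for \<epsilon> by (simp add: e_def grid_pos)
  have e_le_1: "e \<epsilon> \<le> 1" for \<epsilon> using H by (simp add: e_def grid_le_1)
  \<comment> \<open>The net exponent: \<open>\<gamma> / \<alpha>\<close> is gained from the gap,
    \<open>k * (H - \<gamma>)\<close> is lost in estimating \<open>k\<close>-th powers. As
    \<open>\<gamma> > 1 / 2\<close>, the gain exceeds \<open>(1 - H) / 4\<close>.\<close>
  define \<theta> where "\<theta> = \<gamma> / \<alpha> - k * (H - \<gamma>)"
  have \<theta>: "0 < \<theta>"
  proof -
    have "(1 / 2) * ((1 - H) / 2) \<le> \<gamma> * ((1 - H) / 2)" using \<gamma> H by (intro mult_right_mono) auto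
    then show ?thesis using \<gamma>H by (simp add: \<theta>_def \<alpha>_def)
  qed
  have "bounded (w ` {0..1})" using w by (intro compact_imp_bounded compact_continuous_image) auto
  then obtain W where "\<forall>y\<in>w ` {0..1}. norm y \<le> W" by (auto simp: bounded_iff)
  then have W: "\<And>u. u \<in> {0..1} \<Longrightarrow> \<bar>w u\<bar> \<le> W" by auto
  have W0: "0 \<le> W" using W[of 0] by auto
  define C where "C = 2 * B * K / s"
  have C: "0 \<le> C" using B K s by (simp add: C_def)
  define L where "L = k * (C * (2 powr \<alpha>) powr \<gamma>) powr (k - 1) * (C * (\<alpha> * 2 powr \<alpha>) powr \<gamma>)"
  have L: "0 \<le> L" using k C by (simp add: L_def)
  have Y_cont: "continuous_on {0..1} (\<lambda>u. w u * \<bar>Y \<epsilon> u\<bar> powr k)" for \<epsilon>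
    unfolding Y_def using k
    by (intro continuous_intros continuous_on_powr' w kernel_average_continuous \<psi>(1) g) auto
  have main: "\<bar>integral {0..1} (\<lambda>u. w u * \<bar>Y \<epsilon> u\<bar> powr k) - (e \<epsilon> / \<epsilon>) powr (H * k) * integral {0..1} (\<lambda>u. w u * \<bar>Y (e \<epsilon>) u\<bar> powr k)\<bar>
      \<le> W * L * \<epsilon> powr \<theta>" if \<epsilon>: "0 < \<epsilon>" "\<epsilon> \<le> 1" for \<epsilon>
  proof -
    note r = grid_ratio[OF H \<epsilon>, folded e_def \<alpha>_def]
    have pt: "\<bar>\<bar>Y \<epsilon> u\<bar> powr k - (e \<epsilon> / \<epsilon>) powr (H * k) * \<bar>Y (e \<epsilon>) u\<bar> powr k\<bar> \<le> L * \<epsilon> powr \<theta>" if u: "u \<in> {0..1}" for u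
    proof -
      note kb = kernel_average_holder[OF \<psi> g holder K _ u]
      define a where "a = \<epsilon> powr (- H) / s * \<bar>kernel_average \<psi> g \<epsilon> u\<bar>"
      \<comment> \<open>The average at the grid scale with the normalization of \<epsilon>, so that
        \<open>a\<close> and \<open>a'\<close> differ only through the paths. It equals
        \<open>\<bar>Y (e \<epsilon>) u\<bar>\<close> times the power \<open>H\<close> of the ratio
        of scales.\<close>
      define a' where "a' = \<epsilon> powr (- H) / s * \<bar>kernel_average \<psi> g (e \<epsilon>) u\<bar>"
      define Q where "Q = C * (2 powr \<alpha>) powr \<gamma> * \<epsilon> powr (\<gamma> - H)"
      have f0: "0 \<le> \<epsilon> powr (- H) / s" using s by simp
      have Q_le: "\<epsilon> powr (- H) / s * (2 * B * (K * (2 powr \<alpha> * \<epsilon>) powr \<gamma>)) = Q"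
      proof -
        have "(2 powr \<alpha> * \<epsilon>) powr \<gamma> = (2 powr \<alpha>) powr \<gamma> * \<epsilon> powr \<gamma>" by (rule powr_mult)
        moreover have "\<epsilon> powr (- H) * \<epsilon> powr \<gamma> = \<epsilon> powr (\<gamma> - H)" by (simp flip: powr_add)
        ultimately show ?thesis by (simp add: Q_def C_def mult_ac)
      qed
      have big: "r' powr \<gamma> \<le> (2 powr \<alpha> * \<epsilon>) powr \<gamma>" if "0 < r'" "r' \<le> 2 powr \<alpha> * \<epsilon>" for r'
        using that \<gamma> by (intro powr_mono2) auto
      have "1 \<le> 2 powr \<alpha>" using \<alpha> by (simp add: ge_one_powr_ge_zero)
      then have \<epsilon>_le: "\<epsilon> \<le> 2 powr \<alpha> * \<epsilon>" using \<epsilon> mult_right_mono[of 1 "2 powr \<alpha>" \<epsilon>] by simp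
      have aQ: "a \<le> Q"
      proof -
        have "\<bar>kernel_average \<psi> g \<epsilon> u\<bar> \<le> 2 * B * (K * \<epsilon> powr \<gamma>)" using \<gamma> \<epsilon> by (intro kb(1)) auto
        also have "\<dots> \<le> 2 * B * (K * (2 powr \<alpha> * \<epsilon>) powr \<gamma>)" using B K big[OF \<epsilon>(1) \<epsilon>_le] by (intro mult_left_mono) auto
        finally show ?thesis unfolding a_def Q_le[symmetric] by (intro mult_left_mono f0)
      qed
      have aQ': "a' \<le> Q"
      proof -
        have "\<bar>kernel_average \<psi> g (e \<epsilon>) u\<bar> \<le> 2 * B * (K * e \<epsilon> powr \<gamma>)" using \<gamma> e_pos e_le_1 by (intro kb(1)) auto
        also have "\<dots> \<le> 2 * B * (K * (2 powr \<alpha> * \<epsilon>) powr \<gamma>)" using B K big[OF e_pos r(3)] by (intro mult_left_mono) auto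
        finally show ?thesis unfolding a'_def Q_le[symmetric] by (intro mult_left_mono f0)
      qed
      have diff: "\<bar>a - a'\<bar> \<le> C * (\<alpha> * 2 powr \<alpha>) powr \<gamma> * \<epsilon> powr (\<gamma> - H + \<gamma> / \<alpha>)"
      proof -
        have "\<bar>a - a'\<bar> = \<epsilon> powr (- H) / s * \<bar>\<bar>kernel_average \<psi> g \<epsilon> u\<bar> - \<bar>kernel_average \<psi> g (e \<epsilon>) u\<bar>\<bar>"
          unfolding a_def a'_def right_diff_distrib[symmetric] abs_mult using f0 s by simp
        also have "\<dots> \<le> \<epsilon> powr (- H) / s * (2 * B * (K * (e \<epsilon> - \<epsilon>) powr \<gamma>))"
        proof (intro mult_left_mono f0)
          have "\<bar>kernel_average \<psi> g \<epsilon> u - kernel_average \<psi> g (e \<epsilon>) u\<bar> \<le> 2 * B * (K * (e \<epsilon> - \<epsilon>) powr \<gamma>)"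
            using \<gamma> \<epsilon> r(1) e_le_1 by (intro kb(2)) auto
          then show "\<bar>\<bar>kernel_average \<psi> g \<epsilon> u\<bar> - \<bar>kernel_average \<psi> g (e \<epsilon>) u\<bar>\<bar> \<le> 2 * B * (K * (e \<epsilon> - \<epsilon>) powr \<gamma>)"
            by (rule order_trans[OF abs_triangle_ineq3])
        qed
        also have "\<dots> \<le> \<epsilon> powr (- H) / s * (2 * B * (K * (\<alpha> * 2 powr \<alpha> * \<epsilon> powr (1 + 1 / \<alpha>)) powr \<gamma>))"
          using B K f0 r(1,4) \<gamma> by (intro mult_left_mono powr_mono2) auto
        also have "(\<alpha> * 2 powr \<alpha> * \<epsilon> powr (1 + 1 / \<alpha>)) powr \<gamma> = (\<alpha> * 2 powr \<alpha>) powr \<gamma> * \<epsilon> powr (\<gamma> + \<gamma> / \<alpha>)"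
          unfolding powr_mult[of "\<alpha> * 2 powr \<alpha>"] powr_powr by (simp add: algebra_simps)
        also have "\<epsilon> powr (- H) / s * (2 * B * (K * ((\<alpha> * 2 powr \<alpha>) powr \<gamma> * \<epsilon> powr (\<gamma> + \<gamma> / \<alpha>))))
            = C * (\<alpha> * 2 powr \<alpha>) powr \<gamma> * (\<epsilon> powr (- H) * \<epsilon> powr (\<gamma> + \<gamma> / \<alpha>))"
          by (simp add: C_def mult_ac)
        also have "\<epsilon> powr (- H) * \<epsilon> powr (\<gamma> + \<gamma> / \<alpha>) = \<epsilon> powr (\<gamma> - H + \<gamma> / \<alpha>)"
          unfolding powr_add[symmetric] by (simp add: algebra_simps)
        finally show ?thesis .
      qed
      have "0 \<le> a" "0 \<le> a'" unfolding a_def a'_def by (intro mult_nonneg_nonneg f0 abs_ge_zero)+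
      then have "\<bar>a powr k - a' powr k\<bar> \<le> k * Q powr (k - 1) * \<bar>a - a'\<bar>"
        by (intro powr_diff_le aQ aQ' k)
      also have "\<dots> \<le> k * Q powr (k - 1) * (C * (\<alpha> * 2 powr \<alpha>) powr \<gamma> * \<epsilon> powr (\<gamma> - H + \<gamma> / \<alpha>))"
        using diff k by (intro mult_left_mono) auto
      also have "Q powr (k - 1) = (C * (2 powr \<alpha>) powr \<gamma>) powr (k - 1) * \<epsilon> powr ((\<gamma> - H) * (k - 1))"
        unfolding Q_def powr_mult[of "C * (2 powr \<alpha>) powr \<gamma>"] powr_powr[of \<epsilon>] ..
      also have "k * ((C * (2 powr \<alpha>) powr \<gamma>) powr (k - 1) * \<epsilon> powr ((\<gamma> - H) * (k - 1))) * (C * (\<alpha> * 2 powr \<alpha>) powr \<gamma> * \<epsilon> powr (\<gamma> - H + \<gamma> / \<alpha>))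
          = L * (\<epsilon> powr ((\<gamma> - H) * (k - 1)) * \<epsilon> powr (\<gamma> - H + \<gamma> / \<alpha>))"
        by (simp add: L_def mult_ac)
      also have "\<epsilon> powr ((\<gamma> - H) * (k - 1)) * \<epsilon> powr (\<gamma> - H + \<gamma> / \<alpha>) = \<epsilon> powr \<theta>"
        unfolding powr_add[symmetric] \<theta>_def by (simp add: algebra_simps)
      finally have "\<bar>a powr k - a' powr k\<bar> \<le> L * \<epsilon> powr \<theta>" .
      moreover have "a = \<bar>Y \<epsilon> u\<bar>" using s by (simp add: a_def Y_def abs_mult)
      moreover have "a' powr k = (e \<epsilon> / \<epsilon>) powr (H * k) * \<bar>Y (e \<epsilon>) u\<bar> powr k"
      proof -
        have "(e \<epsilon> / \<epsilon>) powr H * e \<epsilon> powr (- H) = \<epsilon> powr (- H)"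
        proof -
          have "(e \<epsilon> / \<epsilon>) powr H = e \<epsilon> powr H * \<epsilon> powr (- H)" using e_pos[of \<epsilon>] \<epsilon> by (subst powr_divide) (auto simp: powr_minus divide_inverse)
          moreover have "e \<epsilon> powr H * e \<epsilon> powr (- H) = 1" using e_pos[of \<epsilon>] by (simp add: less_imp_neq[symmetric] flip: powr_add)
          ultimately show ?thesis by (simp add: mult_ac)
        qed
        then have "a' = (e \<epsilon> / \<epsilon>) powr H * \<bar>Y (e \<epsilon>) u\<bar>" using s by (simp add: a'_def Y_def abs_mult)
        then show ?thesis by (simp only: powr_mult powr_powr)
      qed
      ultimately show ?thesis by simp
    qed
    have "integral {0..1} (\<lambda>u. w u * \<bar>Y \<epsilon> u\<bar> powr k) - (e \<epsilon> / \<epsilon>) powr (H * k) * integral {0..1} (\<lambda>u. w u * \<bar>Y (e \<epsilon>) u\<bar> powr k)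
        = integral {0..1} (\<lambda>u. w u * \<bar>Y \<epsilon> u\<bar> powr k - (e \<epsilon> / \<epsilon>) powr (H * k) * (w u * \<bar>Y (e \<epsilon>) u\<bar> powr k))"
      by (intro integral_unique[symmetric] has_integral_diff has_integral_mult_right integrable_integral integrable_continuous_real Y_cont)
    also have "\<bar>\<dots>\<bar> \<le> integral {0..1} (\<lambda>u::real. W * L * \<epsilon> powr \<theta>)"
    proof -
      have pw: "norm (w u * \<bar>Y \<epsilon> u\<bar> powr k - (e \<epsilon> / \<epsilon>) powr (H * k) * (w u * \<bar>Y (e \<epsilon>) u\<bar> powr k)) \<le> W * L * \<epsilon> powr \<theta>" if u: "u \<in> {0..1}" for u
      proof -
        have "w u * \<bar>Y \<epsilon> u\<bar> powr k - (e \<epsilon> / \<epsilon>) powr (H * k) * (w u * \<bar>Y (e \<epsilon>) u\<bar> powr k) =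
            w u * (\<bar>Y \<epsilon> u\<bar> powr k - (e \<epsilon> / \<epsilon>) powr (H * k) * \<bar>Y (e \<epsilon>) u\<bar> powr k)" by (simp add: algebra_simps)
        then have "norm (w u * \<bar>Y \<epsilon> u\<bar> powr k - (e \<epsilon> / \<epsilon>) powr (H * k) * (w u * \<bar>Y (e \<epsilon>) u\<bar> powr k)) =
            \<bar>w u\<bar> * \<bar>\<bar>Y \<epsilon> u\<bar> powr k - (e \<epsilon> / \<epsilon>) powr (H * k) * \<bar>Y (e \<epsilon>) u\<bar> powr k\<bar>" by (simp add: abs_mult)
        also have "\<dots> \<le> W * (L * \<epsilon> powr \<theta>)" using W[OF u] W0 pt[OF u] by (intro mult_mono) auto
        finally show ?thesis by (simp add: mult.assoc)
      qed
      have "(\<lambda>u. w u * \<bar>Y \<epsilon> u\<bar> powr k - (e \<epsilon> / \<epsilon>) powr (H * k) * (w u * \<bar>Y (e \<epsilon>) u\<bar> powr k)) integrable_on {0..1}"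
        by (intro integrable_continuous_real continuous_intros Y_cont)
      from integral_norm_bound_integral[OF this integrable_const_ivl pw] show ?thesis
        by (simp only: real_norm_def)
    qed
    finally show ?thesis by simp
  qed
  have "((\<lambda>\<epsilon>. integral {0..1} (\<lambda>u. w u * \<bar>Y (e \<epsilon>) u\<bar> powr k)) \<longlongrightarrow> m) (at_right 0)"
    unfolding e_def by (rule filterlim_compose[OF lim grid_index_at_top[OF H(2)]])
  moreover have "((\<lambda>\<epsilon>. (e \<epsilon> / \<epsilon>) powr (H * k)) \<longlongrightarrow> 1 powr (H * k)) (at_right 0)"
  proof (intro tendsto_powr tendsto_const)
    have ev: "\<forall>\<^sub>F \<epsilon> in at_right (0::real). 0 < \<epsilon> \<and> \<epsilon> < 1" using eventually_at_right_real[of 0 "1::real"] by auto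
    have up: "((\<lambda>\<epsilon>. (1 + 1 / real (Suc (grid_index H \<epsilon>))) powr \<alpha>) \<longlongrightarrow> (1 + 0) powr \<alpha>) (at_right 0)"
    proof (intro tendsto_powr tendsto_add tendsto_const)
      show "((\<lambda>\<epsilon>. 1 / real (Suc (grid_index H \<epsilon>))) \<longlongrightarrow> 0) (at_right 0)"
        by (rule filterlim_compose[OF LIMSEQ_Suc[OF lim_const_over_n] grid_index_at_top[OF H(2)]])
    qed simp
    show "((\<lambda>\<epsilon>. e \<epsilon> / \<epsilon>) \<longlongrightarrow> 1) (at_right 0)"
    proof (rule tendsto_sandwich[OF _ _ tendsto_const])
      show "\<forall>\<^sub>F \<epsilon> in at_right 0. 1 \<le> e \<epsilon> / \<epsilon>"
        using ev
      proof eventually_elim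
        case (elim \<epsilon>)
        then show ?case using grid_ratio(1)[OF H, of \<epsilon>] by (simp add: e_def)
      qed
      show "\<forall>\<^sub>F \<epsilon> in at_right 0. e \<epsilon> / \<epsilon> \<le> (1 + 1 / real (Suc (grid_index H \<epsilon>))) powr \<alpha>"
        using ev
      proof eventually_elim
        case (elim \<epsilon>)
        then show ?case using grid_ratio(2)[OF H, of \<epsilon>] by (simp add: e_def \<alpha>_def divide_le_eq del: of_nat_Suc)
      qed
      show "((\<lambda>\<epsilon>. (1 + 1 / real (Suc (grid_index H \<epsilon>))) powr \<alpha>) \<longlongrightarrow> 1) (at_right 0)" using up by simp
    qed
  qed simp
  ultimately have lim2: "((\<lambda>\<epsilon>. (e \<epsilon> / \<epsilon>) powr (H * k) * integral {0..1} (\<lambda>u. w u * \<bar>Y (e \<epsilon>) u\<bar> powr k)) \<longlongrightarrow> m) (at_right 0)"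
    using tendsto_mult by fastforce
  have ev: "\<forall>\<^sub>F \<epsilon> in at_right (0::real). 0 < \<epsilon> \<and> \<epsilon> < 1" using eventually_at_right_real[of 0 "1::real"] by auto
  have "((\<lambda>\<epsilon>. integral {0..1} (\<lambda>u. w u * \<bar>Y \<epsilon> u\<bar> powr k) - (e \<epsilon> / \<epsilon>) powr (H * k) * integral {0..1} (\<lambda>u. w u * \<bar>Y (e \<epsilon>) u\<bar> powr k)) \<longlongrightarrow> 0) (at_right 0)"
  proof (rule Lim_null_comparison)
    show "\<forall>\<^sub>F \<epsilon> in at_right 0. norm (integral {0..1} (\<lambda>u. w u * \<bar>Y \<epsilon> u\<bar> powr k) - (e \<epsilon> / \<epsilon>) powr (H * k) * integral {0..1} (\<lambda>u. w u * \<bar>Y (e \<epsilon>) u\<bar> powr k)) \<le> W * L * \<epsilon> powr \<theta>"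
      using ev
    proof eventually_elim
      case (elim \<epsilon>)
      then show ?case using main[of \<epsilon>] by simp
    qed
    show "((\<lambda>\<epsilon>. W * L * \<epsilon> powr \<theta>) \<longlongrightarrow> 0) (at_right 0)"
      using tendsto_mult[OF tendsto_const tendsto_powr_at_right_0[OF \<theta>], of "W * L"] by simp
  qed
  from tendsto_add[OF this lim2] show ?thesis by simp
qed

section \<open>The limit along a path\<close>

text \<open>Writing \<open>a * P - a0 * Q = a * (P - Q) + (a - a0) * Q\<close>, the first part is
  small in mean since \<open>a\<close> is eventually bounded, the second since \<open>a\<close> is
  uniformly close to \<open>a0\<close> while the integrals of \<open>Q\<close> stay bounded.\<close>

lemma tendsto_integral_product:
  fixes a P Q :: "'b \<Rightarrow> real \<Rightarrow> real" and a0 :: "real \<Rightarrow> real"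
  assumes cont: "\<And>\<epsilon>. continuous_on {0..1} (a \<epsilon>)" "\<And>\<epsilon>. continuous_on {0..1} (P \<epsilon>)"
      "\<And>\<epsilon>. continuous_on {0..1} (Q \<epsilon>)" "continuous_on {0..1} a0"
    and Q0: "\<And>\<epsilon> u. 0 \<le> Q \<epsilon> u"
    and PQ: "((\<lambda>\<epsilon>. integral {0..1} (\<lambda>u. \<bar>P \<epsilon> u - Q \<epsilon> u\<bar>)) \<longlongrightarrow> 0) F"
    and a: "\<And>e. 0 < e \<Longrightarrow> \<forall>\<^sub>F \<epsilon> in F. \<forall>u\<in>{0..1}. \<bar>a \<epsilon> u - a0 u\<bar> \<le> e"
    and Q: "((\<lambda>\<epsilon>. integral {0..1} (Q \<epsilon>)) \<longlongrightarrow> q) F"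
    and l: "((\<lambda>\<epsilon>. integral {0..1} (\<lambda>u. a0 u * Q \<epsilon> u)) \<longlongrightarrow> l) F"
  shows "((\<lambda>\<epsilon>. integral {0..1} (\<lambda>u. a \<epsilon> u * P \<epsilon> u)) \<longlongrightarrow> l) F"
proof -
  have "bounded (a0 ` {0..1})" using cont(4) by (intro compact_imp_bounded compact_continuous_image) auto
  then obtain A where "\<forall>y\<in>a0 ` {0..1}. norm y \<le> A" by (auto simp: bounded_iff)
  then have A: "\<And>u. u \<in> {0..1} \<Longrightarrow> \<bar>a0 u\<bar> \<le> A" by auto
  have A0: "0 \<le> A" using A[of 0] by auto
  have "((\<lambda>\<epsilon>. integral {0..1} (\<lambda>u. a \<epsilon> u * P \<epsilon> u) - integral {0..1} (\<lambda>u. a0 u * Q \<epsilon> u)) \<longlongrightarrow> 0) F"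
  proof (rule tendstoI)
    fix r :: real assume r: "0 < r"
    define e where "e = min 1 (r / (2 * (\<bar>q\<bar> + 1)))"
    have e: "0 < e" "e \<le> 1" "e * (\<bar>q\<bar> + 1) \<le> r / 2"
    proof -
      show "0 < e" "e \<le> 1" using r by (auto simp: e_def)
      have "e * (\<bar>q\<bar> + 1) \<le> r / (2 * (\<bar>q\<bar> + 1)) * (\<bar>q\<bar> + 1)" by (intro mult_right_mono) (auto simp: e_def)
      also have "\<dots> = r / 2" by (simp add: field_simps)
      finally show "e * (\<bar>q\<bar> + 1) \<le> r / 2" .
    qed
    have "\<forall>\<^sub>F \<epsilon> in F. integral {0..1} (\<lambda>u. \<bar>P \<epsilon> u - Q \<epsilon> u\<bar>) < r / (2 * (A + 1))"
      using r A0 by (intro order_tendstoD(2)[OF PQ]) auto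
    moreover have "\<forall>\<^sub>F \<epsilon> in F. integral {0..1} (Q \<epsilon>) < \<bar>q\<bar> + 1" by (intro order_tendstoD(2)[OF Q]) auto
    ultimately show "\<forall>\<^sub>F \<epsilon> in F. dist (integral {0..1} (\<lambda>u. a \<epsilon> u * P \<epsilon> u) - integral {0..1} (\<lambda>u. a0 u * Q \<epsilon> u)) 0 < r"
      using a[OF e(1)]
    proof eventually_elim
      case (elim \<epsilon>)
      note ci = integrable_continuous_real
      have "integral {0..1} (\<lambda>u. a \<epsilon> u * P \<epsilon> u) - integral {0..1} (\<lambda>u. a0 u * Q \<epsilon> u) = integral {0..1} (\<lambda>u. a \<epsilon> u * P \<epsilon> u - a0 u * Q \<epsilon> u)"
        by (intro Henstock_Kurzweil_Integration.integral_diff[symmetric] ci continuous_intros cont)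
      moreover have "\<bar>integral {0..1} (\<lambda>u. a \<epsilon> u * P \<epsilon> u - a0 u * Q \<epsilon> u)\<bar> \<le> integral {0..1} (\<lambda>u. (A + 1) * \<bar>P \<epsilon> u - Q \<epsilon> u\<bar> + e * Q \<epsilon> u)"
      proof -
        have "norm (integral {0..1} (\<lambda>u. a \<epsilon> u * P \<epsilon> u - a0 u * Q \<epsilon> u)) \<le> integral {0..1} (\<lambda>u. (A + 1) * \<bar>P \<epsilon> u - Q \<epsilon> u\<bar> + e * Q \<epsilon> u)"
        proof (rule integral_norm_bound_integral)
          fix u :: real assume u: "u \<in> {0..1}"
          have au: "\<bar>a \<epsilon> u - a0 u\<bar> \<le> e" using elim(3) u by blast
          then have "\<bar>a \<epsilon> u\<bar> \<le> A + 1" using A[OF u] e(2) by linarith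
          then have t1: "\<bar>a \<epsilon> u\<bar> * \<bar>P \<epsilon> u - Q \<epsilon> u\<bar> \<le> (A + 1) * \<bar>P \<epsilon> u - Q \<epsilon> u\<bar>" by (rule mult_right_mono) simp
          have t2: "\<bar>a \<epsilon> u - a0 u\<bar> * Q \<epsilon> u \<le> e * Q \<epsilon> u" using au Q0 by (rule mult_right_mono)
          have "a \<epsilon> u * P \<epsilon> u - a0 u * Q \<epsilon> u = a \<epsilon> u * (P \<epsilon> u - Q \<epsilon> u) + (a \<epsilon> u - a0 u) * Q \<epsilon> u" by (simp add: algebra_simps)
          then have "norm (a \<epsilon> u * P \<epsilon> u - a0 u * Q \<epsilon> u) \<le> \<bar>a \<epsilon> u * (P \<epsilon> u - Q \<epsilon> u)\<bar> + \<bar>(a \<epsilon> u - a0 u) * Q \<epsilon> u\<bar>"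
            unfolding real_norm_def by (simp only: abs_triangle_ineq)
          also have "\<dots> \<le> (A + 1) * \<bar>P \<epsilon> u - Q \<epsilon> u\<bar> + e * Q \<epsilon> u"
            using t1 t2 Q0[of \<epsilon> u] by (simp add: abs_mult)
          finally show "norm (a \<epsilon> u * P \<epsilon> u - a0 u * Q \<epsilon> u) \<le> (A + 1) * \<bar>P \<epsilon> u - Q \<epsilon> u\<bar> + e * Q \<epsilon> u" .
        qed (intro ci continuous_intros cont)+
        then show ?thesis by simp
      qed
      moreover have "integral {0..1} (\<lambda>u. (A + 1) * \<bar>P \<epsilon> u - Q \<epsilon> u\<bar> + e * Q \<epsilon> u) =
          (A + 1) * integral {0..1} (\<lambda>u. \<bar>P \<epsilon> u - Q \<epsilon> u\<bar>) + e * integral {0..1} (Q \<epsilon>)"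
        by (intro integral_unique has_integral_add has_integral_mult_right integrable_integral ci continuous_intros cont)
      moreover have "(A + 1) * integral {0..1} (\<lambda>u. \<bar>P \<epsilon> u - Q \<epsilon> u\<bar>) < r / 2"
        using elim(1) A0 by (simp add: field_simps)
      moreover have "e * integral {0..1} (Q \<epsilon>) \<le> r / 2"
        using elim(2) e mult_left_mono[of "integral {0..1} (Q \<epsilon>)" "\<bar>q\<bar> + 1" e] by linarith
      ultimately show ?case by simp
    qed
  qed
  from tendsto_add[OF this l] show ?thesis by simp
qed

text \<open>All probability is hidden in \<open>holder\<close> and \<open>grid\<close>. The
  normalized second derivative \<open>U\<close> of the solution is replaced by \<sigma> times that
  of the driver, \<open>Y\<close>, with an error vanishing in mean; the limit for \<open>Y\<close>
  is then used with the path-dependent weights \<open>\<sigma> (x u) powr k\<close> and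
  \<open>h (x u) * \<sigma> (x u) powr k\<close>.\<close>

lemma pathwise_limit:
  fixes \<phi> \<sigma> \<mu> h g x :: "real \<Rightarrow> real" and H k c :: real
  assumes \<phi>: "smoothing_kernel \<phi>"
    and g: "continuous_on UNIV g"
    and holder: "\<And>s t. s \<in> {-1..2} \<Longrightarrow> t \<in> {-1..2} \<Longrightarrow> \<bar>g t - g s\<bar> \<le> K * \<bar>t - s\<bar> powr \<gamma>"
    and K: "0 \<le> K" and H: "1 / 2 < H" "H < 1" and \<gamma>: "1 / 2 < \<gamma>" "\<gamma> < H" and k: "1 \<le> k"
    and \<gamma>H: "k * (H - \<gamma>) < (1 - H) / 4"
    and sol: "pathwise_solution c \<sigma> \<mu> g x"
    and \<mu>: "continuous_on UNIV \<mu>" "\<And>y. \<bar>\<mu> y\<bar> \<le> B"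
    and m: "0 < m" "\<And>y. m \<le> \<sigma> y" and L: "L-lipschitz_on UNIV \<sigma>"
    and h: "continuous_on UNIV h"
    and grid: "\<And>w. continuous_on {0..1} w \<Longrightarrow> (\<lambda>n. integral {0..1} (\<lambda>u. w u *
        \<bar>grid H n powr (- H) / sigma2 \<phi> H * kernel_average (deriv (deriv \<phi>)) g (grid H n) u\<bar> powr k))
      \<longlonglongrightarrow> M * integral {0..1} w"
  shows "((\<lambda>\<epsilon>. integral {0..1} (\<lambda>u. h (smoothed \<phi> \<epsilon> x u) *
          \<bar>\<epsilon> powr (2 - H) * (deriv ^^ 2) (smoothed \<phi> \<epsilon> x) u / sigma2 \<phi> H\<bar> powr k))
      \<longlongrightarrow> M * integral {0..1} (\<lambda>u. h (x u) * \<sigma> (x u) powr k)) (at_right 0)"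
proof -
  define \<psi> where "\<psi> = deriv (deriv \<phi>)"
  define s where "s = sigma2 \<phi> H"
  have s: "0 < s" using sigma2_pos[OF \<phi>] H by (simp add: s_def)
  note kk = smoothing_kernelD[OF \<phi>, folded \<psi>_def]
  have \<psi>_mean: "integral {-1..1} \<psi> = 0" using integral_deriv2_kernel[OF \<phi>] by (simp add: \<psi>_def)
  have bnd: "\<exists>R. \<forall>v\<in>{-1..1}. \<bar>f v\<bar> \<le> R" if "continuous_on UNIV f" for f :: "real \<Rightarrow> real"
  proof -
    have "bounded (f ` {-1..1})" using continuous_on_subset[OF that] by (intro compact_imp_bounded compact_continuous_image) auto
    then show ?thesis by (auto simp: bounded_iff)
  qed
  obtain B\<psi> where B\<psi>: "\<And>v. v \<in> {-1..1} \<Longrightarrow> \<bar>\<psi> v\<bar> \<le> B\<psi>" using bnd[OF kk(5)] by blast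
  obtain B\<phi> where B\<phi>: "\<And>v. v \<in> {-1..1} \<Longrightarrow> \<bar>\<phi> v\<bar> \<le> B\<phi>" using bnd[OF kk(3)] by blast
  have B0: "0 \<le> B\<psi>" "0 \<le> B\<phi>" using B\<psi>[of 0] B\<phi>[of 0] by auto
  have pos: "\<sigma> z > 0" for z using m(1) m(2)[of z] by linarith
  have \<sigma>_cont: "continuous_on UNIV \<sigma>" using L by (rule lipschitz_on_continuous_on)
  have x_neg: "x t = x 0" if "t < 0" for t
  proof -
    have "x 0 = c" by (rule pathwise_solution_decomposition[OF sol])
    then show ?thesis using sol that by (simp add: pathwise_solution_def)
  qed
  \<comment> \<open>The extended solution factors through \<open>max t 0\<close>, a contraction, so
    continuity and the Hoelder bound transfer from nonnegative times.\<close>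
  have x_max: "x t = x (max t 0)" for t using x_neg[of t] by (cases "t = 0") (auto simp: max_def)
  have x: "continuous_on UNIV x"
  proof -
    have nn: "continuous_on {0..T} x" for T
      using pathwise_solution_continuous[OF sol continuous_on_subset[OF g] \<mu>(2)] by blast
    have "isCont x t" for t
    proof -
      have "continuous_on {..\<bar>t\<bar> + 1} (\<lambda>t. x (max t 0))"
        by (rule continuous_on_compose2[OF nn[of "\<bar>t\<bar> + 1"]]) (auto intro!: continuous_intros)
      then have "continuous_on {..\<bar>t\<bar> + 1} x" by (simp only: x_max[symmetric])
      moreover have "t \<in> interior {..\<bar>t\<bar> + 1}" by (simp add: abs_less_iff)
      ultimately show ?thesis by (rule continuous_on_interior)
    qed
    then show ?thesis by (simp add: continuous_on_eq_continuous_at)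
  qed
  obtain C where C: "0 \<le> C"
    "\<And>s r. s \<in> {0..2} \<Longrightarrow> r \<in> {0..2} \<Longrightarrow> \<bar>x r - x s\<bar> \<le> C * \<bar>r - s\<bar> powr \<gamma>"
    "\<And>s r. s \<in> {0..2} \<Longrightarrow> r \<in> {0..2} \<Longrightarrow>
      \<bar>x r - x s - \<sigma> (x s) * (g r - g s)\<bar> \<le> C * (\<bar>r - s\<bar> + \<bar>r - s\<bar> powr (2 * \<gamma>))"
  \<comment> \<open>The horizon 2 covers the windows of radius at most 1 around times up to
    1.\<close>
  proof (rule pathwise_solution_expansion[OF sol _ \<gamma>(1) _ K _ _ \<mu> m L, where T = 2])
    show "\<bar>g r - g s\<bar> \<le> K * \<bar>r - s\<bar> powr \<gamma>" if "s \<in> {0..2}" "r \<in> {0..2}" for s r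
      using that by (intro holder) auto
  qed (use \<gamma> H continuous_on_subset[OF g] in auto)
  have x_holder: "\<bar>x t - x s\<bar> \<le> C * \<bar>t - s\<bar> powr \<gamma>" if "s \<in> {-1..2}" "t \<in> {-1..2}" for s t
  proof -
    have "\<bar>x t - x s\<bar> \<le> C * \<bar>max t 0 - max s 0\<bar> powr \<gamma>"
      unfolding x_max[of t] x_max[of s] using that by (intro C(2)) auto
    also have "\<dots> \<le> C * \<bar>t - s\<bar> powr \<gamma>" using C(1) \<gamma> by (intro mult_left_mono powr_mono2) auto
    finally show ?thesis .
  qed
  define Y where "Y \<epsilon> u = \<epsilon> powr (- H) / s * kernel_average \<psi> g \<epsilon> u" for \<epsilon> u
  define U where "U \<epsilon> u = \<epsilon> powr (- H) / s * kernel_average \<psi> x \<epsilon> u" for \<epsilon> u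
  have Y_lim: "((\<lambda>\<epsilon>. integral {0..1} (\<lambda>u. w u * \<bar>Y \<epsilon> u\<bar> powr k)) \<longlongrightarrow> M * integral {0..1} w) (at_right 0)"
    if w: "continuous_on {0..1} w" for w
    unfolding Y_def
    by (rule limit_from_grid[OF kk(5) \<psi>_mean B\<psi> g holder K H \<gamma> k \<gamma>H s w])
       (use grid[OF w] in \<open>auto simp: s_def \<psi>_def\<close>)
  note [continuous_intros] = continuous_on_compose2[OF h] continuous_on_compose2[OF \<sigma>_cont]
  have x01: "continuous_on {0..1} x" by (rule continuous_on_subset[OF x]) simp
  have \<sigma>x: "continuous_on {0..1} (\<lambda>u. \<sigma> (x u))" by (intro continuous_intros x01) auto
  have \<sigma>k: "continuous_on {0..1} (\<lambda>u. \<sigma> (x u) powr k)"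
    using pos by (intro continuous_on_powr \<sigma>x continuous_on_const) (auto simp: less_imp_neq[symmetric])
  have "bounded ((\<lambda>u. \<sigma> (x u)) ` {0..1})" using \<sigma>x by (intro compact_imp_bounded compact_continuous_image) auto
  then obtain S where "\<forall>y\<in>(\<lambda>u. \<sigma> (x u)) ` {0..1}. norm y \<le> S" by (auto simp: bounded_iff)
  then have S: "\<And>u. u \<in> {0..1} \<Longrightarrow> \<bar>\<sigma> (x u)\<bar> \<le> S" by auto
  have S0: "0 \<le> S" using S[of 0] by auto
  define P where "P \<epsilon> u = \<bar>U \<epsilon> u\<bar> powr k" for \<epsilon> u
  define Q where "Q \<epsilon> u = \<bar>\<sigma> (x u) * Y \<epsilon> u\<bar> powr k" for \<epsilon> u
  have Q_eq: "Q \<epsilon> u = \<sigma> (x u) powr k * \<bar>Y \<epsilon> u\<bar> powr k" for \<epsilon> u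
    using pos[of "x u"] by (simp add: Q_def abs_mult powr_mult)
  have P_cont: "continuous_on {0..1} (P \<epsilon>)" for \<epsilon>
    unfolding P_def[abs_def] U_def using k by (intro continuous_on_powr' continuous_intros kernel_average_continuous kk(5) x) auto
  have Q_cont: "continuous_on {0..1} (Q \<epsilon>)" for \<epsilon>
    unfolding Q_def[abs_def] Y_def using k by (intro continuous_on_powr' continuous_intros \<sigma>x kernel_average_continuous kk(5) g) auto
  have ev: "\<forall>\<^sub>F \<epsilon> in at_right (0::real). 0 < \<epsilon> \<and> \<epsilon> < 1" using eventually_at_right_real[of 0 "1::real"] by auto
  define q where "q = (2 * B\<psi> * C + S * (2 * B\<psi> * K)) / s"
  have q0: "0 \<le> q" using B0 C(1) S0 K s by (simp add: q_def)
  have bounds: "\<bar>U \<epsilon> u\<bar> \<le> q * \<epsilon> powr (\<gamma> - H)" "\<bar>\<sigma> (x u) * Y \<epsilon> u\<bar> \<le> q * \<epsilon> powr (\<gamma> - H)"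
    if \<epsilon>: "0 < \<epsilon>" "\<epsilon> \<le> 1" and u: "u \<in> {0..1}" for \<epsilon> u
  proof -
    have pw: "\<epsilon> powr (- H) * \<epsilon> powr \<gamma> = \<epsilon> powr (\<gamma> - H)" by (simp flip: powr_add)
    have "\<bar>U \<epsilon> u\<bar> = \<epsilon> powr (- H) / s * \<bar>kernel_average \<psi> x \<epsilon> u\<bar>" using s by (simp add: U_def abs_mult)
    also have "\<dots> \<le> \<epsilon> powr (- H) / s * (2 * B\<psi> * (C * \<epsilon> powr \<gamma>))"
      using s \<gamma> by (intro mult_left_mono kernel_average_holder(1)[OF kk(5) \<psi>_mean B\<psi> x x_holder C(1) _ u \<epsilon>]) auto
    also have "\<dots> = 2 * B\<psi> * C / s * \<epsilon> powr (\<gamma> - H)" unfolding pw[symmetric] by simp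
    also have "\<dots> \<le> q * \<epsilon> powr (\<gamma> - H)"
      using B0 S0 K s by (intro mult_right_mono) (auto simp: q_def add_divide_distrib)
    finally show "\<bar>U \<epsilon> u\<bar> \<le> q * \<epsilon> powr (\<gamma> - H)" .
    have "\<bar>\<sigma> (x u) * Y \<epsilon> u\<bar> = \<bar>\<sigma> (x u)\<bar> * (\<epsilon> powr (- H) / s * \<bar>kernel_average \<psi> g \<epsilon> u\<bar>)" using s by (simp add: Y_def abs_mult)
    also have "\<dots> \<le> S * (\<epsilon> powr (- H) / s * (2 * B\<psi> * (K * \<epsilon> powr \<gamma>)))"
      using s \<gamma> S[OF u] S0 by (intro mult_mono kernel_average_holder(1)[OF kk(5) \<psi>_mean B\<psi> g holder K _ u \<epsilon>]) auto
    also have "\<dots> = S * (2 * B\<psi> * K) / s * \<epsilon> powr (\<gamma> - H)" unfolding pw[symmetric] by simp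
    also have "\<dots> \<le> q * \<epsilon> powr (\<gamma> - H)"
      using B0 C(1) s by (intro mult_right_mono) (auto simp: q_def add_divide_distrib)
    finally show "\<bar>\<sigma> (x u) * Y \<epsilon> u\<bar> \<le> q * \<epsilon> powr (\<gamma> - H)" .
  qed
  \<comment> \<open>Requiring \<open>u \<ge> \<epsilon>\<close> keeps the window within nonnegative
    times, where the expansion holds. Its error is at most \<open>2 * \<epsilon>\<close> up to a
    constant because \<open>2 * \<gamma> > 1\<close>, and the normalization leaves
    \<open>\<epsilon> powr (1 - H)\<close>.\<close>
  have close: "\<bar>U \<epsilon> u - \<sigma> (x u) * Y \<epsilon> u\<bar> \<le> 4 * B\<psi> * C / s * \<epsilon> powr (1 - H)"
    if \<epsilon>: "0 < \<epsilon>" "\<epsilon> \<le> 1" and u: "u \<in> {\<epsilon>..1}" for \<epsilon> u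
  proof -
    define G where "G v = x (u - \<epsilon> * v) - x u - \<sigma> (x u) * (g (u - \<epsilon> * v) - g u)" for v
    have G_cont: "continuous_on UNIV G" unfolding G_def
      by (intro continuous_intros continuous_on_compose2[OF x] continuous_on_compose2[OF g]) auto
    have "kernel_average \<psi> x \<epsilon> u - \<sigma> (x u) * kernel_average \<psi> g \<epsilon> u = integral {-1..1} (\<lambda>v. \<psi> v * G v)"
    proof -
      have "((\<lambda>v. \<psi> v * (x (u - \<epsilon> * v) - x u) - \<sigma> (x u) * (\<psi> v * (g (u - \<epsilon> * v) - g u))) has_integral
          (kernel_average \<psi> x \<epsilon> u - \<sigma> (x u) * kernel_average \<psi> g \<epsilon> u)) {-1..1}"
        unfolding kernel_average_increment[OF kk(5) \<psi>_mean x, of \<epsilon> u "x u"] kernel_average_increment[OF kk(5) \<psi>_mean g, of \<epsilon> u "g u"]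
        by (intro has_integral_diff has_integral_mult_right integrable_integral integrable_continuous_real continuous_intros
            continuous_on_compose2[OF x] continuous_on_compose2[OF g] continuous_on_subset[OF kk(5)]) auto
      then show ?thesis by (simp add: G_def integral_unique algebra_simps)
    qed
    also have "\<bar>\<dots>\<bar> \<le> 2 * B\<psi> * (C * (2 * \<epsilon>))"
    proof (rule kernel_average_abs_le[OF kk(5) B\<psi> G_cont])
      fix v :: real assume v: "v \<in> {-1..1}"
      have ev: "\<bar>\<epsilon> * v\<bar> \<le> \<epsilon> * 1" unfolding abs_mult using v \<epsilon> by (intro mult_mono) auto
      then have "u - \<epsilon> * v \<in> {0..2}" using u \<epsilon> by auto
      moreover have "u \<in> {0..2}" using u \<epsilon> by auto
      ultimately have "\<bar>G v\<bar> \<le> C * (\<bar>(u - \<epsilon> * v) - u\<bar> + \<bar>(u - \<epsilon> * v) - u\<bar> powr (2 * \<gamma>))"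
        unfolding G_def by (intro C(3)) auto
      also have "\<dots> \<le> C * (\<epsilon> + \<epsilon>)"
      proof (intro mult_left_mono add_mono)
        show "\<bar>(u - \<epsilon> * v) - u\<bar> \<le> \<epsilon>" using ev by simp
        have "\<bar>(u - \<epsilon> * v) - u\<bar> powr (2 * \<gamma>) \<le> \<epsilon> powr (2 * \<gamma>)" using ev \<gamma> by (intro powr_mono2) auto
        also have "\<dots> \<le> \<epsilon> powr 1" using \<epsilon> \<gamma> by (intro powr_mono') auto
        finally show "\<bar>(u - \<epsilon> * v) - u\<bar> powr (2 * \<gamma>) \<le> \<epsilon>" using \<epsilon> by simp
      qed (rule C(1))
      finally show "\<bar>G v\<bar> \<le> C * (2 * \<epsilon>)" by simp
    qed
    finally have "\<epsilon> powr (- H) / s * \<bar>kernel_average \<psi> x \<epsilon> u - \<sigma> (x u) * kernel_average \<psi> g \<epsilon> u\<bar> \<le> \<epsilon> powr (- H) / s * (2 * B\<psi> * (C * (2 * \<epsilon>)))"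
      using s by (intro mult_left_mono) auto
    moreover have "U \<epsilon> u - \<sigma> (x u) * Y \<epsilon> u = \<epsilon> powr (- H) / s * (kernel_average \<psi> x \<epsilon> u - \<sigma> (x u) * kernel_average \<psi> g \<epsilon> u)"
      by (simp add: U_def Y_def right_diff_distrib)
    moreover have "\<epsilon> powr (1 - H) = \<epsilon> powr (- H) * \<epsilon>"
      using \<epsilon> powr_add[of \<epsilon> "- H" 1] by simp
    ultimately show ?thesis using s by (simp add: abs_mult mult_ac)
  qed
  \<comment> \<open>Growth exponent of the \<open>k\<close>-th powers under the mere Hoelder bound.
    Replacing \<open>U\<close> costs at most \<open>\<epsilon> powr (1 - H - \<delta>)\<close> away
    from 0, still a positive power since \<open>\<delta> < (1 - H) / 4\<close>.\<close>
  define \<delta> where "\<delta> = k * (H - \<gamma>)"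
  have \<delta>: "0 < \<delta>" "\<delta> < (1 - H) / 4" using k \<gamma> \<gamma>H by (auto simp: \<delta>_def)
  define c1 where "c1 = k * q powr (k - 1) * (4 * B\<psi> * C / s)"
  define c2 where "c2 = 2 * q powr k"
  have c1: "0 \<le> c1" using k B0 C(1) s by (simp add: c1_def)
  have c2: "0 \<le> c2" by (simp add: c2_def)
  have PQ_right: "\<bar>P \<epsilon> u - Q \<epsilon> u\<bar> \<le> c1 * \<epsilon> powr (1 - H - \<delta>)" if \<epsilon>: "0 < \<epsilon>" "\<epsilon> \<le> 1" and u: "u \<in> {\<epsilon>..1}" for \<epsilon> u
  proof -
    have u01: "u \<in> {0..1}" using u \<epsilon> by auto
    define R where "R = q * \<epsilon> powr (\<gamma> - H)"
    have "\<bar>P \<epsilon> u - Q \<epsilon> u\<bar> \<le> k * R powr (k - 1) * \<bar>\<bar>U \<epsilon> u\<bar> - \<bar>\<sigma> (x u) * Y \<epsilon> u\<bar>\<bar>"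
      unfolding P_def Q_def R_def by (intro powr_diff_le bounds \<epsilon> u01 k abs_ge_zero)
    also have "\<dots> \<le> k * R powr (k - 1) * (4 * B\<psi> * C / s * \<epsilon> powr (1 - H))"
      using k by (intro mult_left_mono order_trans[OF abs_triangle_ineq3 close[OF \<epsilon> u]]) auto
    also have "R powr (k - 1) = q powr (k - 1) * \<epsilon> powr ((\<gamma> - H) * (k - 1))"
      unfolding R_def powr_mult powr_powr ..
    also have "k * (q powr (k - 1) * \<epsilon> powr ((\<gamma> - H) * (k - 1))) * (4 * B\<psi> * C / s * \<epsilon> powr (1 - H))
        = c1 * (\<epsilon> powr ((\<gamma> - H) * (k - 1)) * \<epsilon> powr (1 - H))" by (simp add: c1_def)
    also have "\<dots> \<le> c1 * \<epsilon> powr (1 - H - \<delta>)"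
    proof (intro mult_left_mono c1)
      have "\<epsilon> powr ((\<gamma> - H) * (k - 1)) * \<epsilon> powr (1 - H) = \<epsilon> powr ((\<gamma> - H) * (k - 1) + (1 - H))" by (rule powr_add[symmetric])
      also have "\<dots> \<le> \<epsilon> powr (1 - H - \<delta>)" using \<epsilon> \<gamma> by (intro powr_mono') (auto simp: \<delta>_def algebra_simps)
      finally show "\<epsilon> powr ((\<gamma> - H) * (k - 1)) * \<epsilon> powr (1 - H) \<le> \<epsilon> powr (1 - H - \<delta>)" .
    qed
    finally show ?thesis .
  qed
  have PQ_left: "\<bar>P \<epsilon> u - Q \<epsilon> u\<bar> \<le> c2 * \<epsilon> powr (- \<delta>)" if \<epsilon>: "0 < \<epsilon>" "\<epsilon> \<le> 1" and u: "u \<in> {0..1}" for \<epsilon> u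
  proof -
    have R: "(q * \<epsilon> powr (\<gamma> - H)) powr k = q powr k * \<epsilon> powr (- \<delta>)"
      unfolding powr_mult powr_powr \<delta>_def by (simp add: algebra_simps)
    have "P \<epsilon> u \<le> q powr k * \<epsilon> powr (- \<delta>)" "Q \<epsilon> u \<le> q powr k * \<epsilon> powr (- \<delta>)"
      unfolding P_def Q_def R[symmetric] using bounds[OF \<epsilon> u] k by (auto intro!: powr_mono2)
    moreover have "0 \<le> P \<epsilon> u" "0 \<le> Q \<epsilon> u" by (auto simp: P_def Q_def)
    ultimately show ?thesis unfolding c2_def by linarith
  qed
  \<comment> \<open>Near time 0, where windows reach negative times, only the crude bound is
    available; the length \<epsilon> of that interval compensates for it.\<close>
  have PQ_int: "integral {0..1} (\<lambda>u. \<bar>P \<epsilon> u - Q \<epsilon> u\<bar>) \<le> c2 * \<epsilon> powr (1 - \<delta>) + c1 * \<epsilon> powr (1 - H - \<delta>)" if \<epsilon>: "0 < \<epsilon>" "\<epsilon> < 1" for \<epsilon>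
  proof -
    have d_cont: "continuous_on {0..1} (\<lambda>u. \<bar>P \<epsilon> u - Q \<epsilon> u\<bar>)" by (intro continuous_intros P_cont Q_cont)
    note int = integrable_continuous_real[OF d_cont]
    have "integral {0..1} (\<lambda>u. \<bar>P \<epsilon> u - Q \<epsilon> u\<bar>) = integral {0..\<epsilon>} (\<lambda>u. \<bar>P \<epsilon> u - Q \<epsilon> u\<bar>) + integral {\<epsilon>..1} (\<lambda>u. \<bar>P \<epsilon> u - Q \<epsilon> u\<bar>)"
      using \<epsilon> int by (intro Henstock_Kurzweil_Integration.integral_combine[symmetric]) auto
    also have "integral {0..\<epsilon>} (\<lambda>u. \<bar>P \<epsilon> u - Q \<epsilon> u\<bar>) \<le> integral {0..\<epsilon>} (\<lambda>u. c2 * \<epsilon> powr (- \<delta>))"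
      using \<epsilon> by (intro integral_le integrable_on_subinterval[OF int] PQ_left integrable_const_ivl) auto
    also have "integral {\<epsilon>..1} (\<lambda>u. \<bar>P \<epsilon> u - Q \<epsilon> u\<bar>) \<le> integral {\<epsilon>..1} (\<lambda>u. c1 * \<epsilon> powr (1 - H - \<delta>))"
      using \<epsilon> by (intro integral_le integrable_on_subinterval[OF int] PQ_right integrable_const_ivl) auto
    also have "integral {0..\<epsilon>} (\<lambda>u. c2 * \<epsilon> powr (- \<delta>)) = c2 * \<epsilon> powr (1 - \<delta>)"
      using \<epsilon> powr_add[of \<epsilon> 1 "- \<delta>"] by simp
    also have "integral {\<epsilon>..1} (\<lambda>u. c1 * \<epsilon> powr (1 - H - \<delta>)) \<le> c1 * \<epsilon> powr (1 - H - \<delta>)"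
    proof -
      have "(1 - \<epsilon>) * (c1 * \<epsilon> powr (1 - H - \<delta>)) \<le> 1 * (c1 * \<epsilon> powr (1 - H - \<delta>))"
        using \<epsilon> c1 by (intro mult_right_mono) auto
      moreover have "integral {\<epsilon>..1} (\<lambda>u. c1 * \<epsilon> powr (1 - H - \<delta>)) = (1 - \<epsilon>) * (c1 * \<epsilon> powr (1 - H - \<delta>))"
        using \<epsilon> by simp
      ultimately show ?thesis by (simp only: mult_1_left)
    qed
    finally show ?thesis by simp
  qed
  have PQ_lim: "((\<lambda>\<epsilon>. integral {0..1} (\<lambda>u. \<bar>P \<epsilon> u - Q \<epsilon> u\<bar>)) \<longlongrightarrow> 0) (at_right 0)"
  proof (rule Lim_null_comparison)
    show "\<forall>\<^sub>F \<epsilon> in at_right 0. norm (integral {0..1} (\<lambda>u. \<bar>P \<epsilon> u - Q \<epsilon> u\<bar>)) \<le> c2 * \<epsilon> powr (1 - \<delta>) + c1 * \<epsilon> powr (1 - H - \<delta>)"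
      using ev
    proof eventually_elim
      case (elim \<epsilon>)
      have "0 \<le> integral {0..1} (\<lambda>u. \<bar>P \<epsilon> u - Q \<epsilon> u\<bar>)"
        by (intro integral_nonneg integrable_continuous_real continuous_intros P_cont Q_cont) auto
      then show ?case using PQ_int[of \<epsilon>] elim by simp
    qed
    have "((\<lambda>\<epsilon>. c2 * \<epsilon> powr (1 - \<delta>) + c1 * \<epsilon> powr (1 - H - \<delta>)) \<longlongrightarrow> c2 * 0 + c1 * 0) (at_right 0)"
      using \<delta> H by (intro tendsto_add tendsto_mult tendsto_const tendsto_powr_at_right_0) auto
    then show "((\<lambda>\<epsilon>. c2 * \<epsilon> powr (1 - \<delta>) + c1 * \<epsilon> powr (1 - H - \<delta>)) \<longlongrightarrow> 0) (at_right 0)" by simp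
  qed
  define a where "a \<epsilon> u = h (kernel_average \<phi> x \<epsilon> u)" for \<epsilon> u
  have a_cont: "continuous_on {0..1} (a \<epsilon>)" for \<epsilon>
    unfolding a_def[abs_def] by (intro continuous_intros kernel_average_continuous kk(3) x) auto
  have a_lim: "\<forall>\<^sub>F \<epsilon> in at_right 0. \<forall>u\<in>{0..1}. \<bar>a \<epsilon> u - h (x u)\<bar> \<le> e" if e: "0 < e" for e
  proof -
    have "bounded (x ` {0..1})" using x01 by (intro compact_imp_bounded compact_continuous_image) auto
    then obtain R where "\<forall>y\<in>x ` {0..1}. norm y \<le> R" by (auto simp: bounded_iff)
    then have R: "\<And>u. u \<in> {0..1} \<Longrightarrow> \<bar>x u\<bar> \<le> R" by auto
    \<comment> \<open>The margin 1 leaves room for the averages, which eventually differ from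
      \<open>x u\<close> by less than 1.\<close>
    have "uniformly_continuous_on {- (R + 1)..R + 1} h"
      by (intro compact_uniformly_continuous continuous_on_subset[OF h]) auto
    then obtain d where d: "0 < d" "\<And>y z. y \<in> {- (R + 1)..R + 1} \<Longrightarrow> z \<in> {- (R + 1)..R + 1} \<Longrightarrow> dist z y < d \<Longrightarrow> dist (h z) (h y) < e"
      unfolding uniformly_continuous_on_def using e by blast
    have "((\<lambda>\<epsilon>. 2 * B\<phi> * (C * \<epsilon> powr \<gamma>)) \<longlongrightarrow> 2 * B\<phi> * (C * 0)) (at_right 0)"
      using \<gamma> by (intro tendsto_mult tendsto_const tendsto_powr_at_right_0) auto
    then have "\<forall>\<^sub>F \<epsilon> in at_right 0. 2 * B\<phi> * (C * \<epsilon> powr \<gamma>) < min d 1"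
      using d(1) by (intro order_tendstoD(2)) auto
    then show ?thesis using ev
    proof eventually_elim
      case (elim \<epsilon>)
      show ?case
      proof
        fix u :: real assume u: "u \<in> {0..1}"
        have "kernel_average \<phi> x \<epsilon> u - x u = integral {-1..1} (\<lambda>v. \<phi> v * (x (u - \<epsilon> * v) - x u))"
        proof -
          have "(\<phi> has_integral 1) {-1..1}"
            using kk(10) integrable_continuous_real[OF continuous_on_subset[OF kk(3)], of "-1" 1] by (metis integrable_integral subset_UNIV)
          from has_integral_mult_left[OF this, of "x u"]
          have "((\<lambda>v. \<phi> v * x u) has_integral x u) {-1..1}" by simp
          moreover have "((\<lambda>v. \<phi> v * x (u - \<epsilon> * v)) has_integral kernel_average \<phi> x \<epsilon> u) {-1..1}"
            unfolding kernel_average_def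
            by (intro integrable_integral integrable_continuous_real continuous_intros continuous_on_compose2[OF x] continuous_on_subset[OF kk(3)]) auto
          ultimately have "((\<lambda>v. \<phi> v * x (u - \<epsilon> * v) - \<phi> v * x u) has_integral (kernel_average \<phi> x \<epsilon> u - x u)) {-1..1}"
            by (intro has_integral_diff)
          then show ?thesis by (simp add: integral_unique right_diff_distrib)
        qed
        also have "\<bar>\<dots>\<bar> \<le> 2 * B\<phi> * (C * \<epsilon> powr \<gamma>)"
        proof (rule kernel_average_abs_le[OF kk(3) B\<phi>])
          show "continuous_on UNIV (\<lambda>v. x (u - \<epsilon> * v) - x u)"
            by (intro continuous_intros continuous_on_compose2[OF x]) auto
          fix v :: real assume v: "v \<in> {-1..1}"
          have ev: "\<bar>\<epsilon> * v\<bar> \<le> \<epsilon> * 1" unfolding abs_mult using v elim by (intro mult_mono) auto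
          have "\<bar>x (u - \<epsilon> * v) - x u\<bar> \<le> C * \<bar>(u - \<epsilon> * v) - u\<bar> powr \<gamma>"
            using ev u elim by (intro x_holder) auto
          also have "\<dots> \<le> C * \<epsilon> powr \<gamma>" using ev C(1) \<gamma> by (intro mult_left_mono powr_mono2) auto
          finally show "\<bar>x (u - \<epsilon> * v) - x u\<bar> \<le> C * \<epsilon> powr \<gamma>" .
        qed
        finally have near: "\<bar>kernel_average \<phi> x \<epsilon> u - x u\<bar> < min d 1" using elim by simp
        have "x u \<in> {- (R + 1)..R + 1}" "kernel_average \<phi> x \<epsilon> u \<in> {- (R + 1)..R + 1}"
          using near R[OF u] by (auto simp: abs_le_iff abs_less_iff)
        from d(2)[OF this] near show "\<bar>a \<epsilon> u - h (x u)\<bar> \<le> e"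
          by (simp add: a_def dist_real_def)
      qed
    qed
  qed
  have "((\<lambda>\<epsilon>. integral {0..1} (\<lambda>u. a \<epsilon> u * P \<epsilon> u)) \<longlongrightarrow> M * integral {0..1} (\<lambda>u. h (x u) * \<sigma> (x u) powr k)) (at_right 0)"
  proof (rule tendsto_integral_product[OF a_cont P_cont Q_cont _ _ PQ_lim a_lim])
    show "continuous_on {0..1} (\<lambda>u. h (x u))" by (intro continuous_intros x01) auto
    show "0 \<le> Q \<epsilon> u" for \<epsilon> u by (simp add: Q_def)
    show "((\<lambda>\<epsilon>. integral {0..1} (Q \<epsilon>)) \<longlongrightarrow> M * integral {0..1} (\<lambda>u. \<sigma> (x u) powr k)) (at_right 0)"
      using Y_lim[OF \<sigma>k] by (simp add: Q_eq[abs_def])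
    have "continuous_on {0..1} (\<lambda>u. h (x u) * \<sigma> (x u) powr k)" by (intro continuous_intros x01 \<sigma>k) auto
    from Y_lim[OF this] show "((\<lambda>\<epsilon>. integral {0..1} (\<lambda>u. h (x u) * Q \<epsilon> u)) \<longlongrightarrow> M * integral {0..1} (\<lambda>u. h (x u) * \<sigma> (x u) powr k)) (at_right 0)"
      by (simp add: Q_eq mult.assoc)
  qed
  then show ?thesis
  proof (rule Lim_transform_eventually)
    show "\<forall>\<^sub>F \<epsilon> in at_right 0. integral {0..1} (\<lambda>u. a \<epsilon> u * P \<epsilon> u) =
        integral {0..1} (\<lambda>u. h (smoothed \<phi> \<epsilon> x u) * \<bar>\<epsilon> powr (2 - H) * (deriv ^^ 2) (smoothed \<phi> \<epsilon> x) u / sigma2 \<phi> H\<bar> powr k)"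
      using ev
    proof eventually_elim
      case (elim \<epsilon>)
      have "\<epsilon> powr (2 - H) / \<epsilon>\<^sup>2 = \<epsilon> powr (- H)"
        using elim powr_diff[of \<epsilon> "2 - H" 2] by (simp add: powr_numeral)
      then have "\<epsilon> powr (2 - H) * (kernel_average \<psi> x \<epsilon> u / \<epsilon>\<^sup>2) / s = U \<epsilon> u" for u
        by (simp add: U_def flip: times_divide_eq_left)
      then show ?case
        using smoothed_second_deriv[OF \<phi> x, of \<epsilon>] smoothed_eq_kernel_average[OF \<phi> x, of \<epsilon>] elim
        by (simp add: a_def P_def s_def \<psi>_def)
    qed
  qed
qed

section \<open>Almost sure convergence\<close>

text \<open>One-point combinations show that each value is Gaussian and hence square integrable.
  This makes products integrable, and only then may the second moment of a combination be expanded
  into covariances.\<close>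

lemma (in prob_space) gaussian_linear_combination:
  assumes b: "centered_gaussian_process M b" and T: "finite T"
  shows "gaussian_with_std M (\<lambda>\<omega>. \<Sum>t\<in>T. a t * b t \<omega>)
    (sqrt (\<Sum>s\<in>T. \<Sum>t\<in>T. a s * a t * (\<integral>\<omega>. b s \<omega> * b t \<omega> \<partial>M)))"
proof -
  have rv: "gaussian_rv M (\<lambda>\<omega>. \<Sum>t\<in>T. a t * b t \<omega>)" if "finite T" for T a
    using b that by (auto simp: centered_gaussian_process_def)
  have mean: "(\<integral>\<omega>. b t \<omega> \<partial>M) = 0" for t using b by (simp add: centered_gaussian_process_def)
  have g1: "\<exists>s\<ge>0. gaussian_with_std M (b t) s" for t
    using gaussian_rv_imp_gaussian_with_std[of "b t"] rv[of "{t}" "\<lambda>_. 1"] mean by simp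
  have [measurable]: "b t \<in> borel_measurable M" for t using g1 gaussian_with_std_measurable by blast
  have sq: "integrable M (\<lambda>\<omega>. (b t \<omega>)\<^sup>2)" for t using g1 gaussian_with_std_second_moment(1) by blast
  have int: "integrable M (b t)" for t by (rule square_integrable_imp_integrable[OF _ sq]) measurable
  have prod: "integrable M (\<lambda>\<omega>. b s \<omega> * b t \<omega>)" for s t
  proof (rule Bochner_Integration.integrable_bound)
    show "integrable M (\<lambda>\<omega>. (b s \<omega>)\<^sup>2 + (b t \<omega>)\<^sup>2)" using sq by simp
    have "\<bar>y * z\<bar> \<le> y\<^sup>2 + z\<^sup>2" for y z :: real
    proof -
      have "2 * \<bar>y * z\<bar> \<le> y\<^sup>2 + z\<^sup>2" using sum_squares_bound[of "\<bar>y\<bar>" "\<bar>z\<bar>"] by (simp add: abs_mult mult.assoc)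
      then show ?thesis using abs_ge_zero[of "y * z"] by linarith
    qed
    then show "AE \<omega> in M. norm (b s \<omega> * b t \<omega>) \<le> norm ((b s \<omega>)\<^sup>2 + (b t \<omega>)\<^sup>2)" by (intro AE_I2) simp
  qed measurable
  have "(\<integral>\<omega>. (\<Sum>t\<in>T. a t * b t \<omega>) \<partial>M) = 0" using int mean by (simp add: Bochner_Integration.integral_sum)
  then obtain s where s: "0 \<le> s" "gaussian_with_std M (\<lambda>\<omega>. \<Sum>t\<in>T. a t * b t \<omega>) s"
    using gaussian_rv_imp_gaussian_with_std[OF rv[OF T]] by blast
  have "s\<^sup>2 = (\<integral>\<omega>. (\<Sum>t\<in>T. a t * b t \<omega>)\<^sup>2 \<partial>M)" using gaussian_with_std_second_moment(2)[OF s(2)] by simp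
  also have "\<dots> = (\<integral>\<omega>. (\<Sum>s\<in>T. \<Sum>t\<in>T. a s * a t * (b s \<omega> * b t \<omega>)) \<partial>M)"
    by (intro Bochner_Integration.integral_cong HOL.refl) (simp add: power2_eq_square sum_product mult_ac)
  also have "\<dots> = (\<Sum>s\<in>T. \<Sum>t\<in>T. a s * a t * (\<integral>\<omega>. b s \<omega> * b t \<omega> \<partial>M))"
    using prod by (simp add: Bochner_Integration.integral_sum)
  finally have "s = sqrt (\<Sum>s\<in>T. \<Sum>t\<in>T. a s * a t * (\<integral>\<omega>. b s \<omega> * b t \<omega> \<partial>M))"
    using s(1) by (metis real_sqrt_abs abs_of_nonneg)
  with s(2) show ?thesis by simp
qed

text \<open>Paths are set to 0 on a measurable null set containing all discontinuous ones. Laws of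
  linear combinations are unaffected, and the two processes agree at all times simultaneously
  outside a null set.\<close>

lemma continuous_modification:
  fixes M :: "'a measure"
  assumes M: "prob_space M" and H: "1 / 2 < H" "H < 1" and b: "fractional_brownian_motion M H b"
  obtains b' where "continuous_fbm M H b'" "AE \<omega> in M. \<forall>t. b' t \<omega> = b t \<omega>"
proof -
  interpret prob_space M by (rule M)
  have gp: "centered_gaussian_process M b"
    and cov: "\<And>s t. (\<integral>\<omega>. b s \<omega> * b t \<omega> \<partial>M) = fbm_cov H s t"
    and cont: "AE \<omega> in M. continuous_on UNIV (\<lambda>t. b t \<omega>)"
    using b by (auto simp: fractional_brownian_motion_def fbm_cov_def)
  obtain N where N: "{\<omega> \<in> space M. \<not> continuous_on UNIV (\<lambda>t. b t \<omega>)} \<subseteq> N" "emeasure M N = 0" "N \<in> sets M"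
    using cont by (rule AE_E)
  define b' where "b' t \<omega> = (if \<omega> \<in> space M - N then b t \<omega> else 0)" for t \<omega>
  have notN: "AE \<omega> in M. \<omega> \<notin> N" using N by (intro AE_not_in null_setsI)
  have eq: "AE \<omega> in M. \<forall>t. b' t \<omega> = b t \<omega>"
    using notN AE_space by eventually_elim (simp add: b'_def)
  have "continuous_fbm M H b'"
  proof
    show "continuous_on UNIV (\<lambda>t. b' t \<omega>)" for \<omega> using N(1) by (cases "\<omega> \<in> space M - N") (auto simp: b'_def)
    fix T a assume T: "finite (T :: real set)"
    have g: "gaussian_with_std M (\<lambda>\<omega>. \<Sum>t\<in>T. a t * b t \<omega>) (sqrt (\<Sum>s\<in>T. \<Sum>t\<in>T. a s * a t * fbm_cov H s t))"
      using gaussian_linear_combination[OF gp T, of a] by (simp only: cov)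
    then have meas: "(\<lambda>\<omega>. \<Sum>t\<in>T. a t * b t \<omega>) \<in> borel_measurable M" by (rule gaussian_with_std_measurable)
    have b'_sum: "(\<Sum>t\<in>T. a t * b' t \<omega>) = (if \<omega> \<in> space M - N then \<Sum>t\<in>T. a t * b t \<omega> else 0)" for \<omega>
      by (cases "\<omega> \<in> space M - N") (simp_all only: b'_def if_True if_False mult_zero_right sum.neutral_const)
    have meas': "(\<lambda>\<omega>. \<Sum>t\<in>T. a t * b' t \<omega>) \<in> borel_measurable M"
      unfolding b'_sum using N(3) meas by (intro measurable_If_set) auto
    have "distr M borel (\<lambda>\<omega>. \<Sum>t\<in>T. a t * b' t \<omega>) = distr M borel (\<lambda>\<omega>. \<Sum>t\<in>T. a t * b t \<omega>)"
      using eq by (intro distr_cong_AE meas meas') auto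
    with g meas' show "gaussian_with_std M (\<lambda>\<omega>. \<Sum>t\<in>T. a t * b' t \<omega>) (sqrt (\<Sum>s\<in>T. \<Sum>t\<in>T. a s * a t * fbm_cov H s t))"
      by (simp add: gaussian_with_std_def)
  qed (use H in auto)
  with eq show thesis by (rule that[rotated])
qed

text \<open>The quantifier over \<open>w\<close> stands inside the almost sure statement because the
  weight will be a function of the path; this is possible as the hypotheses of
  \<open>occupation\<close> are countably many almost sure conditions.\<close>

lemma (in smoothed_fbm) AE_grid_limit:
  assumes k: "1 \<le> k"
  shows "AE \<omega> in M. \<forall>w. continuous_on {0..1} w \<longrightarrow>
    (\<lambda>n. integral {0..1} (\<lambda>u. w u * \<bar>\<zeta> (grid H n) u \<omega>\<bar> powr k)) \<longlonglongrightarrow> gaussian_abs_moment k * integral {0..1} w"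
proof -
  have "AE \<omega> in M. \<forall>i R. \<forall>j. (\<lambda>n. integral {0..1} (\<lambda>u. u ^ j *
      (cos (pi * real i / real R * \<zeta> (grid H n) u \<omega>) - exp (- ((pi * real i / real R)\<^sup>2) / 2)))) \<longlonglongrightarrow> 0"
    unfolding AE_all_countable[where P = "\<lambda>(i::nat) \<omega>. \<forall>R. _ i R \<omega>"] AE_all_countable[where P = "\<lambda>(R::nat) \<omega>. \<forall>j. _ R j \<omega>"]
    by (intro allI AE_cos_\<zeta>_tendsto)
  with AE_cosh_\<zeta>_bounded show ?thesis
  proof eventually_elim
    case (elim \<omega>)
    then obtain K where K: "\<And>n. integral {0..1} (\<lambda>u. cosh (\<zeta> (grid H n) u \<omega>)) \<le> K" by blast
    interpret occupation "\<lambda>n u. \<zeta> (grid H n) u \<omega>" K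
    proof
      show "continuous_on {0..1} (\<lambda>u. \<zeta> (grid H n) u \<omega>)" for n
        by (rule continuous_on_subset[OF \<zeta>_continuous']) simp
    qed (use elim K in auto)
    show ?case using abs_powr_limit[OF k] by blast
  qed
qed

theorem theorem3p8:
  fixes M :: "'a measure" and b X :: "real \<Rightarrow> 'a \<Rightarrow> real"
    and H k c \<eta> :: real and h \<sigma> \<mu> \<phi> :: "real \<Rightarrow> real"
  assumes "prob_space M"
    and "1 / 2 < H" "H < 1"
    and "fractional_brownian_motion M H b"
    and "smoothing_kernel \<phi>"
    and "1 \<le> k"
    and "continuous_on UNIV h"
    and "\<And>x. 0 < \<sigma> x"
    and "\<sigma> C1_differentiable_on UNIV"
    and "\<exists>L. L-lipschitz_on UNIV \<sigma>"
    and "\<exists>m>0. \<forall>x. m \<le> \<sigma> x"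
    and "1 / H - 1 < \<eta>" "\<eta> \<le> 1"
    and "\<And>N0. 0 < N0 \<Longrightarrow> \<exists>MN>0. \<forall>x y. \<bar>x\<bar> \<le> N0 \<longrightarrow> \<bar>y\<bar> \<le> N0 \<longrightarrow>
           \<bar>deriv \<sigma> x - deriv \<sigma> y\<bar> \<le> MN * \<bar>x - y\<bar> powr \<eta>"
    and "\<mu> C1_differentiable_on UNIV"
    and "bounded (range \<mu>)"
    and "\<exists>L. L-lipschitz_on UNIV \<mu>"
    and "sde_solution M c \<sigma> \<mu> b X"
  shows "AE \<omega> in M.
    ((\<lambda>\<epsilon>. 1 / gaussian_abs_moment k *
        integral {0..1} (\<lambda>u. h (smoothed \<phi> \<epsilon> (\<lambda>t. X t \<omega>) u) *
          \<bar>\<epsilon> powr (2 - H) * (deriv ^^ 2) (smoothed \<phi> \<epsilon> (\<lambda>t. X t \<omega>)) u / sigma2 \<phi> H\<bar> powr k))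
      \<longlongrightarrow> integral {0..1} (\<lambda>u. h (X u \<omega>) * \<sigma> (X u \<omega>) powr k)) (at_right 0)"
proof -
  obtain b' where b': "continuous_fbm M H b'" "AE \<omega> in M. \<forall>t. b' t \<omega> = b t \<omega>"
    using continuous_modification[OF assms(1-4)] by blast
  interpret continuous_fbm M H b' by (rule b'(1))
  interpret smoothed_fbm M H b' \<phi> by unfold_locales (rule assms(5))
  \<comment> \<open>The first entry yields \<open>k * \<delta> \<le> (1 - H) / 8\<close>, below the
    threshold \<open>(1 - H) / 4\<close>; the second keeps \<gamma> above one half.\<close>
  define \<delta> where "\<delta> = min ((1 - H) / (8 * k)) ((H - 1 / 2) / 2)"
  define \<gamma> where "\<gamma> = H - \<delta>"
  have \<delta>: "0 < \<delta>" using H assms(6) by (simp add: \<delta>_def)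
  have \<gamma>: "1 / 2 < \<gamma>" "\<gamma> < H" "0 < \<gamma>"
  proof -
    have "\<delta> \<le> (H - 1 / 2) / 2" unfolding \<delta>_def by (rule min.cobounded2)
    then have "\<delta> * 2 \<le> H - 1 / 2" by simp
    then show "1 / 2 < \<gamma>" using \<delta> unfolding \<gamma>_def by linarith
    then show "0 < \<gamma>" by simp
    show "\<gamma> < H" using \<delta> by (simp add: \<gamma>_def)
  qed
  have \<gamma>H: "k * (H - \<gamma>) < (1 - H) / 4"
  proof -
    have "k * \<delta> \<le> k * ((1 - H) / (8 * k))" using assms(6) by (intro mult_left_mono) (auto simp: \<delta>_def)
    also have "\<dots> = (1 - H) / 8" using assms(6) by simp
    also have "\<dots> < (1 - H) / 4" using H by simp
    finally show ?thesis by (simp add: \<gamma>_def)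
  qed
  obtain L where L: "L-lipschitz_on UNIV \<sigma>" using assms(10) by blast
  obtain m where m: "0 < m" "\<And>y. m \<le> \<sigma> y" using assms(11) by blast
  obtain L\<mu> where "L\<mu>-lipschitz_on UNIV \<mu>" using assms(17) by blast
  then have \<mu>: "continuous_on UNIV \<mu>" by (rule lipschitz_on_continuous_on)
  obtain B where B: "\<And>y. \<bar>\<mu> y\<bar> \<le> B" using assms(16) by (auto simp: bounded_iff)
  have moment: "0 < gaussian_abs_moment k" using assms(6) by (intro gaussian_abs_moment_pos) auto
  have "AE \<omega> in M. pathwise_solution c \<sigma> \<mu> (\<lambda>t. b t \<omega>) (\<lambda>t. X t \<omega>)"
    using assms(18) by (simp add: sde_solution_def)
  with b'(2) AE_holder[OF \<gamma>(3,2)] AE_grid_limit[OF assms(6)] show ?thesis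
  proof eventually_elim
    case (elim \<omega>)
    have paths_eq: "(\<lambda>t. b t \<omega>) = (\<lambda>t. b' t \<omega>)" using elim(1) by (intro ext) (erule allE, erule sym)
    have sol: "pathwise_solution c \<sigma> \<mu> (\<lambda>t. b' t \<omega>) (\<lambda>t. X t \<omega>)"
      using elim(4) unfolding paths_eq .
    obtain K where K: "0 \<le> K" "\<And>s t. s \<in> {-1..2} \<Longrightarrow> t \<in> {-1..2} \<Longrightarrow> \<bar>b' t \<omega> - b' s \<omega>\<bar> \<le> K * \<bar>t - s\<bar> powr \<gamma>"
      using elim(2) by blast
    have "((\<lambda>\<epsilon>. integral {0..1} (\<lambda>u. h (smoothed \<phi> \<epsilon> (\<lambda>t. X t \<omega>) u) *
          \<bar>\<epsilon> powr (2 - H) * (deriv ^^ 2) (smoothed \<phi> \<epsilon> (\<lambda>t. X t \<omega>)) u / sigma2 \<phi> H\<bar> powr k))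
      \<longlongrightarrow> gaussian_abs_moment k * integral {0..1} (\<lambda>u. h (X u \<omega>) * \<sigma> (X u \<omega>) powr k)) (at_right 0)"
    proof (rule pathwise_limit[OF assms(5) paths K(2) K(1) assms(2,3) \<gamma>(1,2) assms(6) \<gamma>H sol \<mu> B m L assms(7)])
      fix w :: "real \<Rightarrow> real" assume "continuous_on {0..1} w"
      then show "(\<lambda>n. integral {0..1} (\<lambda>u. w u * \<bar>grid H n powr (- H) / sigma2 \<phi> H *
          kernel_average (deriv (deriv \<phi>)) (\<lambda>t. b' t \<omega>) (grid H n) u\<bar> powr k))
        \<longlonglongrightarrow> gaussian_abs_moment k * integral {0..1} w"
        using elim(3) by (simp add: \<zeta>_def kernel_average_def)
    qed
    from tendsto_mult[OF tendsto_const[of "1 / gaussian_abs_moment k"] this] show ?case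
      using moment by simp
  qed
qed

end
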